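(* Let $k_1,k_2,l\in\mathbb{N}$ be fixed and let $m,n\to\infty$ with $\alpha=\lim_{n\to\infty}\frac{m}{n}$ a constant (not necessarily $1$). Let $A_1,\dots,A_l\in\mathbb{R}^{k_1\times k_2}$ be deterministic, let $G_1,\dots,G_l\in\mathbb{R}^{m\times n}$ be independent matrices with independent standard normal entries, and let $$H=\frac{1}{\sqrt n}\sum_{i=1}^{l}A_i\otimes G_i .$$ Let $s_n(H)$ denote the largest singular value of $H$. Then $$\lim_{n\to\infty}\mathbb{E}\,s_n(H)\;\ge\;\frac12\inf_{\substack{Z_Y=Z_Y^T\succ0\\ Z_X=Z_X^T\succ0}}\left(\lambda_n\Big(Z_X+\alpha\sum_{i=1}^{l}A_i^TZ_Y^{-1}A_i\Big)+\lambda_n\Big(Z_Y+\sum_{i=1}^{l}A_iZ_X^{-1}A_i^T\Big)\right),$$ where $Z_X\in\mathbb{R}^{k_2\times k_2}$ and $Z_Y\in\mathbb{R}^{k_1\times k_1}$.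
   Context: For a symmetric matrix $M$ of any size, $\lambda_n(M)$ denotes its largest eigenvalue (the subscript is only notation for "largest"). *)

theory Defs
  imports
    "HOL-Probability.Probability"
    "Jordan_Normal_Form.Spectral_Radius"
    "Jordan_Normal_Form.Gauss_Jordan_Elimination"
begin

text \<open>
  Matrix sizes vary with the sequence index, so matrices are those of
  \<^theory>\<open>Jordan_Normal_Form.Matrix\<close>, whose dimensions are natural numbers. Rows and columns are
  indexed from 0, and families of \<open>l\<close> matrices are indexed by \<open>0, \<dots>, l - 1\<close>.
\<close>

text \<open>
  The type of matrices of all sizes has no zero, so \<open>sum\<close> does not apply to it; the dimensions
  are passed explicitly, which also fixes the value of the empty sum.
\<close>

definition mat_sum :: "nat \<Rightarrow> nat \<Rightarrow> (nat \<Rightarrow> real mat) \<Rightarrow> nat \<Rightarrow> real mat" where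
  "mat_sum nr nc F l = mat nr nc (\<lambda>(r, c). \<Sum>i<l. F i $$ (r, c))"

definition kronecker :: "real mat \<Rightarrow> real mat \<Rightarrow> real mat" where
  "kronecker A B =
     mat (dim_row A * dim_row B) (dim_col A * dim_col B)
       (\<lambda>(r, c). A $$ (r div dim_row B, c div dim_col B) * B $$ (r mod dim_row B, c mod dim_col B))"

text \<open>Meant for real symmetric matrices of positive dimension.\<close>

definition max_eigenvalue :: "real mat \<Rightarrow> real" where
  "max_eigenvalue M = Max (spectrum M)"

text \<open>
  The list of singular values is padded by zeros when there are more columns than rows, which does
  not affect the largest one. For a matrix without columns the value is unspecified.
\<close>

definition singular_values :: "real mat \<Rightarrow> real set" where
  "singular_values H = sqrt ` spectrum (transpose_mat H * H)"

definition max_singular_value :: "real mat \<Rightarrow> real" where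
  "max_singular_value H = Max (singular_values H)"

definition sym_pos_def :: "nat \<Rightarrow> real mat \<Rightarrow> bool" where
  "sym_pos_def k Z \<longleftrightarrow>
     Z \<in> carrier_mat k k \<and> transpose_mat Z = Z \<and>
     (\<forall>v \<in> carrier_vec k. v \<noteq> 0\<^sub>v k \<longrightarrow> scalar_prod v (Z *\<^sub>v v) > 0)"

text \<open>Only used for invertible matrices, where \<^const>\<open>mat_inverse\<close> is not \<^const>\<open>None\<close>.\<close>

definition inv_mat :: "real mat \<Rightarrow> real mat" where
  "inv_mat Z = the (mat_inverse Z)"

text \<open>
  \<open>G 0, \<dots>, G (l - 1)\<close> are independent random \<open>m \<times> n\<close> matrices, each with independent standard
  normal entries; equivalently, all \<open>l * m * n\<close> entries are mutually independent.
\<close>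

definition indep_std_normal_mats ::
  "'w measure \<Rightarrow> nat \<Rightarrow> nat \<Rightarrow> nat \<Rightarrow> (nat \<Rightarrow> 'w \<Rightarrow> real mat) \<Rightarrow> bool" where
  "indep_std_normal_mats M l m n G \<longleftrightarrow>
     prob_space M \<and>
     (\<forall>i<l. \<forall>\<omega> \<in> space M. G i \<omega> \<in> carrier_mat m n) \<and>
     (\<forall>i<l. \<forall>a<m. \<forall>b<n. distributed M lborel (\<lambda>\<omega>. G i \<omega> $$ (a, b)) std_normal_density) \<and>
     prob_space.indep_vars M (\<lambda>_. borel) (\<lambda>(i, a, b) \<omega>. G i \<omega> $$ (a, b))
       ({..<l} \<times> {..<m} \<times> {..<n})"

text \<open>The matrix \<open>H\<close>, built from \<open>k1 \<times> k2\<close> coefficients \<open>A i\<close> and \<open>m \<times> n\<close> matrices \<open>G i\<close>.\<close>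

definition gaussian_kronecker ::
  "nat \<Rightarrow> nat \<Rightarrow> nat \<Rightarrow> nat \<Rightarrow> nat \<Rightarrow> (nat \<Rightarrow> real mat) \<Rightarrow> (nat \<Rightarrow> real mat) \<Rightarrow> real mat" where
  "gaussian_kronecker k1 k2 l m n A G =
     (1 / sqrt (real n)) \<cdot>\<^sub>m mat_sum (k1 * m) (k2 * n) (\<lambda>i. kronecker (A i) (G i)) l"

end

theory Submission
 imports Defs
begin

text \<open>
 Let \<open>X\<close> be the symmetric matrix whose off-diagonal blocks are \<open>H\<close> and its transpose, and let \<open>s\<close> be
 the largest singular value of \<open>H\<close>. Then \<open>s ^ (2 * q)\<close> is at most half the trace of \<open>X ^ (2 * q)\<close>,
 and at least the quotient of the traces of \<open>X ^ (2 * (p + q))\<close> and \<open>X ^ (2 * p)\<close>. All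
 information on \<open>s\<close> is drawn from such traces.

 Gaussian integration by parts expresses the expected trace of a word in \<open>X\<close> by expected products
 of traces of shorter words. Covariances of normalised traces vanish in the limit
 (\<open>covariance_bound\<close>), so the normalised moments converge to the solution \<open>Mo\<close> of a closed quadratic
 recursion (\<open>EM_limit\<close>); its trace over the row block is \<open>tt\<close>. The number \<open>L\<close> is the infimum of
 all \<open>z\<close> for which \<open>tt \<alpha> (2 * Suc q) \<le> z ^ (2 * q) * tt \<alpha> 2\<close> holds for every \<open>q\<close>.

 The limit inferior of the expectations is at least \<open>L\<close>: for \<open>z < L\<close> one of these inequalities
 fails, the two traces concentrate, and their quotient bounds \<open>s\<close> from below (\<open>lower_edge\<close>).

 For the upper bound the order \<open>P\<close> of the moments has to grow faster than \<open>ln n\<close>, while the limits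
 above are for fixed order. Two independent copies of \<open>X\<close> are rotated into one matrix of twice the
 size. The derivative of the trace of order \<open>P\<close> along the rotation is a sum of covariances, and is
 bounded by \<open>P\<^sup>2 / n\<close> times the trace itself; so doubling the size lowers the normalised trace at most
 by a factor \<open>exp (C * P\<^sup>2 / n)\<close> (\<open>doubling\<close>). The exponents of repeated doublings form a geometric
 series, and infinitely many of them lead to \<open>tt\<close>: as long as \<open>P\<^sup>2 \<le> n\<close>, the trace at size \<open>n\<close> is
 bounded by a constant multiple of its limit (\<open>trace_moment_bound\<close>). Doubling keeps the quotient of
 the two dimensions, whereas \<open>m / n\<close> only converges. The matrix is therefore first enlarged to one
 with a fixed rational quotient slightly above \<open>\<alpha>\<close>, and the exponential growth rate of \<open>tt\<close> is shown to
 be continuous from the right in \<open>\<alpha>\<close> (\<open>edge_right_continuous\<close>).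

 Finally, for \<open>t > L\<close> the series of \<open>Mo \<alpha> p / t ^ (p + 1)\<close> converges to a positive definite matrix
 with two diagonal blocks, and the recursion becomes the Dyson equation. It says that the blocks are
 inverse to matrices \<open>Z\<^sub>Y\<close> and \<open>Z\<^sub>X\<close> for which both matrices under the infimum are \<open>t\<close> times the identity
 (\<open>edge_variational\<close>). So the infimum is at most \<open>2 * t\<close>.
\<close>

section \<open>The ring of locally finite matrices\<close>

text \<open>Matrices with finitely many nonzero entries in each row and column form a unital real algebra. One
 type thus serves matrices of all sizes, with the ring operations of the type classes; a matrix
 of a given size is one that is considered on a finite index set.\<close>

typedef 'a lmat =
 "{A :: 'a => 'a => real. (\<forall>i. finite {j. A i j \<noteq> 0}) \<and> (\<forall>j. finite {i. A i j \<noteq> 0})}"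
 morphisms ent Lmat
 by (rule exI[of _ "%_ _. 0"]) simp

setup_lifting type_definition_lmat

lemma finite_support:
 fixes f g :: "'a => real"
 assumes "finite {i. f i \<noteq> 0}"
 shows "finite {i. g i \<noteq> 0} ==> finite {i. f i + g i \<noteq> 0}" and "finite {i. c * f i \<noteq> 0}"
proof -
 show "finite {i. c * f i \<noteq> 0}"
  using assms by (rule rev_finite_subset) auto
 assume "finite {i. g i \<noteq> 0}"
 with assms have "finite ({i. f i \<noteq> 0} \<union> {i. g i \<noteq> 0})" by simp
 then show "finite {i. f i + g i \<noteq> 0}" by (rule rev_finite_subset) auto
qed

instantiation lmat :: (type) real_algebra_1
begin

lift_definition zero_lmat :: "'a lmat" is "%_ _. 0" by simp

lift_definition one_lmat :: "'a lmat" is "%i j. if i = j then 1 else 0" by simp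

lift_definition plus_lmat :: "'a lmat => 'a lmat => 'a lmat" is "%A B i j. A i j + B i j"
 by (simp add: finite_support)

lift_definition uminus_lmat :: "'a lmat => 'a lmat" is "%A i j. - A i j" by simp

definition minus_lmat :: "'a lmat => 'a lmat => 'a lmat" where "minus_lmat A B = A + - B"

lift_definition scaleR_lmat :: "real => 'a lmat => 'a lmat" is "%c A i j. c * A i j"
 by (simp only: finite_support simp_thms)

lift_definition times_lmat :: "'a lmat => 'a lmat => 'a lmat"
 is "%A B i k. \<Sum>j | A i j \<noteq> 0. A i j * B j k"
proof -
 fix A B :: "'a => 'a => real"
 assume *: "(\<forall>i. finite {j. A i j \<noteq> 0}) \<and> (\<forall>j. finite {i. A i j \<noteq> 0})"
  "(\<forall>i. finite {j. B i j \<noteq> 0}) \<and> (\<forall>j. finite {i. B i j \<noteq> 0})"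
 have ex: "\<exists>j. A i j \<noteq> 0 \<and> B j k \<noteq> 0" if "(\<Sum>j | A i j \<noteq> 0. A i j * B j k) \<noteq> 0" for i k
  using sum.not_neutral_contains_not_neutral[OF that] by auto
 show "(\<forall>i. finite {k. (\<Sum>j | A i j \<noteq> 0. A i j * B j k) \<noteq> 0}) \<and>
    (\<forall>k. finite {i. (\<Sum>j | A i j \<noteq> 0. A i j * B j k) \<noteq> 0})"
 proof (intro conjI allI)
  fix i
  have "{k. (\<Sum>j | A i j \<noteq> 0. A i j * B j k) \<noteq> 0} \<subseteq> (\<Union>j\<in>{j. A i j \<noteq> 0}. {k. B j k \<noteq> 0})"
   using ex[of i] by blast
  moreover have "finite (\<Union>j\<in>{j. A i j \<noteq> 0}. {k. B j k \<noteq> 0})"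
   using * by blast
  ultimately show "finite {k. (\<Sum>j | A i j \<noteq> 0. A i j * B j k) \<noteq> 0}"
   by (rule finite_subset)
 next
  fix k
  have "{i. (\<Sum>j | A i j \<noteq> 0. A i j * B j k) \<noteq> 0} \<subseteq> (\<Union>j\<in>{j. B j k \<noteq> 0}. {i. A i j \<noteq> 0})"
   using ex[of _ k] by blast
  moreover have "finite (\<Union>j\<in>{j. B j k \<noteq> 0}. {i. A i j \<noteq> 0})"
   using * by blast
  ultimately show "finite {i. (\<Sum>j | A i j \<noteq> 0. A i j * B j k) \<noteq> 0}"
   by (rule finite_subset)
 qed
qed

lemma finite_row: "finite {j. ent A i j \<noteq> 0}" and finite_col: "finite {i. ent A i j \<noteq> 0}"
 using ent[of A] by auto

lemma ent_times_on:
 assumes "finite S" "!!j. j \<notin> S ==> ent A i j = 0 \<or> ent B j k = 0"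
 shows "ent (A * B) i k = (\<Sum>j\<in>S. ent A i j * ent B j k)"
proof -
 have "ent (A * B) i k = (\<Sum>j | ent A i j \<noteq> 0. ent A i j * ent B j k)"
  by transfer rule
 also have "\<dots> = (\<Sum>j\<in>S. ent A i j * ent B j k)"
  using assms finite_row[of A i] by (intro sum.mono_neutral_cong) auto
 finally show ?thesis .
qed

lemma lmat_eqI: "(!!i j. ent A i j = ent B i j) ==> A = B"
 by (metis ent_inject ext)

lemmas ent_simps [simp] =
 zero_lmat.rep_eq one_lmat.rep_eq plus_lmat.rep_eq uminus_lmat.rep_eq scaleR_lmat.rep_eq

instance
proof
 fix A B C :: "'a lmat" and c d :: real
 show "A * B * C = A * (B * C)"
 proof (rule lmat_eqI)
  fix i l
  define S where "S = {j. ent A i j \<noteq> 0}"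
  define T where "T = (\<Union>j\<in>S. {k. ent B j k \<noteq> 0})"
  have fin: "finite S" "finite T"
   unfolding S_def T_def using finite_row[of A] finite_row[of B] by auto
  have AB: "ent (A * B) i k = (\<Sum>j\<in>S. ent A i j * ent B j k)" for k
   by (rule ent_times_on[OF fin(1)]) (auto simp: S_def)
  have AB0: "ent (A * B) i k = 0" if "k \<notin> T" for k
   unfolding AB using that by (intro sum.neutral) (auto simp: T_def)
  have BC: "ent (B * C) j l = (\<Sum>k\<in>T. ent B j k * ent C k l)" if "j \<in> S" for j
   by (rule ent_times_on[OF fin(2)]) (use that in \<open>auto simp: T_def\<close>)
  have "ent (A * B * C) i l = (\<Sum>k\<in>T. (\<Sum>j\<in>S. ent A i j * ent B j k) * ent C k l)"
   using AB0 by (subst ent_times_on[OF fin(2)]) (auto simp: AB)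
  also have "\<dots> = (\<Sum>j\<in>S. ent A i j * ent (B * C) j l)"
   by (simp add: BC sum_distrib_left sum_distrib_right mult.assoc) (rule sum.swap)
  also have "\<dots> = ent (A * (B * C)) i l"
   by (rule ent_times_on[OF fin(1), symmetric]) (auto simp: S_def)
  finally show "ent (A * B * C) i l = ent (A * (B * C)) i l" .
 qed
 show "1 * A = A"
 proof (rule lmat_eqI)
  show "ent (1 * A) i j = ent A i j" for i j
   by (subst ent_times_on[of "{i}"]) auto
 qed
 show "A * 1 = A"
 proof (rule lmat_eqI)
  show "ent (A * 1) i j = ent A i j" for i j
   by (subst ent_times_on[of "{j}"]) auto
 qed
 show "(A + B) * C = A * C + B * C"
 proof (rule lmat_eqI)
  fix i j
  let ?S = "{j. ent A i j \<noteq> 0} \<union> {j. ent B i j \<noteq> 0}"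
  have S: "finite ?S" using finite_row[of A i] finite_row[of B i] by auto
  show "ent ((A + B) * C) i j = ent (A * C + B * C) i j"
   by (subst ent_times_on[OF S], simp, simp, subst ent_times_on[OF S], simp, subst ent_times_on[OF S])
    (simp_all add: sum.distrib algebra_simps)
 qed
 show "A * (B + C) = A * B + A * C"
 proof (rule lmat_eqI)
  fix i j
  let ?S = "{j. ent A i j \<noteq> 0}"
  have S: "finite ?S" using finite_row[of A i] by auto
  show "ent (A * (B + C)) i j = ent (A * B + A * C) i j"
   by (subst ent_times_on[OF S], simp, simp, subst ent_times_on[OF S], simp, subst ent_times_on[OF S])
    (simp_all add: sum.distrib algebra_simps)
 qed
 show "(c *\<^sub>R A) * B = c *\<^sub>R (A * B)"
 proof (rule lmat_eqI)
  fix i j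
  let ?S = "{j. ent A i j \<noteq> 0}"
  have S: "finite ?S" using finite_row[of A i] by auto
  show "ent ((c *\<^sub>R A) * B) i j = ent (c *\<^sub>R (A * B)) i j"
   by (subst ent_times_on[OF S], simp, simp, subst ent_times_on[OF S])
    (simp_all add: sum_distrib_left algebra_simps)
 qed
 show "A * (c *\<^sub>R B) = c *\<^sub>R (A * B)"
 proof (rule lmat_eqI)
  fix i j
  let ?S = "{j. ent A i j \<noteq> 0}"
  have S: "finite ?S" using finite_row[of A i] by auto
  show "ent (A * (c *\<^sub>R B)) i j = ent (c *\<^sub>R (A * B)) i j"
   by (subst ent_times_on[OF S], simp, simp, subst ent_times_on[OF S])
    (simp_all add: sum_distrib_left algebra_simps)
 qed
 show "A + B + C = A + (B + C)" "A + B = B + A" "0 + A = A" "- A + A = 0" "A - B = A + - B"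
  "c *\<^sub>R (A + B) = c *\<^sub>R A + c *\<^sub>R B" "(c + d) *\<^sub>R A = c *\<^sub>R A + d *\<^sub>R A"
  "c *\<^sub>R d *\<^sub>R A = (c * d) *\<^sub>R A" "1 *\<^sub>R A = A"
  by (auto intro!: lmat_eqI simp: algebra_simps minus_lmat_def)
 show "(0 :: 'a lmat) \<noteq> 1"
 proof
  assume "(0 :: 'a lmat) = 1"
  then have "ent (0 :: 'a lmat) undefined undefined = ent 1 undefined undefined" by simp
  then show False by simp
 qed
qed

end

lemma ent_diff [simp]: "ent (A - B) i j = ent A i j - ent B i j"
 unfolding minus_lmat_def plus_lmat.rep_eq uminus_lmat.rep_eq by simp

lemma ent_sum: "ent (sum F S) i j = (\<Sum>s\<in>S. ent (F s) i j)"
 by (induction S rule: infinite_finite_induct) auto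

lift_definition tp :: "'a lmat => 'a lmat" is "%A i j. A j i" by simp

lemmas ent_tp [simp] = tp.rep_eq

lemma tp_mult: "tp (A * B) = tp B * tp A"
proof (rule lmat_eqI)
 fix i k
 let ?S = "{j. ent A k j \<noteq> 0}"
 have S: "finite ?S" using finite_row[of A k] by auto
 show "ent (tp (A * B)) i k = ent (tp B * tp A) i k"
  by (simp, subst ent_times_on[OF S], simp, subst ent_times_on[OF S]) (auto simp: mult.commute)
qed

lemma tp_simps [simp]: "tp (tp A) = A" "tp 1 = 1" "tp 0 = 0" "tp (A + B) = tp A + tp B"
 "tp (c *\<^sub>R A) = c *\<^sub>R tp A" "tp (A - B) = tp A - tp B"
 by (auto intro!: lmat_eqI)

lemma tp_sum: "tp (sum F S) = (\<Sum>s\<in>S. tp (F s))"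
 by (induction S rule: infinite_finite_induct) auto

lemma tp_power: "tp (A ^ n) = tp A ^ n"
 by (induction n) (auto simp: tp_mult power_commutes)

text \<open>Block-diagonality with respect to \<open>D\<close> and its complement, which makes the entries in
 \<open>D\<close> of a product depend on the entries in \<open>D\<close> of the factors only. In
 contrast to matrices supported on \<open>D\<close>, these contain the unit.\<close>

definition adm :: "'a set => 'a lmat => bool" where
 "adm D A \<longleftrightarrow> (\<forall>i j. ent A i j \<noteq> 0 \<longrightarrow> (i \<in> D \<longleftrightarrow> j \<in> D))"

lemma adm_times_ent:
 assumes "finite D" "adm D A" "i \<in> D"
 shows "ent (A * B) i k = (\<Sum>j\<in>D. ent A i j * ent B j k)"
 by (rule ent_times_on[OF assms(1)]) (use assms in \<open>auto simp: adm_def\<close>)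

lemma adm_intros [simp, intro]:
 "adm D 0" "adm D 1" "adm D A ==> adm D B ==> adm D (A + B)" "adm D A ==> adm D (c *\<^sub>R A)"
 "adm D A ==> adm D B ==> adm D (A - B)"
 "adm D A ==> adm D (tp A)"
 unfolding adm_def by (force split: if_splits)+

lemma adm_mult [simp, intro]:
 assumes "adm D A" "adm D B" shows "adm D (A * B)"
 unfolding adm_def
proof (intro allI impI)
 fix i k assume "ent (A * B) i k \<noteq> 0"
 moreover have "ent (A * B) i k = (\<Sum>j | ent A i j \<noteq> 0. ent A i j * ent B j k)"
  by (rule ent_times_on[OF finite_row]) auto
 ultimately have "(\<Sum>j | ent A i j \<noteq> 0. ent A i j * ent B j k) \<noteq> 0" by simp
 from sum.not_neutral_contains_not_neutral[OF this]
 obtain j where "ent A i j \<noteq> 0" "ent B j k \<noteq> 0" by auto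
 then show "i \<in> D \<longleftrightarrow> k \<in> D" using assms by (auto simp: adm_def)
qed

lemma adm_power [simp, intro]: "adm D A ==> adm D (A ^ n)"
 by (induction n) auto

lemma adm_sum: "(!!s. s \<in> S ==> adm D (F s)) ==> adm D (sum F S)"
 by (induction S rule: infinite_finite_induct) auto

definition tr :: "'a set => 'a lmat => real" where
 "tr D A = (\<Sum>i\<in>D. ent A i i)"

lemma tr_simps [simp]: "tr D 0 = 0" "tr D (A + B) = tr D A + tr D B" "tr D (c *\<^sub>R A) = c * tr D A"
 "tr D (A - B) = tr D A - tr D B" "tr D (tp A) = tr D A"
 by (auto simp: tr_def sum.distrib sum_distrib_left sum_subtractf)

lemma tr_one [simp]: "tr D 1 = real (card D)"
 by (simp add: tr_def)

lemma tr_sum: "tr D (sum F S) = (\<Sum>s\<in>S. tr D (F s))"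
 by (induction S rule: infinite_finite_induct) auto

lemma tr_times:
 assumes "finite D" "adm D A"
 shows "tr D (A * B) = (\<Sum>i\<in>D. \<Sum>j\<in>D. ent A i j * ent B j i)"
 unfolding tr_def by (intro sum.cong refl adm_times_ent assms)

lemma tr_commute:
 assumes "finite D" "adm D A" "adm D B"
 shows "tr D (A * B) = tr D (B * A)"
 unfolding tr_times[OF assms(1,2)] tr_times[OF assms(1,3)]
 by (subst sum.swap) (simp add: mult.commute)

lemma tr_gram_nonneg:
 assumes "finite D" "adm D A"
 shows "0 \<le> tr D (tp A * A)"
 by (subst tr_times[OF assms(1)]) (use assms in \<open>auto intro!: sum_nonneg\<close>)

section \<open>A trace inequality of Hoelder type\<close>

lemma tr_two_le:
 assumes D: "finite D" and adm: "adm D A" "adm D B"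
  and T: "tr D (tp A * A) \<le> T" "tr D (tp B * B) \<le> T"
 shows "\<bar>tr D (A * B)\<bar> \<le> T"
proof -
 have "\<bar>tr D (A * B)\<bar> \<le> (\<Sum>i\<in>D. \<Sum>j\<in>D. \<bar>ent A i j * ent B j i\<bar>)"
  unfolding tr_times[OF D adm(1)] by (intro order_trans[OF sum_abs] sum_mono sum_abs)
 also have "\<dots> \<le> (\<Sum>i\<in>D. \<Sum>j\<in>D. ((ent A i j)\<^sup>2 + (ent B j i)\<^sup>2) / 2)"
 proof (intro sum_mono)
  fix i j
  have "2 * (\<bar>ent A i j\<bar> * \<bar>ent B j i\<bar>) \<le> \<bar>ent A i j\<bar>\<^sup>2 + \<bar>ent B j i\<bar>\<^sup>2"
   using sum_squares_bound[of "\<bar>ent A i j\<bar>" "\<bar>ent B j i\<bar>"] by (simp add: mult.assoc)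
  then show "\<bar>ent A i j * ent B j i\<bar> \<le> ((ent A i j)\<^sup>2 + (ent B j i)\<^sup>2) / 2"
   by (simp add: abs_mult)
 qed
 also have "\<dots> = (tr D (tp A * A) + tr D (tp B * B)) / 2"
 proof -
  have A: "tr D (tp A * A) = (\<Sum>i\<in>D. \<Sum>j\<in>D. (ent A i j)\<^sup>2)"
   using D adm by (subst tr_times) (auto simp: power2_eq_square intro: sum.swap)
  have B: "tr D (tp B * B) = (\<Sum>i\<in>D. \<Sum>j\<in>D. (ent B j i)\<^sup>2)"
   using D adm by (subst tr_times) (auto simp: power2_eq_square)
  show ?thesis unfolding A B by (simp add: sum.distrib sum_divide_distrib[symmetric])
 qed
 also have "\<dots> \<le> T" using T by simp
 finally show ?thesis .
qed

fun pair_up :: "'a :: times list => 'a list" where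
 "pair_up (x # y # xs) = x * y # pair_up xs"
| "pair_up xs = xs"

lemma prod_list_pair_up: "prod_list (pair_up xs) = prod_list (xs :: 'a :: monoid_mult list)"
 by (induction xs rule: pair_up.induct) (auto simp: mult.assoc)

lemma length_pair_up: "even (length xs) ==> length (pair_up xs) = length xs div 2"
 by (induction xs rule: pair_up.induct) auto

lemma set_pair_up:
 "even (length xs) ==> z \<in> set (pair_up xs) ==> \<exists>x\<in>set xs. \<exists>y\<in>set xs. z = x * y"
 by (induction xs rule: pair_up.induct) auto

lemma prod_list_concat_replicate:
 "prod_list (concat (replicate n xs)) = prod_list xs ^ n"
 for xs :: "'a :: monoid_mult list"
 by (induction n) auto

lemma sandwich_power:
 fixes A B C :: "'a :: monoid_mult"
 shows "(A * B * C) ^ Suc n = A * (B * C * A) ^ n * (B * C)"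
proof (induction n)
 case (Suc n)
 have "(A * B * C) ^ Suc (Suc n) = (A * (B * C * A) ^ n * (B * C)) * (A * B * C)"
  by (metis Suc.IH power_Suc2)
 also have "\<dots> = A * ((B * C * A) ^ n * (B * C * A)) * (B * C)"
  by (simp add: mult.assoc)
 finally show ?case by (simp only: power_Suc2)
qed (simp add: mult.assoc)

lemma tr_cycle_power:
 assumes "finite D" "adm D A" "adm D B" "0 < n"
 shows "tr D ((A * B) ^ n) = tr D ((B * A) ^ n)"
proof -
 obtain m where n: "n = Suc m" using assms(4) by (cases n) auto
 have "(A * B) ^ Suc m = A * ((B * A) ^ m * B)"
  using sandwich_power[of A B 1 m] by (simp add: mult.assoc)
 moreover have "(B * A) ^ Suc m = ((B * A) ^ m * B) * A"
  by (simp only: power_Suc2 mult.assoc)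
 ultimately show ?thesis
  unfolding n using assms by (metis tr_commute adm_mult adm_power)
qed

text \<open>The Hoelder inequality for a word whose length is a power of two, by induction on the exponent:
 the Cauchy--Schwarz inequality for the trace splits a word into two halves, each of which is
 turned into a word of half the length in the products \<open>tp L * L\<close>.\<close>

lemma tr_word_le:
 assumes D: "finite D"
 shows "length Ls = 2 ^ Suc s ==>
  (!!L. L \<in> set Ls ==> adm D L \<and> tr D ((tp L * L) ^ (2 ^ s)) \<le> T) ==>
  \<bar>tr D (prod_list Ls)\<bar> \<le> T"
proof (induction s arbitrary: Ls)
 case 0
 then obtain A B where Ls: "Ls = [A, B]"
  by (auto simp: length_Suc_conv numeral_2_eq_2)
 show ?case using 0(2) unfolding Ls by (auto intro!: tr_two_le D)
next
 case (Suc s)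
 have ev: "even (length Ls)" using Suc.prems by simp
 have "\<bar>tr D (prod_list (pair_up Ls))\<bar> \<le> T"
 proof (rule Suc.IH)
  show "length (pair_up Ls) = 2 ^ Suc s" using Suc.prems by (simp add: length_pair_up)
  fix L assume "L \<in> set (pair_up Ls)"
  then obtain A B where AB: "A \<in> set Ls" "B \<in> set Ls" "L = A * B"
   using set_pair_up[OF ev] by blast
  then have adm: "adm D A" "adm D B" and
   T: "tr D ((tp A * A) ^ (2 ^ Suc s)) \<le> T" "tr D ((tp B * B) ^ (2 ^ Suc s)) \<le> T"
   using Suc.prems(2) by auto
  define P where "P = tp A * A"
  define Q where "Q = B * tp B"
  have admPQ: "adm D P" "adm D Q" using adm by (auto simp: P_def Q_def)
  have PQ: "tp P * P = P ^ 2" "tp Q * Q = Q ^ 2"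
   by (auto simp: P_def Q_def tp_mult power2_eq_square)
  have trQ: "tr D (Q ^ (2 ^ Suc s)) \<le> T"
   using T(2) unfolding Q_def using adm D by (subst tr_cycle_power) auto
  have len: "length (concat (replicate (2 ^ s) [P, Q])) = 2 ^ Suc s"
   by (simp add: length_concat sum_list_replicate)
  have "\<bar>tr D (prod_list (concat (replicate (2 ^ s) [P, Q])))\<bar> \<le> T"
  proof (rule Suc.IH[OF len])
   fix L assume "L \<in> set (concat (replicate (2 ^ s) [P, Q]))"
   then have "L = P \<or> L = Q" by auto
   then show "adm D L \<and> tr D ((tp L * L) ^ 2 ^ s) \<le> T"
    using admPQ T(1) trQ PQ by (auto simp: power_mult[symmetric] P_def)
  qed
  then have *: "\<bar>tr D ((P * Q) ^ (2 ^ s))\<bar> \<le> T"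
   by (simp only: prod_list_concat_replicate) simp
  have "tp L * L = tp B * (P * B)"
   unfolding AB P_def by (simp add: tp_mult mult.assoc)
  then have "tr D ((tp L * L) ^ (2 ^ s)) = tr D ((P * B * tp B) ^ (2 ^ s))"
   using adm admPQ D by (subst tr_cycle_power[symmetric]) auto
  also have "\<dots> = tr D ((P * Q) ^ (2 ^ s))" by (simp add: Q_def mult.assoc)
  finally show "adm D L \<and> tr D ((tp L * L) ^ 2 ^ s) \<le> T"
   using * adm AB by auto
 qed
 then show ?case by (simp add: prod_list_pair_up)
qed

lemma scaleR_lmat_power: "(c *\<^sub>R A) ^ n = c ^ n *\<^sub>R A ^ n" for A :: "'a lmat"
 by (induction n) (simp_all add: mult.commute)

text \<open>A substitute for operator norm at most one that is a statement on traces, as the Hoelder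
 inequality below needs it.\<close>

definition small :: "'a set => 'a lmat => bool" where
 "small D B \<longleftrightarrow> adm D B \<and> (\<forall>q. tr D ((tp B * B) ^ q) \<le> real (card D))"

lemma small_one [simp]: "small D 1"
 by (simp add: small_def)

text \<open>Compressing a symmetric matrix by an orthogonal projection decreases the traces of its even
 powers.\<close>

lemma tr_compress:
 assumes D: "finite D" and Q: "adm D Q" "tp Q = Q" "Q * Q = Q"
 shows "adm D S ==> tp S = S ==> tr D ((Q * S) ^ (2 ^ Suc k)) \<le> tr D (S ^ (2 ^ Suc k))"
proof (induction k arbitrary: S)
 have step: "tr D ((Q * S) ^ (2 ^ Suc k)) \<le> tr D ((Q * (S * S)) ^ (2 ^ k))"
  if S: "adm D S" "tp S = S" for S k
 proof -
  have "tp (Q * S) * (Q * S) = S * (Q * S)"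
   using S Q by (simp add: tp_mult mult.assoc) (metis mult.assoc)
  then have "tr D ((tp (Q * S) * (Q * S)) ^ 2 ^ k) = tr D ((Q * (S * S)) ^ 2 ^ k)"
   using S Q D by (simp add: mult.assoc) (subst tr_cycle_power, auto simp: mult.assoc)
  then have "\<bar>tr D (prod_list (replicate (2 ^ Suc k) (Q * S)))\<bar> \<le> tr D ((Q * (S * S)) ^ 2 ^ k)"
   using S Q D by (intro tr_word_le[OF D]) auto
  then show ?thesis by (simp add: prod_list_replicate)
 qed
 {
  case 0
  let ?R = "(1 - Q) * S"
  have "tp ?R * ?R = S * ((1 - Q) * (1 - Q)) * S"
   using 0 Q by (simp add: tp_mult mult.assoc)
  also have "(1 - Q) * (1 - Q) = 1 - Q"
   using Q by (simp add: algebra_simps)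
  finally have "tp ?R * ?R = S * S - S * (Q * S)" by (simp add: algebra_simps)
  moreover have "0 \<le> tr D (tp ?R * ?R)"
   using 0 Q D by (intro tr_gram_nonneg) auto
  moreover have "tr D (S * (Q * S)) = tr D (Q * (S * S))"
   using 0 Q D by (subst tr_commute) (auto simp: mult.assoc)
  ultimately have "tr D (Q * (S * S)) \<le> tr D (S * S)" by simp
  with step[OF 0, of 0] show ?case by (simp add: power2_eq_square)
 next
  case (Suc k)
  have "tr D ((Q * (S * S)) ^ (2 ^ Suc k)) \<le> tr D ((S * S) ^ (2 ^ Suc k))"
   using Suc by (intro Suc.IH) (auto simp: tp_mult)
  moreover have "(S * S) ^ (2 ^ Suc k) = S ^ (2 ^ Suc (Suc k))"
  proof -
   have "S ^ (2 * 2 ^ Suc k) = (S ^ 2) ^ 2 ^ Suc k" by (rule power_mult)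
   then show ?thesis by (simp only: power2_eq_square power_Suc[of 2 "Suc k"])
  qed
  ultimately show ?case using step[OF Suc.prems, of "Suc k"] by simp
 }
qed

section \<open>Polynomials in independent standard normal variables\<close>

abbreviation stdn :: "real measure" where "stdn \<equiv> density lborel std_normal_density"

definition gm :: "'e set => ('e => real) measure" where
 "gm I = Pi\<^sub>M I (%_. stdn)"

lemma prob_space_stdn: "prob_space stdn"
 by (rule prob_space_normal_density) simp

lemma prob_space_gm: "prob_space (gm I)"
 unfolding gm_def by (intro prob_space_PiM prob_space_stdn)

lemma integrable_stdn_power: "integrable stdn (%x. x ^ k)"
 by (subst integrable_density) (use integrable_std_normal_moment[of k] in auto)

definition stdn_moment :: "nat => real" where
 "stdn_moment k = (\<integral>x. x ^ k \<partial>stdn)"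

lemma stdn_moment_eq: "stdn_moment k = (\<integral>x. std_normal_density x * x ^ k \<partial>lborel)"
 unfolding stdn_moment_def by (subst integral_density) auto

lemma stdn_moment_0 [simp]: "stdn_moment 0 = 1"
 using prob_space.prob_space[OF prob_space_stdn] by (simp add: stdn_moment_def)

lemma stdn_moment_Suc: "stdn_moment (Suc k) = real k * stdn_moment (k - 1)"
proof (cases "even k")
 case True
 then obtain j where k: "k = 2 * j" by (auto elim: evenE)
 show ?thesis
 proof (cases j)
  case 0
  then show ?thesis
   using integral_std_normal_moment_odd[of 0] by (simp add: k stdn_moment_eq)
 next
  case (Suc i)
  then have "k - 1 = 2 * i + 1" "Suc k = 2 * j + 1" using k by auto
  then show ?thesis
   using integral_std_normal_moment_odd[of j] integral_std_normal_moment_odd[of i]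
   by (simp add: stdn_moment_eq)
 qed
next
 case False
 then obtain j where k: "k = 2 * j + 1" by (auto elim: oddE)
 then have "k - 1 = 2 * j" "Suc k = 2 * (j + 1)" by auto
 then have "stdn_moment (k - 1) = fact (2 * j) / (2 ^ j * fact j)"
  "stdn_moment (Suc k) = fact (2 * (j + 1)) / (2 ^ (j + 1) * fact (j + 1))"
  unfolding stdn_moment_eq by (simp_all only: integral_std_normal_moment_even)
 moreover have "fact (2 * (j + 1)) / (2 ^ (j + 1) * fact (j + 1))
   = (2 * (real j + 1)) * ((2 * real j + 1) * fact (2 * j)) / ((2 * (real j + 1)) * (2 ^ j * fact j))"
  by (simp add: algebra_simps)
 moreover have "\<dots> = (2 * real j + 1) * (fact (2 * j) / (2 ^ j * fact j))"
  by (subst mult_divide_mult_cancel_left) auto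
 ultimately show ?thesis
  by (simp add: k)
qed

definition mon :: "'e set => ('e => nat) => ('e => real) => real" where
 "mon I k x = (\<Prod>e\<in>I. x e ^ k e)"

lemma mon_0 [simp]: "mon I (%_. 0) x = 1"
 by (simp add: mon_def)

lemma mon_Suc:
 assumes "finite I" "e \<in> I"
 shows "mon I (k(e := Suc (k e))) x = x e * mon I k x"
 using assms by (auto simp: mon_def prod.remove[of I e])

lemma integral_mon:
 assumes "finite I"
 shows "integrable (gm I) (mon I k)" "(\<integral>x. mon I k x \<partial>gm I) = (\<Prod>e\<in>I. stdn_moment (k e))"
proof -
 interpret product_prob_space "%_. stdn"
  by (intro product_prob_spaceI prob_space_stdn)
 show "integrable (gm I) (mon I k)"
  unfolding mon_def gm_def by (intro product_integrable_prod assms integrable_stdn_power)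
 show "(\<integral>x. mon I k x \<partial>gm I) = (\<Prod>e\<in>I. stdn_moment (k e))"
  unfolding mon_def gm_def stdn_moment_def
  by (intro product_integral_prod assms integrable_stdn_power)
qed

text \<open>The last argument is the gradient of the polynomial. Generating a polynomial together with its
 gradient turns every statement about derivatives into an induction.\<close>

inductive gp :: "'e set => (('e => real) => real) => ('e => ('e => real) => real) => bool"
 for I where
 gp_const: "gp I (%_. c) (%_ _. 0)"
| gp_add: "gp I F D ==> gp I G E ==> gp I (%x. F x + G x) (%e x. D e x + E e x)"
| gp_var_mult: "e \<in> I ==> gp I F D ==>
  gp I (%x. x e * F x) (%e' x. (if e' = e then F x else 0) + x e * D e' x)"

lemma gp_cong:
 assumes "gp I F D" "!!x. F' x = F x" "!!e x. D' e x = D e x"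
 shows "gp I F' D'"
proof -
 have "F' = F" "D' = D" using assms by (auto intro!: ext)
 with assms(1) show ?thesis by simp
qed

lemma gp_local:
 assumes "gp I F D" "!!e. e \<in> I ==> z e = z' e" shows "F z = F z'"
 using assms by induction auto

lemma gp_smult:
 assumes "gp I F D" shows "gp I (%x. c * F x) (%e x. c * D e x)"
 using assms
proof induction
 case (gp_const c')
 show ?case by (rule gp_cong[OF gp.gp_const[of I "c * c'"]]) auto
next
 case (gp_add F D G E)
 show ?case by (rule gp_cong[OF gp.gp_add[OF gp_add.IH]]) (auto simp: algebra_simps)
next
 case (gp_var_mult e F D)
 show ?case
  by (rule gp_cong[OF gp.gp_var_mult[OF gp_var_mult.hyps(1) gp_var_mult.IH]])
   (auto simp: algebra_simps)
qed

lemma gp_mult: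
 assumes "gp I F D" "gp I G E"
 shows "gp I (%x. F x * G x) (%e x. D e x * G x + F x * E e x)"
 using assms(1)
proof induction
 case (gp_const c)
 show ?case by (rule gp_cong[OF gp_smult[OF assms(2)]]) auto
next
 case (gp_add F D F' D')
 show ?case by (rule gp_cong[OF gp.gp_add[OF gp_add.IH]]) (auto simp: algebra_simps)
next
 case (gp_var_mult e F D)
 show ?case
  by (rule gp_cong[OF gp.gp_var_mult[OF gp_var_mult.hyps(1) gp_var_mult.IH]])
   (auto simp: algebra_simps)
qed

lemma gp_sum:
 assumes "!!s. s \<in> S ==> gp I (F s) (D s)"
 shows "gp I (%x. \<Sum>s\<in>S. F s x) (%e x. \<Sum>s\<in>S. D s e x)"
 using assms
proof (induction S rule: infinite_finite_induct)
 case (insert s S)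
 then have "gp I (%x. F s x + (\<Sum>s\<in>S. F s x)) (%e x. D s e x + (\<Sum>s\<in>S. D s e x))"
  by (intro gp.gp_add) auto
 with insert show ?case by simp
qed (simp_all add: gp.gp_const)

lemma gp_var:
 assumes "e \<in> I" shows "gp I (%x. x e) (%e' x. if e' = e then 1 else 0)"
 by (rule gp_cong[OF gp.gp_var_mult[OF assms gp.gp_const[of I 1]]]) auto

lemma gp_linear:
 assumes "finite I"
 shows "gp I (%x. \<Sum>e\<in>I. c e * x e) (%e' x. if e' \<in> I then c e' else 0)"
proof -
 have "gp I (%x. \<Sum>e\<in>I. c e * x e) (%e' x. \<Sum>e\<in>I. c e * (if e' = e then 1 else 0))"
  by (intro gp_sum gp_smult gp_var)
 moreover have "(\<Sum>e\<in>I. c e * (if e' = e then 1 else 0)) = (if e' \<in> I then c e' else 0)" for e'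
 proof -
  have "(\<Sum>e\<in>I. c e * (if e' = e then 1 else 0)) = (\<Sum>e\<in>I. if e' = e then c e else 0)"
   by (intro sum.cong) auto
  then show ?thesis using assms by simp
 qed
 ultimately show ?thesis by simp
qed

lemma gp_deriv:
 assumes "gp I F D"
 shows "\<exists>E. \<forall>e. gp I (D e) (E e)"
 using assms
proof induction
  case (gp_const c)
  show ?case by (intro exI[of _ "%_ _ _. 0"] allI gp.gp_const)
 next
  case (gp_add F D G E)
  then obtain D2 E2 where "!!e. gp I (D e) (D2 e)" "!!e. gp I (E e) (E2 e)" by blast
  then show ?case
   by (intro exI[of _ "%e e' x. D2 e e' x + E2 e e' x"] allI gp.gp_add)
 next
  case (gp_var_mult e F D)
  then obtain E where E: "!!e. gp I (D e) (E e)" by blast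
  have 1: "gp I (%x. if e' = e then F x else 0) (%e'' x. if e' = e then D e'' x else 0)" for e'
   using gp_var_mult.hyps(2) gp.gp_const[of I 0] by (cases "e' = e") auto
  show ?case
   using gp.gp_add[OF 1 gp.gp_var_mult[OF gp_var_mult.hyps(1) E]]
   by (intro exI[of _ "%e' e'' x. (if e' = e then D e'' x else 0) +
    ((if e'' = e then D e' x else 0) + x e * E e' e'' x)"] allI)
qed

lemma gp_subst:
 assumes "gp I F D" "finite I" "finite I'"
 shows "gp I' (%x. F (%e. \<Sum>f\<in>I'. c e f * x f))
  (%f x. \<Sum>e\<in>I. (if f \<in> I' then c e f else 0) * D e (%e. \<Sum>f\<in>I'. c e f * x f))"
 using assms(1)
proof induction
 case (gp_const c)
 show ?case by (rule gp_cong[OF gp.gp_const]) auto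
next
 case (gp_add F D G E)
 show ?case
  by (rule gp_cong[OF gp.gp_add[OF gp_add.IH]]) (auto simp: algebra_simps sum.distrib)
next
 case (gp_var_mult e F D)
 let ?L = "%x e. \<Sum>f\<in>I'. c e f * x f"
 have eq: "(\<Sum>e'\<in>I. (if f \<in> I' then c e' f else 0) * ((if e' = e then F (?L x) else 0) + ?L x e * D e' (?L x)))
  = (if f \<in> I' then c e f else 0) * F (?L x) +
   ?L x e * (\<Sum>e'\<in>I. (if f \<in> I' then c e' f else 0) * D e' (?L x))" for f x
 proof -
  have "(\<Sum>e'\<in>I. (if f \<in> I' then c e' f else 0) * (if e' = e then F (?L x) else 0))
   = (\<Sum>e'\<in>I. if e' = e then (if f \<in> I' then c e f else 0) * F (?L x) else 0)"
   by (intro sum.cong) auto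
  also have "\<dots> = (if f \<in> I' then c e f else 0) * F (?L x)"
   using gp_var_mult.hyps(1) assms(2) by simp
  finally show ?thesis
   by (simp only: distrib_left sum.distrib sum_distrib_left mult.left_commute[of _ "?L x e"])
 qed
 show ?case
  by (rule gp_cong[OF gp_mult[OF gp_linear[OF assms(3), of "c e"] gp_var_mult.IH]])
   (simp_all only: eq)
qed

lemma gp_span_induct [consumes 2, case_names mon add]:
 assumes "gp I F D" "finite I"
  and mon: "!!c k. Q (%x. c * mon I k x)"
  and add: "!!F G. Q F ==> Q G ==> Q (%x. F x + G x)"
 shows "Q F"
proof -
 have "Q (%x. mon I k x * F x)" for k
  using assms(1)
 proof (induction arbitrary: k)
  case (gp_const c)
  show ?case using mon[of c k] by (simp add: mult.commute)
 next
  case (gp_add F D G E)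
  then show ?case using add by (simp add: distrib_left)
 next
  case (gp_var_mult e F D)
  have "(%x. mon I k x * (x e * F x)) = (%x. mon I (k(e := Suc (k e))) x * F x)"
   using gp_var_mult.hyps(1) assms(2) by (simp only: mon_Suc mult_ac)
  with gp_var_mult.IH[of "k(e := Suc (k e))"] show ?case by (simp only:)
 qed
 from this[of "%_. 0"] show ?thesis by simp
qed

lemma gp_integrable:
 assumes "gp I F D" "finite I" shows "integrable (gm I) F"
 using assms by (induction rule: gp_span_induct) (auto simp: integral_mon(1)[OF assms(2)])

lemma integral_mon_var:
 assumes "finite I" "e \<in> I"
 shows "(\<integral>x. x e * mon I k x \<partial>gm I) = real (k e) * (\<integral>x. mon I (k(e := k e - 1)) x \<partial>gm I)"
proof -
 have "(\<integral>x. x e * mon I k x \<partial>gm I) = (\<integral>x. mon I (k(e := Suc (k e))) x \<partial>gm I)"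
  using assms by (simp add: mon_Suc)
 also have "\<dots> = real (k e) * (\<integral>x. mon I (k(e := k e - 1)) x \<partial>gm I)"
  using assms by (simp add: integral_mon prod.remove[of I e] stdn_moment_Suc)
 finally show ?thesis .
qed

text \<open>For a monomial this is the recursion \<open>E g ^ (k + 2) = (k + 1) * E g ^ k\<close> of the
 standard normal moments.\<close>

theorem gaussian_integration_by_parts:
 assumes F: "gp I F D" and I: "finite I" and e: "e \<in> I"
 shows "(\<integral>x. x e * F x \<partial>gm I) = (\<integral>x. D e x \<partial>gm I)"
proof -
 have monG: "\<exists>D. gp I (mon I k) D" for k
 proof -
  have *: "\<exists>D. gp I (%x. x f ^ n) D" if "f \<in> I" for f n
   by (induction n) (use that in \<open>auto intro: gp.gp_const gp.gp_var_mult\<close>)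
  have "\<exists>D. gp I (mon J k) D" if "J \<subseteq> I" for J
   using finite_subset[OF that I] that
  proof (induction J)
   case empty
   then show ?case using gp.gp_const[of I 1] by (auto simp: mon_def[abs_def])
  next
   case (insert f J)
   then obtain D D' where "gp I (mon J k) D" "gp I (%x. x f ^ k f) D'"
    using *[of f "k f"] by auto
   from gp_mult[OF this(2,1)] show ?case
    using insert by (auto simp: mon_def[abs_def])
  qed
  then show ?thesis by blast
 qed
 have int: "integrable (gm I) (%x. mon I k x * G x)" if "gp I G E" for G E k
 proof -
  obtain D' where "gp I (mon I k) D'" using monG by blast
  from gp_mult[OF this that] show ?thesis using gp_integrable I by blast
 qed
 have varint: "integrable (gm I) (%x. x e * (mon I k x * G x))" if "gp I G E" for G E k
  using int[OF gp.gp_var_mult[OF e that], of k] by (simp add: mult_ac)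
 have "(\<integral>x. x e * (mon I k x * F x) \<partial>gm I)
   = real (k e) * (\<integral>x. mon I (k(e := k e - 1)) x * F x \<partial>gm I) + (\<integral>x. mon I k x * D e x \<partial>gm I)" for k
  using F
 proof (induction arbitrary: k)
  case (gp_const c)
  have "(\<integral>x. x e * (mon I k x * c) \<partial>gm I) = (\<integral>x. x e * mon I k x \<partial>gm I) * c"
   by (simp only: mult.assoc[symmetric]) simp
  also have "\<dots> = real (k e) * (\<integral>x. mon I (k(e := k e - 1)) x * c \<partial>gm I)"
   unfolding integral_mon_var[OF I e] by (simp only: integral_mult_left_zero mult.assoc)
  finally show ?case
   by (simp only: mult_zero_right Bochner_Integration.integral_zero add_0_right)
 next
  case (gp_add F D G E)
  obtain D2 where D2: "!!e. gp I (D e) (D2 e)" using gp_deriv[OF gp_add.hyps(1)] by blast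
  obtain E2 where E2: "!!e. gp I (E e) (E2 e)" using gp_deriv[OF gp_add.hyps(2)] by blast
  have "(\<integral>x. x e * (mon I k x * (F x + G x)) \<partial>gm I)
    = (\<integral>x. x e * (mon I k x * F x) \<partial>gm I) + (\<integral>x. x e * (mon I k x * G x) \<partial>gm I)"
   by (simp only: distrib_left)
    (rule Bochner_Integration.integral_add[OF varint[OF gp_add.hyps(1)] varint[OF gp_add.hyps(2)]])
  moreover have "(\<integral>x. mon I k' x * (F x + G x) \<partial>gm I)
    = (\<integral>x. mon I k' x * F x \<partial>gm I) + (\<integral>x. mon I k' x * G x \<partial>gm I)" for k'
   by (simp only: distrib_left)
    (rule Bochner_Integration.integral_add[OF int[OF gp_add.hyps(1)] int[OF gp_add.hyps(2)]])
  moreover have "(\<integral>x. mon I k x * (D e x + E e x) \<partial>gm I)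
    = (\<integral>x. mon I k x * D e x \<partial>gm I) + (\<integral>x. mon I k x * E e x \<partial>gm I)"
   by (simp only: distrib_left)
    (rule Bochner_Integration.integral_add[OF int[OF D2] int[OF E2]])
  ultimately show ?case
   unfolding gp_add.IH by (simp only: distrib_left add_ac)
 next
  case (gp_var_mult f F D)
  let ?k = "k(f := Suc (k f))"
  obtain D2 where D2: "!!e. gp I (D e) (D2 e)" using gp_deriv[OF gp_var_mult.hyps(2)] by blast
  note mf = mon_Suc[OF I gp_var_mult.hyps(1)]
  have 1: "(\<integral>x. x e * (mon I k x * (x f * F x)) \<partial>gm I) = (\<integral>x. x e * (mon I ?k x * F x) \<partial>gm I)"
   by (simp add: mf mult_ac)
  have 2: "(\<integral>x. mon I k x * ((if e = f then F x else 0) + x f * D e x) \<partial>gm I)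
    = (if e = f then \<integral>x. mon I k x * F x \<partial>gm I else 0) + (\<integral>x. mon I ?k x * D e x \<partial>gm I)"
  proof (cases "e = f")
   case True
   then show ?thesis
    using int[OF gp_var_mult.hyps(2), of k] int[OF D2, of ?k e]
    by (simp add: distrib_left mf mult_ac)
  qed (simp add: mf mult_ac)
  have 3: "real (?k e) * (\<integral>x. mon I (?k(e := ?k e - 1)) x * F x \<partial>gm I)
    = real (k e) * (\<integral>x. mon I (k(e := k e - 1)) x * (x f * F x) \<partial>gm I)
     + (if e = f then \<integral>x. mon I k x * F x \<partial>gm I else 0)"
  proof (cases "e = f")
   case True
   show ?thesis
   proof (cases "k f")
    case 0
    then have "?k(e := ?k e - 1) = k" using True by auto
    then show ?thesis using 0 True by simp
   next
    case (Suc j)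
    have "mon I (k(f := j)) x * x f = mon I k x" for x
     using mon_Suc[OF I gp_var_mult.hyps(1), of "k(f := j)" x] Suc
     by (simp add: mult.commute fun_upd_idem)
    then have "(\<integral>x. mon I (k(f := j)) x * (x f * F x) \<partial>gm I) = (\<integral>x. mon I k x * F x \<partial>gm I)"
     by (simp add: mult.assoc[symmetric])
    then show ?thesis using True Suc by (simp add: algebra_simps fun_upd_idem)
   qed
  next
   case False
   have "?k(e := k e - 1) = (k(e := k e - 1))(f := Suc ((k(e := k e - 1)) f))"
    using False by auto
   then have "mon I (?k(e := k e - 1)) x = x f * mon I (k(e := k e - 1)) x" for x
    by (simp only: mf)
   then show ?thesis using False by (simp add: mult_ac)
  qed
  show ?case unfolding 1 2 gp_var_mult.IH 3 by (simp only: add_ac)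
 qed
 from this[of "%_. 0"] show ?thesis by simp
qed

lemma gp_reindex:
 assumes F: "gp I F D" and I: "finite I" "finite I'" and f: "inj_on f I" "f ` I \<subseteq> I'"
 shows "(\<integral>x. F (%e. x (f e)) \<partial>gm I') = (\<integral>x. F x \<partial>gm I)"
  and "integrable (gm I') (%x. F (%e. x (f e)))"
proof -
 have "integrable (gm I) F \<and> integrable (gm I') (%x. F (%e. x (f e))) \<and>
  (\<integral>x. F (%e. x (f e)) \<partial>gm I') = (\<integral>x. F x \<partial>gm I)"
  using F I(1)
 proof (induction rule: gp_span_induct)
  case (mon c k)
  define k' where "k' e' = (if e' \<in> f ` I then k (the_inv_into I f e') else 0)" for e'
  have k': "k' (f e) = k e" if "e \<in> I" for e
   using that f by (simp add: k'_def the_inv_into_f_f)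
  have "mon I k (%e. x (f e)) = mon I' k' x" for x :: "'b => real"
  proof -
   have "mon I' k' x = (\<Prod>e\<in>f ` I. x e ^ k' e)"
    unfolding mon_def using I f by (intro prod.mono_neutral_right) (auto simp: k'_def)
   also have "\<dots> = mon I k (%e. x (f e))"
    using f k' by (simp add: prod.reindex mon_def)
   finally show ?thesis by simp
  qed
  moreover have "(\<Prod>e\<in>I'. stdn_moment (k' e)) = (\<Prod>e\<in>I. stdn_moment (k e))"
  proof -
   have "(\<Prod>e\<in>I'. stdn_moment (k' e)) = (\<Prod>e\<in>f ` I. stdn_moment (k' e))"
    using I f by (intro prod.mono_neutral_right) (auto simp: k'_def)
   also have "\<dots> = (\<Prod>e\<in>I. stdn_moment (k e))"
    using f k' by (simp add: prod.reindex)
   finally show ?thesis .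
  qed
  ultimately show ?case using I by (simp add: integral_mon)
 qed auto
 then show "(\<integral>x. F (%e. x (f e)) \<partial>gm I') = (\<integral>x. F x \<partial>gm I)"
  "integrable (gm I') (%x. F (%e. x (f e)))" by auto
qed

lemma gp_factor:
 assumes F: "gp I F D" and G: "gp I G E" and I: "finite I"
 shows "(\<integral>x. F (%e. x (False, e)) * G (%e. x (True, e)) \<partial>gm (UNIV \<times> I))
  = (\<integral>x. F x \<partial>gm I) * (\<integral>x. G x \<partial>gm I)"
proof -
 let ?I = "UNIV \<times> I :: (bool \<times> 'a) set"
 let ?P = "%F G x. F (%e. x (False, e)) * G (%e. x (True, e))"
 define good where "good F G \<longleftrightarrow> integrable (gm ?I) (?P F G) \<and>
  (\<integral>x. ?P F G x \<partial>gm ?I) = (\<integral>x. F x \<partial>gm I) * (\<integral>x. G x \<partial>gm I)"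
  for F G :: "('a => real) => real"
 have mm: "good (%x. c * mon I k x) (%x. c' * mon I k' x)" for c c' k k'
 proof -
  define k2 where "k2 = (%(b, e). if b then k' e else k e)"
  have split: "(\<Prod>p\<in>?I. f p) = (\<Prod>e\<in>I. f (False, e)) * (\<Prod>e\<in>I. f (True, e))" for f :: "_ => real"
   using prod.cartesian_product[of "%b e. f (b, e)" I "UNIV :: bool set"]
   by (simp add: UNIV_bool case_prod_eta mult.commute)
  have eq: "?P (%x. c * mon I k x) (%x. c' * mon I k' x) = (%x. c * c' * mon ?I k2 x)"
   unfolding mon_def split by (auto simp: k2_def)
  have "(\<Prod>p\<in>?I. stdn_moment (k2 p)) = (\<Prod>e\<in>I. stdn_moment (k e)) * (\<Prod>e\<in>I. stdn_moment (k' e))"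
   unfolding split by (simp add: k2_def)
  then show ?thesis
   using I unfolding good_def eq by (simp add: integral_mon)
 qed
 have mG: "good (%x. c * mon I k x) G \<and> integrable (gm I) G" for c k
  using G I
 proof (induction rule: gp_span_induct)
  case (mon c' k')
  show ?case using mm I by (simp add: integral_mon)
 next
  case (add G G')
  then show ?case unfolding good_def by (simp add: distrib_left)
 qed
 have "good F G \<and> integrable (gm I) F"
  using F I
 proof (induction rule: gp_span_induct)
  case (mon c' k')
  show ?case using mG I by (simp add: integral_mon)
 next
  case (add F F')
  then show ?case unfolding good_def by (simp add: distrib_right)
 qed
 then show ?thesis by (simp add: good_def)
qed

section \<open>Differentiating Gaussian expectations in the covariance\<close>

inductive sepd :: "'e set => (real => ('e => real) => real) => (real => ('e => real) => real) => bool"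
 for I where
 sepd_base: "(!!th. (a has_real_derivative a' th) (at th)) ==> gp I f D ==>
  sepd I (%th x. a th * f x) (%th x. a' th * f x)"
| sepd_add: "sepd I F F' ==> sepd I G G' ==>
  sepd I (%th x. F th x + G th x) (%th x. F' th x + G' th x)"

lemma sepd_cong:
 assumes "sepd I F F'" "!!th x. G th x = F th x" "!!th x. G' th x = F' th x"
 shows "sepd I G G'"
proof -
 have "G = F" "G' = F'" using assms by (auto intro!: ext)
 with assms(1) show ?thesis by simp
qed

lemma sepd_mult:
 assumes "sepd I F F'" "sepd I G G'"
 shows "sepd I (%th x. F th x * G th x) (%th x. F' th x * G th x + F th x * G' th x)"
 using assms(1)
proof induction
 case (sepd_base a a' f D)
 show ?case
  using assms(2)
 proof induction
  case (sepd_base b b' g E)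
  have "((%th. a th * b th) has_real_derivative (a' th * b th + a th * b' th)) (at th)" for th
   using DERIV_mult[OF \<open>!!th. (a has_real_derivative a' th) (at th)\<close> sepd_base(1)]
   by (simp add: algebra_simps)
  from sepd.sepd_base[OF this gp_mult[OF \<open>gp I f D\<close> sepd_base(2)]]
  show ?case by (rule sepd_cong) (auto simp: algebra_simps)
 next
  case (sepd_add G G' H H')
  show ?case by (rule sepd_cong[OF sepd.sepd_add[OF sepd_add.IH]]) (auto simp: algebra_simps)
 qed
next
 case (sepd_add F F' H H')
 show ?case by (rule sepd_cong[OF sepd.sepd_add[OF sepd_add.IH]]) (auto simp: algebra_simps)
qed

lemma sepd_const: "sepd I (%_ _. c) (%_ _. 0)"
 by (rule sepd_cong[OF sepd_base[of "%_. c" "%_. 0" I "%_. 1"]]) (auto intro: gp_const)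

lemma sepd_sum:
 assumes "!!s. s \<in> S ==> sepd I (F s) (F' s)"
 shows "sepd I (%th x. \<Sum>s\<in>S. F s th x) (%th x. \<Sum>s\<in>S. F' s th x)"
 using assms
proof (induction S rule: infinite_finite_induct)
 case (insert s S)
 then have "sepd I (%th x. F s th x + (\<Sum>s\<in>S. F s th x)) (%th x. F' s th x + (\<Sum>s\<in>S. F' s th x))"
  by (intro sepd_add) auto
 with insert show ?case by simp
qed (simp_all add: sepd_const)

lemma sepd_DERIV:
 assumes "sepd I F F'" "finite I"
 shows "((%th. \<integral>x. F th x \<partial>gm I) has_real_derivative (\<integral>x. F' th x \<partial>gm I)) (at th)"
proof -
 have "(\<forall>th. integrable (gm I) (F th) \<and> integrable (gm I) (F' th)) \<and>
  ((%th. \<integral>x. F th x \<partial>gm I) has_real_derivative (\<integral>x. F' th x \<partial>gm I)) (at th)"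
  using assms(1)
 proof induction
  case (sepd_base a a' f D)
  have "integrable (gm I) f" using gp_integrable[OF sepd_base(2) assms(2)] .
  moreover have "((%th. a th * (\<integral>x. f x \<partial>gm I)) has_real_derivative a' th * (\<integral>x. f x \<partial>gm I)) (at th)"
   using sepd_base(1) by (intro DERIV_cmult_right)
  ultimately show ?case by simp
 next
  case (sepd_add F F' G G')
  then show ?case by (auto intro!: DERIV_add)
 qed
 then show ?thesis by simp
qed

lemma sepd_linear_subst:
 assumes "gp I G D" "finite I" "finite I'"
  and c: "!!e f th. ((%th. c th e f) has_real_derivative c' th e f) (at th)"
 shows "sepd I' (%th x. G (%e. \<Sum>f\<in>I'. c th e f * x f))
  (%th x. \<Sum>e\<in>I. D e (%e. \<Sum>f\<in>I'. c th e f * x f) * (\<Sum>f\<in>I'. c' th e f * x f))"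
 using assms(1)
proof induction
 case (gp_const a)
 show ?case by (rule sepd_cong[OF sepd_const[of _ a]]) auto
next
 case (gp_add F D G E)
 show ?case
  by (rule sepd_cong[OF sepd_add[OF gp_add.IH]]) (auto simp: algebra_simps sum.distrib)
next
 case (gp_var_mult e F D)
 let ?L = "%th x e. \<Sum>f\<in>I'. c th e f * x f" and ?L' = "%th x e. \<Sum>f\<in>I'. c' th e f * x f"
 have lin: "sepd I' (%th x. ?L th x e) (%th x. ?L' th x e)"
  by (intro sepd_sum sepd_base[OF c gp_var])
 have eq: "(\<Sum>e'\<in>I. ((if e' = e then F (?L th x) else 0) + ?L th x e * D e' (?L th x)) * ?L' th x e')
  = ?L' th x e * F (?L th x) + ?L th x e * (\<Sum>e'\<in>I. D e' (?L th x) * ?L' th x e')" for th x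
 proof -
  have "(\<Sum>e'\<in>I. (if e' = e then F (?L th x) else 0) * ?L' th x e')
   = (\<Sum>e'\<in>I. if e' = e then ?L' th x e * F (?L th x) else 0)"
   by (intro sum.cong) auto
  also have "\<dots> = ?L' th x e * F (?L th x)"
   using gp_var_mult.hyps(1) assms(2) by simp
  finally show ?thesis
   by (simp only: distrib_right sum.distrib mult.assoc) (simp only: sum_distrib_left)
 qed
 show ?case
  by (rule sepd_cong[OF sepd_mult[OF lin gp_var_mult.IH]]) (simp_all only: eq)
qed

text \<open>Only the time derivative of the covariance matters, because integration by parts turns each
 coefficient \<open>c' th e f\<close> times a variable into a second derivative.\<close>

theorem gaussian_interpolation:
 assumes G: "gp I G D" and D: "!!e. gp I (D e) (D2 e)" and I: "finite I" "finite I'"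
  and c: "!!e f th. ((%th. c th e f) has_real_derivative c' th e f) (at th)"
 shows "((%th. \<integral>x. G (%e. \<Sum>f\<in>I'. c th e f * x f) \<partial>gm I') has_real_derivative
  (\<Sum>e\<in>I. \<Sum>e'\<in>I. (\<Sum>f\<in>I'. c' th e f * c th e' f) *
   (\<integral>x. D2 e e' (%e. \<Sum>f\<in>I'. c th e f * x f) \<partial>gm I'))) (at th)"
proof -
 let ?L = "%x e. \<Sum>f\<in>I'. c th e f * x f"
 obtain D3 where D3: "!!e e'. gp I (D2 e e') (D3 e e')"
 proof -
  have "\<forall>e. \<exists>E. \<forall>e'. gp I (D2 e e') (E e')" using gp_deriv[OF D] by blast
  then show ?thesis using that by metis
 qed
 have int2: "integrable (gm I') (%x. D2 e e' (?L x))" for e e'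
  by (rule gp_integrable[OF gp_subst[OF D3 I] I(2)])
 have Dsub: "gp I' (%x. D e (?L x))
   (%f x. \<Sum>e'\<in>I. (if f \<in> I' then c th e' f else 0) * D2 e e' (?L x))" for e
  by (rule gp_subst[OF D I])
 have ibp: "(\<integral>x. x f * D e (?L x) \<partial>gm I') = (\<Sum>e'\<in>I. c th e' f * (\<integral>x. D2 e e' (?L x) \<partial>gm I'))"
  if "f \<in> I'" for e f
  using gaussian_integration_by_parts[OF Dsub I(2) that, of e] that int2 by simp
 have int1: "integrable (gm I') (%x. x f * D e (?L x))" if "f \<in> I'" for e f
  by (rule gp_integrable[OF gp_var_mult[OF that Dsub] I(2)])
 have "(\<integral>x. (\<Sum>e\<in>I. D e (?L x) * (\<Sum>f\<in>I'. c' th e f * x f)) \<partial>gm I')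
  = (\<integral>x. (\<Sum>e\<in>I. \<Sum>f\<in>I'. c' th e f * (x f * D e (?L x))) \<partial>gm I')"
  by (intro Bochner_Integration.integral_cong sum.cong refl, subst sum_distrib_left)
   (intro sum.cong refl, simp only: mult_ac)
 also have "\<dots> = (\<Sum>e\<in>I. \<Sum>f\<in>I'. c' th e f * (\<integral>x. x f * D e (?L x) \<partial>gm I'))"
  using int1 by (simp add: Bochner_Integration.integral_sum integrable_sum)
 also have "\<dots> = (\<Sum>e\<in>I. \<Sum>f\<in>I'. \<Sum>e'\<in>I. c' th e f * c th e' f * (\<integral>x. D2 e e' (?L x) \<partial>gm I'))"
  by (intro sum.cong refl) (simp add: ibp sum_distrib_left mult.assoc)
 also have "\<dots> = (\<Sum>e\<in>I. \<Sum>e'\<in>I. (\<Sum>f\<in>I'. c' th e f * c th e' f) * (\<integral>x. D2 e e' (?L x) \<partial>gm I'))"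
  by (intro sum.cong refl, subst sum.swap) (simp add: sum_distrib_right)
 finally have "(\<integral>x. (\<Sum>e\<in>I. D e (?L x) * (\<Sum>f\<in>I'. c' th e f * x f)) \<partial>gm I')
  = (\<Sum>e\<in>I. \<Sum>e'\<in>I. (\<Sum>f\<in>I'. c' th e f * c th e' f) * (\<integral>x. D2 e e' (?L x) \<partial>gm I'))" .
 moreover have sep: "sepd I' (%th x. G (%e. \<Sum>f\<in>I'. c th e f * x f))
  (%th x. \<Sum>e\<in>I. D e (%e. \<Sum>f\<in>I'. c th e f * x f) * (\<Sum>f\<in>I'. c' th e f * x f))"
  by (rule sepd_linear_subst[OF G I]) (rule c)
 ultimately show ?thesis
  using sepd_DERIV[OF sep I(2), of th] by simp
qed

lemma gp_rename:
 assumes F: "gp I F D" and I: "finite I" "finite I'" and f: "f ` I \<subseteq> I'"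
 shows "gp I' (%x. F (%e. x (f e))) (%e' x. \<Sum>e\<in>I. if f e = e' then D e (%e. x (f e)) else 0)"
 using F
proof induction
 case (gp_const a)
 show ?case by (rule gp_cong[OF gp.gp_const[of _ a]]) (auto intro!: sum.neutral)
next
 case (gp_add F D G E)
 have "(\<Sum>e\<in>I. if f e = e' then D e z + E e z else 0)
  = (\<Sum>e\<in>I. if f e = e' then D e z else 0) + (\<Sum>e\<in>I. if f e = e' then E e z else 0)" for e' z
  unfolding sum.distrib[symmetric] by (intro sum.cong) auto
 then show ?case by (intro gp_cong[OF gp.gp_add[OF gp_add.IH]]) simp_all
next
 case (gp_var_mult e F D)
 let ?x = "%x e. x (f e)"
 have "f e \<in> I'" using gp_var_mult.hyps(1) f by auto
 have eq: "(\<Sum>e''\<in>I. if f e'' = e' then (if e'' = e then F (?x x) else 0) + x (f e) * D e'' (?x x) else 0)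
  = (if e' = f e then F (?x x) else 0) + x (f e) * (\<Sum>e''\<in>I. if f e'' = e' then D e'' (?x x) else 0)"
  for e' and x :: "'b => real"
 proof -
  have "(\<Sum>e''\<in>I. if f e'' = e' then (if e'' = e then F (?x x) else 0) + x (f e) * D e'' (?x x) else 0)
   = (\<Sum>e''\<in>I. (if e'' = e then (if e' = f e then F (?x x) else 0) else 0)
     + x (f e) * (if f e'' = e' then D e'' (?x x) else 0))"
   by (intro sum.cong) auto
  then show ?thesis
   using gp_var_mult.hyps(1) I by (simp add: sum.distrib sum_distrib_left)
 qed
 show ?case
  by (rule gp_cong[OF gp.gp_var_mult[OF \<open>f e \<in> I'\<close> gp_var_mult.IH]]) (simp_all only: eq)
qed

lemma gp_scale:
 assumes "gp I F D"
 shows "gp I (%x. F (%e. w e * x e)) (%e x. w e * D e (%e. w e * x e))"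
 using assms
proof induction
 case (gp_const c)
 show ?case by (rule gp_cong[OF gp.gp_const]) auto
next
 case (gp_add F D G E)
 show ?case by (rule gp_cong[OF gp.gp_add[OF gp_add.IH]]) (auto simp: algebra_simps)
next
 case (gp_var_mult e F D)
 show ?case
  by (rule gp_cong[OF gp_smult[OF gp.gp_var_mult[OF gp_var_mult.hyps(1) gp_var_mult.IH], of "w e"]])
   (auto simp: algebra_simps)
qed

lemma scaled_integration_by_parts:
 assumes F: "gp I F D" and I: "finite I" and e: "e \<in> I"
 shows "(\<integral>x. w e * x e * F (%e. w e * x e) \<partial>gm I)
  = (w e)\<^sup>2 * (\<integral>x. D e (%e. w e * x e) \<partial>gm I)"
 using gaussian_integration_by_parts[OF gp_scale[OF F] I e, of w]
 by (simp add: power2_eq_square mult.assoc)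

lemma scaled_DERIV:
 assumes G: "gp I G D" and D: "!!e. gp I (D e) (D2 e)" and I: "finite I"
  and w: "!!e th. ((%th. w th e) has_real_derivative w' th e) (at th)"
 shows "((%th. \<integral>x. G (%e. w th e * x e) \<partial>gm I) has_real_derivative
  (\<Sum>e\<in>I. w' th e * w th e * (\<integral>x. D2 e e (%e. w th e * x e) \<partial>gm I))) (at th)"
proof -
 define c where "c th e f = (if e = f then w th e else 0)" for th e f
 define c' where "c' th e f = (if e = f then w' th e else 0)" for th e f
 have cc': "((%th. c th e f) has_real_derivative c' th e f) (at th)" for e f th
  using w by (cases "e = f") (auto simp: c_def c'_def)
 have L: "(\<Sum>f\<in>I. c th e f * x f) = w th e * x e" if "e \<in> I" for e th x
 proof -
  have "(\<Sum>f\<in>I. c th e f * x f) = (\<Sum>f\<in>I. if f = e then w th e * x e else 0)"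
   by (intro sum.cong) (auto simp: c_def)
  then show ?thesis using that I by simp
 qed
 have LE: "H (%e. \<Sum>f\<in>I. c th e f * x f) = H (%e. w th e * x e)" if "gp I H E" for H E th x
  using L by (rule gp_local[OF that])
 have cc: "(\<Sum>f\<in>I. c' th e f * c th e' f) = (if e' = e then w' th e * w th e else 0)" if "e \<in> I" for e e'
 proof -
  have "(\<Sum>f\<in>I. c' th e f * c th e' f) = (\<Sum>f\<in>I. if f = e then (if e' = e then w' th e * w th e else 0) else 0)"
   by (intro sum.cong) (auto simp: c_def c'_def)
  then show ?thesis using that I by simp
 qed
 have "(\<Sum>e\<in>I. \<Sum>e'\<in>I. (\<Sum>f\<in>I. c' th e f * c th e' f) *
   (\<integral>x. D2 e e' (%e. \<Sum>f\<in>I. c th e f * x f) \<partial>gm I))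
  = (\<Sum>e\<in>I. \<Sum>e'\<in>I. if e' = e then w' th e * w th e * (\<integral>x. D2 e e (%e. w th e * x e) \<partial>gm I) else 0)"
 proof (intro sum.cong refl)
  fix e e' assume e: "e \<in> I" "e' \<in> I"
  obtain E where E: "!!e'. gp I (D2 e e') (E e')" using gp_deriv[OF D[of e]] by blast
  show "(\<Sum>f\<in>I. c' th e f * c th e' f) * (\<integral>x. D2 e e' (%e. \<Sum>f\<in>I. c th e f * x f) \<partial>gm I)
   = (if e' = e then w' th e * w th e * (\<integral>x. D2 e e (%e. w th e * x e) \<partial>gm I) else 0)"
   using cc[OF e(1), of e'] LE[OF E] by auto
 qed
 also have "\<dots> = (\<Sum>e\<in>I. w' th e * w th e * (\<integral>x. D2 e e (%e. w th e * x e) \<partial>gm I))"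
  using I by simp
 finally have eq: "(\<Sum>e\<in>I. \<Sum>e'\<in>I. (\<Sum>f\<in>I. c' th e f * c th e' f) *
   (\<integral>x. D2 e e' (%e. \<Sum>f\<in>I. c th e f * x f) \<partial>gm I))
  = (\<Sum>e\<in>I. w' th e * w th e * (\<integral>x. D2 e e (%e. w th e * x e) \<partial>gm I))" .
 have "((%th. \<integral>x. G (%e. \<Sum>f\<in>I. c th e f * x f) \<partial>gm I) has_real_derivative
  (\<Sum>e\<in>I. \<Sum>e'\<in>I. (\<Sum>f\<in>I. c' th e f * c th e' f) *
   (\<integral>x. D2 e e' (%e. \<Sum>f\<in>I. c th e f * x f) \<partial>gm I))) (at th)"
  by (rule gaussian_interpolation[OF G D I I]) (rule cc')
 then show ?thesis unfolding eq LE[OF G] .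
qed

definition rot :: "real => (bool \<times> 'e => real) => 'e => real" where
 "rot th x e = cos th * x (False, e) + sin th * x (True, e)"

text \<open>An independent copy is rotated into the original variables; the two endpoints of the rotation give
 the two terms of a covariance.\<close>

lemma rotation_DERIV:
 assumes F: "gp I F DF" and G: "gp I G DG" and I: "finite I"
 shows "((%th. \<integral>x. F (%e. x (False, e)) * G (rot th x) \<partial>gm (UNIV \<times> I)) has_real_derivative
  - sin th * (\<Sum>e\<in>I. \<integral>x. DF e (%e. x (False, e)) * DG e (rot th x) \<partial>gm (UNIV \<times> I))) (at th)"
proof -
 let ?I = "UNIV \<times> I :: (bool \<times> 'a) set"
 let ?x = "%b (x :: bool \<times> 'a => real) e. x (b, e)"
 have fin: "finite ?I" using I by simp
 obtain DDF where DDF: "!!e. gp I (DF e) (DDF e)" using gp_deriv[OF F] by blast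
 obtain DDG where DDG: "!!e. gp I (DG e) (DDG e)" using gp_deriv[OF G] by blast
 have ren: "gp ?I (%x. H (?x b x)) (%(b', e) x. if b' = b \<and> e \<in> I then E e (?x b x) else 0)"
  if "gp I H E" for b H E
 proof (rule gp_cong[OF gp_rename[OF that I fin, of "Pair b"]])
  fix e' :: "bool \<times> 'a" and x
  obtain b' e where e': "e' = (b', e)" by force
  have "(\<Sum>e\<in>I. if (b, e) = e' then E e (?x b x) else 0)
   = (\<Sum>e''\<in>I. if e'' = e then (if b' = b then E e (?x b x) else 0) else 0)"
   unfolding e' by (intro sum.cong) auto
  then show "(case e' of (b', e) => %x. if b' = b \<and> e \<in> I then E e (?x b x) else 0) x
   = (\<Sum>e\<in>I. if (b, e) = e' then E e (?x b x) else 0)"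
   using I by (simp add: e')
 qed auto
 define H where "H z = F (?x False z) * G (?x True z)" for z
 define D where "D e' z = (case e' of (b, e) => if e \<in> I then
   if b then F (?x False z) * DG e (?x True z) else DF e (?x False z) * G (?x True z) else 0)" for e' z
 have H: "gp ?I H D"
  unfolding H_def[abs_def]
  by (rule gp_cong[OF gp_mult[OF ren[OF F, where b = False] ren[OF G, where b = True]]])
   (auto simp: D_def split: prod.splits)
 define D2 where "D2 e1 e2 z = (case e1 of (b1, e1) => case e2 of (b2, e2) =>
   if e1 \<in> I \<and> e2 \<in> I then
   if b1 then (if b2 then F (?x False z) * DDG e1 e2 (?x True z)
         else DF e2 (?x False z) * DG e1 (?x True z))
   else (if b2 then DF e1 (?x False z) * DG e2 (?x True z)
      else DDF e1 e2 (?x False z) * G (?x True z)) else 0)" for e1 e2 z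
 have D: "gp ?I (D e) (D2 e)" for e
 proof (cases e)
  case (Pair b e)
  show ?thesis
  proof (cases "e \<in> I")
   case True
   show ?thesis
   proof (cases b)
    case b: True
    show ?thesis
     by (rule gp_cong[OF gp_mult[OF ren[OF F, where b = False] ren[OF DDG[of e], where b = True]]])
      (use b True Pair in \<open>auto simp: D_def D2_def split: prod.splits\<close>)
   next
    case b: False
    show ?thesis
     by (rule gp_cong[OF gp_mult[OF ren[OF DDF[of e], where b = False] ren[OF G, where b = True]]])
      (use b True Pair in \<open>auto simp: D_def D2_def split: prod.splits\<close>)
   qed
  next
   case False
   show ?thesis
    by (rule gp_cong[OF gp_const[of _ 0]])
     (use False Pair in \<open>auto simp: D_def D2_def split: prod.splits\<close>)
  qed
 qed
 define c where "c th p q = (case p of (b, e) => case q of (b', e') =>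
   if e = e' then (if b then (if b' then sin th else cos th) else (if b' then 0 else 1)) else (0 :: real))"
  for th :: real and p q :: "bool \<times> 'a"
 define c' where "c' th p q = (case p of (b, e) => case q of (b', e') =>
   if e = e' then (if b then (if b' then cos th else - sin th) else 0) else (0 :: real))"
  for th :: real and p q :: "bool \<times> 'a"
 have cc': "((%th. c th p q) has_real_derivative c' th p q) (at th)" for p q th
  unfolding c_def c'_def
  by (cases p; cases q; cases "fst p"; cases "fst q"; cases "snd p = snd q")
   (auto intro!: derivative_eq_intros)
 have sumI: "(\<Sum>q\<in>?I. f q) = (\<Sum>e\<in>I. f (False, e) + f (True, e))" for f :: "_ => real"
  using sum.cartesian_product[of "%b e. f (b, e)" I "UNIV :: bool set"]
  by (simp add: UNIV_bool case_prod_eta add.commute sum.distrib)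
 have cF: "(\<Sum>q\<in>?I. c th (False, e) q * x q) = x (False, e)"
  and cT: "(\<Sum>q\<in>?I. c th (True, e) q * x q) = rot th x e" if "e \<in> I" for e x th
 proof -
  have "(\<Sum>q\<in>?I. c th (False, e) q * x q) = (\<Sum>e'\<in>I. if e = e' then x (False, e) else 0)"
   unfolding sumI c_def by (intro sum.cong) auto
  then show "(\<Sum>q\<in>?I. c th (False, e) q * x q) = x (False, e)" using that I by simp
  have "(\<Sum>q\<in>?I. c th (True, e) q * x q) = (\<Sum>e'\<in>I. if e = e' then rot th x e else 0)"
   unfolding sumI c_def rot_def by (intro sum.cong) auto
  then show "(\<Sum>q\<in>?I. c th (True, e) q * x q) = rot th x e" using that I by simp
 qed
 let ?L = "%x p. \<Sum>q\<in>?I. c th p q * x q"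
 have L: "E (?x False (%p. \<Sum>q\<in>?I. c th p q * x q)) = E (?x False x)"
  "E (?x True (%p. \<Sum>q\<in>?I. c th p q * x q)) = E (rot th x)" if "gp I E E'" for E E' x th
  by (rule gp_local[OF that], simp add: cF cT)+
 have coef: "(\<Sum>q\<in>?I. c' th (b1, e1) q * c th (b2, e2) q)
   = (if b1 \<and> \<not> b2 \<and> e1 = e2 then - sin th else 0)" if "e1 \<in> I" for b1 b2 e1 e2
 proof -
  have "(\<Sum>q\<in>?I. c' th (b1, e1) q * c th (b2, e2) q)
   = (\<Sum>e\<in>I. if e = e1 then (if b1 \<and> \<not> b2 \<and> e1 = e2 then - sin th else 0) else 0)"
   unfolding sumI c_def c'_def by (intro sum.cong) auto
  then show ?thesis using that I by simp
 qed
 have "((%th. \<integral>x. H (%p. \<Sum>q\<in>?I. c th p q * x q) \<partial>gm ?I) has_real_derivative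
  (\<Sum>p\<in>?I. \<Sum>p'\<in>?I. (\<Sum>q\<in>?I. c' th p q * c th p' q) *
   (\<integral>x. D2 p p' (?L x) \<partial>gm ?I))) (at th)"
  by (rule gaussian_interpolation[OF H D fin fin cc'])
 moreover have "(%x. H (%p. \<Sum>q\<in>?I. c th p q * x q)) = (%x. F (?x False x) * G (rot th x))" for th
  unfolding H_def using L(1)[OF F] L(2)[OF G] by simp
 moreover have "(\<Sum>p\<in>?I. \<Sum>p'\<in>?I. (\<Sum>q\<in>?I. c' th p q * c th p' q) * (\<integral>x. D2 p p' (?L x) \<partial>gm ?I))
  = (\<Sum>e\<in>I. - sin th * (\<integral>x. DF e (?x False x) * DG e (rot th x) \<partial>gm ?I))"
 proof -
  have D2eq: "D2 (True, e) (False, e) (?L x) = DF e (?x False x) * DG e (rot th x)" if "e \<in> I" for e x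
   unfolding D2_def using L(1)[OF DDF, of e] L(2)[OF DDG, of e] that by simp
  define W where "W p p' = (\<Sum>q\<in>?I. c' th p q * c th p' q)" for p p'
  define K where "K p p' = (\<integral>x. D2 p p' (?L x) \<partial>gm ?I)" for p p'
  have W: "W (b1, e1) (b2, e2) = (if b1 \<and> \<not> b2 \<and> e1 = e2 then - sin th else 0)" if "e1 \<in> I" for b1 b2 e1 e2
   unfolding W_def by (rule coef[OF that])
  have "(\<Sum>p'\<in>?I. W (False, e) p' * K (False, e) p') = 0" if "e \<in> I" for e
   unfolding sumI using that by (simp add: W)
  moreover have "(\<Sum>p'\<in>?I. W (True, e) p' * K (True, e) p') = - sin th * K (True, e) (False, e)"
   if "e \<in> I" for e
  proof -
   have "(\<Sum>p'\<in>?I. W (True, e) p' * K (True, e) p')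
    = (\<Sum>e'\<in>I. if e' = e then - sin th * K (True, e) (False, e) else 0)"
    unfolding sumI using that by (intro sum.cong) (auto simp: W)
   then show ?thesis using that I by simp
  qed
  ultimately have "(\<Sum>p\<in>?I. \<Sum>p'\<in>?I. W p p' * K p p') = (\<Sum>e\<in>I. - sin th * K (True, e) (False, e))"
   by (subst sumI) (intro sum.cong, auto)
  also have "\<dots> = (\<Sum>e\<in>I. - sin th * (\<integral>x. DF e (?x False x) * DG e (rot th x) \<partial>gm ?I))"
   unfolding K_def using D2eq by (intro sum.cong) auto
  finally show ?thesis unfolding W_def K_def .
 qed
 ultimately show ?thesis by (simp add: sum_distrib_left sum_negf)
qed

lemma gp_exI: "gp I F D ==> \<exists>D. gp I F D"
 by blast

lemma gp_rot:
 assumes "gp I G DG" "finite I"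
 shows "\<exists>E. gp (UNIV \<times> I) (%x. G (rot th x)) E"
 using assms(1)
proof induction
 case (gp_const c)
 show ?case by (rule gp_exI, rule gp.gp_const)
next
 case (gp_add F D G E)
 then obtain E1 E2 where "gp (UNIV \<times> I) (%x. F (rot th x)) E1"
  "gp (UNIV \<times> I) (%x. G (rot th x)) E2" by blast
 from gp.gp_add[OF this] show ?case
  by (rule gp_exI)
next
 case (gp_var_mult e F D)
 then obtain E where E: "gp (UNIV \<times> I) (%x. F (rot th x)) E" by blast
 have v: "gp (UNIV \<times> I) (%x. x (b, e)) (%e' x. if e' = (b, e) then 1 else 0)" for b
  using gp_var_mult.hyps(1) by (intro gp_var) auto
 from gp_mult[OF gp_add[OF gp_smult[OF v[of False], of "cos th"] gp_smult[OF v[of True], of "sin th"]] E]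
 show ?case
  unfolding rot_def[of th _ e] by (rule gp_exI)
qed

lemma gp_slice:
 fixes b :: bool
 assumes "gp I G DG" "finite I"
 shows "\<exists>E. gp (UNIV \<times> I) (%x. G (%e. x (b, e))) E"
proof -
 have "finite (UNIV \<times> I :: (bool \<times> 'a) set)" "Pair b ` I \<subseteq> UNIV \<times> I"
  using assms(2) by auto
 from gp_rename[OF assms(1,2) this] show ?thesis
  by (rule gp_exI)
qed

lemma rot_integral:
 assumes G: "gp I G DG" and I: "finite I"
 shows "(\<integral>x. G (rot th x) \<partial>gm (UNIV \<times> I)) = (\<integral>x. G x \<partial>gm I)"
  and "integrable (gm (UNIV \<times> I)) (%x. G (rot th x))"
proof -
 have "((%th. \<integral>x. 1 * G (rot th x) \<partial>gm (UNIV \<times> I)) has_real_derivative 0) (at th)" for th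
  using rotation_DERIV[OF gp_const[of I 1] G I, of th] by simp
 then have "(\<integral>x. 1 * G (rot th x) \<partial>gm (UNIV \<times> I)) = (\<integral>x. 1 * G (rot 0 x) \<partial>gm (UNIV \<times> I))"
  by (intro DERIV_isconst_all allI)
 also have "\<dots> = (\<integral>x. G (%e. x (False, e)) \<partial>gm (UNIV \<times> I))"
  by (simp add: rot_def[abs_def])
 also have "\<dots> = (\<integral>x. G x \<partial>gm I)"
  by (rule gp_reindex[OF G I]) (use I in \<open>auto simp: inj_on_def\<close>)
 finally show "(\<integral>x. G (rot th x) \<partial>gm (UNIV \<times> I)) = (\<integral>x. G x \<partial>gm I)" by simp
 show "integrable (gm (UNIV \<times> I)) (%x. G (rot th x))"
 proof -
  obtain E where "gp (UNIV \<times> I) (%x. G (rot th x)) E" using gp_rot[OF G I] by blast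
  then show ?thesis by (rule gp_integrable) (use I in simp)
 qed
qed

theorem gaussian_covariance_bound:
 assumes F: "gp I F DF" and G: "gp I G DG" and I: "finite I"
  and B: "!!th. \<bar>\<Sum>e\<in>I. \<integral>x. DF e (%e. x (False, e)) * DG e (rot th x) \<partial>gm (UNIV \<times> I)\<bar> \<le> B"
 shows "\<bar>(\<integral>x. F x * G x \<partial>gm I) - (\<integral>x. F x \<partial>gm I) * (\<integral>x. G x \<partial>gm I)\<bar> \<le> 2 * B"
proof -
 let ?c = "%th. \<integral>x. F (%e. x (False, e)) * G (rot th x) \<partial>gm (UNIV \<times> I)"
 have B0: "0 \<le> B" using B[of 0] by linarith
 have "?c 0 = (\<integral>x. (%x. F x * G x) (%e. x (False, e)) \<partial>gm (UNIV \<times> I))"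
  by (simp add: rot_def[abs_def])
 also have "\<dots> = (\<integral>x. F x * G x \<partial>gm I)"
  by (rule gp_reindex[OF gp_mult[OF F G] I]) (use I in \<open>auto simp: inj_on_def\<close>)
 finally have c0: "?c 0 = (\<integral>x. F x * G x \<partial>gm I)" .
 have c1: "?c (pi / 2) = (\<integral>x. F x \<partial>gm I) * (\<integral>x. G x \<partial>gm I)"
  using gp_factor[OF F G I] by (simp add: rot_def[abs_def])
 obtain z where "?c (pi / 2) - ?c 0 = (pi / 2 - 0) *
   (- sin z * (\<Sum>e\<in>I. \<integral>x. DF e (%e. x (False, e)) * DG e (rot z x) \<partial>gm (UNIV \<times> I)))"
  using MVT2[of 0 "pi / 2" ?c, OF _ rotation_DERIV[OF F G I]] by auto
 then have "\<bar>?c (pi / 2) - ?c 0\<bar> = (pi / 2) * (\<bar>sin z\<bar> *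
   \<bar>\<Sum>e\<in>I. \<integral>x. DF e (%e. x (False, e)) * DG e (rot z x) \<partial>gm (UNIV \<times> I)\<bar>)"
  by (simp add: abs_mult)
 also have "\<dots> \<le> 2 * (1 * B)"
  using pi_less_4 B0 B by (intro mult_mono) auto
 finally show ?thesis unfolding c0 c1 by (simp add: abs_minus_commute)
qed

section \<open>Matrix-valued Gaussian polynomials\<close>

definition gpM :: "'a set => 'e set => (('e => real) => 'a lmat) => ('e => ('e => real) => 'a lmat) => bool"
 where "gpM D I X DX \<longleftrightarrow> (\<forall>x. adm D (X x)) \<and> (\<forall>e x. adm D (DX e x)) \<and>
  (\<forall>i\<in>D. \<forall>j\<in>D. gp I (%x. ent (X x) i j) (%e x. ent (DX e x) i j))"

lemma gpM_const: "adm D A ==> gpM D I (%_. A) (%_ _. 0)"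
 by (auto simp: gpM_def gp_const)

lemma gpM_mult:
 assumes D: "finite D" and X: "gpM D I X DX" and Y: "gpM D I Y DY"
 shows "gpM D I (%x. X x * Y x) (%e x. DX e x * Y x + X x * DY e x)"
 unfolding gpM_def
proof (intro conjI ballI allI)
 fix i j assume ij: "i \<in> D" "j \<in> D"
 have "gp I (%x. \<Sum>k\<in>D. ent (X x) i k * ent (Y x) k j)
  (%e x. \<Sum>k\<in>D. ent (DX e x) i k * ent (Y x) k j + ent (X x) i k * ent (DY e x) k j)"
  using X Y ij by (intro gp_sum gp_mult) (auto simp: gpM_def)
 then show "gp I (%x. ent (X x * Y x) i j) (%e x. ent (DX e x * Y x + X x * DY e x) i j)"
  using X Y ij D by (simp add: gpM_def adm_times_ent[OF D] sum.distrib)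
qed (use X Y in \<open>auto simp: gpM_def\<close>)

lemma gpM_power:
 assumes D: "finite D" and X: "gpM D I X DX"
 shows "gpM D I (%x. X x ^ n) (%e x. \<Sum>j<n. X x ^ j * DX e x * X x ^ (n - 1 - j))"
proof (induction n)
 case 0
 then show ?case using gpM_const[of D 1 I] by simp
next
 case (Suc n)
 have "(\<Sum>j<Suc n. X x ^ j * DX e x * X x ^ (Suc n - 1 - j))
  = DX e x * X x ^ n + X x * (\<Sum>j<n. X x ^ j * DX e x * X x ^ (n - 1 - j))" for e x
  by (subst sum.lessThan_Suc_shift) (simp add: sum_distrib_left mult.assoc)
 then show ?case using gpM_mult[OF D X Suc] by simp
qed

lemma gpM_tr:
 assumes "gpM D I X DX"
 shows "gp I (%x. tr D (X x)) (%e x. tr D (DX e x))"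
 unfolding tr_def using assms by (intro gp_sum) (auto simp: gpM_def)

section \<open>The block Gaussian matrix\<close>

definition mk :: "'a set => ('a => 'a => real) => 'a lmat" where
 "mk D f = Lmat (%i j. if i \<in> D \<and> j \<in> D then f i j else 0)"

lemma ent_mk:
 assumes "finite D"
 shows "ent (mk D f) i j = (if i \<in> D \<and> j \<in> D then f i j else 0)"
proof -
 have "finite {j. (if i \<in> D \<and> j \<in> D then f i j else 0) \<noteq> 0}" for i
  using assms by (rule rev_finite_subset) auto
 moreover have "finite {i. (if i \<in> D \<and> j \<in> D then f i j else 0) \<noteq> 0}" for j
  using assms by (rule rev_finite_subset) auto
 ultimately show ?thesis unfolding mk_def by (subst Lmat_inverse) auto
qed

lemma adm_mk: "finite D ==> adm D (mk D f)"
 unfolding adm_def by (auto simp: ent_mk)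

locale coeffs =
 fixes K l :: nat and a :: "nat => nat => nat => real"
begin

definition DD :: "nat set => (nat \<times> nat) set" where "DD J = {..<K} \<times> J"

definition EE :: "nat set => (nat \<times> nat \<times> nat) set" where "EE J = {..<l} \<times> J \<times> J"

text \<open>The Kronecker product of the coefficient matrix \<open>a i\<close> and the matrix unit at
 \<open>(r, c)\<close>.\<close>

definition UU :: "nat set => nat => nat => nat => (nat \<times> nat) lmat" where
 "UU J i r c = mk (DD J) (%(ka, r') (mu, c'). if r' = r \<and> c' = c then a i ka mu else 0)"

text \<open>The Kronecker product of a matrix unit and a diagonal matrix.\<close>

definition BB :: "nat set => nat => nat => (nat => real) => (nat \<times> nat) lmat" where
 "BB J ka mu \<tau> = mk (DD J) (%(ka', r) (mu', c). if ka' = ka \<and> mu' = mu \<and> r = c then \<tau> r else 0)"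

definition Del :: "nat set => nat \<times> nat \<times> nat => (nat \<times> nat) lmat" where
 "Del J e = (case e of (i, r, c) => UU J i r c + tp (UU J i r c))"

definition XX :: "nat set => (nat \<times> nat \<times> nat => real) => (nat \<times> nat) lmat" where
 "XX J z = (\<Sum>e\<in>EE J. z e *\<^sub>R Del J e)"

lemma finite_DD [simp]: "finite J ==> finite (DD J)"
 and finite_EE [simp]: "finite J ==> finite (EE J)"
 by (simp_all add: DD_def EE_def)

lemma card_DD: "card (DD J) = K * card J"
 by (simp add: DD_def card_cartesian_product)

lemma mem_DD [simp]: "(ka, r) \<in> DD J \<longleftrightarrow> ka < K \<and> r \<in> J"
 and mem_EE [simp]: "(i, r, c) \<in> EE J \<longleftrightarrow> i < l \<and> r \<in> J \<and> c \<in> J"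
 by (auto simp: DD_def EE_def)

lemma sum_DD: "(\<Sum>p\<in>DD J. f p) = (\<Sum>ka<K. \<Sum>r\<in>J. f (ka, r))"
 by (simp add: DD_def sum.cartesian_product)

lemma sum_EE: "(\<Sum>e\<in>EE J. f e) = (\<Sum>i<l. \<Sum>r\<in>J. \<Sum>c\<in>J. f (i, r, c))"
 by (simp add: EE_def sum.cartesian_product)

context
 fixes J :: "nat set" assumes J: "finite J"
begin

lemma adm_UU [simp]: "adm (DD J) (UU J i r c)"
 and adm_BB [simp]: "adm (DD J) (BB J ka mu \<tau>)"
 unfolding UU_def BB_def using J by (auto intro: adm_mk)

lemma adm_Del [simp]: "adm (DD J) (Del J e)"
 unfolding Del_def by (auto split: prod.splits)

lemma adm_XX [simp]: "adm (DD J) (XX J z)"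
 unfolding XX_def by (intro adm_sum) simp

lemma tp_Del [simp]: "tp (Del J e) = Del J e"
 unfolding Del_def by (auto split: prod.splits simp: add.commute)

lemma tp_XX [simp]: "tp (XX J z) = XX J z"
 unfolding XX_def by (simp add: tp_sum)

lemma ent_UU: "ka < K ==> mu < K ==> r' \<in> J ==> c' \<in> J ==>
  ent (UU J i r c) (ka, r') (mu, c') = (if r' = r \<and> c' = c then a i ka mu else 0)"
 unfolding UU_def using J by (simp add: ent_mk)

lemma ent_BB: "ka' < K ==> mu' < K ==> r \<in> J ==> c \<in> J ==>
  ent (BB J ka mu \<tau>) (ka', r) (mu', c) = (if ka' = ka \<and> mu' = mu \<and> r = c then \<tau> r else 0)"
 unfolding BB_def using J by (simp add: ent_mk)

lemma sum_pick: "r \<in> J ==> (\<Sum>c\<in>J. (if c = r then f c else 0)) = (f r :: real)"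
 using J by simp

lemma ent_UU_times:
 assumes "ka < K" "r' \<in> J" "c \<in> J"
 shows "ent (UU J i r c * Y) (ka, r') q = (if r' = r then \<Sum>mu<K. a i ka mu * ent Y (mu, c) q else 0)"
proof -
 have "ent (UU J i r c * Y) (ka, r') q
  = (\<Sum>mu<K. \<Sum>c'\<in>J. ent (UU J i r c) (ka, r') (mu, c') * ent Y (mu, c') q)"
  using assms J by (subst adm_times_ent[of "DD J"]) (auto simp: sum_DD)
 also have "\<dots> = (\<Sum>mu<K. \<Sum>c'\<in>J. if c' = c then (if r' = r then a i ka mu * ent Y (mu, c) q else 0) else 0)"
  using assms by (intro sum.cong refl) (auto simp: ent_UU)
 also have "\<dots> = (if r' = r then \<Sum>mu<K. a i ka mu * ent Y (mu, c) q else 0)"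
  using assms by (simp add: sum_pick)
 finally show ?thesis .
qed

lemma ent_tp_UU_times:
 assumes "mu < K" "c' \<in> J" "r \<in> J"
 shows "ent (tp (UU J i r c) * Y) (mu, c') q = (if c' = c then \<Sum>ka<K. a i ka mu * ent Y (ka, r) q else 0)"
proof -
 have "ent (tp (UU J i r c) * Y) (mu, c') q
  = (\<Sum>ka<K. \<Sum>r'\<in>J. ent (UU J i r c) (ka, r') (mu, c') * ent Y (ka, r') q)"
  using assms J by (subst adm_times_ent[of "DD J"]) (auto simp: sum_DD)
 also have "\<dots> = (\<Sum>ka<K. \<Sum>r'\<in>J. if r' = r then (if c' = c then a i ka mu * ent Y (ka, r) q else 0) else 0)"
  using assms by (intro sum.cong refl) (auto simp: ent_UU)
 also have "\<dots> = (if c' = c then \<Sum>ka<K. a i ka mu * ent Y (ka, r) q else 0)"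
  using assms by (simp add: sum_pick)
 finally show ?thesis .
qed

lemma ent_BB_times:
 assumes "ka' < K" "mu < K" "r \<in> J"
 shows "ent (BB J ka mu \<tau> * Y) (ka', r) q = (if ka' = ka then \<tau> r * ent Y (mu, r) q else 0)"
proof -
 have "ent (BB J ka mu \<tau> * Y) (ka', r) q
  = (\<Sum>mu'<K. \<Sum>c\<in>J. ent (BB J ka mu \<tau>) (ka', r) (mu', c) * ent Y (mu', c) q)"
  using assms J by (subst adm_times_ent[of "DD J"]) (auto simp: sum_DD)
 also have "\<dots> = (\<Sum>mu'<K. if mu' = mu then (\<Sum>c\<in>J. if c = r then
   (if ka' = ka then \<tau> r * ent Y (mu, r) q else 0) else 0) else 0)"
  using assms by (intro sum.cong refl) (auto simp: ent_BB intro!: sum.cong sum.neutral)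
 also have "\<dots> = (if ka' = ka then \<tau> r * ent Y (mu, r) q else 0)"
  using assms by (simp add: sum_pick)
 finally show ?thesis .
qed

lemma tr_UU_times:
 assumes "r \<in> J" "c \<in> J"
 shows "tr (DD J) (UU J i r c * Y) = (\<Sum>ka<K. \<Sum>mu<K. a i ka mu * ent Y (mu, c) (ka, r))"
proof -
 have "tr (DD J) (UU J i r c * Y)
  = (\<Sum>ka<K. \<Sum>r'\<in>J. if r' = r then \<Sum>mu<K. a i ka mu * ent Y (mu, c) (ka, r) else 0)"
  unfolding tr_def sum_DD using assms by (intro sum.cong refl) (auto simp: ent_UU_times)
 then show ?thesis using assms by (simp add: sum_pick)
qed

lemma tr_BB_times:
 assumes "ka < K" "mu < K"
 shows "tr (DD J) (BB J ka mu \<tau> * Y) = (\<Sum>r\<in>J. \<tau> r * ent Y (mu, r) (ka, r))"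
proof -
 have "tr (DD J) (BB J ka mu \<tau> * Y)
  = (\<Sum>ka'<K. if ka' = ka then (\<Sum>r\<in>J. \<tau> r * ent Y (mu, r) (ka, r)) else 0)"
  unfolding tr_def sum_DD using assms by (intro sum.cong refl) (auto simp: ent_BB_times)
 then show ?thesis using assms by simp
qed

lemma tr_BB_BB:
 assumes "ka < K" "mu < K" "ka' < K" "mu' < K" and that: "adm (DD J) Y"
 shows "tr (DD J) (BB J ka mu \<beta> * Y * (BB J ka' mu' \<alpha> * Y'))
  = (\<Sum>c\<in>J. \<Sum>r\<in>J. \<beta> c * \<alpha> r * ent Y (mu, c) (ka', r) * ent Y' (mu', r) (ka, c))"
proof -
 have "tr (DD J) (BB J ka mu \<beta> * Y * (BB J ka' mu' \<alpha> * Y'))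
  = (\<Sum>c\<in>J. \<beta> c * ent (Y * (BB J ka' mu' \<alpha> * Y')) (mu, c) (ka, c))"
  using assms by (simp add: mult.assoc tr_BB_times)
 also have "\<dots> = (\<Sum>c\<in>J. \<beta> c * (\<Sum>\<nu><K. \<Sum>r\<in>J. ent Y (mu, c) (\<nu>, r) *
   ent (BB J ka' mu' \<alpha> * Y') (\<nu>, r) (ka, c)))"
  using assms that J by (intro sum.cong refl, subst adm_times_ent[of "DD J"]) (auto simp: sum_DD)
 also have "\<dots> = (\<Sum>c\<in>J. \<beta> c * (\<Sum>\<nu><K. if \<nu> = ka' then
   (\<Sum>r\<in>J. ent Y (mu, c) (ka', r) * (\<alpha> r * ent Y' (mu', r) (ka, c))) else 0))"
  using assms by (intro sum.cong refl arg_cong2[where f = "(*)"]) (auto simp: ent_BB_times)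
 also have "\<dots> = (\<Sum>c\<in>J. \<Sum>r\<in>J. \<beta> c * \<alpha> r * ent Y (mu, c) (ka', r) * ent Y' (mu', r) (ka, c))"
  using assms by (simp add: sum_distrib_left mult_ac)
 finally show ?thesis .
qed

lemma tp_BB: "tp (BB J ka mu \<tau>) = BB J mu ka \<tau>"
 by (rule lmat_eqI) (auto simp: BB_def ent_mk[OF finite_DD[OF J]] split: prod.splits)

lemma BB_mult:
 assumes "mu < K"
 shows "BB J ka mu \<tau> * BB J mu' \<nu> \<sigma> = (if mu = mu' then BB J ka \<nu> (%r. \<tau> r * \<sigma> r) else 0)"
proof (rule lmat_eqI)
 fix p q
 show "ent (BB J ka mu \<tau> * BB J mu' \<nu> \<sigma>) p q
  = ent (if mu = mu' then BB J ka \<nu> (%r. \<tau> r * \<sigma> r) else 0) p q"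
 proof (cases "p \<in> DD J")
  case True
  then obtain ka' r where p: "p = (ka', r)" "ka' < K" "r \<in> J" by (cases p) auto
  show ?thesis
   unfolding p(1) using p assms
   by (simp add: ent_BB_times) (auto simp: BB_def ent_mk[OF finite_DD[OF J]] split: prod.splits)
 next
  case False
  have "ent (BB J ka mu \<tau> * BB J mu' \<nu> \<sigma>) p q = 0"
   using False by (subst ent_times_on[of "{}"]) (auto simp: BB_def ent_mk[OF finite_DD[OF J]])
  then show ?thesis using False by (auto simp: BB_def ent_mk[OF finite_DD[OF J]])
 qed
qed

lemma small_BB:
 assumes "ka < K" "mu < K" and \<tau>: "!!r. r \<in> J ==> \<bar>\<tau> r\<bar> \<le> 1"
 shows "small (DD J) (BB J ka mu \<tau>)"
 unfolding small_def
proof (intro conjI allI)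
 fix q
 have pow: "BB J mu mu \<sigma> ^ Suc q = BB J mu mu (%r. \<sigma> r ^ Suc q)" for \<sigma> q
  using assms by (induction q) (auto simp: BB_mult)
 have "tp (BB J ka mu \<tau>) * BB J ka mu \<tau> = BB J mu mu (%r. \<tau> r * \<tau> r)"
  using assms by (simp add: tp_BB BB_mult)
 moreover have "tr (DD J) (BB J mu mu (%r. \<tau> r * \<tau> r) ^ q) \<le> real (card (DD J))"
 proof (cases q)
  case (Suc q')
  have "tr (DD J) (BB J mu mu (%r. \<tau> r * \<tau> r) ^ q) = (\<Sum>r\<in>J. (\<tau> r * \<tau> r) ^ q)"
   unfolding Suc pow using tr_BB_times[OF assms(2,2), of _ 1] by simp
  also have "\<dots> \<le> (\<Sum>r\<in>J. 1)"
  proof (intro sum_mono)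
   fix r assume "r \<in> J"
   then have "\<bar>\<tau> r\<bar> * \<bar>\<tau> r\<bar> \<le> 1 * 1" using \<tau> by (intro mult_mono) auto
   then show "(\<tau> r * \<tau> r) ^ q \<le> 1" by (intro power_le_one) auto
  qed
  also have "\<dots> \<le> real (card (DD J))"
  proof -
   have "1 * card J \<le> K * card J" using assms by (intro mult_right_mono) auto
   then have "real (1 * card J) \<le> real (K * card J)" by (simp only: of_nat_le_iff)
   then show ?thesis by (simp add: card_DD)
  qed
  finally show ?thesis .
 qed simp
 ultimately show "tr (DD J) ((tp (BB J ka mu \<tau>) * BB J ka mu \<tau>) ^ q) \<le> real (card (DD J))"
  by simp
qed simp

text \<open>Sums over the coefficient indices.\<close>

text \<open>Every sum over the entries of the Gaussian matrices collapses to such a sum over the coefficients;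
 \<open>AA\<close> below is its norm.\<close>

definition csum :: "(nat => nat => nat => nat => real) => real" where
 "csum f = (\<Sum>i<l. \<Sum>ka<K. \<Sum>mu<K. \<Sum>ka'<K. \<Sum>mu'<K. a i ka mu * a i ka' mu' * f ka mu ka' mu')"

definition AA :: real where
 "AA = (\<Sum>i<l. \<Sum>ka<K. \<Sum>mu<K. \<Sum>ka'<K. \<Sum>mu'<K. \<bar>a i ka mu\<bar> * \<bar>a i ka' mu'\<bar>)"

lemma AA_nonneg: "0 \<le> AA"
 unfolding AA_def by (intro sum_nonneg) auto

lemma csum_bound:
 assumes "!!ka mu ka' mu'. ka < K ==> mu < K ==> ka' < K ==> mu' < K ==> \<bar>f ka mu ka' mu'\<bar> \<le> W"
 shows "\<bar>csum f\<bar> \<le> AA * W"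
 unfolding csum_def AA_def sum_distrib_right
 by (intro order_trans[OF sum_abs] sum_mono) (auto simp: abs_mult intro!: mult_mono assms)

lemma sum_sum4:
 "(\<Sum>r\<in>J. \<Sum>c\<in>J. x r c * (\<Sum>ka<K. \<Sum>mu<K. \<Sum>ka'<K. \<Sum>mu'<K. g ka mu ka' mu' * f r c ka mu ka' mu'))
  = (\<Sum>ka<K. \<Sum>mu<K. \<Sum>ka'<K. \<Sum>mu'<K. g ka mu ka' mu' * (\<Sum>r\<in>J. \<Sum>c\<in>J. x r c * f r c ka mu ka' mu' :: real))"
proof -
 have "(\<Sum>p\<in>J \<times> J. (case p of (r, c) => x r c) *
   (\<Sum>ka<K. \<Sum>mu<K. \<Sum>ka'<K. \<Sum>mu'<K. g ka mu ka' mu' * (case p of (r, c) => f r c ka mu ka' mu')))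
  = (\<Sum>ka<K. \<Sum>mu<K. \<Sum>ka'<K. \<Sum>mu'<K. g ka mu ka' mu' *
    (\<Sum>p\<in>J \<times> J. (case p of (r, c) => x r c * f r c ka mu ka' mu')))"
  unfolding sum_distrib_left
  apply (subst sum.swap, rule sum.cong[OF refl])
  apply (subst sum.swap, rule sum.cong[OF refl])
  apply (subst sum.swap, rule sum.cong[OF refl])
  apply (subst sum.swap, rule sum.cong[OF refl])
  apply (rule sum.cong[OF refl])
  apply (auto split: prod.splits simp: mult_ac)
  done
 then show ?thesis by (simp add: sum.cartesian_product case_prod_unfold)
qed

lemma prod_sum2:
 "(\<Sum>ka<K. \<Sum>mu<K. f ka mu) * (\<Sum>ka<K. \<Sum>mu<K. g ka mu)
  = (\<Sum>ka<K. \<Sum>mu<K. \<Sum>ka'<K. \<Sum>mu'<K. f ka mu * g ka' mu' :: real)"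
 by (simp only: sum_distrib_right) (simp only: sum_distrib_left)

lemma sum_UU_UU:
 assumes P: "adm (DD J) P" "adm (DD J) P'"
 shows "(\<Sum>(i, r, c)\<in>EE J. \<alpha> r * \<beta> c * (tr (DD J) (UU J i r c * P) * tr (DD J) (tp (UU J i r c) * P')))
  = csum (%ka mu ka' mu'. tr (DD J) (BB J mu' mu \<beta> * P * (BB J ka ka' \<alpha> * P')))"
proof -
 have tpU: "tr (DD J) (tp (UU J i r c) * P') = (\<Sum>ka<K. \<Sum>mu<K. a i ka mu * ent P' (ka, r) (mu, c))"
  if "r \<in> J" "c \<in> J" for i r c
 proof -
  have "tr (DD J) (tp (UU J i r c) * P') = tr (DD J) (tp P' * UU J i r c)"
   using tr_simps(5)[of "DD J" "tp P' * UU J i r c"] by (simp add: tp_mult)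
  also have "\<dots> = tr (DD J) (UU J i r c * tp P')"
   using P J by (intro tr_commute) auto
  finally show ?thesis using that by (simp add: tr_UU_times)
 qed
 have "(\<Sum>(i, r, c)\<in>EE J. \<alpha> r * \<beta> c * (tr (DD J) (UU J i r c * P) * tr (DD J) (tp (UU J i r c) * P')))
  = (\<Sum>i<l. \<Sum>r\<in>J. \<Sum>c\<in>J. \<alpha> r * \<beta> c * (\<Sum>ka<K. \<Sum>mu<K. \<Sum>ka'<K. \<Sum>mu'<K.
    a i ka mu * a i ka' mu' * (ent P (mu, c) (ka, r) * ent P' (ka', r) (mu', c))))"
  unfolding sum_EE prod.case
 proof (intro sum.cong refl arg_cong2[where f = "(*)"])
  fix i r c assume rc: "r \<in> J" "c \<in> J"
  show "tr (DD J) (UU J i r c * P) * tr (DD J) (tp (UU J i r c) * P')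
   = (\<Sum>ka<K. \<Sum>mu<K. \<Sum>ka'<K. \<Sum>mu'<K.
    a i ka mu * a i ka' mu' * (ent P (mu, c) (ka, r) * ent P' (ka', r) (mu', c)))"
   unfolding tpU[OF rc] tr_UU_times[OF rc] prod_sum2 by (intro sum.cong refl) (simp only: mult_ac)
 qed
 also have "\<dots> = (\<Sum>i<l. \<Sum>ka<K. \<Sum>mu<K. \<Sum>ka'<K. \<Sum>mu'<K. a i ka mu * a i ka' mu' *
    (\<Sum>r\<in>J. \<Sum>c\<in>J. \<alpha> r * \<beta> c * (ent P (mu, c) (ka, r) * ent P' (ka', r) (mu', c))))"
  unfolding sum_sum4 ..
 also have "\<dots> = csum (%ka mu ka' mu'. tr (DD J) (BB J mu' mu \<beta> * P * (BB J ka ka' \<alpha> * P')))"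
  unfolding csum_def
 proof (intro sum.cong refl arg_cong2[where f = "(*)"])
  fix ka mu ka' mu' assume "ka \<in> {..<K}" "mu \<in> {..<K}" "ka' \<in> {..<K}" "mu' \<in> {..<K}"
  then show "(\<Sum>r\<in>J. \<Sum>c\<in>J. \<alpha> r * \<beta> c * (ent P (mu, c) (ka, r) * ent P' (ka', r) (mu', c)))
   = tr (DD J) (BB J mu' mu \<beta> * P * (BB J ka ka' \<alpha> * P'))"
   using P by (subst sum.swap, subst tr_BB_BB) (auto simp: mult_ac)
 qed
 finally show ?thesis .
qed

lemma sum_U_tpU:
 assumes Y: "adm (DD J) Y"
 shows "(\<Sum>(i, r, c)\<in>EE J. \<alpha> r * \<beta> c * tr (DD J) (UU J i r c * Y * (tp (UU J i r c) * Y')))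
  = csum (%ka mu ka' mu'. tr (DD J) (BB J mu' mu \<beta> * Y) * tr (DD J) (BB J ka ka' \<alpha> * Y'))"
proof -
 have T: "tr (DD J) (UU J i r c * Y * (tp (UU J i r c) * Y')) = (\<Sum>ka<K. \<Sum>mu<K. \<Sum>ka'<K. \<Sum>mu'<K.
   a i ka mu * a i ka' mu' * (ent Y (mu, c) (mu', c) * ent Y' (ka', r) (ka, r)))"
  if rc: "r \<in> J" "c \<in> J" for i r c
 proof -
  have "ent (Y * (tp (UU J i r c) * Y')) (mu, c) (ka, r)
    = (\<Sum>mu'<K. \<Sum>ka'<K. a i ka' mu' * (ent Y (mu, c) (mu', c) * ent Y' (ka', r) (ka, r)))"
   if "mu < K" for mu ka
  proof -
   have "ent (Y * (tp (UU J i r c) * Y')) (mu, c) (ka, r)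
    = (\<Sum>mu'<K. \<Sum>c'\<in>J. ent Y (mu, c) (mu', c') * ent (tp (UU J i r c) * Y') (mu', c') (ka, r))"
    using that rc J Y by (subst adm_times_ent[of "DD J"]) (auto simp: sum_DD)
   also have "\<dots> = (\<Sum>mu'<K. \<Sum>c'\<in>J. if c' = c then
     \<Sum>ka'<K. a i ka' mu' * (ent Y (mu, c) (mu', c) * ent Y' (ka', r) (ka, r)) else 0)"
    using rc by (intro sum.cong refl) (auto simp: ent_tp_UU_times sum_distrib_left mult_ac)
   finally show ?thesis using rc by (simp add: sum_pick)
  qed
  then have "tr (DD J) (UU J i r c * Y * (tp (UU J i r c) * Y'))
   = (\<Sum>ka<K. \<Sum>mu<K. a i ka mu * (\<Sum>mu'<K. \<Sum>ka'<K. a i ka' mu' * (ent Y (mu, c) (mu', c) * ent Y' (ka', r) (ka, r))))"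
   using rc by (simp add: mult.assoc tr_UU_times)
  also have "\<dots> = (\<Sum>ka<K. \<Sum>mu<K. \<Sum>ka'<K. \<Sum>mu'<K.
   a i ka mu * a i ka' mu' * (ent Y (mu, c) (mu', c) * ent Y' (ka', r) (ka, r)))"
   by (intro sum.cong refl, subst sum.swap) (simp add: sum_distrib_left mult_ac)
  finally show ?thesis .
 qed
 have "(\<Sum>(i, r, c)\<in>EE J. \<alpha> r * \<beta> c * tr (DD J) (UU J i r c * Y * (tp (UU J i r c) * Y')))
  = (\<Sum>i<l. \<Sum>r\<in>J. \<Sum>c\<in>J. \<alpha> r * \<beta> c * (\<Sum>ka<K. \<Sum>mu<K. \<Sum>ka'<K. \<Sum>mu'<K.
    a i ka mu * a i ka' mu' * (ent Y (mu, c) (mu', c) * ent Y' (ka', r) (ka, r))))"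
  unfolding sum_EE prod.case by (intro sum.cong refl arg_cong2[where f = "(*)"] T)
 also have "\<dots> = (\<Sum>i<l. \<Sum>ka<K. \<Sum>mu<K. \<Sum>ka'<K. \<Sum>mu'<K. a i ka mu * a i ka' mu' *
    (\<Sum>r\<in>J. \<Sum>c\<in>J. \<alpha> r * \<beta> c * (ent Y (mu, c) (mu', c) * ent Y' (ka', r) (ka, r))))"
  unfolding sum_sum4 ..
 also have "\<dots> = csum (%ka mu ka' mu'. tr (DD J) (BB J mu' mu \<beta> * Y) * tr (DD J) (BB J ka ka' \<alpha> * Y'))"
  unfolding csum_def
 proof (intro sum.cong refl arg_cong2[where f = "(*)"])
  fix ka mu ka' mu' assume "ka \<in> {..<K}" "mu \<in> {..<K}" "ka' \<in> {..<K}" "mu' \<in> {..<K}"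
  then have "tr (DD J) (BB J ka ka' \<alpha> * Y') * tr (DD J) (BB J mu' mu \<beta> * Y)
   = (\<Sum>r\<in>J. \<Sum>c\<in>J. \<alpha> r * ent Y' (ka', r) (ka, r) * (\<beta> c * ent Y (mu, c) (mu', c)))"
   by (simp only: lessThan_iff tr_BB_times sum_product)
  then show "(\<Sum>r\<in>J. \<Sum>c\<in>J. \<alpha> r * \<beta> c * (ent Y (mu, c) (mu', c) * ent Y' (ka', r) (ka, r)))
   = tr (DD J) (BB J mu' mu \<beta> * Y) * tr (DD J) (BB J ka ka' \<alpha> * Y')"
   by (simp only: mult_ac)
 qed
 finally show ?thesis .
qed

lemma sum_U_U:
 assumes Y: "adm (DD J) Y" "adm (DD J) Y'"
 shows "(\<Sum>(i, r, c)\<in>EE J. \<alpha> r * \<beta> c * tr (DD J) (UU J i r c * Y * (UU J i r c * Y')))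
  = csum (%ka mu ka' mu'. tr (DD J) (BB J mu' mu \<beta> * Y * (BB J ka' ka \<alpha> * tp Y')))"
proof -
 have T: "tr (DD J) (UU J i r c * Y * (UU J i r c * Y')) = (\<Sum>ka<K. \<Sum>mu<K. \<Sum>ka'<K. \<Sum>mu'<K.
   a i ka mu * a i ka' mu' * (ent Y (mu, c) (ka', r) * ent Y' (mu', c) (ka, r)))"
  if rc: "r \<in> J" "c \<in> J" for i r c
 proof -
  have "ent (Y * (UU J i r c * Y')) (mu, c) (ka, r)
    = (\<Sum>ka'<K. \<Sum>mu'<K. a i ka' mu' * (ent Y (mu, c) (ka', r) * ent Y' (mu', c) (ka, r)))"
   if "mu < K" for mu ka
  proof -
   have "ent (Y * (UU J i r c * Y')) (mu, c) (ka, r)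
    = (\<Sum>ka'<K. \<Sum>r'\<in>J. ent Y (mu, c) (ka', r') * ent (UU J i r c * Y') (ka', r') (ka, r))"
    using that rc J Y by (subst adm_times_ent[of "DD J"]) (auto simp: sum_DD)
   also have "\<dots> = (\<Sum>ka'<K. \<Sum>r'\<in>J. if r' = r then
     \<Sum>mu'<K. a i ka' mu' * (ent Y (mu, c) (ka', r) * ent Y' (mu', c) (ka, r)) else 0)"
    using rc by (intro sum.cong refl) (auto simp: ent_UU_times sum_distrib_left mult_ac)
   finally show ?thesis using rc by (simp add: sum_pick)
  qed
  then show ?thesis
   using rc by (simp add: mult.assoc tr_UU_times sum_distrib_left)
 qed
 have "(\<Sum>(i, r, c)\<in>EE J. \<alpha> r * \<beta> c * tr (DD J) (UU J i r c * Y * (UU J i r c * Y')))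
  = (\<Sum>i<l. \<Sum>r\<in>J. \<Sum>c\<in>J. \<alpha> r * \<beta> c * (\<Sum>ka<K. \<Sum>mu<K. \<Sum>ka'<K. \<Sum>mu'<K.
    a i ka mu * a i ka' mu' * (ent Y (mu, c) (ka', r) * ent Y' (mu', c) (ka, r))))"
  unfolding sum_EE prod.case by (intro sum.cong refl arg_cong2[where f = "(*)"] T)
 also have "\<dots> = (\<Sum>i<l. \<Sum>ka<K. \<Sum>mu<K. \<Sum>ka'<K. \<Sum>mu'<K. a i ka mu * a i ka' mu' *
    (\<Sum>r\<in>J. \<Sum>c\<in>J. \<alpha> r * \<beta> c * (ent Y (mu, c) (ka', r) * ent Y' (mu', c) (ka, r))))"
  unfolding sum_sum4 ..
 also have "\<dots> = csum (%ka mu ka' mu'. tr (DD J) (BB J mu' mu \<beta> * Y * (BB J ka' ka \<alpha> * tp Y')))"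
  unfolding csum_def
 proof (intro sum.cong refl arg_cong2[where f = "(*)"])
  fix ka mu ka' mu' assume "ka \<in> {..<K}" "mu \<in> {..<K}" "ka' \<in> {..<K}" "mu' \<in> {..<K}"
  then show "(\<Sum>r\<in>J. \<Sum>c\<in>J. \<alpha> r * \<beta> c * (ent Y (mu, c) (ka', r) * ent Y' (mu', c) (ka, r)))
   = tr (DD J) (BB J mu' mu \<beta> * Y * (BB J ka' ka \<alpha> * tp Y'))"
   using Y by (subst sum.swap, subst tr_BB_BB) (auto simp: mult_ac)
 qed
 finally show ?thesis .
qed

text \<open>Each \<open>Del J e\<close> is a sum of a matrix and its transpose. The two mixed terms split the
 trace into a product of two traces, the other two only reverse a part of the word, and are of
 lower order.\<close>

theorem sum_Del_Del:
 assumes Y: "adm (DD J) Y" "adm (DD J) Y'"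
 shows "(\<Sum>(i, r, c)\<in>EE J. \<alpha> r * \<beta> c * tr (DD J) (Del J (i, r, c) * Y * (Del J (i, r, c) * Y')))
  = csum (%ka mu ka' mu'. tr (DD J) (BB J mu' mu \<beta> * Y) * tr (DD J) (BB J ka ka' \<alpha> * Y'))
  + csum (%ka mu ka' mu'. tr (DD J) (BB J mu' mu \<beta> * Y') * tr (DD J) (BB J ka ka' \<alpha> * Y))
  + csum (%ka mu ka' mu'. tr (DD J) (BB J mu' mu \<beta> * Y * (BB J ka' ka \<alpha> * tp Y')))
  + csum (%ka mu ka' mu'. tr (DD J) (BB J mu' mu \<beta> * tp Y' * (BB J ka' ka \<alpha> * Y)))"
proof -
 have 1: "tr (DD J) (tp (UU J i r c) * Y * (UU J i r c * Y'))
   = tr (DD J) (UU J i r c * Y' * (tp (UU J i r c) * Y))" for i r c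
  using Y J by (intro tr_commute) auto
 have 2: "tr (DD J) (tp (UU J i r c) * Y * (tp (UU J i r c) * Y'))
   = tr (DD J) (UU J i r c * tp Y' * (UU J i r c * tp Y))" for i r c
 proof -
  let ?U = "UU J i r c"
  have "tr (DD J) (tp ?U * Y * (tp ?U * Y')) = tr (DD J) (tp (tp ?U * Y * (tp ?U * Y')))" by simp
  also have "\<dots> = tr (DD J) (tp Y' * (?U * tp Y * ?U))"
   by (simp only: tp_mult tp_simps mult.assoc)
  also have "\<dots> = tr (DD J) ((?U * tp Y * ?U) * tp Y')"
   using Y J by (intro tr_commute) auto
  also have "\<dots> = tr (DD J) ((?U * tp Y) * (?U * tp Y'))" by (simp only: mult.assoc)
  also have "\<dots> = tr (DD J) ((?U * tp Y') * (?U * tp Y))"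
   using Y J by (intro tr_commute) auto
  finally show ?thesis .
 qed
 have "tr (DD J) (Del J (i, r, c) * Y * (Del J (i, r, c) * Y'))
   = tr (DD J) (UU J i r c * Y * (tp (UU J i r c) * Y'))
   + tr (DD J) (UU J i r c * Y' * (tp (UU J i r c) * Y))
   + tr (DD J) (UU J i r c * Y * (UU J i r c * Y'))
   + tr (DD J) (UU J i r c * tp Y' * (UU J i r c * tp Y))" for i r c
  unfolding Del_def 1[symmetric] 2[symmetric] by (simp add: distrib_left distrib_right)
 then have "(\<Sum>(i, r, c)\<in>EE J. \<alpha> r * \<beta> c * tr (DD J) (Del J (i, r, c) * Y * (Del J (i, r, c) * Y')))
  = (\<Sum>(i, r, c)\<in>EE J. \<alpha> r * \<beta> c * tr (DD J) (UU J i r c * Y * (tp (UU J i r c) * Y')))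
  + (\<Sum>(i, r, c)\<in>EE J. \<alpha> r * \<beta> c * tr (DD J) (UU J i r c * Y' * (tp (UU J i r c) * Y)))
  + (\<Sum>(i, r, c)\<in>EE J. \<alpha> r * \<beta> c * tr (DD J) (UU J i r c * Y * (UU J i r c * Y')))
  + (\<Sum>(i, r, c)\<in>EE J. \<alpha> r * \<beta> c * tr (DD J) (UU J i r c * tp Y' * (UU J i r c * tp Y)))"
  by (simp add: case_prod_unfold distrib_left sum.distrib)
 then show ?thesis
  using Y by (simp only: sum_U_tpU sum_U_U adm_intros tp_simps)
qed

text \<open>Two traces that share a Gaussian variable merge into one. This gain of one trace is the reason why
 covariances are small.\<close>

theorem sum_tr_Del_tr_Del:
 assumes P: "adm (DD J) P" "adm (DD J) P'"
 shows "(\<Sum>(i, r, c)\<in>EE J. \<alpha> r * \<beta> c * (tr (DD J) (Del J (i, r, c) * P) * tr (DD J) (Del J (i, r, c) * P')))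
  = csum (%ka mu ka' mu'. tr (DD J) (BB J mu' mu \<beta> * P * (BB J ka ka' \<alpha> * P')))
  + csum (%ka mu ka' mu'. tr (DD J) (BB J mu' mu \<beta> * P * (BB J ka ka' \<alpha> * tp P')))
  + csum (%ka mu ka' mu'. tr (DD J) (BB J mu' mu \<beta> * tp P * (BB J ka ka' \<alpha> * P')))
  + csum (%ka mu ka' mu'. tr (DD J) (BB J mu' mu \<beta> * tp P * (BB J ka ka' \<alpha> * tp P')))"
proof -
 have tpU: "tr (DD J) (tp V * R) = tr (DD J) (V * tp R)" if "adm (DD J) V" "adm (DD J) R" for V R
 proof -
  have "tr (DD J) (tp V * R) = tr (DD J) (tp (tp V * R))" by simp
  also have "\<dots> = tr (DD J) (tp R * V)" by (simp only: tp_mult tp_simps)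
  also have "\<dots> = tr (DD J) (V * tp R)" using that J by (intro tr_commute) auto
  finally show ?thesis .
 qed
 have "tr (DD J) (Del J (i, r, c) * P) * tr (DD J) (Del J (i, r, c) * P')
  = tr (DD J) (UU J i r c * P) * tr (DD J) (tp (UU J i r c) * P')
  + tr (DD J) (UU J i r c * P) * tr (DD J) (tp (UU J i r c) * tp P')
  + tr (DD J) (UU J i r c * tp P) * tr (DD J) (tp (UU J i r c) * P')
  + tr (DD J) (UU J i r c * tp P) * tr (DD J) (tp (UU J i r c) * tp P')" for i r c
  using P by (simp add: Del_def distrib_left distrib_right tpU)
 then have "(\<Sum>(i, r, c)\<in>EE J. \<alpha> r * \<beta> c * (tr (DD J) (Del J (i, r, c) * P) * tr (DD J) (Del J (i, r, c) * P')))
  = (\<Sum>(i, r, c)\<in>EE J. \<alpha> r * \<beta> c * (tr (DD J) (UU J i r c * P) * tr (DD J) (tp (UU J i r c) * P')))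
  + (\<Sum>(i, r, c)\<in>EE J. \<alpha> r * \<beta> c * (tr (DD J) (UU J i r c * P) * tr (DD J) (tp (UU J i r c) * tp P')))
  + (\<Sum>(i, r, c)\<in>EE J. \<alpha> r * \<beta> c * (tr (DD J) (UU J i r c * tp P) * tr (DD J) (tp (UU J i r c) * P')))
  + (\<Sum>(i, r, c)\<in>EE J. \<alpha> r * \<beta> c * (tr (DD J) (UU J i r c * tp P) * tr (DD J) (tp (UU J i r c) * tp P')))"
  by (simp add: case_prod_unfold distrib_left sum.distrib)
 then show ?thesis using P by (simp only: sum_UU_UU adm_intros)
qed

end

end

text \<open>Words of any length up to \<open>P\<close> are filled up with multiples of the unit, whose scale
 \<open>\<tau>\<close> is free. Powers of \<open>\<tau>\<close> then compensate for the missing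
 letters.\<close>

lemma tr_letters_le:
 assumes D: "finite D" and P: "P = 2 ^ Suc s" "length Ls \<le> P" and \<tau>: "0 < \<tau>"
  and L: "!!b L. (b, L) \<in> set Ls ==>
   if b then adm D L \<and> tp L = L \<and> tr D (L ^ P) \<le> T else small D L"
  and T: "\<tau> ^ P * real (card D) \<le> T"
 shows "\<tau> ^ (P - length (filter fst Ls)) * \<bar>tr D (prod_list (map snd Ls))\<bar> \<le> T"
proof -
 let ?f = "%(b, L). if b then L else \<tau> *\<^sub>R L"
 define Ms where "Ms = map ?f Ls @ replicate (P - length Ls) (\<tau> *\<^sub>R 1)"
 have len: "length Ms = 2 ^ Suc s" using P by (simp add: Ms_def)
 have smallT: "adm D (\<tau> *\<^sub>R B) \<and> tr D ((tp (\<tau> *\<^sub>R B) * (\<tau> *\<^sub>R B)) ^ 2 ^ s) \<le> T" if "small D B" for B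
 proof -
  have "(tp (\<tau> *\<^sub>R B) * (\<tau> *\<^sub>R B)) ^ 2 ^ s = (\<tau>\<^sup>2 *\<^sub>R (tp B * B)) ^ 2 ^ s"
   by (simp add: power2_eq_square)
  also have "\<dots> = (\<tau> ^ P) *\<^sub>R ((tp B * B) ^ 2 ^ s)"
   by (simp add: power_mult P scaleR_lmat_power)
  finally have "tr D ((tp (\<tau> *\<^sub>R B) * (\<tau> *\<^sub>R B)) ^ 2 ^ s) = \<tau> ^ P * tr D ((tp B * B) ^ 2 ^ s)"
   by simp
  also have "\<dots> \<le> \<tau> ^ P * real (card D)"
   using that \<tau> by (intro mult_left_mono) (auto simp: small_def)
  finally show ?thesis using T that by (auto simp: small_def)
 qed
 have symT: "tr D ((tp Z * Z) ^ 2 ^ s) = tr D (Z ^ P)" if "tp Z = Z" for Z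
  using that by (simp add: P power_mult power2_eq_square)
 have "\<bar>tr D (prod_list Ms)\<bar> \<le> T"
 proof (rule tr_word_le[OF D len])
  fix M assume "M \<in> set Ms"
  then consider b L where "(b, L) \<in> set Ls" "M = ?f (b, L)" | "M = \<tau> *\<^sub>R 1"
   unfolding Ms_def by (auto simp: set_replicate_conv_if split: if_splits)
  then show "adm D M \<and> tr D ((tp M * M) ^ 2 ^ s) \<le> T"
  proof cases
   case (1 b L)
   show ?thesis
   proof (cases b)
    case True
    then have "adm D L \<and> tp L = L \<and> tr D (L ^ P) \<le> T" using L[OF 1(1)] by simp
    then show ?thesis using True 1(2) symT[of L] by simp
   next
    case False
    then show ?thesis using L[OF 1(1)] 1(2) smallT[of L] by simp
   qed
  next
   case 2
   then show ?thesis using smallT[OF small_one] by blast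
  qed
 qed
 moreover have "prod_list (map ?f Ls) = \<tau> ^ (length Ls - length (filter fst Ls)) *\<^sub>R prod_list (map snd Ls)"
 proof (induction Ls)
  case (Cons p Ls)
  have "length (filter fst Ls) \<le> length Ls" by simp
  then show ?case using Cons by (cases p) (auto simp: Suc_diff_le)
 qed simp
 moreover have "prod_list (replicate n (\<tau> *\<^sub>R (1 :: 'a lmat))) = \<tau> ^ n *\<^sub>R 1" for n
  by (simp only: prod_list_replicate scaleR_lmat_power power_one)
 ultimately have "\<bar>(\<tau> ^ (P - length Ls) * \<tau> ^ (length Ls - length (filter fst Ls))) *
   tr D (prod_list (map snd Ls))\<bar> \<le> T"
  by (simp add: Ms_def mult_ac)
 moreover have "(P - length Ls) + (length Ls - length (filter fst Ls)) = P - length (filter fst Ls)"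
  using P length_filter_le[of fst Ls] by linarith
 ultimately show ?thesis
  using \<tau> by (simp add: power_add[symmetric] abs_mult)
qed

lemma small_tp: assumes "finite D" "small D B" shows "small D (tp B)"
 unfolding small_def
proof (intro conjI allI)
 fix q
 show "tr D ((tp (tp B) * tp B) ^ q) \<le> real (card D)"
 proof (cases "q = 0")
  case False
  then have "tr D ((B * tp B) ^ q) = tr D ((tp B * B) ^ q)"
   using assms by (intro tr_cycle_power) (auto simp: small_def)
  then show ?thesis using assms by (auto simp: small_def)
 qed simp
qed (use assms in \<open>auto simp: small_def\<close>)

lemma tr_even_nonneg:
 assumes "finite D" "adm D X" "tp X = X" shows "0 \<le> tr D (X ^ (2 ^ Suc s))"
proof -
 have "X ^ (2 ^ Suc s) = tp (X ^ 2 ^ s) * X ^ 2 ^ s"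
  using assms by (simp add: tp_power power_add[symmetric] mult_2)
 then show ?thesis using assms tr_gram_nonneg by auto
qed

lemma word4:
 assumes D: "finite D" and X: "adm D X" "tp X = X" and Y: "adm D Y" "tp Y = Y"
  and B: "small D B1" "small D B2" "small D B3" "small D B4"
  and P: "P = 2 ^ Suc s" "j1 + j2 + j3 + j4 + 4 \<le> P"
  and \<tau>: "0 < \<tau>"
 shows "\<bar>tr D (B1 * (X ^ j1 * B2 * X ^ j2) * (B3 * (Y ^ j3 * B4 * Y ^ j4)))\<bar>
  \<le> (tr D (X ^ P) + tr D (Y ^ P) + \<tau> ^ P * real (card D)) / \<tau> ^ (P - (j1 + j2 + j3 + j4))"
proof -
 let ?T = "tr D (X ^ P) + tr D (Y ^ P) + \<tau> ^ P * real (card D)"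
 let ?Ls = "(False, B1) # replicate j1 (True, X) @ (False, B2) # replicate j2 (True, X) @
   (False, B3) # replicate j3 (True, Y) @ (False, B4) # replicate j4 (True, Y)"
 have nn: "0 \<le> tr D (X ^ P)" "0 \<le> tr D (Y ^ P)" "0 \<le> \<tau> ^ P * real (card D)"
  using X Y D \<tau> tr_even_nonneg unfolding P(1) by auto
 have "\<tau> ^ (P - length (filter fst ?Ls)) * \<bar>tr D (prod_list (map snd ?Ls))\<bar> \<le> ?T"
 proof (rule tr_letters_le[OF D P(1) _ \<tau>])
  fix b L assume "(b, L) \<in> set ?Ls"
  then show "if b then adm D L \<and> tp L = L \<and> tr D (L ^ P) \<le> ?T else small D L"
   using B X Y nn by (auto simp: set_replicate_conv_if split: if_splits)
 qed (use P nn in auto)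
 then have "\<tau> ^ (P - (j1 + j2 + j3 + j4)) *
  \<bar>tr D (B1 * (X ^ j1 * B2 * X ^ j2) * (B3 * (Y ^ j3 * B4 * Y ^ j4)))\<bar> \<le> ?T"
  by (simp add: prod_list_replicate mult.assoc filter_replicate add.assoc)
 then show ?thesis using \<tau> by (simp add: pos_le_divide_eq mult.commute)
qed

lemma word2:
 assumes D: "finite D" and X: "adm D X" "tp X = X"
  and B: "small D B1" "small D B2"
  and P: "P = 2 ^ Suc s" "j1 + j2 + 2 \<le> P"
  and \<tau>: "0 < \<tau>"
 shows "\<bar>tr D (B1 * X ^ j1 * (B2 * X ^ j2))\<bar>
  \<le> (tr D (X ^ P) + \<tau> ^ P * real (card D)) / \<tau> ^ (P - (j1 + j2))"
proof -
 let ?T = "tr D (X ^ P) + \<tau> ^ P * real (card D)"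
 let ?Ls = "(False, B1) # replicate j1 (True, X) @ (False, B2) # replicate j2 (True, X)"
 have nn: "0 \<le> tr D (X ^ P)" "0 \<le> \<tau> ^ P * real (card D)"
  using X D \<tau> tr_even_nonneg unfolding P(1) by auto
 have "\<tau> ^ (P - length (filter fst ?Ls)) * \<bar>tr D (prod_list (map snd ?Ls))\<bar> \<le> ?T"
 proof (rule tr_letters_le[OF D P(1) _ \<tau>])
  fix b L assume "(b, L) \<in> set ?Ls"
  then show "if b then adm D L \<and> tp L = L \<and> tr D (L ^ P) \<le> ?T else small D L"
   using B X nn by (auto simp: set_replicate_conv_if split: if_splits)
 qed (use P nn in auto)
 then have "\<tau> ^ (P - (j1 + j2)) * \<bar>tr D (B1 * X ^ j1 * (B2 * X ^ j2))\<bar> \<le> ?T"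
  by (simp add: prod_list_replicate mult.assoc filter_replicate add.assoc)
 then show ?thesis using \<tau> by (simp add: pos_le_divide_eq mult.commute)
qed

lemma word1:
 assumes D: "finite D" and X: "adm D X" "tp X = X" and B: "small D B"
  and P: "P = 2 ^ Suc s" "j + 1 \<le> P" and \<tau>: "0 < \<tau>"
  and T: "tr D (X ^ P) \<le> \<tau> ^ P * real (card D)"
 shows "\<bar>tr D (B * X ^ j)\<bar> \<le> \<tau> ^ j * real (card D)"
proof -
 let ?Ls = "(False, B) # replicate j (True, X)"
 have "\<tau> ^ (P - length (filter fst ?Ls)) * \<bar>tr D (prod_list (map snd ?Ls))\<bar> \<le> \<tau> ^ P * real (card D)"
 proof (rule tr_letters_le[OF D P(1) _ \<tau>])
  fix b L assume "(b, L) \<in> set ?Ls"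
  then show "if b then adm D L \<and> tp L = L \<and> tr D (L ^ P) \<le> \<tau> ^ P * real (card D) else small D L"
   using B X T by (auto simp: set_replicate_conv_if split: if_splits)
 qed (use P in auto)
 then have "\<tau> ^ (P - j) * \<bar>tr D (B * X ^ j)\<bar> \<le> \<tau> ^ (P - j) * (\<tau> ^ j * real (card D))"
  using P by (simp add: prod_list_replicate filter_replicate power_add[symmetric] mult.assoc[symmetric])
 then show ?thesis using \<tau> by (simp add: mult_le_cancel_left_pos)
qed

lemma abs_sum4_le:
 fixes a b c d S T :: real
 shows "\<bar>a\<bar> \<le> S ==> \<bar>b\<bar> \<le> S ==> \<bar>c\<bar> \<le> T ==> \<bar>d\<bar> \<le> T ==> \<bar>a + b + c + d\<bar> \<le> 2 * S + 2 * T"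
 by linarith

lemma double_sum_const:
 "(\<Sum>j<p. \<Sum>j'<q. 2 * \<nu> * (4 * (A * T))) = 8 * \<nu> * A * real p * real q * (T :: real)"
 by simp

lemma two_traces:
 assumes D: "finite D" and X: "adm D X" "tp X = X" and B: "small D B1" "small D B2"
  and P: "P = 2 ^ Suc s" "i + j + 2 = P" and \<tau>: "0 < \<tau>"
 shows "\<bar>tr D (B1 * X ^ i) * tr D (B2 * X ^ j)\<bar>
  \<le> real (card D) * ((tr D (X ^ P) + \<tau> ^ P * real (card D)) / \<tau>\<^sup>2)"
proof -
 define x where "x = tr D (X ^ P)"
 define M where "M = real (card D)"
 have x0: "0 \<le> x" unfolding x_def P(1) by (rule tr_even_nonneg[OF D X])
 have bound: "\<bar>tr D (B1 * X ^ i) * tr D (B2 * X ^ j)\<bar> \<le> M * ((\<sigma> ^ P * M) / \<sigma>\<^sup>2)"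
  if \<sigma>: "0 < \<sigma>" "x \<le> \<sigma> ^ P * M" for \<sigma>
 proof -
  have "\<bar>tr D (B1 * X ^ i) * tr D (B2 * X ^ j)\<bar> \<le> (\<sigma> ^ i * M) * (\<sigma> ^ j * M)"
   unfolding abs_mult M_def using P \<sigma> D X B
   by (intro mult_mono word1[OF D X _ P(1) _ \<sigma>(1)]) (auto simp: x_def M_def)
  also have "\<dots> = M * ((\<sigma> ^ P * M) / \<sigma>\<^sup>2)"
   using \<sigma>(1) unfolding P(2)[symmetric] by (simp add: power_add power2_eq_square field_simps)
  finally show ?thesis .
 qed
 show ?thesis
 proof (cases "x \<le> \<tau> ^ P * M")
  case True
  have "M * ((\<tau> ^ P * M) / \<tau>\<^sup>2) \<le> M * ((x + \<tau> ^ P * M) / \<tau>\<^sup>2)"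
   using x0 \<tau> by (intro mult_left_mono divide_right_mono) (auto simp: M_def)
  then show ?thesis using bound[OF \<tau> True] unfolding x_def M_def by linarith
 next
  case False
  have M: "0 < M"
  proof (rule ccontr)
   assume "\<not> 0 < M"
   then have "D = {}" using D by (simp add: M_def)
   then show False using False by (simp add: x_def M_def tr_def)
  qed
  have P0: "0 < P" using P by simp
  define \<sigma> where "\<sigma> = root P (x / M)"
  have \<sigma>P: "\<sigma> ^ P * M = x" and \<sigma>0: "0 \<le> \<sigma>"
   using P0 x0 M by (auto simp: \<sigma>_def)
  have "\<tau> ^ P * M < \<sigma> ^ P * M" using False \<sigma>P by simp
  then have "\<tau> ^ P < \<sigma> ^ P" using M by simp
  then have \<tau>\<sigma>: "\<tau> < \<sigma>" using \<sigma>0 by (rule power_less_imp_less_base)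
  have "M * ((\<sigma> ^ P * M) / \<sigma>\<^sup>2) \<le> M * ((x + \<tau> ^ P * M) / \<tau>\<^sup>2)"
   unfolding \<sigma>P using M \<tau> \<tau>\<sigma> x0
   by (intro mult_left_mono frac_le power_mono) auto
  then show ?thesis using bound[of \<sigma>] \<sigma>P \<tau> \<tau>\<sigma> unfolding x_def M_def by linarith
 qed
qed

context coeffs
begin

definition W :: "(nat => nat => real) => nat \<times> nat \<times> nat => real" where
 "W w e = (case e of (i, r, c) => w r c)"

lemma W_simp [simp]: "W w (i, r, c) = w r c"
 by (simp add: W_def)

abbreviation XW :: "nat set => (nat => nat => real) => (nat \<times> nat \<times> nat => real) => (nat \<times> nat) lmat" where
 "XW J w x \<equiv> XX J (%e. W w e * x e)"

definition Phi :: "nat set => (nat => nat => real) => nat => real" where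
 "Phi J w P = (\<integral>x. tr (DD J) (XW J w x ^ P) \<partial>gm (EE J))"

text \<open>The partial derivative of \<open>tr (DD J) (Q * XX J z ^ p)\<close>.\<close>

definition dtr :: "nat set => (nat \<times> nat) lmat => nat => nat \<times> nat \<times> nat => (nat \<times> nat \<times> nat => real) => real" where
 "dtr J Q p e z = (if e \<in> EE J then \<Sum>j<p. tr (DD J) (Del J e * (XX J z ^ (p - 1 - j) * Q * XX J z ^ j)) else 0)"

context
 fixes J :: "nat set" assumes J: "finite J"
begin

lemma gpM_XX: "gpM (DD J) (EE J) (XX J) (%e z. if e \<in> EE J then Del J e else 0)"
 unfolding gpM_def
proof (intro conjI ballI allI)
 fix i j
 have "gp (EE J) (%z. \<Sum>e\<in>EE J. ent (Del J e) i j * z e) (%e z. if e \<in> EE J then ent (Del J e) i j else 0)"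
  using J by (intro gp_linear) simp
 then show "gp (EE J) (%z. ent (XX J z) i j) (%e z. ent (if e \<in> EE J then Del J e else 0) i j)"
  by (rule gp_cong) (auto simp: XX_def ent_sum mult.commute)
qed (use J in auto)

lemma gp_tr_power:
 assumes Q: "adm (DD J) Q"
 shows "gp (EE J) (%z. tr (DD J) (Q * XX J z ^ p)) (dtr J Q p)"
proof (rule gp_cong[OF gpM_tr[OF gpM_mult[OF finite_DD[OF J] gpM_const[OF Q] gpM_power[OF finite_DD[OF J] gpM_XX]]]])
 fix e z
 show "dtr J Q p e z = tr (DD J) (0 * XX J z ^ p + Q * (\<Sum>j<p. XX J z ^ j *
   (if e \<in> EE J then Del J e else 0) * XX J z ^ (p - 1 - j)))"
 proof (cases "e \<in> EE J")
  case True
  have "tr (DD J) (Del J e * (XX J z ^ (p - 1 - j) * Q * XX J z ^ j))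
    = tr (DD J) (Q * (XX J z ^ j * Del J e * XX J z ^ (p - 1 - j)))" for j
  proof -
   have "tr (DD J) ((Del J e * XX J z ^ (p - 1 - j)) * (Q * XX J z ^ j))
     = tr (DD J) ((Q * XX J z ^ j) * (Del J e * XX J z ^ (p - 1 - j)))"
    using J Q by (intro tr_commute) auto
   then show ?thesis by (simp only: mult.assoc)
  qed
  then show ?thesis using True by (simp add: dtr_def tr_sum sum_distrib_left)
 qed (simp add: dtr_def)
qed simp

lemma gp_trace_power: "gp (EE J) (%z. tr (DD J) (XX J z ^ p)) (dtr J 1 p)"
 using gp_tr_power[of 1 p] by simp

lemma dtr_one: "dtr J 1 p e z = (if e \<in> EE J then real p * tr (DD J) (Del J e * XX J z ^ (p - 1)) else 0)"
proof (cases "e \<in> EE J")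
 case True
 have "(\<Sum>j<p. tr (DD J) (Del J e * (XX J z ^ (p - 1 - j) * 1 * XX J z ^ j)))
  = (\<Sum>j<p. tr (DD J) (Del J e * XX J z ^ (p - 1)))"
  by (intro sum.cong refl) (simp add: power_add[symmetric])
 then show ?thesis using True by (simp add: dtr_def)
qed (simp add: dtr_def)

lemma XW_integrable:
 assumes Q: "adm (DD J) Q"
 shows "integrable (gm (EE J)) (%x. tr (DD J) (Q * XW J w x ^ p))"
 using gp_integrable[OF gp_scale[OF gp_tr_power[OF Q]]] J by simp

lemma XW_integrable': "integrable (gm (EE J)) (%x. tr (DD J) (XW J w x ^ p))"
 using XW_integrable[of 1] by simp

lemma Phi_nonneg: "P = 2 ^ Suc s ==> 0 \<le> Phi J w P"
 unfolding Phi_def using tr_even_nonneg[OF finite_DD[OF J] adm_XX[OF J] tp_XX[OF J]]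
 by (intro Bochner_Integration.integral_nonneg) simp

text \<open>Weights whose squares are a sum of two products.\<close>

text \<open>Variances that are sums of two products \<open>\<alpha> r * \<beta> c\<close>; this covers
 block-constant matrices along the whole rotation in the doubling step, and reduces sums over
 entries to the product weights of the sums over \<open>Del\<close>.\<close>

definition wts :: "(nat => nat => real) => real => bool" where
 "wts w \<nu> \<longleftrightarrow> 0 \<le> \<nu> \<and> (\<exists>\<alpha> \<beta> \<gamma> \<delta>. (\<forall>r\<in>J. \<bar>\<alpha> r\<bar> \<le> 1 \<and> \<bar>\<beta> r\<bar> \<le> 1 \<and> \<bar>\<gamma> r\<bar> \<le> 1 \<and> \<bar>\<delta> r\<bar> \<le> 1) \<and>
   (\<forall>r\<in>J. \<forall>c\<in>J. (w r c)\<^sup>2 = \<nu> * (\<alpha> r * \<beta> c + \<gamma> r * \<delta> c)))"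

lemma wts_sum_bound:
 assumes w: "wts w \<nu>"
  and S: "!!\<alpha> \<beta>. (\<forall>r\<in>J. \<bar>\<alpha> r\<bar> \<le> 1) ==> (\<forall>r\<in>J. \<bar>\<beta> r\<bar> \<le> 1) ==>
   \<bar>\<Sum>(i, r, c)\<in>EE J. \<alpha> r * \<beta> c * f (i, r, c)\<bar> \<le> B"
 shows "\<bar>\<Sum>e\<in>EE J. (W w e)\<^sup>2 * f e\<bar> \<le> 2 * \<nu> * B"
proof -
 obtain \<alpha> \<beta> \<gamma> \<delta> where ab: "\<forall>r\<in>J. \<bar>\<alpha> r\<bar> \<le> 1 \<and> \<bar>\<beta> r\<bar> \<le> 1 \<and> \<bar>\<gamma> r\<bar> \<le> 1 \<and> \<bar>\<delta> r\<bar> \<le> (1 :: real)"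
  and sq: "\<forall>r\<in>J. \<forall>c\<in>J. (w r c)\<^sup>2 = \<nu> * (\<alpha> r * \<beta> c + \<gamma> r * \<delta> c)" and \<nu>: "0 \<le> \<nu>"
  using w unfolding wts_def by blast
 have "(\<Sum>e\<in>EE J. (W w e)\<^sup>2 * f e) = (\<Sum>(i, r, c)\<in>EE J. \<nu> * (\<alpha> r * \<beta> c * f (i, r, c)) + \<nu> * (\<gamma> r * \<delta> c * f (i, r, c)))"
  using sq by (intro sum.cong refl) (auto simp: algebra_simps EE_def)
 also have "\<dots> = \<nu> * (\<Sum>(i, r, c)\<in>EE J. \<alpha> r * \<beta> c * f (i, r, c)) + \<nu> * (\<Sum>(i, r, c)\<in>EE J. \<gamma> r * \<delta> c * f (i, r, c))"
  by (simp add: case_prod_unfold sum.distrib sum_distrib_left)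
 finally have eq: "(\<Sum>e\<in>EE J. (W w e)\<^sup>2 * f e)
  = \<nu> * (\<Sum>(i, r, c)\<in>EE J. \<alpha> r * \<beta> c * f (i, r, c)) + \<nu> * (\<Sum>(i, r, c)\<in>EE J. \<gamma> r * \<delta> c * f (i, r, c))" .
 have "\<bar>\<Sum>e\<in>EE J. (W w e)\<^sup>2 * f e\<bar>
  \<le> \<bar>\<nu> * (\<Sum>(i, r, c)\<in>EE J. \<alpha> r * \<beta> c * f (i, r, c))\<bar> + \<bar>\<nu> * (\<Sum>(i, r, c)\<in>EE J. \<gamma> r * \<delta> c * f (i, r, c))\<bar>"
  unfolding eq by (rule abs_triangle_ineq)
 also have "\<dots> = \<nu> * \<bar>\<Sum>(i, r, c)\<in>EE J. \<alpha> r * \<beta> c * f (i, r, c)\<bar> + \<nu> * \<bar>\<Sum>(i, r, c)\<in>EE J. \<gamma> r * \<delta> c * f (i, r, c)\<bar>"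
  unfolding abs_mult abs_of_nonneg[OF \<nu>] ..
 also have "\<dots> \<le> \<nu> * B + \<nu> * B"
  using \<nu> ab by (intro add_mono mult_left_mono S) auto
 finally show ?thesis by linarith
qed

lemma covariance_pointwise:
 assumes w: "wts w \<nu>" and Q: "small (DD J) Q" "small (DD J) Q'"
  and P: "P = 2 ^ Suc s" "p + q + 2 \<le> P" and pq: "0 < p" "0 < q" and \<tau>: "0 < \<tau>"
 shows "\<bar>\<Sum>e\<in>EE J. (W w e)\<^sup>2 * (dtr J Q p e z * dtr J Q' q e y)\<bar>
  \<le> 8 * \<nu> * AA * real p * real q *
   ((tr (DD J) (XX J z ^ P) + tr (DD J) (XX J y ^ P) + \<tau> ^ P * real (card (DD J))) / \<tau> ^ (P - (p + q - 2)))"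
  (is "_ \<le> 8 * \<nu> * AA * real p * real q * ?T")
proof -
 let ?D = "DD J" and ?X = "XX J z" and ?Y = "XX J y"
 note fin = finite_DD[OF J]
 define M where "M j = ?X ^ (p - 1 - j) * Q * ?X ^ j" for j
 define N where "N j = ?Y ^ (q - 1 - j) * Q' * ?Y ^ j" for j
 have admQ: "adm ?D Q" "adm ?D Q'" using Q by (auto simp: small_def)
 have admMN: "adm ?D (M j)" "adm ?D (N j)" for j
  using admQ J by (auto simp: M_def N_def)
 have word: "\<bar>tr ?D (BB J mu' mu \<beta> * M' * (BB J ka ka' \<alpha> * N'))\<bar> \<le> ?T"
  if "M' = M j \<or> M' = tp (M j)" "N' = N j' \<or> N' = tp (N j')" "j < p" "j' < q"
   "ka < K" "mu < K" "ka' < K" "mu' < K" "\<forall>r\<in>J. \<bar>\<alpha> r\<bar> \<le> 1" "\<forall>r\<in>J. \<bar>\<beta> r\<bar> \<le> 1"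
  for M' N' j j' \<alpha> \<beta> ka mu ka' mu'
 proof -
  obtain j1 j2 R where M': "M' = ?X ^ j1 * R * ?X ^ j2" "small ?D R" "j1 + j2 = p - 1"
  proof (cases "M' = M j")
   case True
   then show ?thesis using that(1)[of "p - 1 - j" Q j] Q \<open>j < p\<close> by (auto simp: M_def)
  next
   case False
   then have "M' = ?X ^ j * tp Q * ?X ^ (p - 1 - j)"
    using \<open>M' = M j \<or> M' = tp (M j)\<close> J
    by (simp add: M_def tp_mult tp_power mult.assoc)
   then show ?thesis using that(1) small_tp[OF fin Q(1)] \<open>j < p\<close> by auto
  qed
  obtain j3 j4 S where N': "N' = ?Y ^ j3 * S * ?Y ^ j4" "small ?D S" "j3 + j4 = q - 1"
  proof (cases "N' = N j'")
   case True
   then show ?thesis using that(1)[of "q - 1 - j'" Q' j'] Q \<open>j' < q\<close> by (auto simp: N_def)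
  next
   case False
   then have "N' = ?Y ^ j' * tp Q' * ?Y ^ (q - 1 - j')"
    using \<open>N' = N j' \<or> N' = tp (N j')\<close> J
    by (simp add: N_def tp_mult tp_power mult.assoc)
   then show ?thesis using that(1) small_tp[OF fin Q(2)] \<open>j' < q\<close> by auto
  qed
  have "j1 + j2 + j3 + j4 = p + q - 2" using M' N' pq by auto
  then show ?thesis
   unfolding M'(1) N'(1)
   using word4[OF fin _ _ _ _ small_BB[OF J, of mu' mu \<beta>] M'(2) small_BB[OF J, of ka ka' \<alpha>] N'(2) P(1) _ \<tau>,
     of ?X ?Y j1 j2 j3 j4] that P pq J by auto
 qed
 have key: "\<bar>\<Sum>e\<in>EE J. (W w e)\<^sup>2 * (tr ?D (Del J e * M j) * tr ?D (Del J e * N j'))\<bar> \<le> 2 * \<nu> * (4 * (AA * ?T))"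
  if j: "j < p" "j' < q" for j j'
 proof (rule wts_sum_bound[OF w])
  fix \<alpha> \<beta> :: "nat => real" assume ab: "\<forall>r\<in>J. \<bar>\<alpha> r\<bar> \<le> 1" "\<forall>r\<in>J. \<bar>\<beta> r\<bar> \<le> 1"
  have c: "\<bar>csum (%ka mu ka' mu'. tr ?D (BB J mu' mu \<beta> * M' * (BB J ka ka' \<alpha> * N')))\<bar> \<le> AA * ?T"
   if "M' = M j \<or> M' = tp (M j)" "N' = N j' \<or> N' = tp (N j')" for M' N'
   using that j ab J by (intro csum_bound[OF J] word) auto
  show "\<bar>\<Sum>(i, r, c)\<in>EE J. \<alpha> r * \<beta> c * (tr ?D (Del J (i, r, c) * M j) * tr ?D (Del J (i, r, c) * N j'))\<bar>
   \<le> 4 * (AA * ?T)"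
   unfolding sum_tr_Del_tr_Del[OF J admMN]
   by (rule order_trans[OF abs_sum4_le[OF c c c c]]) auto
 qed
 have "(\<Sum>e\<in>EE J. (W w e)\<^sup>2 * (dtr J Q p e z * dtr J Q' q e y))
  = (\<Sum>e\<in>EE J. \<Sum>j<p. \<Sum>j'<q. (W w e)\<^sup>2 * (tr ?D (Del J e * M j) * tr ?D (Del J e * N j')))"
  unfolding M_def N_def dtr_def by (intro sum.cong refl) (simp only: if_P sum_product, simp only: sum_distrib_left)
 also have "\<dots> = (\<Sum>j<p. \<Sum>e\<in>EE J. \<Sum>j'<q. (W w e)\<^sup>2 * (tr ?D (Del J e * M j) * tr ?D (Del J e * N j')))"
  by (rule sum.swap)
 also have "\<dots> = (\<Sum>j<p. \<Sum>j'<q. \<Sum>e\<in>EE J. (W w e)\<^sup>2 * (tr ?D (Del J e * M j) * tr ?D (Del J e * N j')))"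
  by (intro sum.cong refl, rule sum.swap)
 finally have eq: "(\<Sum>e\<in>EE J. (W w e)\<^sup>2 * (dtr J Q p e z * dtr J Q' q e y))
  = (\<Sum>j<p. \<Sum>j'<q. \<Sum>e\<in>EE J. (W w e)\<^sup>2 * (tr ?D (Del J e * M j) * tr ?D (Del J e * N j')))" .
 have "\<bar>\<Sum>e\<in>EE J. (W w e)\<^sup>2 * (dtr J Q p e z * dtr J Q' q e y)\<bar> \<le> (\<Sum>j<p. \<Sum>j'<q. 2 * \<nu> * (4 * (AA * ?T)))"
  unfolding eq
  by (rule order_trans[OF sum_abs], rule sum_mono, rule order_trans[OF sum_abs], rule sum_mono, rule key)
   (simp_all only: lessThan_iff)
 also have "\<dots> = 8 * \<nu> * AA * real p * real q * ?T" by (rule double_sum_const)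
 finally show ?thesis .
qed

text \<open>The covariance is an integral over the rotation of an independent copy into the original, and the
 integrand merges two traces into single traces of words in both copies. No normalisation by the
 size remains, so covariances of traces are bounded, up to the factor \<open>\<nu> * card (DD
 J)\<close>.\<close>

theorem covariance_bound:
 assumes w: "wts w \<nu>" and Q: "small (DD J) Q" "small (DD J) Q'"
  and P: "P = 2 ^ Suc s" "p + q + 2 \<le> P" and \<tau>: "0 < \<tau>"
 shows "\<bar>(\<integral>x. tr (DD J) (Q * XW J w x ^ p) * tr (DD J) (Q' * XW J w x ^ q) \<partial>gm (EE J))
   - (\<integral>x. tr (DD J) (Q * XW J w x ^ p) \<partial>gm (EE J)) * (\<integral>x. tr (DD J) (Q' * XW J w x ^ q) \<partial>gm (EE J))\<bar>
  \<le> 16 * \<nu> * AA * real p * real q * ((2 * Phi J w P + \<tau> ^ P * real (card (DD J))) / \<tau> ^ (P - (p + q - 2)))"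
proof (cases "0 < p \<and> 0 < q")
 case False
 interpret prob_space "gm (EE J)" by (rule prob_space_gm)
 from False show ?thesis by (auto simp: prob_space)
next
 case pq: True
 let ?D = "DD J" and ?G = "gm (UNIV \<times> EE J) :: (bool \<times> nat \<times> nat \<times> nat => real) measure"
 have fin: "finite (EE J)" using J by simp
 have admQ: "adm ?D Q" "adm ?D Q'" using Q by (auto simp: small_def)
 let ?z = "%x e. W w e * x (False, e)" and ?y = "%th x e. W w e * rot th x e"
 have \<nu>: "0 \<le> \<nu>" using w by (simp add: wts_def)
 let ?c = "8 * \<nu> * AA * real p * real q"
 let ?m = "\<tau> ^ P * real (card ?D)"
 let ?d = "\<tau> ^ (P - (p + q - 2))"
 note F = gp_scale[OF gp_tr_power[OF admQ(1), of p], of "W w"]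
 note G = gp_scale[OF gp_tr_power[OF admQ(2), of q], of "W w"]
 note X = gp_scale[OF gp_trace_power[of P], of "W w"]
 obtain DF where DF: "!!e. gp (EE J) (%x. W w e * dtr J Q p e (%e. W w e * x e)) (DF e)"
  using gp_deriv[OF F] by blast
 obtain DG where DG: "!!e. gp (EE J) (%x. W w e * dtr J Q' q e (%e. W w e * x e)) (DG e)"
  using gp_deriv[OF G] by blast
 interpret prob_space ?G by (rule prob_space_gm)
 have B: "\<bar>\<Sum>e\<in>EE J. \<integral>x. (W w e * dtr J Q p e (?z x)) * (W w e * dtr J Q' q e (?y th x)) \<partial>?G\<bar>
   \<le> ?c * ((2 * Phi J w P + ?m) / ?d)" for th
 proof -
  have int: "integrable ?G (%x. (W w e * dtr J Q p e (?z x)) * (W w e * dtr J Q' q e (?y th x)))" for e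
  proof -
   obtain E1 where E1: "gp (UNIV \<times> EE J) (%x. W w e * dtr J Q p e (?z x)) E1"
    using gp_slice[OF DF[of e] fin, where b = False] by blast
   obtain E2 where E2: "gp (UNIV \<times> EE J) (%x. W w e * dtr J Q' q e (?y th x)) E2"
    using gp_rot[OF DG[of e] fin, where th = th] by blast
   show ?thesis by (rule gp_integrable[OF gp_mult[OF E1 E2]]) (use fin in simp)
  qed
  have i1: "integrable ?G (%x. tr ?D (XX J (?z x) ^ P))" "(\<integral>x. tr ?D (XX J (?z x) ^ P) \<partial>?G) = Phi J w P"
   unfolding Phi_def using fin
   by (auto intro!: gp_reindex[OF X fin, of "UNIV \<times> EE J" "Pair False"] simp: inj_on_def)
  have i2: "integrable ?G (%x. tr ?D (XX J (?y th x) ^ P))" "(\<integral>x. tr ?D (XX J (?y th x) ^ P) \<partial>?G) = Phi J w P"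
   unfolding Phi_def by (rule rot_integral[OF X fin])+
  have eq: "(\<Sum>e\<in>EE J. \<integral>x. (W w e * dtr J Q p e (?z x)) * (W w e * dtr J Q' q e (?y th x)) \<partial>?G)
   = (\<integral>x. (\<Sum>e\<in>EE J. (W w e)\<^sup>2 * (dtr J Q p e (?z x) * dtr J Q' q e (?y th x))) \<partial>?G)"
   by (subst Bochner_Integration.integral_sum[symmetric, OF int])
    (simp add: power2_eq_square mult_ac)
  have "\<bar>\<integral>x. (\<Sum>e\<in>EE J. (W w e)\<^sup>2 * (dtr J Q p e (?z x) * dtr J Q' q e (?y th x))) \<partial>?G\<bar>
   \<le> (\<integral>x. ?c * ((tr ?D (XX J (?z x) ^ P) + tr ?D (XX J (?y th x) ^ P) + ?m) / ?d) \<partial>?G)"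
  proof (rule order_trans[OF integral_abs_bound integral_mono])
   show "integrable ?G (%x. \<bar>\<Sum>e\<in>EE J. (W w e)\<^sup>2 * (dtr J Q p e (?z x) * dtr J Q' q e (?y th x))\<bar>)"
   proof (intro integrable_abs Bochner_Integration.integrable_sum)
    show "integrable ?G (%x. (W w e)\<^sup>2 * (dtr J Q p e (?z x) * dtr J Q' q e (?y th x)))" for e
     using int[of e] by (simp add: power2_eq_square mult_ac)
   qed
   show "integrable ?G (%x. ?c * ((tr ?D (XX J (?z x) ^ P) + tr ?D (XX J (?y th x) ^ P) + ?m) / ?d))"
    using i1(1) i2(1) by (intro integrable_mult_right integrable_divide Bochner_Integration.integrable_add) auto
   show "\<bar>\<Sum>e\<in>EE J. (W w e)\<^sup>2 * (dtr J Q p e (?z x) * dtr J Q' q e (?y th x))\<bar>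
    \<le> ?c * ((tr ?D (XX J (?z x) ^ P) + tr ?D (XX J (?y th x) ^ P) + ?m) / ?d)" for x
    using covariance_pointwise[OF w Q P _ _ \<tau>] pq by blast
  qed
  also have "\<dots> = ?c * ((2 * Phi J w P + ?m) / ?d)"
   using i1 i2 by (simp add: prob_space)
  finally show ?thesis by (simp only: eq)
 qed
 have "\<bar>(\<integral>x. tr (DD J) (Q * XW J w x ^ p) * tr (DD J) (Q' * XW J w x ^ q) \<partial>gm (EE J))
   - (\<integral>x. tr (DD J) (Q * XW J w x ^ p) \<partial>gm (EE J)) * (\<integral>x. tr (DD J) (Q' * XW J w x ^ q) \<partial>gm (EE J))\<bar>
  \<le> 2 * (?c * ((2 * Phi J w P + ?m) / ?d))"
  by (rule gaussian_covariance_bound[OF F G fin B])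
 moreover have "2 * (?c * T) = 16 * \<nu> * AA * real p * real q * T" for T :: real by simp
 ultimately show ?thesis by (simp only:)
qed

lemma Del_Del_pointwise:
 assumes w: "wts w \<nu>" and P: "P = 2 ^ Suc s" "i + j + 2 = P" and \<tau>: "0 < \<tau>"
 shows "\<bar>\<Sum>e\<in>EE J. (W w e)\<^sup>2 * tr (DD J) (Del J e * XX J z ^ i * (Del J e * XX J z ^ j))\<bar>
  \<le> 8 * \<nu> * AA * (real (card (DD J)) + 1) * ((tr (DD J) (XX J z ^ P) + \<tau> ^ P * real (card (DD J))) / \<tau>\<^sup>2)"
  (is "_ \<le> 8 * \<nu> * AA * (?M + 1) * ?T")
proof -
 let ?D = "DD J" and ?X = "XX J z"
 note fin = finite_DD[OF J]
 have P2: "P - (i + j) = 2" "P - (j + i) = 2" "j + i + 2 = P" "i + j + 2 \<le> P" "j + i + 2 \<le> P" using P by auto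
 have T0: "0 \<le> ?T"
  using tr_even_nonneg[OF fin, of ?X s] J \<tau> P by auto
 have "\<bar>\<Sum>e\<in>EE J. (W w e)\<^sup>2 * tr ?D (Del J e * ?X ^ i * (Del J e * ?X ^ j))\<bar>
  \<le> 2 * \<nu> * (2 * (AA * (?M * ?T)) + 2 * (AA * ?T))"
 proof (rule wts_sum_bound[OF w])
  fix \<alpha> \<beta> :: "nat => real" assume ab: "\<forall>r\<in>J. \<bar>\<alpha> r\<bar> \<le> 1" "\<forall>r\<in>J. \<bar>\<beta> r\<bar> \<le> 1"
  have c1: "\<bar>csum (%ka mu ka' mu'. tr ?D (BB J mu' mu \<beta> * ?X ^ i') * tr ?D (BB J ka ka' \<alpha> * ?X ^ j'))\<bar> \<le> AA * (?M * ?T)"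
   if "i' + j' + 2 = P" for i' j'
   using ab J that by (intro csum_bound[OF J] two_traces[OF fin _ _ _ _ P(1) _ \<tau>] small_BB) auto
  have c2: "\<bar>csum (%ka mu ka' mu'. tr ?D (BB J mu' mu \<beta> * ?X ^ i' * (BB J ka' ka \<alpha> * ?X ^ j')))\<bar> \<le> AA * ?T"
   if "i' + j' + 2 = P" for i' j'
  proof (rule csum_bound[OF J])
   fix ka mu ka' mu' assume "ka < K" "mu < K" "ka' < K" "mu' < K"
   moreover have "P - (i' + j') = 2" using that by simp
   ultimately show "\<bar>tr ?D (BB J mu' mu \<beta> * ?X ^ i' * (BB J ka' ka \<alpha> * ?X ^ j'))\<bar> \<le> ?T"
    using word2[OF fin _ _ small_BB[OF J, of mu' mu \<beta>] small_BB[OF J, of ka' ka \<alpha>] P(1) _ \<tau>, of ?X i' j']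
     ab J that by auto
  qed
  have ad: "adm ?D (?X ^ i)" "adm ?D (?X ^ j)" using J by auto
  show "\<bar>\<Sum>(i', r, c)\<in>EE J. \<alpha> r * \<beta> c * tr ?D (Del J (i', r, c) * ?X ^ i * (Del J (i', r, c) * ?X ^ j))\<bar>
   \<le> 2 * (AA * (?M * ?T)) + 2 * (AA * ?T)"
   unfolding sum_Del_Del[OF J ad] tp_power tp_XX[OF J]
   by (rule abs_sum4_le[OF c1[OF P(2)] c1[OF P2(3)] c2[OF P(2)] c2[OF P2(3)]])
 qed
 also have "\<dots> = 4 * \<nu> * AA * (?M + 1) * ?T" by (simp add: algebra_simps)
 also have "\<dots> \<le> 8 * \<nu> * AA * (?M + 1) * ?T"
  using w AA_nonneg[OF J] T0 by (intro mult_right_mono) (auto simp: wts_def)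
 finally show ?thesis .
qed

lemma gp_Del_power:
 "gp (EE J) (%z. tr (DD J) (Del J e * XX J z ^ p)) (dtr J (Del J e) p)"
 using J by (intro gp_tr_power) simp

text \<open>Integration by parts in one letter \<open>X\<close> of the word.\<close>

lemma trace_power_ibp:
 assumes Q: "adm (DD J) Q"
 shows "(\<integral>x. tr (DD J) (Q * XW J w x ^ Suc p) \<partial>gm (EE J))
  = (\<integral>x. (\<Sum>j<p. \<Sum>e\<in>EE J. (W w e)\<^sup>2 * tr (DD J) (Del J e * XW J w x ^ (p - 1 - j) * (Del J e * (XW J w x ^ j * Q)))) \<partial>gm (EE J))"
proof -
 let ?D = "DD J" and ?z = "%x e. W w e * x e"
 have fin: "finite (EE J)" using J by simp
 have QD: "adm ?D (Q * Del J e)" for e using Q J by auto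
 note G = gp_tr_power[OF QD]
 have D: "dtr J (Q * Del J e) p e z = (\<Sum>j<p. tr ?D (Del J e * XX J z ^ (p - 1 - j) * (Q * Del J e * XX J z ^ j)))" if "e \<in> EE J" for e z
  using that by (simp add: dtr_def mult.assoc)
 obtain E where E: "!!e e'. gp (EE J) (dtr J (Q * Del J e) p e') (E e e')"
 proof -
  have "\<forall>e. \<exists>E. \<forall>e'. gp (EE J) (dtr J (Q * Del J e) p e') (E e')" using gp_deriv[OF G] by blast
  then show ?thesis using that by metis
 qed
 have intD: "integrable (gm (EE J)) (%x. dtr J (Q * Del J e) p e (?z x))" for e
  using gp_integrable[OF gp_scale[OF E] fin] .
 have int: "integrable (gm (EE J)) (%x. (W w e * x e) * tr ?D (Q * Del J e * XW J w x ^ p))" if "e \<in> EE J" for e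
  using gp_integrable[OF gp_smult[OF gp_var_mult[OF that gp_scale[OF G[of e p], of "W w"]], of "W w e"] fin]
  by (simp add: mult_ac)
 have "tr ?D (Q * XW J w x ^ Suc p) = (\<Sum>e\<in>EE J. (W w e * x e) * tr ?D (Q * Del J e * XW J w x ^ p))" for x
 proof -
  have "Q * XW J w x ^ Suc p = Q * XW J w x * XW J w x ^ p" by (simp add: mult.assoc)
  also have "\<dots> = (\<Sum>e\<in>EE J. (W w e * x e) *\<^sub>R (Q * Del J e * XW J w x ^ p))"
   by (subst XX_def) (simp add: sum_distrib_left sum_distrib_right)
  finally show ?thesis by (simp add: tr_sum)
 qed
 then have "(\<integral>x. tr ?D (Q * XW J w x ^ Suc p) \<partial>gm (EE J))
  = (\<Sum>e\<in>EE J. \<integral>x. (W w e * x e) * tr ?D (Q * Del J e * XW J w x ^ p) \<partial>gm (EE J))"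
  using int by (simp only:) (rule Bochner_Integration.integral_sum)
 also have "\<dots> = (\<Sum>e\<in>EE J. (W w e)\<^sup>2 * (\<integral>x. dtr J (Q * Del J e) p e (?z x) \<partial>gm (EE J)))"
  by (intro sum.cong refl scaled_integration_by_parts[OF G fin])
 also have "\<dots> = (\<integral>x. (\<Sum>e\<in>EE J. (W w e)\<^sup>2 * dtr J (Q * Del J e) p e (?z x)) \<partial>gm (EE J))"
  using intD by simp
 also have "(%x. \<Sum>e\<in>EE J. (W w e)\<^sup>2 * dtr J (Q * Del J e) p e (?z x))
  = (%x. \<Sum>j<p. \<Sum>e\<in>EE J. (W w e)\<^sup>2 * tr ?D (Del J e * XW J w x ^ (p - 1 - j) * (Q * Del J e * XW J w x ^ j)))"
  by (subst sum.swap, intro ext sum.cong refl) (simp add: D sum_distrib_left)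
 finally have "(\<integral>x. tr (DD J) (Q * XW J w x ^ Suc p) \<partial>gm (EE J)) = (\<integral>x. (\<Sum>j<p. \<Sum>e\<in>EE J. (W w e)\<^sup>2 * tr ?D (Del J e * XW J w x ^ (p - 1 - j) * (Q * Del J e * XW J w x ^ j))) \<partial>gm (EE J))" .
 also have "(%x. \<Sum>j<p. \<Sum>e\<in>EE J. (W w e)\<^sup>2 * tr ?D (Del J e * XW J w x ^ (p - 1 - j) * (Q * Del J e * XW J w x ^ j)))
  = (%x. \<Sum>j<p. \<Sum>e\<in>EE J. (W w e)\<^sup>2 * tr ?D (Del J e * XW J w x ^ (p - 1 - (p - 1 - j)) * (Del J e * (XW J w x ^ (p - 1 - j) * Q))))"
 proof (intro ext sum.cong refl arg_cong2[where f = "(*)"])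
  fix x j e assume "j \<in> {..<p}"
  then have j: "p - 1 - (p - 1 - j) = j" by auto
  have "tr ?D ((Del J e * XW J w x ^ (p - 1 - j) * Q) * (Del J e * XW J w x ^ j))
   = tr ?D ((Del J e * XW J w x ^ j) * (Del J e * XW J w x ^ (p - 1 - j) * Q))"
   using J Q by (intro tr_commute) auto
  then show "tr ?D (Del J e * XW J w x ^ (p - 1 - j) * (Q * Del J e * XW J w x ^ j))
   = tr ?D (Del J e * XW J w x ^ (p - 1 - (p - 1 - j)) * (Del J e * (XW J w x ^ (p - 1 - j) * Q)))"
   unfolding j by (simp only: mult.assoc)
 qed
 also have "\<dots> = (%x. \<Sum>j<p. \<Sum>e\<in>EE J. (W w e)\<^sup>2 * tr ?D (Del J e * XW J w x ^ (p - 1 - j) * (Del J e * (XW J w x ^ j * Q))))"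
  by (rule ext, rule sum.nat_diff_reindex[symmetric, THEN trans]) (auto intro!: sum.cong)
 finally show ?thesis .
qed

text \<open>A crude bound, not uniform in the order \<open>P\<close>. It shows that every fixed moment stays
 bounded when the size grows. Differentiating in a scaling of all weights gives a differential
 inequality for the moment.\<close>

theorem apriori_bound:
 assumes w: "wts w \<nu>" and P: "P = 2 ^ Suc s" and \<tau>: "0 < \<tau>"
  and big: "16 * real P * \<nu> * AA * (real (card (DD J)) + 1) \<le> \<tau>\<^sup>2"
 shows "Phi J w P \<le> \<tau> ^ P * real (card (DD J))"
proof -
 let ?D = "DD J" and ?m = "\<tau> ^ P * real (card (DD J))"
 interpret prob_space "gm (EE J)" by (rule prob_space_gm)
 have P2: "2 \<le> P" using P by simp
 let ?c = "8 * \<nu> * AA * (real (card ?D) + 1)"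
 have "Phi J w P = (\<integral>x. tr ?D (1 * XW J w x ^ Suc (P - 1)) \<partial>gm (EE J))"
  using P2 by (simp add: Phi_def)
 also have "\<dots> \<le> (\<integral>x. real P * (?c * ((tr ?D (XW J w x ^ P) + ?m) / \<tau>\<^sup>2)) \<partial>gm (EE J))"
  unfolding trace_power_ibp[OF adm_intros(2)]
 proof (rule integral_mono')
  show "integrable (gm (EE J)) (%x. real P * (?c * ((tr ?D (XW J w x ^ P) + ?m) / \<tau>\<^sup>2)))"
   using XW_integrable' by (intro integrable_mult_right integrable_divide Bochner_Integration.integrable_add) auto
  fix x
  have nn: "0 \<le> tr ?D (XW J w x ^ P) + ?m"
   using tr_even_nonneg[OF finite_DD[OF J], of "XW J w x" s] J \<tau> unfolding P by simp
  show "0 \<le> real P * (?c * ((tr ?D (XW J w x ^ P) + ?m) / \<tau>\<^sup>2))"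
   using nn w AA_nonneg[OF J] by (auto simp: wts_def intro!: mult_nonneg_nonneg divide_nonneg_nonneg)
  have "(\<Sum>j<P - 1. \<Sum>e\<in>EE J. (W w e)\<^sup>2 * tr ?D (Del J e * XW J w x ^ (P - 1 - 1 - j) * (Del J e * (XW J w x ^ j * 1))))
   \<le> (\<Sum>j<P - 1. ?c * ((tr ?D (XW J w x ^ P) + ?m) / \<tau>\<^sup>2))"
  proof (intro sum_mono)
   fix j assume "j \<in> {..<P - 1}"
   then have "P - 1 - 1 - j + j + 2 = P" using P2 by auto
   from Del_Del_pointwise[OF w P this \<tau>, of "%e. W w e * x e"]
   show "(\<Sum>e\<in>EE J. (W w e)\<^sup>2 * tr ?D (Del J e * XW J w x ^ (P - 1 - 1 - j) * (Del J e * (XW J w x ^ j * 1))))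
    \<le> ?c * ((tr ?D (XW J w x ^ P) + ?m) / \<tau>\<^sup>2)" by simp
  qed
  also have "\<dots> = real (P - 1) * (?c * ((tr ?D (XW J w x ^ P) + ?m) / \<tau>\<^sup>2))" by simp
  also have "\<dots> \<le> real P * (?c * ((tr ?D (XW J w x ^ P) + ?m) / \<tau>\<^sup>2))"
   using nn w AA_nonneg[OF J]
   by (intro mult_right_mono) (auto simp: wts_def intro!: mult_nonneg_nonneg divide_nonneg_nonneg)
  finally show "(\<Sum>j<P - 1. \<Sum>e\<in>EE J. (W w e)\<^sup>2 * tr ?D (Del J e * XW J w x ^ (P - 1 - 1 - j) * (Del J e * (XW J w x ^ j * 1))))
   \<le> real P * (?c * ((tr ?D (XW J w x ^ P) + ?m) / \<tau>\<^sup>2))" .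
 qed
 also have "\<dots> = real P * (?c * ((Phi J w P + ?m) / \<tau>\<^sup>2))"
  using XW_integrable'[of w P] by (simp add: Phi_def prob_space)
 also have "\<dots> = (16 * real P * \<nu> * AA * (real (card ?D) + 1)) / \<tau>\<^sup>2 * ((Phi J w P + ?m) / 2)"
  by simp
 also have "\<dots> \<le> 1 * ((Phi J w P + ?m) / 2)"
  using big \<tau> Phi_nonneg[OF P, of w] by (intro mult_right_mono) (auto simp: divide_le_eq)
 finally show ?thesis by simp
qed

end

end

lemma gronwall_le:
 fixes f :: "real => real"
 assumes d: "!!th. (f has_real_derivative f' th) (at th)" and b: "!!th. \<bar>f' th\<bar> \<le> c * f th" and t: "0 \<le> t"
 shows "f 0 \<le> exp (c * t) * f t"
proof -
 have "f 0 * exp (c * 0) \<le> f t * exp (c * t)"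
 proof (rule DERIV_nonneg_imp_nondecreasing[OF t])
  fix x :: real
  have "((%x. f x * exp (c * x)) has_real_derivative (f' x + c * f x) * exp (c * x)) (at x)"
   by (rule derivative_eq_intros d refl)+ (simp add: algebra_simps)
  moreover have "0 \<le> (f' x + c * f x) * exp (c * x)"
   using b[of x] by (intro mult_nonneg_nonneg) auto
  ultimately show "\<exists>y. ((%x. f x * exp (c * x)) has_real_derivative y) (at x) \<and> 0 \<le> y" by blast
 qed
 then show ?thesis by (simp add: mult.commute)
qed

lemma abs_sum4_le':
 fixes a b c d S T :: real
 shows "\<bar>a\<bar> \<le> S ==> \<bar>b\<bar> \<le> S ==> \<bar>c\<bar> \<le> T ==> \<bar>d\<bar> \<le> T ==> \<bar>(a + b + c + d)\<bar> \<le> 2 * (S + T)"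
 using abs_sum4_le[of a S b c T d] by (simp add: distrib_left)

lemma interpolation_arith:
 "\<nu> * p * (p * (2 * (A * (16 * \<nu> * A * p ^ 2 * (T / a)) + A * (T / b))))
  = \<nu> * p ^ 2 * (2 * A * (16 * \<nu> * A * p ^ 2 / a + 1 / b)) * (T :: real)"
 by (simp add: algebra_simps power2_eq_square)

context coeffs
begin

context
 fixes J :: "nat set" assumes J: "finite J"
begin

lemma integral_csum:
 assumes "!!ka mu ka' mu'. integrable M (%x. f x ka mu ka' mu')"
 shows "(\<integral>x. csum (f x) \<partial>M) = csum (%ka mu ka' mu'. \<integral>x. f x ka mu ka' mu' \<partial>M)"
  and "integrable M (%x. csum (f x))"
 unfolding csum_def[OF J] using assms
 by (simp_all add: Bochner_Integration.integral_sum Bochner_Integration.integrable_sum)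

lemma XW_prod_integrable:
 assumes "adm (DD J) Q" "adm (DD J) Q'"
 shows "integrable (gm (EE J)) (%x. tr (DD J) (Q * XW J w x ^ p) * tr (DD J) (Q' * XW J w x ^ q))"
 by (rule gp_integrable[OF gp_mult[OF gp_scale[OF gp_tr_power[OF J assms(1)]] gp_scale[OF gp_tr_power[OF J assms(2)]]]])
  (use J in simp)

lemma XW_word_integrable:
 assumes "adm (DD J) Q" "adm (DD J) Q'"
 shows "integrable (gm (EE J)) (%x. tr (DD J) (Q * XW J w x ^ p * (Q' * XW J w x ^ q)))"
proof -
 note fin = finite_DD[OF J]
 note M = gpM_mult[OF fin gpM_mult[OF fin gpM_const[OF assms(1)] gpM_power[OF fin gpM_XX[OF J]]]
   gpM_mult[OF fin gpM_const[OF assms(2)] gpM_power[OF fin gpM_XX[OF J]]]]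
 show ?thesis
  by (rule gp_integrable[OF gp_scale[OF gpM_tr[OF M]]]) (use J in simp)
qed

text \<open>If the traces against \<open>\<gamma>\<close> vanish in the mean, then the leading terms of the
 derivative, which are products of two traces, are covariances; the remaining terms are single
 traces. Both cost a factor \<open>P\<^sup>2 * \<nu>\<close> only.\<close>

theorem interpolation_DERIV:
 assumes w: "!!th r c. ((%th. w th r c) has_real_derivative w' th r c) (at th)"
  and wt: "!!th. wts J (w th) \<nu>"
  and g: "!!th r c. r \<in> J ==> c \<in> J ==> w' th r c * w th r c = \<eta> th * (\<gamma> r * \<delta> c)"
  and le: "!!r. r \<in> J ==> \<bar>\<gamma> r\<bar> \<le> 1" "!!r. r \<in> J ==> \<bar>\<delta> r\<bar> \<le> 1" "!!th. \<bar>\<eta> th\<bar> \<le> \<nu>"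
  and zero: "!!ka mu p th. ka < K ==> mu < K ==>
   (\<integral>x. tr (DD J) (BB J ka mu \<gamma> * XW J (w th) x ^ p) \<partial>gm (EE J)) = 0"
  and P: "P = 2 ^ Suc s" and \<tau>: "0 < \<tau>"
 shows "\<exists>d. ((%th. Phi J (w th) P) has_real_derivative d) (at th) \<and>
  \<bar>d\<bar> \<le> \<nu> * real P ^ 2 * (2 * AA * (16 * \<nu> * AA * real P ^ 2 / \<tau> ^ 4 + 1 / \<tau>\<^sup>2)) *
   (2 * Phi J (w th) P + \<tau> ^ P * real (card (DD J)))"
proof -
 let ?D = "DD J" and ?E = "gm (EE J)" and ?X = "%x. XW J (w th) x"
 let ?m = "\<tau> ^ P * real (card (DD J))"
 let ?T = "2 * Phi J (w th) P + ?m"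
 note fin = finite_DD[OF J] and finE = finite_EE[OF J]
 have P2: "2 \<le> P" using P by simp
 have \<nu>: "0 \<le> \<nu>" using wt[of 0] by (auto simp: wts_def[OF J])
 have Phi0: "0 \<le> Phi J (w th) P" using Phi_nonneg[OF J P] .
 have T0: "0 \<le> ?T" using Phi0 \<tau> by simp
 define D2 where "D2 e e' z = (if e \<in> EE J then real P * dtr J (Del J e) (P - 1) e' z else 0)" for e e' z
 have D: "gp (EE J) (dtr J 1 P e) (D2 e)" for e
 proof (cases "e \<in> EE J")
  case True
  show ?thesis
   by (rule gp_cong[OF gp_smult[OF gp_Del_power[OF J], of "real P" e "P - 1"]])
    (use True in \<open>auto simp: dtr_one[OF J] D2_def\<close>)
 next
  case False
  show ?thesis
   by (rule gp_cong[OF gp_const[of _ 0]]) (use False in \<open>auto simp: dtr_def D2_def\<close>)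
 qed
 obtain E where E: "!!e e'. gp (EE J) (D2 e e') (E e e')"
 proof -
  have "\<forall>e. \<exists>E. \<forall>e'. gp (EE J) (D2 e e') (E e')" using gp_deriv[OF D] by blast
  then show ?thesis using that by metis
 qed
 define d where "d = (\<Sum>e\<in>EE J. W (w' th) e * W (w th) e * (\<integral>x. D2 e e (%e. W (w th) e * x e) \<partial>?E))"
 have der: "((%th. Phi J (w th) P) has_real_derivative d) (at th)"
  unfolding Phi_def d_def
  by (rule scaled_DERIV[OF gp_trace_power[OF J] D finE]) (use w in \<open>auto simp: W_def split: prod.splits\<close>)
 define S where "S j x = (\<Sum>(i, r, c)\<in>EE J. \<gamma> r * \<delta> c *
   tr ?D (Del J (i, r, c) * ?X x ^ (P - 2 - j) * (Del J (i, r, c) * ?X x ^ j)))" for j x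
 have "d = (\<Sum>e\<in>EE J. \<integral>x. W (w' th) e * W (w th) e * D2 e e (%e. W (w th) e * x e) \<partial>?E)"
  unfolding d_def by simp
 also have "\<dots> = (\<integral>x. (\<Sum>e\<in>EE J. W (w' th) e * W (w th) e * D2 e e (%e. W (w th) e * x e)) \<partial>?E)"
  by (rule Bochner_Integration.integral_sum[symmetric])
   (use gp_integrable[OF gp_scale[OF E] finE] in auto)
 also have "(%x. \<Sum>e\<in>EE J. W (w' th) e * W (w th) e * D2 e e (%e. W (w th) e * x e))
  = (%x. \<eta> th * real P * (\<Sum>j<P - 1. S j x))"
 proof
  fix x
  have "(\<Sum>e\<in>EE J. W (w' th) e * W (w th) e * D2 e e (%e. W (w th) e * x e))
   = (\<Sum>e\<in>EE J. \<Sum>j<P - 1. \<eta> th * real P * (case e of (i, r, c) => \<gamma> r * \<delta> c *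
     tr ?D (Del J (i, r, c) * ?X x ^ (P - 2 - j) * (Del J (i, r, c) * ?X x ^ j))))"
  proof (rule sum.cong[OF refl])
   fix e assume e: "e \<in> EE J"
   obtain i r c where irc: "e = (i, r, c)" by (cases e) auto
   have "W (w' th) e * W (w th) e = \<eta> th * (\<gamma> r * \<delta> c)" using e g by (simp add: irc)
   moreover have "D2 e e (%e. W (w th) e * x e)
    = real P * (\<Sum>j<P - 1. tr ?D (Del J e * ?X x ^ (P - 2 - j) * (Del J e * ?X x ^ j)))"
    using e by (simp add: D2_def dtr_def mult.assoc numeral_2_eq_2)
   ultimately show "W (w' th) e * W (w th) e * D2 e e (%e. W (w th) e * x e)
    = (\<Sum>j<P - 1. \<eta> th * real P * (case e of (i, r, c) => \<gamma> r * \<delta> c *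
     tr ?D (Del J (i, r, c) * ?X x ^ (P - 2 - j) * (Del J (i, r, c) * ?X x ^ j))))"
    by (simp add: irc sum_distrib_left mult_ac)
  qed
  also have "\<dots> = (\<Sum>j<P - 1. \<eta> th * real P * S j x)"
   unfolding S_def sum_distrib_left by (rule sum.swap)
  finally show "(\<Sum>e\<in>EE J. W (w' th) e * W (w th) e * D2 e e (%e. W (w th) e * x e))
   = \<eta> th * real P * (\<Sum>j<P - 1. S j x)" by (simp only: sum_distrib_left)
 qed
 finally have d_eq: "d = (\<integral>x. \<eta> th * real P * (\<Sum>j<P - 1. S j x) \<partial>?E)" .
 let ?c1 = "16 * \<nu> * AA * real P ^ 2 * (?T / \<tau> ^ 4)" and ?c2 = "?T / \<tau>\<^sup>2"
 have S: "integrable ?E (S j) \<and> \<bar>\<integral>x. S j x \<partial>?E\<bar> \<le> 2 * (AA * ?c1 + AA * ?c2)" if j: "j < P - 1" for j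
 proof -
  define i where "i = P - 2 - j"
  have ij: "i + j + 2 = P" "j + i + 2 = P" using j P2 by (auto simp: i_def)
  have adX: "adm ?D (?X x ^ i)" "adm ?D (?X x ^ j)" for x using J by auto
  have S_eq: "S j x
   = csum (%ka mu ka' mu'. tr ?D (BB J mu' mu \<delta> * ?X x ^ i) * tr ?D (BB J ka ka' \<gamma> * ?X x ^ j))
   + csum (%ka mu ka' mu'. tr ?D (BB J mu' mu \<delta> * ?X x ^ j) * tr ?D (BB J ka ka' \<gamma> * ?X x ^ i))
   + csum (%ka mu ka' mu'. tr ?D (BB J mu' mu \<delta> * ?X x ^ i * (BB J ka' ka \<gamma> * ?X x ^ j)))
   + csum (%ka mu ka' mu'. tr ?D (BB J mu' mu \<delta> * ?X x ^ j * (BB J ka' ka \<gamma> * ?X x ^ i)))" for x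
   unfolding S_def i_def[symmetric] sum_Del_Del[OF J adX] tp_power tp_XX[OF J] ..
  have ad: "adm ?D (BB J ka mu \<sigma>)" for ka mu \<sigma> using J by simp
  have c1: "\<bar>csum (%ka mu ka' mu'. \<integral>x. tr ?D (BB J mu' mu \<delta> * ?X x ^ i') * tr ?D (BB J ka ka' \<gamma> * ?X x ^ j') \<partial>?E)\<bar>
   \<le> AA * ?c1" if ij': "i' + j' + 2 = P" for i' j'
  proof (rule csum_bound[OF J])
   fix ka mu ka' mu' assume lt: "ka < K" "mu < K" "ka' < K" "mu' < K"
   let ?I = "\<integral>x. tr ?D (BB J mu' mu \<delta> * ?X x ^ i') * tr ?D (BB J ka ka' \<gamma> * ?X x ^ j') \<partial>?E"
   have "\<bar>?I\<bar> \<le> 16 * \<nu> * AA * real i' * real j' * (?T / \<tau> ^ (P - (i' + j' - 2)))"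
    using covariance_bound[OF J wt[of th] small_BB[OF J, of mu' mu \<delta>] small_BB[OF J, of ka ka' \<gamma>] P _ \<tau>, of i' j']
     zero[of ka ka' th j'] lt le ij' by auto
   also have "\<dots> \<le> ?c1"
   proof (cases "i' = 0 \<or> j' = 0")
    case True
    then show ?thesis using \<nu> AA_nonneg[OF J] T0 \<tau> by auto
   next
    case False
    then have "P - (i' + j' - 2) = 4" using ij' by auto
    moreover have "real i' * real j' \<le> real P ^ 2"
     unfolding power2_eq_square using ij' by (intro mult_mono) auto
    moreover have "0 \<le> ?T / \<tau> ^ 4" using T0 \<tau> by simp
    ultimately have "real i' * real j' * (?T / \<tau> ^ (P - (i' + j' - 2))) \<le> real P ^ 2 * (?T / \<tau> ^ 4)"
     by (simp only: mult_right_mono)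
    from mult_left_mono[OF this, of "16 * \<nu> * AA"] show ?thesis
     using \<nu> AA_nonneg[OF J] by (simp only: mult.assoc) simp
   qed
   finally show "\<bar>?I\<bar> \<le> ?c1" .
  qed
  have c2: "\<bar>csum (%ka mu ka' mu'. \<integral>x. tr ?D (BB J mu' mu \<delta> * ?X x ^ i' * (BB J ka' ka \<gamma> * ?X x ^ j')) \<partial>?E)\<bar>
   \<le> AA * ?c2" if ij': "i' + j' + 2 = P" for i' j'
  proof (rule csum_bound[OF J])
   fix ka mu ka' mu' assume lt: "ka < K" "mu < K" "ka' < K" "mu' < K"
   interpret prob_space ?E by (rule prob_space_gm)
   have "P - (i' + j') = 2" using ij' by auto
   then have b: "\<bar>tr ?D (BB J mu' mu \<delta> * ?X x ^ i' * (BB J ka' ka \<gamma> * ?X x ^ j'))\<bar>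
     \<le> (tr ?D (?X x ^ P) + ?m) / \<tau>\<^sup>2" for x
    using word2[OF fin _ _ small_BB[OF J, of mu' mu \<delta>] small_BB[OF J, of ka' ka \<gamma>] P _ \<tau>, of "?X x" i' j']
     J lt le ij' by auto
   have "\<bar>\<integral>x. tr ?D (BB J mu' mu \<delta> * ?X x ^ i' * (BB J ka' ka \<gamma> * ?X x ^ j')) \<partial>?E\<bar>
    \<le> (\<integral>x. (tr ?D (?X x ^ P) + ?m) / \<tau>\<^sup>2 \<partial>?E)"
    by (rule order_trans[OF integral_abs_bound integral_mono])
     (use b XW_word_integrable[OF ad ad] XW_integrable'[OF J] in auto)
   also have "\<dots> = (Phi J (w th) P + ?m) / \<tau>\<^sup>2"
    using XW_integrable'[OF J, of "w th" P] by (simp add: Phi_def prob_space)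
   also have "\<dots> \<le> ?c2" using Phi0 \<tau> by (intro divide_right_mono) auto
   finally show "\<bar>\<integral>x. tr ?D (BB J mu' mu \<delta> * ?X x ^ i' * (BB J ka' ka \<gamma> * ?X x ^ j')) \<partial>?E\<bar> \<le> ?c2" .
  qed
  have I1: "(\<integral>x. csum (%ka mu ka' mu'. tr ?D (BB J mu' mu \<delta> * ?X x ^ i') * tr ?D (BB J ka ka' \<gamma> * ?X x ^ j')) \<partial>?E)
    = csum (%ka mu ka' mu'. \<integral>x. tr ?D (BB J mu' mu \<delta> * ?X x ^ i') * tr ?D (BB J ka ka' \<gamma> * ?X x ^ j') \<partial>?E)"
   "integrable ?E (%x. csum (%ka mu ka' mu'. tr ?D (BB J mu' mu \<delta> * ?X x ^ i') * tr ?D (BB J ka ka' \<gamma> * ?X x ^ j')))"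
   for i' j'
   by (intro integral_csum XW_prod_integrable ad)+
  have I2: "(\<integral>x. csum (%ka mu ka' mu'. tr ?D (BB J mu' mu \<delta> * ?X x ^ i' * (BB J ka' ka \<gamma> * ?X x ^ j'))) \<partial>?E)
    = csum (%ka mu ka' mu'. \<integral>x. tr ?D (BB J mu' mu \<delta> * ?X x ^ i' * (BB J ka' ka \<gamma> * ?X x ^ j')) \<partial>?E)"
   "integrable ?E (%x. csum (%ka mu ka' mu'. tr ?D (BB J mu' mu \<delta> * ?X x ^ i' * (BB J ka' ka \<gamma> * ?X x ^ j'))))"
   for i' j'
   by (intro integral_csum XW_word_integrable ad)+
  have int: "integrable ?E (S j)"
   unfolding S_eq[abs_def]
   by (intro Bochner_Integration.integrable_add integral_csum XW_prod_integrable XW_word_integrable ad)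
  have "(\<integral>x. S j x \<partial>?E)
   = csum (%ka mu ka' mu'. \<integral>x. tr ?D (BB J mu' mu \<delta> * ?X x ^ i) * tr ?D (BB J ka ka' \<gamma> * ?X x ^ j) \<partial>?E)
   + csum (%ka mu ka' mu'. \<integral>x. tr ?D (BB J mu' mu \<delta> * ?X x ^ j) * tr ?D (BB J ka ka' \<gamma> * ?X x ^ i) \<partial>?E)
   + csum (%ka mu ka' mu'. \<integral>x. tr ?D (BB J mu' mu \<delta> * ?X x ^ i * (BB J ka' ka \<gamma> * ?X x ^ j)) \<partial>?E)
   + csum (%ka mu ka' mu'. \<integral>x. tr ?D (BB J mu' mu \<delta> * ?X x ^ j * (BB J ka' ka \<gamma> * ?X x ^ i)) \<partial>?E)"
   unfolding S_eq
   by (simp only: Bochner_Integration.integral_add Bochner_Integration.integrable_add I1 I2)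
  then have "\<bar>\<integral>x. S j x \<partial>?E\<bar> \<le> 2 * (AA * ?c1 + AA * ?c2)"
   by (simp only:) (rule abs_sum4_le'[OF c1[OF ij(1)] c1[OF ij(2)] c2[OF ij(1)] c2[OF ij(2)]])
  with int show ?thesis by blast
 qed
 have "d = \<eta> th * real P * (\<Sum>j<P - 1. \<integral>x. S j x \<partial>?E)"
  unfolding d_eq using S by simp
 then have "\<bar>d\<bar> = \<bar>\<eta> th\<bar> * real P * \<bar>\<Sum>j<P - 1. \<integral>x. S j x \<partial>?E\<bar>" by (simp add: abs_mult)
 also have "\<dots> \<le> \<nu> * real P * (\<Sum>j<P - 1. 2 * (AA * ?c1 + AA * ?c2))"
  using \<nu> S by (intro mult_mono le order_trans[OF sum_abs] sum_mono) auto
 also have "\<dots> = \<nu> * real P * (real (P - 1) * (2 * (AA * ?c1 + AA * ?c2)))" by simp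
 also have "\<dots> \<le> \<nu> * real P * (real P * (2 * (AA * ?c1 + AA * ?c2)))"
  using \<nu> T0 Phi0 \<tau> AA_nonneg[OF J] by (intro mult_left_mono mult_right_mono add_nonneg_nonneg mult_nonneg_nonneg divide_nonneg_nonneg) auto
 also have "\<dots> = \<nu> * real P ^ 2 * (2 * AA * (16 * \<nu> * AA * real P ^ 2 / \<tau> ^ 4 + 1 / \<tau>\<^sup>2)) * ?T"
  by (rule interpolation_arith)
 finally show ?thesis using der by blast
qed

lemma ent_XX:
 assumes "ka < K" "mu < K" "r \<in> J" "c \<in> J"
 shows "ent (XX J z) (ka, r) (mu, c) = (\<Sum>i<l. z (i, r, c) * a i ka mu + z (i, c, r) * a i mu ka)"
proof -
 have "ent (XX J z) (ka, r) (mu, c) = (\<Sum>i<l. \<Sum>r'\<in>J. \<Sum>c'\<in>J.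
   z (i, r', c') * ((if r = r' \<and> c = c' then a i ka mu else 0) + (if c = r' \<and> r = c' then a i mu ka else 0)))"
  unfolding XX_def ent_sum sum_EE using assms
  by (intro sum.cong refl) (simp add: Del_def ent_UU[OF J])
 also have "\<dots> = (\<Sum>i<l. (\<Sum>r'\<in>J. if r' = r then \<Sum>c'\<in>J. if c' = c then z (i, r, c) * a i ka mu else 0 else 0)
   + (\<Sum>r'\<in>J. if r' = c then \<Sum>c'\<in>J. if c' = r then z (i, c, r) * a i mu ka else 0 else 0))"
  unfolding distrib_left sum.distrib
  by (intro sum.cong refl arg_cong2[where f = "(+)"]) (auto intro!: sum.cong sum.neutral)
 also have "\<dots> = (\<Sum>i<l. z (i, r, c) * a i ka mu + z (i, c, r) * a i mu ka)"
  using assms J by simp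
 finally show ?thesis .
qed

lemma gp_ent_power:
 assumes "ka < K" "mu < K" "r \<in> J" "c \<in> J"
 shows "\<exists>D. gp (EE J) (%x. ent (XW J w x ^ p) (ka, r) (mu, c)) D"
proof -
 have "gp (EE J) (%z. ent (XX J z ^ p) (ka, r) (mu, c)) (%e z. ent (\<Sum>j<p. XX J z ^ j *
   (if e \<in> EE J then Del J e else 0) * XX J z ^ (p - 1 - j)) (ka, r) (mu, c))"
  using gpM_power[OF finite_DD[OF J] gpM_XX[OF J], of p] assms unfolding gpM_def by simp
 from gp_scale[OF this, of "W w"] show ?thesis by (rule gp_exI)
qed

end

lemma embed_power:
 assumes J: "finite J" "finite J'" and \<phi>: "inj_on \<phi> J" "\<phi> ` J \<subseteq> J'"
  and w: "!!r c. r \<in> J ==> c \<in> J ==> w' (\<phi> r) (\<phi> c) = w r c"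
  and w0: "!!r c. r \<in> J ==> c \<in> J' - \<phi> ` J ==> w' (\<phi> r) c = 0 \<and> w' c (\<phi> r) = 0"
  and lt: "ka < K" "mu < K" "r \<in> J" "c \<in> J"
 shows "ent (XW J' w' x ^ p) (ka, \<phi> r) (mu, \<phi> c)
  = ent (XW J w (%e. x (case e of (i, r, c) => (i, \<phi> r, \<phi> c))) ^ p) (ka, r) (mu, c)"
 using lt
proof (induction p arbitrary: ka r)
 case 0
 then show ?case using \<phi> by (auto simp: inj_on_eq_iff)
next
 case (Suc p)
 let ?y = "%e. x (case e of (i, r, c) => (i, \<phi> r, \<phi> c))"
 have \<phi>r: "\<phi> r \<in> J'" using Suc.prems \<phi> by auto
 have z: "ent (XW J' w' x) (ka, \<phi> r) (\<nu>, c') = 0" if "\<nu> < K" "c' \<in> J' - \<phi> ` J" for \<nu> c'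
  using that Suc.prems \<phi>r w0[of r c'] by (subst ent_XX[OF J(2)]) auto
 have e: "ent (XW J' w' x) (ka, \<phi> r) (\<nu>, \<phi> c') = ent (XW J w ?y) (ka, r) (\<nu>, c')" if "\<nu> < K" "c' \<in> J" for \<nu> c'
  using that Suc.prems \<phi>r \<phi> w[of r c'] w[of c' r]
  by (subst ent_XX[OF J(2)], simp, simp, simp, blast, subst ent_XX[OF J(1)]) auto
 have "ent (XW J' w' x ^ Suc p) (ka, \<phi> r) (mu, \<phi> c)
  = (\<Sum>\<nu><K. \<Sum>c'\<in>J'. ent (XW J' w' x) (ka, \<phi> r) (\<nu>, c') * ent (XW J' w' x ^ p) (\<nu>, c') (mu, \<phi> c))"
  using Suc.prems \<phi>r J by (simp add: adm_times_ent[of "DD J'"] sum_DD)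
 also have "\<dots> = (\<Sum>\<nu><K. \<Sum>c'\<in>\<phi> ` J. ent (XW J' w' x) (ka, \<phi> r) (\<nu>, c') * ent (XW J' w' x ^ p) (\<nu>, c') (mu, \<phi> c))"
  using \<phi> J z by (intro sum.cong refl sum.mono_neutral_right) auto
 also have "\<dots> = (\<Sum>\<nu><K. \<Sum>c'\<in>J. ent (XW J w ?y) (ka, r) (\<nu>, c') * ent (XW J w ?y ^ p) (\<nu>, c') (mu, c))"
  unfolding sum.reindex[OF \<phi>(1)] o_def
  using Suc.prems by (intro sum.cong refl) (simp add: e Suc.IH)
 also have "\<dots> = ent (XW J w ?y ^ Suc p) (ka, r) (mu, c)"
  using Suc.prems J by (simp add: adm_times_ent[of "DD J"] sum_DD)
 finally show ?case .
qed

text \<open>Enlarging the index set by rows and columns that carry no weight does not change the moments.\<close>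

lemma embed_expectation:
 assumes J: "finite J" "finite J'" and \<phi>: "inj_on \<phi> J" "\<phi> ` J \<subseteq> J'"
  and w: "!!r c. r \<in> J ==> c \<in> J ==> w' (\<phi> r) (\<phi> c) = w r c"
  and w0: "!!r c. r \<in> J ==> c \<in> J' - \<phi> ` J ==> w' (\<phi> r) c = 0 \<and> w' c (\<phi> r) = 0"
  and lt: "ka < K" "mu < K" "r \<in> J" "c \<in> J"
 shows "(\<integral>x. ent (XW J' w' x ^ p) (ka, \<phi> r) (mu, \<phi> c) \<partial>gm (EE J'))
  = (\<integral>x. ent (XW J w x ^ p) (ka, r) (mu, c) \<partial>gm (EE J))"
proof -
 let ?f = "%(i, r, c). (i, \<phi> r, \<phi> c) :: nat \<times> nat \<times> nat"
 obtain D where D: "gp (EE J) (%x. ent (XW J w x ^ p) (ka, r) (mu, c)) D"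
  using gp_ent_power[OF J(1) lt] by blast
 have "(\<integral>x. ent (XW J w (%e. x (?f e)) ^ p) (ka, r) (mu, c) \<partial>gm (EE J'))
  = (\<integral>x. ent (XW J w x ^ p) (ka, r) (mu, c) \<partial>gm (EE J))"
  by (rule gp_reindex[OF D]) (use J \<phi> in \<open>auto simp: inj_on_def EE_def\<close>)
 moreover have "ent (XW J' w' x ^ p) (ka, \<phi> r) (mu, \<phi> c)
  = ent (XW J w (%e. x (?f e)) ^ p) (ka, r) (mu, c)" for x
  by (rule embed_power[where \<phi> = \<phi> and J = J]) (use J \<phi> w w0 lt in auto)
 ultimately show ?thesis by simp
qed

definition wb :: "nat set => nat set => nat => nat => real" where
 "wb R C r c = (if r \<in> R \<and> c \<in> C then 1 / sqrt (real (card C)) else 0)"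

definition FF :: "nat set => nat set => nat => real" where
 "FF R C P = Phi (R \<union> C) (wb R C) P"

lemma wts_wb:
 assumes "finite R" "finite C"
 shows "wts (R \<union> C) (wb R C) (1 / real (card C))"
proof -
 have "finite (R \<union> C)" using assms by simp
 then show ?thesis
  unfolding wts_def[OF \<open>finite (R \<union> C)\<close>]
  by (intro conjI exI[of _ "%r. if r \<in> R then 1 else 0"] exI[of _ "%r. if r \<in> C then 1 else 0"]
    exI[of _ "%_. 0"]) (auto simp: wb_def power_divide)
qed

lemma FF_nonneg: "finite R ==> finite C ==> P = 2 ^ Suc s ==> 0 \<le> FF R C P"
 unfolding FF_def by (intro Phi_nonneg) auto

lemma trace_expectation:
 assumes J: "finite J"
 shows "Phi J w p = (\<Sum>ka<K. \<Sum>r\<in>J. \<integral>x. ent (XW J w x ^ p) (ka, r) (ka, r) \<partial>gm (EE J))"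
proof -
 have int: "integrable (gm (EE J)) (%x. ent (XW J w x ^ p) (ka, r) (ka, r))" if lt: "ka < K" "r \<in> J" for ka r
 proof -
  obtain D where "gp (EE J) (%x. ent (XW J w x ^ p) (ka, r) (ka, r)) D"
   using gp_ent_power[OF J lt(1,1,2,2)] by blast
  then show ?thesis by (rule gp_integrable) (use J in simp)
 qed
 have "Phi J w p = (\<Sum>ka<K. \<integral>x. (\<Sum>r\<in>J. ent (XW J w x ^ p) (ka, r) (ka, r)) \<partial>gm (EE J))"
  unfolding Phi_def tr_def sum_DD
  by (rule Bochner_Integration.integral_sum) (auto intro!: Bochner_Integration.integrable_sum int)
 also have "\<dots> = (\<Sum>ka<K. \<Sum>r\<in>J. \<integral>x. ent (XW J w x ^ p) (ka, r) (ka, r) \<partial>gm (EE J))"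
  by (intro sum.cong refl Bochner_Integration.integral_sum) (auto intro!: int)
 finally show ?thesis .
qed

text \<open>Start with two independent copies of the matrix on the diagonal blocks and rotate the weights to
 the off-diagonal blocks; at the angle \<open>pi / 4\<close> all blocks have the weights of the
 matrix of double size. Exchanging the blocks is a symmetry, which makes the traces against the
 alternating signs centred, as the derivative formula requires.\<close>

theorem doubling:
 assumes fin: "finite R" "finite C" and C: "0 < card C"
  and P: "P = 2 ^ Suc s" and \<tau>: "0 < \<tau>"
 shows "\<exists>R2 C2. finite R2 \<and> finite C2 \<and> card R2 = 2 * card R \<and> card C2 = 2 * card C \<and>
  card (R2 \<union> C2) = 2 * card (R \<union> C) \<and>
  2 * FF R C P + \<tau> ^ P * (real K * real (card (R \<union> C)))
   \<le> exp (2 * (1 / real (card C) * real P ^ 2 *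
     (2 * AA * (16 * (1 / real (card C)) * AA * real P ^ 2 / \<tau> ^ 4 + 1 / \<tau>\<^sup>2)))) *
    (FF R2 C2 P + \<tau> ^ P * (real K * real (card (R \<union> C))))"
proof -
 define J where "J = R \<union> C"
 have J: "finite J" using fin by (simp add: J_def)
 obtain t where t: "!!r. r \<in> J ==> r < t"
  using finite_nat_set_iff_bounded J by auto
 define sh where "sh r = r + t" for r
 have sh: "inj_on sh A" for A by (auto simp: sh_def inj_on_def)
 define J2 where "J2 = J \<union> sh ` J"
 define R2 where "R2 = R \<union> sh ` R"
 define C2 where "C2 = C \<union> sh ` C"
 have J2: "finite J2" using J by (simp add: J2_def)
 have tR: "r < t" if "r \<in> R" for r using t that by (auto simp: J_def)
 have tC: "r < t" if "r \<in> C" for r using t that by (auto simp: J_def)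
 have dis: "J \<inter> sh ` J = {}" "R \<inter> sh ` R = {}" "C \<inter> sh ` C = {}"
  using t tR tC by (force simp: sh_def)+
 have card2: "card R2 = 2 * card R" "card C2 = 2 * card C" "card J2 = 2 * card J"
  unfolding R2_def C2_def J2_def using fin J dis by (simp_all add: card_Un_disjoint card_image[OF sh])
 have J2_eq: "R2 \<union> C2 = J2" by (auto simp: R2_def C2_def J2_def J_def)
 define n where "n = real (card C)"
 have n: "0 < n" using C by (simp add: n_def)
 define \<epsilon> where "\<epsilon> r = (if r < t then 1 else -1 :: real)" for r
 \<comment> \<open>At angle \<open>0\<close> two independent copies, at angle \<open>pi / 4\<close> the matrix of double size.\<close>
 define w where "w th r c = (if r \<in> R2 \<and> c \<in> C2 then (if (r < t) = (c < t) then cos th else sin th) / sqrt n else 0)"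
  for th r c
 define w' where "w' th r c = (if r \<in> R2 \<and> c \<in> C2 then (if (r < t) = (c < t) then - sin th else cos th) / sqrt n else 0)"
  for th r c
 define \<gamma> where "\<gamma> r = (if r \<in> R2 then \<epsilon> r else 0)" for r
 define \<delta> where "\<delta> c = (if c \<in> C2 then \<epsilon> c else 0)" for c
 have der: "((%th. w th r c) has_real_derivative w' th r c) (at th)" for th r c
 proof -
  have 1: "((%th. cos th / sqrt n) has_real_derivative - sin th / sqrt n) (at th)"
   by (rule DERIV_cdivide, rule DERIV_cos)
  have 2: "((%th. sin th / sqrt n) has_real_derivative cos th / sqrt n) (at th)"
   by (rule DERIV_cdivide, rule DERIV_sin)
  show ?thesis
   unfolding w_def w'_def using 1 2
   by (cases "r \<in> R2"; cases "c \<in> C2"; cases "(r < t) = (c < t)") simp_all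
 qed
 have trig: "cos th ^ 2 = 1 / 2 + cos (2 * th) / 2" "sin th ^ 2 = 1 / 2 - cos (2 * th) / 2" for th :: real
  using cos_double_cos[of th] sin_cos_squared_add[of th] by linarith+
 have wt: "wts J2 (w th) (1 / n)" for th
 proof -
  have sq: "(w th r c)\<^sup>2 = 1 / n * ((if r \<in> R2 then 1 else 0) * (if c \<in> C2 then 1 / 2 else 0)
    + \<gamma> r * (cos (2 * th) / 2 * \<delta> c))" for r c
   using n trig[of th]
   by (cases "r \<in> R2"; cases "c \<in> C2"; cases "r < t"; cases "c < t")
    (simp_all add: w_def \<gamma>_def \<delta>_def \<epsilon>_def power_divide add_divide_distrib diff_divide_distrib)
  have "\<bar>cos (2 * th) / 2 * \<delta> c\<bar> \<le> 1" for c
  proof -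
   have "\<bar>cos (2 * th)\<bar> * \<bar>\<delta> c\<bar> \<le> 1 * 1" by (intro mult_mono) (auto simp: \<delta>_def \<epsilon>_def)
   then show ?thesis by (simp add: abs_mult)
  qed
  moreover have "\<bar>\<gamma> r\<bar> \<le> 1" for r by (auto simp: \<gamma>_def \<epsilon>_def)
  ultimately show ?thesis
   unfolding wts_def[OF J2]
   by (intro conjI exI[of _ "%r. if r \<in> R2 then 1 else 0"] exI[of _ "%c. if c \<in> C2 then 1 / 2 else 0"]
     exI[of _ \<gamma>] exI[of _ "%c. cos (2 * th) / 2 * \<delta> c"])
    (use n sq in auto)
 qed
 have g: "w' th r c * w th r c = - (sin th * cos th) / n * (\<gamma> r * \<delta> c)" for th r c
  using n by (auto simp: w_def w'_def \<gamma>_def \<delta>_def \<epsilon>_def field_simps)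
 have le: "\<bar>\<gamma> r\<bar> \<le> 1" "\<bar>\<delta> r\<bar> \<le> 1" for r by (auto simp: \<gamma>_def \<delta>_def \<epsilon>_def)
 have le3: "\<bar>- (sin th * cos th) / n\<bar> \<le> 1 / n" for th
 proof -
  have "\<bar>sin th\<bar> * \<bar>cos th\<bar> \<le> 1 * 1" by (intro mult_mono) auto
  then show ?thesis using n by (simp add: abs_mult divide_right_mono)
 qed
 text \<open>Exchanging the two halves flips the signs \<open>\<epsilon>\<close> and preserves the law.\<close>
 define \<sigma> where "\<sigma> r = (if r < t then r + t else r - t)" for r
 have J2_cases: "(r < t \<longrightarrow> r \<in> J) \<and> (\<not> r < t \<longrightarrow> t \<le> r \<and> r - t \<in> J)" if "r \<in> J2" for r
  using that t by (auto simp: J2_def sh_def)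
 have \<sigma>J: "\<sigma> r \<in> J2" "\<sigma> (\<sigma> r) = r" "(\<sigma> r < t) = (\<not> r < t)" if "r \<in> J2" for r
  using J2_cases[OF that] t by (auto simp: \<sigma>_def J2_def sh_def)
 have R2_iff: "r \<in> R2 \<longleftrightarrow> (if r < t then r \<in> R else r - t \<in> R)"
  and C2_iff: "r \<in> C2 \<longleftrightarrow> (if r < t then r \<in> C else r - t \<in> C)" for r
  using tR tC by (auto simp: R2_def C2_def sh_def image_iff) (metis add_diff_inverse_nat add.commute)+
 have \<sigma>RC: "\<sigma> r \<in> R2 \<longleftrightarrow> r \<in> R2" "\<sigma> r \<in> C2 \<longleftrightarrow> r \<in> C2" if "r \<in> J2" for r
  using J2_cases[OF that] t unfolding R2_iff C2_iff by (auto simp: \<sigma>_def)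
 have \<sigma>inj: "inj_on \<sigma> J2" by (rule inj_on_inverseI[of _ \<sigma>]) (rule \<sigma>J)
 have \<sigma>im: "\<sigma> ` J2 = J2"
 proof
  show "\<sigma> ` J2 \<subseteq> J2" using \<sigma>J by auto
  show "J2 \<subseteq> \<sigma> ` J2" using \<sigma>J by (metis image_eqI subsetI)
 qed
 have w\<sigma>: "w th (\<sigma> r) (\<sigma> c) = w th r c" if "r \<in> J2" "c \<in> J2" for th r c
  using that \<sigma>J \<sigma>RC by (simp add: w_def)
 have swap: "(\<integral>x. ent (XW J2 (w th) x ^ p) (ka, \<sigma> r) (mu, \<sigma> c) \<partial>gm (EE J2))
   = (\<integral>x. ent (XW J2 (w th) x ^ p) (ka, r) (mu, c) \<partial>gm (EE J2))"
  if "ka < K" "mu < K" "r \<in> J2" "c \<in> J2" for th p ka mu r c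
  by (rule embed_expectation[OF J2 J2 \<sigma>inj]) (use \<sigma>im w\<sigma> that in auto)
 have zero: "(\<integral>x. tr (DD J2) (BB J2 ka mu \<gamma> * XW J2 (w th) x ^ p) \<partial>gm (EE J2)) = 0"
  if "ka < K" "mu < K" for ka mu p th
 proof -
  let ?e = "%r. \<integral>x. ent (XW J2 (w th) x ^ p) (mu, r) (ka, r) \<partial>gm (EE J2)"
  have int: "integrable (gm (EE J2)) (%x. ent (XW J2 (w th) x ^ p) (mu, r) (ka, r))" if rJ: "r \<in> J2" for r
  proof -
   obtain D where "gp (EE J2) (%x. ent (XW J2 (w th) x ^ p) (mu, r) (ka, r)) D"
    using gp_ent_power[OF J2 \<open>mu < K\<close> \<open>ka < K\<close> rJ rJ] by blast
   then show ?thesis by (rule gp_integrable) (use J2 in simp)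
  qed
  have "(\<integral>x. tr (DD J2) (BB J2 ka mu \<gamma> * XW J2 (w th) x ^ p) \<partial>gm (EE J2)) = (\<Sum>r\<in>J2. \<gamma> r * ?e r)"
   using that int by (simp add: tr_BB_times[OF J2])
  also have "\<dots> = 0"
  proof -
   have "(\<Sum>r\<in>J2. \<gamma> r * ?e r) = (\<Sum>r\<in>\<sigma> ` J2. \<gamma> r * ?e r)" unfolding \<sigma>im ..
   also have "\<dots> = (\<Sum>r\<in>J2. \<gamma> (\<sigma> r) * ?e (\<sigma> r))" unfolding sum.reindex[OF \<sigma>inj] o_def ..
   also have "\<dots> = (\<Sum>r\<in>J2. - (\<gamma> r * ?e r))"
    using that swap \<sigma>J \<sigma>RC by (intro sum.cong refl) (simp add: \<gamma>_def \<epsilon>_def)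
   also have "\<dots> = - (\<Sum>r\<in>J2. \<gamma> r * ?e r)" by (rule sum_negf)
   finally show ?thesis by linarith
  qed
  finally show ?thesis .
 qed
 let ?c = "1 / n * real P ^ 2 * (2 * AA * (16 * (1 / n) * AA * real P ^ 2 / \<tau> ^ 4 + 1 / \<tau>\<^sup>2))"
 let ?m = "\<tau> ^ P * real (card (DD J2))"
 have c0: "0 \<le> ?c"
  using n \<tau> AA_nonneg[OF J] by (intro mult_nonneg_nonneg add_nonneg_nonneg divide_nonneg_nonneg) auto
 define f where "f th = 2 * Phi J2 (w th) P + ?m" for th
 have f0: "0 \<le> f th" for th using Phi_nonneg[OF J2 P, of "w th"] \<tau> by (simp add: f_def)
 have "\<exists>f'. \<forall>th. (f has_real_derivative f' th) (at th) \<and> \<bar>f' th\<bar> \<le> (2 * ?c) * f th"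
 proof -
  have "\<exists>d. (f has_real_derivative d) (at th) \<and> \<bar>d\<bar> \<le> (2 * ?c) * f th" for th
  proof -
   obtain d where d: "((%th. Phi J2 (w th) P) has_real_derivative d) (at th)" "\<bar>d\<bar> \<le> ?c * f th"
    unfolding f_def
    using interpolation_DERIV[OF J2 der wt g le le3 zero P \<tau>, of th] by blast
   have "(f has_real_derivative 2 * d) (at th)"
    unfolding f_def[abs_def] by (auto intro!: derivative_eq_intros d)
   then show ?thesis using d(2) by (intro exI[of _ "2 * d"]) (auto simp: abs_mult)
  qed
  then show ?thesis by metis
 qed
 then obtain f' where f': "!!th. (f has_real_derivative f' th) (at th)" "!!th. \<bar>f' th\<bar> \<le> (2 * ?c) * f th"
  by blast
 have "f 0 \<le> exp (2 * ?c * (pi / 4)) * f (pi / 4)"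
  by (rule gronwall_le[OF f']) simp
 also have "\<dots> \<le> exp (2 * ?c) * f (pi / 4)"
 proof (rule mult_right_mono)
  have "2 * ?c * (pi / 4) \<le> 2 * ?c * 1" using c0 pi_less_4 by (intro mult_left_mono) auto
  then show "exp (2 * ?c * (pi / 4)) \<le> exp (2 * ?c)" by simp
 qed (rule f0)
 finally have main: "f 0 \<le> exp (2 * ?c) * f (pi / 4)" .
 have F2: "Phi J2 (w (pi / 4)) P = FF R2 C2 P"
 proof -
  have h: "sqrt 2 / 2 / sqrt n = 1 / sqrt (2 * n)"
  proof -
   have "sqrt 2 / 2 = 1 / sqrt (2 :: real)" by (simp add: field_simps)
   then have "sqrt 2 / 2 / sqrt n = (1 / sqrt 2) / sqrt n" by (simp only:)
   also have "\<dots> = 1 / sqrt (2 * n)" by (simp add: real_sqrt_mult)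
   finally show ?thesis .
  qed
  have "w (pi / 4) r c = wb R2 C2 r c" for r c
  proof -
   have "w (pi / 4) r c = (if r \<in> R2 \<and> c \<in> C2 then sqrt 2 / 2 / sqrt n else 0)"
    by (simp add: w_def cos_45 sin_45)
   then show ?thesis unfolding h by (simp add: wb_def card2 n_def)
  qed
  then have "w (pi / 4) = wb R2 C2" by blast
  then show ?thesis by (simp add: FF_def J2_eq)
 qed
 have F1: "Phi J2 (w 0) P = 2 * FF R C P"
 proof -
  let ?e = "%ka r. \<integral>x. ent (XW J (wb R C) x ^ P) (ka, r) (ka, r) \<partial>gm (EE J)"
  have e1: "(\<integral>x. ent (XW J2 (w 0) x ^ P) (ka, r) (ka, r) \<partial>gm (EE J2)) = ?e ka r"
   if "ka < K" "r \<in> J" for ka r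
  proof -
   have "(\<integral>x. ent (XW J2 (w 0) x ^ P) (ka, id r) (ka, id r) \<partial>gm (EE J2)) = ?e ka r"
   proof (rule embed_expectation[OF J J2])
    fix r c assume "r \<in> J" "c \<in> J"
    then show "w 0 (id r) (id c) = wb R C r c"
     using t by (simp add: w_def wb_def R2_iff C2_iff n_def)
   next
    fix r c assume "r \<in> J" "c \<in> J2 - id ` J"
    then have "r < t" "\<not> c < t" using t J2_cases[of c] by auto
    then show "w 0 (id r) c = 0 \<and> w 0 c (id r) = 0" by (simp add: w_def)
   qed (use that in \<open>auto simp: J2_def\<close>)
   then show ?thesis by simp
  qed
  have e2: "(\<integral>x. ent (XW J2 (w 0) x ^ P) (ka, sh r) (ka, sh r) \<partial>gm (EE J2)) = ?e ka r"
   if "ka < K" "r \<in> J" for ka r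
  proof (rule embed_expectation[OF J J2])
   fix r c assume "r \<in> J" "c \<in> J"
   then show "w 0 (sh r) (sh c) = wb R C r c"
    using t by (simp add: w_def wb_def R2_iff C2_iff n_def sh_def)
  next
   fix r c assume "r \<in> J" "c \<in> J2 - sh ` J"
   then have "\<not> sh r < t" "c < t" using t by (auto simp: sh_def J2_def)
   then show "w 0 (sh r) c = 0 \<and> w 0 c (sh r) = 0" by (simp add: w_def)
  qed (use that sh in \<open>auto simp: J2_def\<close>)
  have "Phi J2 (w 0) P = (\<Sum>ka<K. (\<Sum>r\<in>J. ?e ka r) + (\<Sum>r\<in>J. ?e ka r))"
   unfolding trace_expectation[OF J2]
  proof (intro sum.cong refl)
   fix ka assume "ka \<in> {..<K}"
   then have ka: "ka < K" by simp
   show "(\<Sum>r\<in>J2. \<integral>x. ent (XW J2 (w 0) x ^ P) (ka, r) (ka, r) \<partial>gm (EE J2))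
    = (\<Sum>r\<in>J. ?e ka r) + (\<Sum>r\<in>J. ?e ka r)"
    unfolding J2_def using J dis
    by (subst sum.union_disjoint) (auto simp: sum.reindex[OF sh] e1[OF ka, unfolded J2_def] e2[OF ka, unfolded J2_def])
  qed
  also have "\<dots> = 2 * FF R C P"
   unfolding FF_def J_def[symmetric] trace_expectation[OF J] by (simp only: sum.distrib mult_2)
  finally show ?thesis .
 qed
 have m: "?m = 2 * (\<tau> ^ P * (real K * real (card J)))"
  by (simp add: card_DD card2)
 have "2 * (2 * FF R C P + \<tau> ^ P * (real K * real (card J)))
  \<le> 2 * (exp (2 * ?c) * (FF R2 C2 P + \<tau> ^ P * (real K * real (card J))))"
  using main unfolding f_def F1 F2 m by (simp add: algebra_simps)
 then have "2 * FF R C P + \<tau> ^ P * (real K * real (card J))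
  \<le> exp (2 * ?c) * (FF R2 C2 P + \<tau> ^ P * (real K * real (card J)))"
  by simp
 then show ?thesis
  using fin card2 J2_eq by (intro exI[of _ R2] exI[of _ C2]) (auto simp: R2_def C2_def J_def n_def)
qed

end

section \<open>Limits of moments\<close>

definition ind :: "nat set => nat => real" where "ind A r = (if r \<in> A then 1 else 0)"

lemma ex_power2_ge: "\<exists>s. (n :: nat) \<le> 2 ^ Suc s"
proof -
 have "n < 2 ^ n" by (rule less_exp)
 also have "2 ^ n \<le> (2 :: nat) ^ Suc n" by simp
 finally show ?thesis by (intro exI[of _ n]) simp
qed

lemma ind_le [simp]: "\<bar>ind A r\<bar> \<le> 1"
 by (simp add: ind_def)

lemma ind_mult: "(%r. ind A r * ind A r) = ind A"
 by (auto simp: ind_def)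

locale bipartite = coeffs K l a for K l a +
 fixes k1 :: nat
 assumes k1: "0 < k1" "k1 < K"
  and bip: "!!i ka mu. a i ka mu \<noteq> 0 ==> ka < k1 \<and> k1 \<le> mu \<and> mu < K"
begin

lemma csum_eq: "csum f = (\<Sum>i<l. \<Sum>ka<K. \<Sum>mu<K. \<Sum>ka'<K. \<Sum>mu'<K. a i ka mu * a i ka' mu' * f ka mu ka' mu')"
 by (rule csum_def[OF finite.emptyI])

lemma csum_cong_bip:
 assumes "!!ka mu ka' mu'. ka < k1 ==> k1 \<le> mu ==> mu < K ==> ka' < k1 ==> k1 \<le> mu' ==> mu' < K ==>
  f ka mu ka' mu' = g ka mu ka' mu'"
 shows "csum f = csum g"
 unfolding csum_eq
proof (intro sum.cong refl)
 fix i ka mu ka' mu'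
 show "a i ka mu * a i ka' mu' * f ka mu ka' mu' = a i ka mu * a i ka' mu' * g ka mu ka' mu'"
 proof (cases "a i ka mu = 0 \<or> a i ka' mu' = 0")
  case False
  then show ?thesis using bip assms by metis
 qed auto
qed

lemma tendsto_csum:
 assumes "!!ka mu ka' mu'. ka < k1 ==> k1 \<le> mu ==> mu < K ==> ka' < k1 ==> k1 \<le> mu' ==> mu' < K ==>
  (%N. f N ka mu ka' mu') \<longlonglongrightarrow> g ka mu ka' mu'"
 shows "(%N. csum (f N)) \<longlonglongrightarrow> csum g"
 unfolding csum_eq
proof (intro tendsto_sum)
 fix i ka mu ka' mu'
 show "(%N. a i ka mu * a i ka' mu' * f N ka mu ka' mu') \<longlonglongrightarrow> a i ka mu * a i ka' mu' * g ka mu ka' mu'"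
 proof (cases "a i ka mu = 0 \<or> a i ka' mu' = 0")
  case True
  then show ?thesis by auto
 next
  case False
  then have "(%N. f N ka mu ka' mu') \<longlonglongrightarrow> g ka mu ka' mu'" using bip assms by metis
  then show ?thesis by (rule tendsto_mult_left)
 qed
qed

lemma csum_divide: "csum f / c = csum (%ka mu ka' mu'. f ka mu ka' mu' / c)"
 unfolding csum_eq by (simp add: sum_divide_distrib)

definition HH :: "real => (nat => nat => real) => (nat => nat => real) => nat => nat => real" where
 "HH \<alpha> A B ka0 ka0' = csum (%ka mu ka' mu'. if ka = ka0 then A mu mu' * B ka' ka0' else 0)
   + csum (%ka mu ka' mu'. if mu' = ka0 then \<alpha> * A ka' ka * B mu ka0' else 0)"

text \<open>The limits of the normalised block moments \<open>EM\<close>. The two summands of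
 \<open>HH\<close> correspond to the row and the column block, and \<open>\<alpha>\<close> is the
 quotient of their dimensions.\<close>

function Mo :: "real => nat => nat => nat => real" where
 "Mo \<alpha> 0 = (%ka ka'. if ka = ka' then 1 else 0)"
| "Mo \<alpha> (Suc 0) = (%ka ka'. 0)"
| "Mo \<alpha> (Suc (Suc p)) = (%ka ka'. \<Sum>j\<le>p. HH \<alpha> (Mo \<alpha> (p - j)) (Mo \<alpha> j) ka ka')"
 by pat_completeness auto
termination by (relation "Wellfounded.measure snd") auto

definition side :: "nat set => nat set => nat => nat set" where
 "side R C ka = (if ka < k1 then R else C)"

definition Gam :: "nat set => nat set => (nat \<times> nat) lmat" where
 "Gam R J = (\<Sum>ka<k1. BB J ka ka (ind R))"

definition tt :: "real => nat => real" where
 "tt \<alpha> p = (\<Sum>ka<k1. Mo \<alpha> p ka ka)"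

lemma adm_Gam: "finite J ==> adm (DD J) (Gam R J)"
 unfolding Gam_def by (intro adm_sum) simp

lemma ent_Gam_times:
 assumes J: "finite J" and "ka < K" "r \<in> J"
 shows "ent (Gam R J * Y) (ka, r) q = (if ka < k1 \<and> r \<in> R then ent Y (ka, r) q else 0)"
proof -
 have "ent (Gam R J * Y) (ka, r) q = (\<Sum>ka'<k1. if ka' = ka then ind R r * ent Y (ka, r) q else 0)"
  unfolding Gam_def sum_distrib_right ent_sum
  using assms k1 by (intro sum.cong refl) (auto simp: ent_BB_times[OF J])
 then show ?thesis by (auto simp: ind_def)
qed

lemma Gam_props:
 assumes J: "finite J"
 shows "tp (Gam R J) = Gam R J" "Gam R J * Gam R J = Gam R J"
proof -
 show "tp (Gam R J) = Gam R J" unfolding Gam_def tp_sum by (simp add: tp_BB[OF J])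
 have "Gam R J * Gam R J = (\<Sum>ka<k1. \<Sum>ka'<k1. if ka' = ka then BB J ka ka (ind R) else 0)"
  unfolding Gam_def sum_product using k1 by (intro sum.cong refl) (auto simp: BB_mult[OF J] ind_mult)
 then show "Gam R J * Gam R J = Gam R J" by (simp add: Gam_def)
qed

lemma tr_Gam_half:
 assumes fin: "finite R" "finite C" and J: "J = R \<union> C" and p: "0 < p"
 shows "tr (DD J) (XW J (wb R C) x ^ p) = 2 * tr (DD J) (Gam R J * XW J (wb R C) x ^ p)"
proof -
 have finJ: "finite J" using fin J by simp
 let ?X = "XW J (wb R C) x" and ?G = "Gam R J"
 have X: "ent ?X (ka, r) (mu, c) = 0"
  if "ka < K" "mu < K" "r \<in> J" "c \<in> J" "(ka < k1 \<and> r \<in> R) = (mu < k1 \<and> c \<in> R)" for ka mu r c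
 proof -
  have "W (wb R C) (i, r, c) * x (i, r, c) * a i ka mu = 0 \<and> W (wb R C) (i, c, r) * x (i, c, r) * a i mu ka = 0" for i
   using that bip[of i ka mu] bip[of i mu ka] by (auto simp: wb_def)
  then show ?thesis using that by (simp add: ent_XX[OF finJ])
 qed
 have supp: "ent ?X p q = 0" if pq: "p \<notin> DD J \<or> q \<notin> DD J" for p q
 proof -
  have U: "ent (UU J i r c) u v = 0" if "u \<notin> DD J \<or> v \<notin> DD J" for i r c u v
   using that unfolding UU_def by (subst ent_mk[OF finite_DD[OF finJ]]) auto
  have "ent (Del J e) p q = 0" for e
  proof -
   obtain i r c where e: "e = (i, r, c)" by (cases e) auto
   have "ent (UU J i r c) p q = 0" "ent (UU J i r c) q p = 0" using U pq by blast+
   then show ?thesis by (simp add: Del_def e)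
  qed
  then show ?thesis unfolding XX_def ent_sum by simp
 qed
 have GX: "?G * ?X = ?X - ?X * ?G"
 proof (rule lmat_eqI)
  fix p q
  have XG: "ent (?X * ?G) p q = ent (?G * ?X) q p"
  proof -
   have "?X * ?G = tp (?G * ?X)" using finJ by (simp add: tp_mult Gam_props)
   then show ?thesis by simp
  qed
  show "ent (?G * ?X) p q = ent (?X - ?X * ?G) p q"
  proof (cases "p \<in> DD J \<and> q \<in> DD J")
   case True
   then obtain ka r mu c where pq: "p = (ka, r)" "q = (mu, c)" "ka < K" "r \<in> J" "mu < K" "c \<in> J"
    by (cases p; cases q) auto
   have sym: "ent ?X (mu, c) (ka, r) = ent ?X (ka, r) (mu, c)"
    using tp_XX[OF finJ] ent_tp by metis
   show ?thesis
    unfolding ent_diff XG unfolding pq(1,2)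
    using pq X[of ka mu r c] sym
    by (cases "ka < k1 \<and> r \<in> R"; cases "mu < k1 \<and> c \<in> R") (auto simp: ent_Gam_times[OF finJ])
  next
   case False
   have Z: "ent (?G * ?X) u v = 0" if "u \<notin> DD J \<or> v \<notin> DD J" for u v
   proof -
    have 1: "ent ?G u w = 0 \<or> ent ?X w v = 0" for w
     using that supp[of w v] adm_Gam[OF finJ, of R]
     unfolding Gam_def ent_sum using finJ
     by (cases "u \<in> DD J") (auto simp: BB_def ent_mk)
    show ?thesis by (subst ent_times_on[of "{}"]) (use 1 in auto)
   qed
   show ?thesis unfolding ent_diff XG using False Z[of p q] Z[of q p] supp[of p q] by auto
  qed
 qed
 obtain q where q: "p = Suc q" using p by (cases p) auto
 have ad: "adm (DD J) ?X" "adm (DD J) ?G" using finJ by (auto simp: adm_Gam)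
 have "tr (DD J) (?G * ?X ^ p) = tr (DD J) ((?G * ?X) * ?X ^ q)" by (simp add: q mult.assoc)
 also have "\<dots> = tr (DD J) (?X ^ p) - tr (DD J) ((?X * ?G) * ?X ^ q)"
  unfolding GX by (simp add: q left_diff_distrib)
 also have "tr (DD J) ((?X * ?G) * ?X ^ q) = tr (DD J) (?X * (?G * ?X ^ q))" by (simp add: mult.assoc)
 also have "\<dots> = tr (DD J) ((?G * ?X ^ q) * ?X)" using ad finJ by (intro tr_commute) auto
 also have "\<dots> = tr (DD J) (?G * ?X ^ p)" by (simp only: q power_Suc2 mult.assoc)
 finally show ?thesis by simp
qed

lemma tr_Gam:
 assumes J: "finite J"
 shows "tr (DD J) (Gam R J * Y) = (\<Sum>ka<k1. tr (DD J) (BB J ka ka (ind R) * Y))"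
 unfolding Gam_def sum_distrib_right tr_sum ..

end

locale bip_seq = bipartite K l a k1 for K l a k1 +
 fixes R C :: "nat => nat set" and \<alpha> :: real
 assumes fin: "!!N. finite (R N)" "!!N. finite (C N)"
  and nz: "!!N. 0 < card (R N)" "!!N. 0 < card (C N)"
  and Rinf: "filterlim (%N. card (R N)) at_top sequentially"
  and Cinf: "filterlim (%N. card (C N)) at_top sequentially"
  and ratio: "(%N. real (card (R N)) / real (card (C N))) \<longlonglongrightarrow> \<alpha>"
begin

abbreviation "JJ N \<equiv> R N \<union> C N"
abbreviation "XN N x \<equiv> XW (JJ N) (wb (R N) (C N)) x"
abbreviation "GN N \<equiv> gm (EE (JJ N)) :: (nat \<times> nat \<times> nat => real) measure"
abbreviation "DN N \<equiv> DD (JJ N)"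

lemma finJJ: "finite (JJ N)" using fin by simp

lemma inv_card_0: "(%N. 1 / real (card (side (R N) (C N) ka))) \<longlonglongrightarrow> 0"
proof -
 have "filterlim (%N. real (card (side (R N) (C N) ka))) at_top sequentially"
  unfolding side_def using filterlim_compose[OF filterlim_real_sequentially Rinf]
   filterlim_compose[OF filterlim_real_sequentially Cinf] by (cases "ka < k1") auto
 then show ?thesis by (intro tendsto_divide_0[OF tendsto_const] filterlim_at_top_imp_at_infinity)
qed

lemma card_bound: "\<exists>B>0. \<forall>N. 1 / real (card (C N)) * (real (card (DN N)) + 1) \<le> B"
proof -
 from ratio have "Bseq (%N. real (card (R N)) / real (card (C N)))"
  by (intro convergent_imp_Bseq convergentI)
 then obtain B where B: "0 < B" "!!N. \<bar>real (card (R N)) / real (card (C N))\<bar> \<le> B"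
  by (auto simp: Bseq_def)
 show ?thesis
 proof (intro exI[of _ "real K * (B + 1) + 1"] conjI allI)
  show "0 < real K * (B + 1) + 1" using B(1) by (auto intro: add_nonneg_pos)
  fix N
  show "1 / real (card (C N)) * (real (card (DN N)) + 1) \<le> real K * (B + 1) + 1"
  proof (cases "card (C N) = 0")
   case True
   then show ?thesis using B(1) by auto
  next
   case False
   let ?n = "real (card (C N))" and ?m = "real (card (R N))"
   have n: "1 \<le> ?n" using False by linarith
   have "card (JJ N) \<le> card (R N) + card (C N)" by (rule card_Un_le)
   then have "real (card (DN N)) \<le> real K * (?m + ?n)"
    unfolding card_DD of_nat_mult by (intro mult_left_mono) linarith+
   then have "1 / ?n * (real (card (DN N)) + 1) \<le> 1 / ?n * (real K * (?m + ?n) + 1)"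
    using n by (intro mult_left_mono) auto
   also have "\<dots> = real K * (?m / ?n + 1) + 1 / ?n" using n by (simp add: field_simps)
   also have "\<dots> \<le> real K * (B + 1) + 1"
    using B(2)[of N] n by (intro add_mono mult_left_mono) auto
   finally show ?thesis .
  qed
 qed
qed

lemma Phi_bound: "\<exists>\<tau>>0. \<forall>N. FF (R N) (C N) (2 ^ Suc s) \<le> \<tau> ^ (2 ^ Suc s) * real (card (DN N))"
proof -
 obtain B where B: "0 < B" "!!N. 1 / real (card (C N)) * (real (card (DN N)) + 1) \<le> B"
  using card_bound by blast
 let ?P = "2 ^ Suc s :: nat"
 define \<tau> where "\<tau> = 1 + 16 * real ?P * AA * B"
 have AA0: "0 \<le> AA" by (rule AA_nonneg[OF finJJ])
 then have \<tau>: "1 \<le> \<tau>" using B unfolding \<tau>_def by (auto intro!: mult_nonneg_nonneg)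
 have "FF (R N) (C N) ?P \<le> \<tau> ^ ?P * real (card (DN N))" for N
  unfolding FF_def
 proof (rule apriori_bound[OF finJJ wts_wb[OF fin] refl])
  have "16 * real ?P * (1 / real (card (C N))) * AA * (real (card (DN N)) + 1)
   = 16 * real ?P * AA * (1 / real (card (C N)) * (real (card (DN N)) + 1))" by simp
  also have "\<dots> \<le> 16 * real ?P * AA * B" using AA0 B by (intro mult_left_mono) auto
  also have "\<dots> \<le> \<tau>" by (simp add: \<tau>_def)
  also have "\<dots> \<le> \<tau>\<^sup>2" using \<tau> by (simp add: power2_eq_square)
  finally show "16 * real ?P * (1 / real (card (C N))) * AA * (real (card (DN N)) + 1) \<le> \<tau>\<^sup>2" .
 qed (use \<tau> in simp)
 then show ?thesis using \<tau> by (intro exI[of _ \<tau>]) auto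
qed

lemma small_BBN: "ka < K ==> mu < K ==> small (DN N) (BB (JJ N) ka mu (ind A))"
 by (intro small_BB[OF finJJ]) auto

lemma cov_bounded:
 assumes lt: "ka < K" "mu < K" "ka' < K" "mu' < K"
 shows "\<exists>A. \<forall>N.
  \<bar>(\<integral>x. tr (DN N) (BB (JJ N) ka mu (ind (S N)) * XN N x ^ p) * tr (DN N) (BB (JJ N) ka' mu' (ind (S' N)) * XN N x ^ q) \<partial>GN N)
   - (\<integral>x. tr (DN N) (BB (JJ N) ka mu (ind (S N)) * XN N x ^ p) \<partial>GN N) *
    (\<integral>x. tr (DN N) (BB (JJ N) ka' mu' (ind (S' N)) * XN N x ^ q) \<partial>GN N)\<bar> \<le> A"
proof -
 obtain s where s: "p + q + 2 \<le> 2 ^ Suc s"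
  using ex_power2_ge by blast
 let ?P = "2 ^ Suc s :: nat"
 obtain \<tau> where \<tau>: "0 < \<tau>" "!!N. FF (R N) (C N) ?P \<le> \<tau> ^ ?P * real (card (DN N))"
  using Phi_bound by blast
 obtain B where B: "0 < B" "!!N. 1 / real (card (C N)) * (real (card (DN N)) + 1) \<le> B"
  using card_bound by blast
 let ?c = "16 * AA * real p * real q * (3 * \<tau> ^ ?P / \<tau> ^ (?P - (p + q - 2)))"
 have AA0: "0 \<le> AA" by (rule AA_nonneg[OF finJJ])
 have c0: "0 \<le> ?c" using AA0 \<tau> by simp
 show ?thesis
 proof (intro exI[of _ "?c * B"] allI)
  fix N
  let ?\<nu> = "1 / real (card (C N))" and ?M = "real (card (DN N))"
  have "\<bar>(\<integral>x. tr (DN N) (BB (JJ N) ka mu (ind (S N)) * XN N x ^ p) * tr (DN N) (BB (JJ N) ka' mu' (ind (S' N)) * XN N x ^ q) \<partial>GN N)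
   - (\<integral>x. tr (DN N) (BB (JJ N) ka mu (ind (S N)) * XN N x ^ p) \<partial>GN N) *
    (\<integral>x. tr (DN N) (BB (JJ N) ka' mu' (ind (S' N)) * XN N x ^ q) \<partial>GN N)\<bar>
   \<le> 16 * ?\<nu> * AA * real p * real q * ((2 * FF (R N) (C N) ?P + \<tau> ^ ?P * ?M) / \<tau> ^ (?P - (p + q - 2)))"
   unfolding FF_def
   by (rule covariance_bound[OF finJJ wts_wb[OF fin] small_BBN small_BBN refl s \<tau>(1)]) (use lt in auto)
  also have "\<dots> \<le> 16 * ?\<nu> * AA * real p * real q * ((3 * (\<tau> ^ ?P * ?M)) / \<tau> ^ (?P - (p + q - 2)))"
   using AA0 \<tau>(1) \<tau>(2)[of N] by (intro mult_left_mono divide_right_mono) (auto simp: mult.commute)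
  also have "\<dots> = ?c * (?\<nu> * ?M)" by (simp add: mult_ac)
  also have "\<dots> \<le> ?c * (?\<nu> * (?M + 1))" by (intro mult_left_mono c0) auto
  also have "\<dots> \<le> ?c * B" by (intro mult_left_mono c0 B)
  finally show "\<bar>(\<integral>x. tr (DN N) (BB (JJ N) ka mu (ind (S N)) * XN N x ^ p) * tr (DN N) (BB (JJ N) ka' mu' (ind (S' N)) * XN N x ^ q) \<partial>GN N)
   - (\<integral>x. tr (DN N) (BB (JJ N) ka mu (ind (S N)) * XN N x ^ p) \<partial>GN N) *
    (\<integral>x. tr (DN N) (BB (JJ N) ka' mu' (ind (S' N)) * XN N x ^ q) \<partial>GN N)\<bar> \<le> ?c * B" .
 qed
qed

lemma word_bounded:
 assumes small: "!!N. small (DN N) (B1 N)" "!!N. small (DN N) (B2 N)"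
 shows "\<exists>A. \<forall>N. \<bar>\<integral>x. tr (DN N) (B1 N * XN N x ^ p * (B2 N * XN N x ^ q)) \<partial>GN N\<bar> \<le> A * real (card (C N))"
proof -
 obtain s where s: "p + q + 2 \<le> 2 ^ Suc s"
  using ex_power2_ge by blast
 let ?P = "2 ^ Suc s :: nat"
 obtain \<tau> where \<tau>: "0 < \<tau>" "!!N. FF (R N) (C N) ?P \<le> \<tau> ^ ?P * real (card (DN N))"
  using Phi_bound by blast
 obtain B where B: "0 < B" "!!N. 1 / real (card (C N)) * (real (card (DN N)) + 1) \<le> B"
  using card_bound by blast
 let ?c = "2 * \<tau> ^ ?P / \<tau> ^ (?P - (p + q))"
 have c0: "0 \<le> ?c" using \<tau> by simp
 show ?thesis
 proof (intro exI[of _ "?c * B"] allI)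
  fix N
  note sm = small[of N]
  interpret prob_space "GN N" by (rule prob_space_gm)
  let ?w = "%x. tr (DN N) (B1 N * XN N x ^ p * (B2 N * XN N x ^ q))"
  let ?M = "real (card (DN N))"
  have b: "\<bar>?w x\<bar> \<le> (tr (DN N) (XN N x ^ ?P) + \<tau> ^ ?P * ?M) / \<tau> ^ (?P - (p + q))" for x
   by (rule word2[OF _ _ _ sm refl s \<tau>(1)]) (use finJJ in auto)
  have "\<bar>\<integral>x. ?w x \<partial>GN N\<bar> \<le> (\<integral>x. (tr (DN N) (XN N x ^ ?P) + \<tau> ^ ?P * ?M) / \<tau> ^ (?P - (p + q)) \<partial>GN N)"
  proof (rule order_trans[OF integral_abs_bound integral_mono'])
   show "integrable (GN N) (%x. (tr (DN N) (XN N x ^ ?P) + \<tau> ^ ?P * ?M) / \<tau> ^ (?P - (p + q)))"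
    using XW_integrable'[OF finJJ] by (intro integrable_divide Bochner_Integration.integrable_add) auto
  qed (use b in \<open>auto intro: order_trans[OF abs_ge_zero]\<close>)
  also have "\<dots> = (FF (R N) (C N) ?P + \<tau> ^ ?P * ?M) / \<tau> ^ (?P - (p + q))"
   using XW_integrable'[OF finJJ, of N "wb (R N) (C N)" ?P] by (simp add: FF_def Phi_def prob_space)
  also have "\<dots> \<le> (2 * (\<tau> ^ ?P * ?M)) / \<tau> ^ (?P - (p + q))"
   using \<tau>(1) \<tau>(2)[of N] by (intro divide_right_mono) (auto simp: mult.commute)
  also have "\<dots> = ?c * ?M" by simp
  also have "\<dots> \<le> ?c * (B * real (card (C N)))"
  proof (rule mult_left_mono[OF _ c0])
   show "?M \<le> B * real (card (C N))" using B(2)[of N] nz(2)[of N] by (simp add: field_simps)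
  qed
  finally show "\<bar>\<integral>x. ?w x \<partial>GN N\<bar> \<le> ?c * B * real (card (C N))" by (simp add: mult.assoc)
 qed
qed

definition SN :: "nat => nat => real" where "SN N ka = real (card (side (R N) (C N) ka))"

lemma SN_pos: "0 < SN N ka"
 using nz by (simp add: SN_def side_def)

definition EM :: "nat => nat => nat => nat => real" where
 "EM N p ka ka' = (\<integral>x. tr (DN N) (BB (JJ N) ka' ka (ind (side (R N) (C N) ka)) * XN N x ^ p) \<partial>GN N) / SN N ka"

lemma EM_0: "ka < K ==> ka' < K ==> EM N 0 ka ka' = Mo \<alpha> 0 ka ka'"
proof -
 assume lt: "ka < K" "ka' < K"
 interpret prob_space "GN N" by (rule prob_space_gm)
 let ?A = "side (R N) (C N) ka"
 have "?A \<subseteq> JJ N" by (auto simp: side_def)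
 then have "(\<Sum>r\<in>JJ N. ind ?A r) = real (card ?A)"
  unfolding ind_def using finJJ[of N] by (simp add: sum.If_cases Int_absorb1)
 then have "tr (DN N) (BB (JJ N) ka' ka (ind ?A)) = (if ka = ka' then SN N ka else 0)"
  using tr_BB_times[OF finJJ lt(2,1), of N "ind ?A" 1] by (auto simp: SN_def)
 then show ?thesis using SN_pos[of N ka] SN_pos[of N ka'] by (auto simp: EM_def prob_space)
qed

lemma EM_1: "ka < K ==> ka' < K ==> EM N (Suc 0) ka ka' = 0"
proof -
 assume "ka < K" "ka' < K"
 have ad: "adm (DN N) (BB (JJ N) ka' ka (ind (side (R N) (C N) ka)))" using finJJ by simp
 show ?thesis unfolding EM_def trace_power_ibp[OF finJJ ad] by simp
qed

lemma EM_rec: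
 fixes N :: nat
 assumes lt: "ka0 < K" "ka0' < K"
 defines "Q \<equiv> BB (JJ N) ka0' ka0 (ind (side (R N) (C N) ka0))"
 shows "EM N (Suc (Suc p)) ka0 ka0' = (\<Sum>j\<le>p.
   csum (%ka mu ka' mu'. (\<integral>x. tr (DN N) (BB (JJ N) mu' mu (ind (C N)) * XN N x ^ (p - j)) *
    tr (DN N) ((Q * BB (JJ N) ka ka' (ind (R N))) * XN N x ^ j) \<partial>GN N) / (SN N k1 * SN N ka0))
  + csum (%ka mu ka' mu'. (\<integral>x. tr (DN N) ((Q * BB (JJ N) mu' mu (ind (C N))) * XN N x ^ j) *
    tr (DN N) (BB (JJ N) ka ka' (ind (R N)) * XN N x ^ (p - j)) \<partial>GN N) / (SN N k1 * SN N ka0))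
  + csum (%ka mu ka' mu'. (\<integral>x. tr (DN N) (BB (JJ N) mu' mu (ind (C N)) * XN N x ^ (p - j) *
    ((BB (JJ N) ka' ka (ind (R N)) * tp Q) * XN N x ^ j)) \<partial>GN N) / (SN N k1 * SN N ka0))
  + csum (%ka mu ka' mu'. (\<integral>x. tr (DN N) ((BB (JJ N) mu' mu (ind (C N)) * tp Q) * XN N x ^ j *
    (BB (JJ N) ka' ka (ind (R N)) * XN N x ^ (p - j))) \<partial>GN N) / (SN N k1 * SN N ka0)))"
  (is "_ = (\<Sum>j\<le>p. csum (?E1 j) + csum (?E2 j) + csum (?E3 j) + csum (?E4 j))")
proof -
 let ?J = "JJ N" and ?D = "DN N" and ?X = "XN N"
 note J = finJJ[of N]
 have ad: "adm ?D (BB ?J ka mu \<sigma>)" for ka mu \<sigma> using J by simp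
 have adQ: "adm ?D Q" "adm ?D (tp Q)" using ad by (auto simp: Q_def)
 let ?n = "real (card (C N))"
 have nS: "SN N k1 = ?n" by (simp add: SN_def side_def)
 define T1 where "T1 j x ka mu ka' mu' = tr ?D (BB ?J mu' mu (ind (C N)) * ?X x ^ (p - j)) *
    tr ?D ((Q * BB ?J ka ka' (ind (R N))) * ?X x ^ j)" for j x ka mu ka' mu'
 define T2 where "T2 j x ka mu ka' mu' = tr ?D ((Q * BB ?J mu' mu (ind (C N))) * ?X x ^ j) *
    tr ?D (BB ?J ka ka' (ind (R N)) * ?X x ^ (p - j))" for j x ka mu ka' mu'
 define T3 where "T3 j x ka mu ka' mu' = tr ?D (BB ?J mu' mu (ind (C N)) * ?X x ^ (p - j) *
    ((BB ?J ka' ka (ind (R N)) * tp Q) * ?X x ^ j))" for j x ka mu ka' mu'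
 define T4 where "T4 j x ka mu ka' mu' = tr ?D ((BB ?J mu' mu (ind (C N)) * tp Q) * ?X x ^ j *
    (BB ?J ka' ka (ind (R N)) * ?X x ^ (p - j)))" for j x ka mu ka' mu'
 have inner: "(\<Sum>e\<in>EE ?J. (W (wb (R N) (C N)) e)\<^sup>2 *
   tr ?D (Del ?J e * ?X x ^ (Suc p - 1 - j) * (Del ?J e * (?X x ^ j * Q))))
  = (csum (T1 j x) + csum (T2 j x) + csum (T3 j x) + csum (T4 j x)) / ?n" for j x
 proof -
  have adX: "adm ?D (?X x ^ (p - j))" "adm ?D (?X x ^ j * Q)" using J adQ by auto
  have swap: "tr ?D (B * (?X x ^ j * Q)) = tr ?D ((Q * B) * ?X x ^ j)" if "adm ?D B" for B
  proof -
   have "tr ?D ((B * ?X x ^ j) * Q) = tr ?D (Q * (B * ?X x ^ j))"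
    using that adQ J by (intro tr_commute) auto
   then show ?thesis by (simp only: mult.assoc)
  qed
  have "(\<Sum>e\<in>EE ?J. (W (wb (R N) (C N)) e)\<^sup>2 * tr ?D (Del ?J e * ?X x ^ (Suc p - 1 - j) * (Del ?J e * (?X x ^ j * Q))))
   = (\<Sum>(i, r, c)\<in>EE ?J. ind (R N) r * ind (C N) c *
     tr ?D (Del ?J (i, r, c) * ?X x ^ (p - j) * (Del ?J (i, r, c) * (?X x ^ j * Q)))) / ?n"
   unfolding sum_divide_distrib
   by (intro sum.cong refl) (auto simp: wb_def ind_def power_divide split: prod.splits)
  also have "\<dots> = (csum (T1 j x) + csum (T2 j x) + csum (T3 j x) + csum (T4 j x)) / ?n"
   unfolding sum_Del_Del[OF J adX] T1_def T2_def T3_def T4_def swap[OF ad]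
   using J by (simp only: tp_mult tp_power tp_XX mult.assoc)
  finally show ?thesis .
 qed
 have i1: "integrable (GN N) (%x. csum (T1 j x))" "(\<integral>x. csum (T1 j x) \<partial>GN N) = csum (%ka mu ka' mu'. \<integral>x. T1 j x ka mu ka' mu' \<partial>GN N)"
  and i2: "integrable (GN N) (%x. csum (T2 j x))" "(\<integral>x. csum (T2 j x) \<partial>GN N) = csum (%ka mu ka' mu'. \<integral>x. T2 j x ka mu ka' mu' \<partial>GN N)"
  and i3: "integrable (GN N) (%x. csum (T3 j x))" "(\<integral>x. csum (T3 j x) \<partial>GN N) = csum (%ka mu ka' mu'. \<integral>x. T3 j x ka mu ka' mu' \<partial>GN N)"
  and i4: "integrable (GN N) (%x. csum (T4 j x))" "(\<integral>x. csum (T4 j x) \<partial>GN N) = csum (%ka mu ka' mu'. \<integral>x. T4 j x ka mu ka' mu' \<partial>GN N)"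
  for j
  unfolding T1_def T2_def T3_def T4_def
  by (intro integral_csum[OF J] XW_prod_integrable[OF J] XW_word_integrable[OF J] ad adQ adm_mult)+
 have "EM N (Suc (Suc p)) ka0 ka0' = (\<integral>x. (\<Sum>j<Suc p. (csum (T1 j x) + csum (T2 j x) + csum (T3 j x) + csum (T4 j x)) / ?n) \<partial>GN N) / SN N ka0"
  unfolding EM_def Q_def[symmetric] trace_power_ibp[OF J adQ(1)] inner ..
 also have "\<dots> = (\<Sum>j<Suc p. (csum (%ka mu ka' mu'. \<integral>x. T1 j x ka mu ka' mu' \<partial>GN N)
   + csum (%ka mu ka' mu'. \<integral>x. T2 j x ka mu ka' mu' \<partial>GN N)
   + csum (%ka mu ka' mu'. \<integral>x. T3 j x ka mu ka' mu' \<partial>GN N)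
   + csum (%ka mu ka' mu'. \<integral>x. T4 j x ka mu ka' mu' \<partial>GN N)) / ?n) / SN N ka0"
  by (subst Bochner_Integration.integral_sum)
   (auto simp: i1 i2 i3 i4 intro!: sum.cong)
 also have "\<dots> = (\<Sum>j\<le>p. csum (?E1 j) + csum (?E2 j) + csum (?E3 j) + csum (?E4 j))"
  unfolding csum_divide[symmetric] nS T1_def T2_def T3_def T4_def sum_divide_distrib lessThan_Suc_atMost
  by (simp add: add_divide_distrib)
 finally show ?thesis .
qed

lemma bounded_div_0:
 assumes "!!N. \<bar>f N\<bar> \<le> A" "g \<longlonglongrightarrow> 0"
 shows "(%N. f N * g N :: real) \<longlonglongrightarrow> 0"
proof (rule Lim_null_comparison)
 show "\<forall>\<^sub>F N in sequentially. norm (f N * g N) \<le> A * \<bar>g N\<bar>"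
  using assms(1) by (intro always_eventually allI) (simp add: abs_mult mult_right_mono)
 show "(%N. A * \<bar>g N\<bar>) \<longlonglongrightarrow> 0"
  using tendsto_mult_right_zero[OF tendsto_rabs_zero[OF assms(2)]] .
qed

lemma product_limit:
 assumes lt: "ka < K" "mu < K" "ka' < K" "mu' < K"
  and u: "(%N. EM N p mu ka) \<longlonglongrightarrow> x" and v: "(%N. EM N q mu' ka') \<longlonglongrightarrow> y"
 shows "(%N. (\<integral>x. tr (DN N) (BB (JJ N) ka mu (ind (side (R N) (C N) mu)) * XN N x ^ p) *
    tr (DN N) (BB (JJ N) ka' mu' (ind (side (R N) (C N) mu')) * XN N x ^ q) \<partial>GN N) / (SN N mu * SN N mu'))
  \<longlonglongrightarrow> x * y"
proof -
 let ?u = "%N x. tr (DN N) (BB (JJ N) ka mu (ind (side (R N) (C N) mu)) * XN N x ^ p)"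
 let ?v = "%N x. tr (DN N) (BB (JJ N) ka' mu' (ind (side (R N) (C N) mu')) * XN N x ^ q)"
 let ?cov = "%N. (\<integral>x. ?u N x * ?v N x \<partial>GN N) - (\<integral>x. ?u N x \<partial>GN N) * (\<integral>x. ?v N x \<partial>GN N)"
 obtain A where A: "!!N. \<bar>?cov N\<bar> \<le> A"
  using cov_bounded[OF lt, of "%N. side (R N) (C N) mu" p "%N. side (R N) (C N) mu'" q] by blast
 have "(%N. 1 / SN N mu * (1 / SN N mu')) \<longlonglongrightarrow> 0 * 0"
  unfolding SN_def by (intro tendsto_mult inv_card_0)
 then have 1: "(%N. ?cov N * (1 / SN N mu * (1 / SN N mu'))) \<longlonglongrightarrow> 0"
  by (intro bounded_div_0[OF A]) simp
 have 2: "(%N. EM N p mu ka * EM N q mu' ka') \<longlonglongrightarrow> x * y"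
  by (intro tendsto_mult u v)
 have "(\<integral>x. ?u N x * ?v N x \<partial>GN N) / (SN N mu * SN N mu')
  = ?cov N * (1 / SN N mu * (1 / SN N mu')) + EM N p mu ka * EM N q mu' ka'" for N
  unfolding EM_def using SN_pos[of N mu] SN_pos[of N mu'] by (simp add: field_simps)
 then show ?thesis using tendsto_add[OF 1 2] by simp
qed

text \<open>In the integration by parts formula the products of two traces factorise by
 \<open>covariance_bound\<close>, and the words with a reversed part carry one normalisation too
 many.\<close>

theorem EM_limit:
 "ka0 < K ==> ka0' < K ==> (%N. EM N p ka0 ka0') \<longlonglongrightarrow> Mo \<alpha> p ka0 ka0'"
proof (induction p arbitrary: ka0 ka0' rule: less_induct)
 case (less p)
 note lt = less.prems
 consider "p = 0" | "p = Suc 0" | q where "p = Suc (Suc q)"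
  by (metis not0_implies_Suc)
 then show ?case
 proof cases
  case 1
  then show ?thesis using EM_0[OF lt] by simp
 next
  case 2
  then show ?thesis using EM_1[OF lt] by simp
 next
  case (3 p)
  have IH: "(%N. EM N j ka ka') \<longlonglongrightarrow> Mo \<alpha> j ka ka'" if "j \<le> p" "ka < K" "ka' < K" for j ka ka'
   using less.IH[of j ka ka'] that 3 by simp
  define Q where "Q N = BB (JJ N) ka0' ka0 (ind (side (R N) (C N) ka0))" for N
  have smQ: "small (DN N) (Q N)" for N unfolding Q_def using small_BBN[of ka0' ka0] lt by simp
  have small0: "small (DN N) 0" for N by (simp add: small_def power_0_left)
  have QBB: "Q N * BB (JJ N) ka mu \<sigma> = (if ka0 = ka then BB (JJ N) ka0' mu (%r. ind (side (R N) (C N) ka0) r * \<sigma> r) else 0)"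
   for N ka mu \<sigma>
   unfolding Q_def by (rule BB_mult[OF finJJ lt(1)])
  have BQ: "small (DN N) (BB (JJ N) ka mu (ind S) * tp (Q N))" if "ka < K" "mu < K" for N ka mu S
   unfolding Q_def tp_BB[OF finJJ] BB_mult[OF finJJ that(2)]
   using that lt small0 by (auto intro!: small_BB[OF finJJ] simp: ind_def)
  have word0: "(%N. f N / (SN N k1 * SN N ka0)) \<longlonglongrightarrow> 0"
   if "!!N. \<bar>f N\<bar> \<le> A * real (card (C N))" for f A
  proof -
   have "\<bar>f N / SN N k1\<bar> \<le> A" for N
    using that[of N] SN_pos[of N k1] by (simp add: SN_def side_def field_simps)
   from bounded_div_0[where f = "%N. f N / SN N k1", OF this inv_card_0[of ka0]] show ?thesis
    by (simp add: SN_def field_simps)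
  qed
  have "(%N. EM N (Suc (Suc p)) ka0 ka0') \<longlonglongrightarrow> (\<Sum>j\<le>p.
    csum (%ka mu ka' mu'. if ka = ka0 then Mo \<alpha> (p - j) mu mu' * Mo \<alpha> j ka' ka0' else 0)
   + csum (%ka mu ka' mu'. if mu' = ka0 then \<alpha> * Mo \<alpha> (p - j) ka' ka * Mo \<alpha> j mu ka0' else 0)
   + csum (%ka mu ka' mu'. 0) + csum (%ka mu ka' mu'. 0))"
   unfolding EM_rec[OF lt] Q_def[symmetric]
  proof (intro tendsto_sum tendsto_add tendsto_csum)
   fix j ka mu ka' mu'
   assume j: "j \<in> {..p}" and i: "ka < k1" "k1 \<le> mu" "mu < K" "ka' < k1" "k1 \<le> mu'" "mu' < K"
   have iK: "ka < K" "ka' < K" using i k1 by auto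
   have sides: "side (R N) (C N) ka = R N" "side (R N) (C N) ka' = R N"
    "side (R N) (C N) mu = C N" "side (R N) (C N) mu' = C N" for N
    using i by (auto simp: side_def)
   have SNs: "SN N ka = SN N 0" "SN N ka' = SN N 0" "SN N mu = SN N k1" "SN N mu' = SN N k1" for N
    using i k1 by (auto simp: side_def SN_def)
   have s1: "small (DN N) (BB (JJ N) mu' mu (ind (C N)))" and s4: "small (DN N) (BB (JJ N) ka' ka (ind (R N)))" for N
    using small_BBN i iK by auto
   have s2: "small (DN N) (BB (JJ N) ka' ka (ind (R N)) * tp (Q N))"
    and s3: "small (DN N) (BB (JJ N) mu' mu (ind (C N)) * tp (Q N))" for N
    using BQ i iK by auto
   show "(%N. (\<integral>x. tr (DN N) (BB (JJ N) mu' mu (ind (C N)) * XN N x ^ (p - j)) *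
     tr (DN N) ((Q N * BB (JJ N) ka ka' (ind (R N))) * XN N x ^ j) \<partial>GN N) / (SN N k1 * SN N ka0))
    \<longlonglongrightarrow> (if ka = ka0 then Mo \<alpha> (p - j) mu mu' * Mo \<alpha> j ka' ka0' else 0)"
   proof (cases "ka = ka0")
    case True
    show ?thesis
     using product_limit[OF i(6,3) lt(2) iK(2) IH IH, of "p - j" j] i iK lt j True
     unfolding QBB sides SNs True[symmetric] by (simp add: ind_mult)
   next
    case False
    then show ?thesis by (simp add: QBB)
   qed
   show "(%N. (\<integral>x. tr (DN N) ((Q N * BB (JJ N) mu' mu (ind (C N))) * XN N x ^ j) *
     tr (DN N) (BB (JJ N) ka ka' (ind (R N)) * XN N x ^ (p - j)) \<partial>GN N) / (SN N k1 * SN N ka0))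
    \<longlonglongrightarrow> (if mu' = ka0 then \<alpha> * Mo \<alpha> (p - j) ka' ka * Mo \<alpha> j mu ka0' else 0)"
   proof (cases "mu' = ka0")
    case True
    let ?I = "%N. \<integral>x. tr (DN N) (BB (JJ N) ka0' mu (ind (C N)) * XN N x ^ j) *
     tr (DN N) (BB (JJ N) ka ka' (ind (R N)) * XN N x ^ (p - j)) \<partial>GN N"
    have "(%N. ?I N / (SN N k1 * SN N 0)) \<longlonglongrightarrow> Mo \<alpha> j mu ka0' * Mo \<alpha> (p - j) ka' ka"
     using product_limit[OF lt(2) i(3) iK IH IH, of j "p - j"] i iK lt j unfolding sides SNs by simp
    moreover have "(%N. SN N 0 / SN N k1) \<longlonglongrightarrow> \<alpha>"
     using ratio k1 by (simp add: SN_def side_def)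
    ultimately have "(%N. ?I N / (SN N k1 * SN N 0) * (SN N 0 / SN N k1))
     \<longlonglongrightarrow> Mo \<alpha> j mu ka0' * Mo \<alpha> (p - j) ka' ka * \<alpha>"
     by (rule tendsto_mult)
    moreover have "?I N / (SN N k1 * SN N 0) * (SN N 0 / SN N k1) = ?I N / (SN N k1 * SN N k1)" for N
     using SN_pos[of N 0] SN_pos[of N k1] by (simp add: field_simps)
    ultimately show ?thesis
     unfolding QBB sides using True SNs(4) by (simp add: ind_mult sides(4)[unfolded True] mult_ac)
   next
    case False
    then show ?thesis by (simp add: QBB)
   qed
   show "(%N. (\<integral>x. tr (DN N) (BB (JJ N) mu' mu (ind (C N)) * XN N x ^ (p - j) *
     ((BB (JJ N) ka' ka (ind (R N)) * tp (Q N)) * XN N x ^ j)) \<partial>GN N) / (SN N k1 * SN N ka0)) \<longlonglongrightarrow> 0"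
   proof -
    obtain A where "!!N. \<bar>\<integral>x. tr (DN N) (BB (JJ N) mu' mu (ind (C N)) * XN N x ^ (p - j) *
     ((BB (JJ N) ka' ka (ind (R N)) * tp (Q N)) * XN N x ^ j)) \<partial>GN N\<bar> \<le> A * real (card (C N))"
     using word_bounded[OF s1 s2, where p = "p - j" and q = j] by blast
    then show ?thesis by (rule word0)
   qed
   show "(%N. (\<integral>x. tr (DN N) ((BB (JJ N) mu' mu (ind (C N)) * tp (Q N)) * XN N x ^ j *
     (BB (JJ N) ka' ka (ind (R N)) * XN N x ^ (p - j))) \<partial>GN N) / (SN N k1 * SN N ka0)) \<longlonglongrightarrow> 0"
   proof -
    obtain A where "!!N. \<bar>\<integral>x. tr (DN N) ((BB (JJ N) mu' mu (ind (C N)) * tp (Q N)) * XN N x ^ j *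
     (BB (JJ N) ka' ka (ind (R N)) * XN N x ^ (p - j))) \<partial>GN N\<bar> \<le> A * real (card (C N))"
     using word_bounded[OF s3 s4, where p = j and q = "p - j"] by blast
    then show ?thesis by (rule word0)
   qed
  qed
  then show ?thesis by (simp add: 3 HH_def csum_eq)
 qed
qed

lemma row_trace_limit:
 "(%N. (\<integral>x. tr (DN N) (Gam (R N) (JJ N) * XN N x ^ p) \<partial>GN N) / real (card (R N))) \<longlonglongrightarrow> tt \<alpha> p"
proof -
 have "(\<integral>x. tr (DN N) (Gam (R N) (JJ N) * XN N x ^ p) \<partial>GN N) / real (card (R N))
  = (\<Sum>ka<k1. EM N p ka ka)" for N
  unfolding tr_Gam[OF finJJ]
  using XW_integrable[OF finJJ adm_BB[OF finJJ]]
  by (simp add: sum_divide_distrib EM_def SN_def side_def)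
 moreover have "(%N. \<Sum>ka<k1. EM N p ka ka) \<longlonglongrightarrow> tt \<alpha> p"
  unfolding tt_def using k1 by (intro tendsto_sum EM_limit) auto
 ultimately show ?thesis by simp
qed

lemma row_trace_square_limit:
 "(%N. (\<integral>x. (tr (DN N) (Gam (R N) (JJ N) * XN N x ^ p) / real (card (R N)))\<^sup>2 \<partial>GN N)) \<longlonglongrightarrow> (tt \<alpha> p)\<^sup>2"
proof -
 let ?u = "%N ka x. tr (DN N) (BB (JJ N) ka ka (ind (R N)) * XN N x ^ p)"
 have "(\<integral>x. (tr (DN N) (Gam (R N) (JJ N) * XN N x ^ p) / real (card (R N)))\<^sup>2 \<partial>GN N)
  = (\<Sum>ka<k1. \<Sum>ka'<k1. (\<integral>x. ?u N ka x * ?u N ka' x \<partial>GN N) / (real (card (R N)) * real (card (R N))))" for N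
 proof -
  have "(\<integral>x. (tr (DN N) (Gam (R N) (JJ N) * XN N x ^ p) / real (card (R N)))\<^sup>2 \<partial>GN N)
   = (\<integral>x. (\<Sum>ka<k1. \<Sum>ka'<k1. ?u N ka x * ?u N ka' x / (real (card (R N)) * real (card (R N)))) \<partial>GN N)"
   unfolding tr_Gam[OF finJJ] power_divide unfolding power2_eq_square sum_product
   by (simp only: sum_divide_distrib)
  also have "\<dots> = (\<Sum>ka<k1. \<Sum>ka'<k1. (\<integral>x. ?u N ka x * ?u N ka' x \<partial>GN N) / (real (card (R N)) * real (card (R N))))"
   using XW_prod_integrable[OF finJJ adm_BB[OF finJJ] adm_BB[OF finJJ]]
   by (simp add: Bochner_Integration.integral_sum Bochner_Integration.integrable_sum)
  finally show ?thesis .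
 qed
 moreover have "(%N. \<Sum>ka<k1. \<Sum>ka'<k1. (\<integral>x. ?u N ka x * ?u N ka' x \<partial>GN N) / (real (card (R N)) * real (card (R N))))
  \<longlonglongrightarrow> (\<Sum>ka<k1. \<Sum>ka'<k1. Mo \<alpha> p ka ka * Mo \<alpha> p ka' ka')"
 proof (intro tendsto_sum)
  fix ka ka' assume "ka \<in> {..<k1}" "ka' \<in> {..<k1}"
  then show "(%N. (\<integral>x. ?u N ka x * ?u N ka' x \<partial>GN N) / (real (card (R N)) * real (card (R N))))
   \<longlonglongrightarrow> Mo \<alpha> p ka ka * Mo \<alpha> p ka' ka'"
   using product_limit[OF _ _ _ _ EM_limit EM_limit, of ka ka ka' ka' p p] k1 by (simp add: side_def SN_def)
 qed
 ultimately show ?thesis by (simp add: tt_def power2_eq_square sum_product)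
qed

end

section \<open>Moments of the limit and submatrices\<close>

lemma triangle_sum_le:
 fixes f g :: "nat => real"
 assumes "!!i. 0 \<le> f i" "!!i. 0 \<le> g i"
 shows "(\<Sum>q\<le>Q. \<Sum>i\<le>q. f i * g (q - i)) \<le> (\<Sum>q\<le>Q. f q) * (\<Sum>q\<le>Q. g q)"
proof -
 have "(\<Sum>q\<le>Q. \<Sum>i\<le>q. f i * g (q - i)) = (\<Sum>(i, j)\<in>{(i, j). i + j \<le> Q}. f i * g j)"
  by (rule sum.triangle_reindex_eq[symmetric])
 also have "\<dots> \<le> (\<Sum>(i, j)\<in>{..Q} \<times> {..Q}. f i * g j)"
  using assms by (intro sum_mono2) auto
 also have "\<dots> = (\<Sum>q\<le>Q. f q) * (\<Sum>q\<le>Q. g q)"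
  by (simp add: sum_product sum.cartesian_product)
 finally show ?thesis .
qed

text \<open>The generating polynomial of \<open>t\<close> is bounded by a supersolution \<open>T\<close> of
 the quadratic fixed point equation, by induction on its degree.\<close>

lemma quadratic_growth:
 fixes t :: "nat => real"
 assumes t: "!!q. 0 \<le> t q" and rec: "!!q. t (Suc q) \<le> c * (t q + \<alpha> * (\<Sum>i<q. t (q - i) * t i))"
  and c: "0 \<le> c" "0 \<le> \<alpha>" "0 < s" and T: "t 0 + s * c * (T + \<alpha> * T\<^sup>2) \<le> T" and T0: "0 \<le> T"
 shows "t q * s ^ q \<le> T"
proof -
 let ?f = "%q. t q * s ^ q"
 have f0: "0 \<le> ?f q" for q using t c by simp
 have S: "(\<Sum>q\<le>Q. ?f q) \<le> T" for Q
 proof (induction Q)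
  case 0
  have "0 \<le> s * c * (T + \<alpha> * T\<^sup>2)" using c T0 by (intro mult_nonneg_nonneg add_nonneg_nonneg) auto
  then show ?case using T by simp
 next
  case (Suc Q)
  let ?S = "\<Sum>q\<le>Q. ?f q"
  have S0: "0 \<le> ?S" using f0 by (intro sum_nonneg) auto
  have "(\<Sum>q\<le>Suc Q. ?f q) = t 0 + (\<Sum>q\<le>Q. ?f (Suc q))"
   by (subst sum.atMost_Suc_shift) simp
  also have "(\<Sum>q\<le>Q. ?f (Suc q)) \<le> (\<Sum>q\<le>Q. s * c * (?f q + \<alpha> * (\<Sum>i\<le>q. ?f i * ?f (q - i))))"
  proof (rule sum_mono)
   fix q
   have "?f (Suc q) \<le> c * (t q + \<alpha> * (\<Sum>i<q. t (q - i) * t i)) * s ^ Suc q"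
    using rec[of q] c by (intro mult_right_mono) auto
   also have "\<dots> = s * c * (?f q + \<alpha> * (\<Sum>i<q. ?f i * ?f (q - i)))"
   proof -
    have "(\<Sum>i<q. t (q - i) * t i) * s ^ q = (\<Sum>i<q. ?f i * ?f (q - i))"
     unfolding sum_distrib_right
    proof (intro sum.cong refl)
     fix i assume "i \<in> {..<q}"
     then have "s ^ q = s ^ i * s ^ (q - i)" by (simp flip: power_add)
     then show "t (q - i) * t i * s ^ q = ?f i * ?f (q - i)" by simp
    qed
    then show ?thesis by (simp add: algebra_simps)
   qed
   also have "\<dots> \<le> s * c * (?f q + \<alpha> * (\<Sum>i\<le>q. ?f i * ?f (q - i)))"
   proof -
    have "(\<Sum>i<q. ?f i * ?f (q - i)) \<le> (\<Sum>i\<le>q. ?f i * ?f (q - i))"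
     by (rule sum_mono2) (auto intro!: mult_nonneg_nonneg t simp: less_imp_le[OF c(3)])
    then show ?thesis using c by (intro mult_left_mono add_left_mono) auto
   qed
   finally show "?f (Suc q) \<le> s * c * (?f q + \<alpha> * (\<Sum>i\<le>q. ?f i * ?f (q - i)))" .
  qed
  also have "\<dots> = s * c * (?S + \<alpha> * (\<Sum>q\<le>Q. \<Sum>i\<le>q. ?f i * ?f (q - i)))"
   by (simp add: sum_distrib_left[symmetric] sum.distrib)
  also have "\<dots> \<le> s * c * (?S + \<alpha> * (?S * ?S))"
   using c triangle_sum_le[OF f0 f0] by (intro mult_left_mono add_left_mono) auto
  also have "\<dots> \<le> s * c * (T + \<alpha> * (T * T))"
   using c Suc.IH S0 T0 by (intro mult_left_mono add_mono mult_mono) auto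
  finally show ?case using T by (simp add: power2_eq_square)
 qed
 have "?f q \<le> (\<Sum>q\<le>q. ?f q)" using f0 by (intro member_le_sum) auto
 then show ?thesis using S[of q] by linarith
qed

context bipartite
begin

lemma Mo_odd: "odd p ==> Mo \<alpha> p ka ka' = 0"
proof (induction p arbitrary: ka ka' rule: less_induct)
 case (less p)
 show ?case
 proof (cases "p = Suc 0")
  case False
  then obtain q where p: "p = Suc (Suc q)" using less.prems
   by (metis even_zero not0_implies_Suc)
  have "HH \<alpha> (Mo \<alpha> (q - j)) (Mo \<alpha> j) ka ka' = 0" if "j \<le> q" for j
  proof (cases "odd j")
   case True
   then have "Mo \<alpha> j x y = 0" for x y using less.IH[of j] that p by simp
   then show ?thesis by (simp add: HH_def csum_eq)
  next
   case False
   then have "Mo \<alpha> (q - j) x y = 0" for x y using less.IH[of "q - j"] that p less.prems by simp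
   then show ?thesis by (simp add: HH_def csum_eq)
  qed
  then show ?thesis by (simp add: p)
 qed simp
qed

definition CC :: "nat => nat => real" where
 "CC ka ka' = (\<Sum>i<l. \<Sum>mu<K. a i ka mu * a i ka' mu)"

definition Psi :: "(nat => nat => real) => (nat => nat => real) => real" where
 "Psi A B = csum (%ka mu ka' mu'. A mu mu' * B ka' ka)"

lemma sum_HH_rows: "(\<Sum>ka0<k1. HH \<alpha> A B ka0 ka0) = Psi A B"
proof -
 have "HH \<alpha> A B ka0 ka0 = csum (%ka mu ka' mu'. if ka = ka0 then A mu mu' * B ka' ka0 else 0)" if "ka0 < k1" for ka0
 proof -
  have "csum (%ka mu ka' mu'. if mu' = ka0 then \<alpha> * A ka' ka * B mu ka0 else 0) = csum (%ka mu ka' mu'. 0)"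
   using that by (intro csum_cong_bip) auto
  then show ?thesis by (simp add: HH_def csum_eq)
 qed
 then have "(\<Sum>ka0<k1. HH \<alpha> A B ka0 ka0)
  = (\<Sum>ka0<k1. csum (%ka mu ka' mu'. if ka = ka0 then A mu mu' * B ka' ka0 else 0))" by simp
 also have "\<dots> = csum (%ka mu ka' mu'. \<Sum>ka0<k1. if ka = ka0 then A mu mu' * B ka' ka0 else 0)"
  unfolding csum_eq sum_distrib_left
  apply (subst sum.swap, rule sum.cong[OF refl])
  apply (subst sum.swap, rule sum.cong[OF refl])
  apply (subst sum.swap, rule sum.cong[OF refl])
  apply (subst sum.swap, rule sum.cong[OF refl])
  apply (subst sum.swap, rule sum.cong[OF refl])
  apply (rule refl)
  done
 also have "\<dots> = Psi A B"
  unfolding Psi_def by (intro csum_cong_bip) auto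
 finally show ?thesis .
qed

lemma tt_Suc: "tt \<alpha> (2 * Suc q) = (\<Sum>i\<le>q. Psi (Mo \<alpha> (2 * (q - i))) (Mo \<alpha> (2 * i)))"
proof -
 have "tt \<alpha> (2 * Suc q) = (\<Sum>ka<k1. \<Sum>j\<le>2 * q. HH \<alpha> (Mo \<alpha> (2 * q - j)) (Mo \<alpha> j) ka ka)"
  unfolding tt_def by simp
 also have "\<dots> = (\<Sum>j\<le>2 * q. Psi (Mo \<alpha> (2 * q - j)) (Mo \<alpha> j))"
  by (subst sum.swap) (simp add: sum_HH_rows)
 also have "\<dots> = (\<Sum>j\<in>(%i. 2 * i) ` {..q}. Psi (Mo \<alpha> (2 * q - j)) (Mo \<alpha> j))"
 proof (rule sum.mono_neutral_right)
  show "\<forall>j\<in>{..2 * q} - (%i. 2 * i) ` {..q}. Psi (Mo \<alpha> (2 * q - j)) (Mo \<alpha> j) = 0"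
  proof
   fix j assume j: "j \<in> {..2 * q} - (%i. 2 * i) ` {..q}"
   have "odd j"
   proof
    assume "even j"
    then obtain i where "j = 2 * i" by (auto elim: evenE)
    then show False using j by auto
   qed
   then show "Psi (Mo \<alpha> (2 * q - j)) (Mo \<alpha> j) = 0" by (simp add: Psi_def Mo_odd csum_eq)
  qed
 qed auto
 also have "\<dots> = (\<Sum>i\<le>q. Psi (Mo \<alpha> (2 * q - 2 * i)) (Mo \<alpha> (2 * i)))"
  by (subst sum.reindex) (auto simp: inj_on_def)
 finally show ?thesis by (simp add: diff_mult_distrib2)
qed

lemma Psi_one: "Psi (%mu mu'. if mu = mu' then 1 else 0) B = (\<Sum>ka<K. \<Sum>ka'<K. CC ka ka' * B ka' ka)"
proof -
 have "Psi (%mu mu'. if mu = mu' then 1 else 0) B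
  = (\<Sum>i<l. \<Sum>ka<K. \<Sum>mu<K. \<Sum>ka'<K. \<Sum>mu'<K. if mu' = mu then a i ka mu * a i ka' mu * B ka' ka else 0)"
  unfolding Psi_def csum_eq by (intro sum.cong refl) auto
 also have "\<dots> = (\<Sum>i<l. \<Sum>ka<K. \<Sum>mu<K. \<Sum>ka'<K. a i ka mu * a i ka' mu * B ka' ka)" by simp
 also have "\<dots> = (\<Sum>ka<K. \<Sum>ka'<K. \<Sum>i<l. \<Sum>mu<K. a i ka mu * a i ka' mu * B ka' ka)"
 proof -
  let ?h = "%i ka mu ka'. a i ka mu * a i ka' mu * B ka' ka"
  have "(\<Sum>i<l. \<Sum>ka<K. \<Sum>mu<K. \<Sum>ka'<K. ?h i ka mu ka') = (\<Sum>ka<K. \<Sum>i<l. \<Sum>mu<K. \<Sum>ka'<K. ?h i ka mu ka')"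
   by (rule sum.swap)
  also have "\<dots> = (\<Sum>ka<K. \<Sum>i<l. \<Sum>ka'<K. \<Sum>mu<K. ?h i ka mu ka')"
   by (intro sum.cong refl sum.swap)
  also have "\<dots> = (\<Sum>ka<K. \<Sum>ka'<K. \<Sum>i<l. \<Sum>mu<K. ?h i ka mu ka')"
   by (intro sum.cong refl sum.swap)
  finally show ?thesis .
 qed
 finally show ?thesis by (simp add: CC_def sum_distrib_right)
qed

lemma row_zero:
 assumes J: "J = R \<union> C" "finite R" "finite C" and r: "ka < K" "r \<in> J" "r \<notin> side R C ka" and p: "0 < p"
 shows "ent (XW J (wb R C) x ^ p) (ka, r) q = 0"
proof -
 have finJ: "finite J" using J by simp
 have X: "ent (XW J (wb R C) x) (ka, r) (mu, c) = 0" if "mu < K" "c \<in> J" for mu c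
 proof -
  have "W (wb R C) (i, r, c) * x (i, r, c) * a i ka mu = 0 \<and> W (wb R C) (i, c, r) * x (i, c, r) * a i mu ka = 0" for i
   using r bip[of i ka mu] bip[of i mu ka] by (auto simp: wb_def side_def split: if_splits)
  then show ?thesis using that r by (simp add: ent_XX[OF finJ])
 qed
 obtain p' where "p = Suc p'" using p by (cases p) auto
 then show ?thesis
  using r X finJ by (simp add: adm_times_ent[of "DD J"] sum_DD)
qed

text \<open>Passing to a submatrix.\<close>

text \<open>A submatrix arises by compression with a projection; the factor accounts for the normalisation by
 the number of columns.\<close>

lemma FF_mono:
 assumes fin: "finite R'" "finite C'" and sub: "R \<subseteq> R'" "C \<subseteq> C'" and n: "0 < card C" and P: "P = 2 ^ Suc s"
 shows "FF R C P \<le> (real (card C') / real (card C)) ^ (2 ^ s) * FF R' C' P"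
proof -
 define J where "J = R \<union> C"
 define J' where "J' = R' \<union> C'"
 have J: "finite J" "finite J'" "J \<subseteq> J'" using fin sub finite_subset by (auto simp: J_def J'_def)
 have finRC: "finite R" "finite C" using fin sub finite_subset by auto
 have n': "0 < card C'" using n fin sub by (metis card_gt_0_iff finite_subset subset_empty)
 define \<sigma> where "\<sigma> = sqrt (real (card C') / real (card C))"
 have \<sigma>: "0 < \<sigma>" "\<sigma>\<^sup>2 = real (card C') / real (card C)" using n n' by (auto simp: \<sigma>_def)
 have P0: "0 < P" using P by simp
 have eq: "FF R C P = Phi J' (wb R C) P"
 proof -
  have e: "(\<integral>x. ent (XW J' (wb R C) x ^ P) (ka, id r) (ka, id r) \<partial>gm (EE J'))
   = (\<integral>x. ent (XW J (wb R C) x ^ P) (ka, r) (ka, r) \<partial>gm (EE J))" if "ka < K" "r \<in> J" for ka r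
   by (rule embed_expectation[OF J(1,2)]) (use that J in \<open>auto simp: wb_def J_def\<close>)
  have X: "ent (XW J' (wb R C) x) (ka, r) (mu, c) = 0" if "mu < K" "c \<in> J'" "ka < K" "r \<in> J' - J" for mu c ka r x
   using that J by (simp add: ent_XX wb_def J_def)
  have z: "ent (XW J' (wb R C) x ^ P) (ka, r) (ka, r) = 0" if "ka < K" "r \<in> J' - J" for ka r x
  proof -
   obtain p' where "P = Suc p'" using P0 by (cases P) auto
   then show ?thesis
    using that X J by (simp add: adm_times_ent[of "DD J'"] sum_DD)
  qed
  have "Phi J' (wb R C) P = (\<Sum>ka<K. \<Sum>r\<in>J. \<integral>x. ent (XW J' (wb R C) x ^ P) (ka, r) (ka, r) \<partial>gm (EE J'))"
   unfolding trace_expectation[OF J(2)] using J z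
   by (intro sum.cong refl sum.mono_neutral_right) auto
  also have "\<dots> = FF R C P"
   unfolding FF_def J_def[symmetric] trace_expectation[OF J(1)] using e by (intro sum.cong refl) simp
  finally show ?thesis by simp
 qed
 define Q where "Q = mk (DD J') (%p q. if p = q \<and> snd p \<in> side R C (fst p) then 1 else 0)"
 have entQ: "ent Q p q = (if p \<in> DD J' \<and> p = q \<and> snd p \<in> side R C (fst p) then 1 else 0)" for p q
  unfolding Q_def ent_mk[OF finite_DD[OF J(2)]] by auto
 have QY: "ent (Q * Y) p q = (if p \<in> DD J' \<and> snd p \<in> side R C (fst p) then ent Y p q else 0)" for Y p q
  by (subst ent_times_on[of "{p}"]) (auto simp: entQ)
 have YQ: "ent (Y * Q) p q = (if q \<in> DD J' \<and> snd q \<in> side R C (fst q) then ent Y p q else 0)" for Y p q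
  by (subst ent_times_on[of "{q}"]) (auto simp: entQ)
 have adQ: "adm (DD J') Q" unfolding Q_def using J by (intro adm_mk) auto
 have tpQ: "tp Q = Q" by (rule lmat_eqI) (auto simp: entQ)
 have QQ: "Q * Q = Q" by (rule lmat_eqI) (auto simp: QY entQ)
 note Q = adQ tpQ QQ
 have key: "tr (DD J') (XW J' (wb R C) x ^ P) \<le> \<sigma> ^ P * tr (DD J') (XW J' (wb R' C') x ^ P)" for x
 proof -
  let ?X = "XW J' (wb R' C') x"
  have supp: "ent (XX J' z) p q = 0" if "p \<notin> DD J' \<or> q \<notin> DD J'" for p q z
  proof -
   have "ent (UU J' i r c) u v = 0" if "u \<notin> DD J' \<or> v \<notin> DD J'" for i r c u v
    using that unfolding UU_def by (subst ent_mk[OF finite_DD[OF J(2)]]) auto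
   then have "ent (Del J' e) p q = 0" for e
    using that unfolding Del_def by (cases e) (simp, blast)
   then show ?thesis unfolding XX_def ent_sum by simp
  qed
  have "XW J' (wb R C) x = \<sigma> *\<^sub>R (Q * (?X * Q))"
  proof (rule lmat_eqI)
   fix p q
   show "ent (XW J' (wb R C) x) p q = ent (\<sigma> *\<^sub>R (Q * (?X * Q))) p q"
   proof (cases "p \<in> DD J' \<and> q \<in> DD J'")
    case True
    then obtain ka r mu c where pq: "p = (ka, r)" "q = (mu, c)" "ka < K" "r \<in> J'" "mu < K" "c \<in> J'"
     by (cases p; cases q) auto
    have w: "wb R C r c = (if r \<in> R \<and> c \<in> C then \<sigma> * wb R' C' r c else 0)" for r c
     using sub n n' by (auto simp: wb_def \<sigma>_def real_sqrt_divide)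
    have t: "wb R C r c * x (i, r, c) * a i ka mu + wb R C c r * x (i, c, r) * a i mu ka
     = (if r \<in> side R C ka \<and> c \<in> side R C mu then
       \<sigma> * (wb R' C' r c * x (i, r, c) * a i ka mu + wb R' C' c r * x (i, c, r) * a i mu ka) else 0)" for i
    proof -
     have "wb R C r c * x (i, r, c) * a i ka mu
      = (if r \<in> side R C ka \<and> c \<in> side R C mu then \<sigma> * (wb R' C' r c * x (i, r, c) * a i ka mu) else 0)"
      using bip[of i ka mu] unfolding w by (cases "a i ka mu = 0") (auto simp: side_def)
     moreover have "wb R C c r * x (i, c, r) * a i mu ka
      = (if r \<in> side R C ka \<and> c \<in> side R C mu then \<sigma> * (wb R' C' c r * x (i, c, r) * a i mu ka) else 0)"
      using bip[of i mu ka] unfolding w by (cases "a i mu ka = 0") (auto simp: side_def)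
     ultimately show ?thesis by (auto simp: distrib_left)
    qed
    show ?thesis
     unfolding pq(1,2) using pq J
     by (simp add: QY YQ ent_XX t sum_distrib_left sum.distrib distrib_left)
   next
    case False
    then show ?thesis using supp by (auto simp: QY YQ)
   qed
  qed
  then have "tr (DD J') (XW J' (wb R C) x ^ P) = \<sigma> ^ P * tr (DD J') ((Q * (?X * Q)) ^ P)"
   by (simp add: scaleR_lmat_power)
  also have "tr (DD J') ((Q * (?X * Q)) ^ P) = tr (DD J') ((?X * Q * Q) ^ P)"
   using J Q P0 by (intro tr_cycle_power) auto
  also have "?X * Q * Q = ?X * Q" using Q by (simp add: mult.assoc)
  also have "tr (DD J') ((?X * Q) ^ P) = tr (DD J') ((Q * ?X) ^ P)"
   using J Q P0 by (intro tr_cycle_power) auto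
  also have "\<sigma> ^ P * tr (DD J') ((Q * ?X) ^ P) \<le> \<sigma> ^ P * tr (DD J') (?X ^ P)"
   using \<sigma> J Q unfolding P by (intro mult_left_mono tr_compress) auto
  finally show ?thesis .
 qed
 have "FF R C P \<le> \<sigma> ^ P * FF R' C' P"
  unfolding eq unfolding FF_def Phi_def J'_def[symmetric]
  using XW_integrable'[OF J(2)] key
  by (subst integral_mult_right_zero[symmetric], intro integral_mono) auto
 moreover have "\<sigma> ^ P = (real (card C') / real (card C)) ^ (2 ^ s)"
  unfolding \<sigma>(2)[symmetric] P by (simp add: power_mult)
 ultimately show ?thesis by simp
qed

lemma FF_rows:
 assumes "finite R" "finite C" "0 < p"
 shows "FF R C p = 2 * (\<integral>x. tr (DD (R \<union> C)) (Gam R (R \<union> C) * XW (R \<union> C) (wb R C) x ^ p) \<partial>gm (EE (R \<union> C)))"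
 unfolding FF_def Phi_def tr_Gam_half[OF assms(1,2) refl assms(3)] by simp

end

context bip_seq
begin

lemma FF_limit: "0 < p ==> (%N. FF (R N) (C N) p / real (card (R N))) \<longlonglongrightarrow> 2 * tt \<alpha> p"
 using tendsto_mult_left[OF row_trace_limit[of p], of 2] by (simp add: FF_rows[OF fin])

lemma \<alpha>_nonneg: "0 \<le> \<alpha>"
 by (rule tendsto_lowerbound[OF ratio]) auto

lemma EM_eq:
 assumes "ka < K" "ka' < K"
 shows "EM N p ka ka' = (\<integral>x. (\<Sum>r\<in>JJ N. ind (side (R N) (C N) ka) r * ent (XN N x ^ p) (ka, r) (ka', r)) \<partial>GN N) / SN N ka"
 unfolding EM_def using assms by (simp add: tr_BB_times[OF finJJ])

lemma ent_power_sym: "ent (XN N x ^ p) u v = ent (XN N x ^ p) v u"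
proof -
 have "tp (XN N x ^ p) = XN N x ^ p" using finJJ by (simp add: tp_power)
 then show ?thesis by (metis ent_tp)
qed

lemma same_side:
 assumes "S = {..<k1} \<or> S = {k1..<K}" "ka \<in> S" "ka' \<in> S"
 shows "ka < K" "ka' < K" "side (R N) (C N) ka = side (R N) (C N) ka'" "SN N ka = SN N ka'"
 using assms k1 by (auto simp: side_def SN_def)

lemma Mo_sym:
 assumes "S = {..<k1} \<or> S = {k1..<K}" "ka \<in> S" "ka' \<in> S"
 shows "Mo \<alpha> p ka ka' = Mo \<alpha> p ka' ka"
proof -
 note ss = same_side[OF assms]
 have "EM N p ka ka' = EM N p ka' ka" for N
  unfolding EM_eq[OF ss(1,2)] EM_eq[OF ss(2,1)] ss(3,4)
  by (subst ent_power_sym) (rule refl)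
 then show ?thesis
  using EM_limit[OF ss(1,2), of p] EM_limit[OF ss(2,1), of p] LIMSEQ_unique by auto
qed

text \<open>A power \<open>X ^ (2 * q)\<close> is the Gram matrix of the columns of \<open>X ^ q\<close>, and
 its block traces inherit positivity. This holds for the limits as well.\<close>

theorem gram_functional:
 assumes S: "S = {..<k1} \<or> S = {k1..<K}"
  and Q: "!!w. 0 \<le> (\<Sum>ka\<in>S. \<Sum>ka'\<in>S. Q ka ka' * (w ka * w ka') :: real)"
 shows "0 \<le> (\<Sum>ka\<in>S. \<Sum>ka'\<in>S. Q ka ka' * Mo \<alpha> (2 * q) ka ka')"
proof -
 have "0 \<in> S \<or> k1 \<in> S" using S k1 by auto
 then obtain ka0 where ka0: "ka0 \<in> S" by blast
 have finS: "finite S" using S by auto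
 have nn: "0 \<le> (\<Sum>ka\<in>S. \<Sum>ka'\<in>S. Q ka ka' * EM N (2 * q) ka ka')" for N
 proof -
  let ?s = "ind (side (R N) (C N) ka0)"
  let ?e = "%x ka ka'. \<Sum>r\<in>JJ N. ?s r * ent (XN N x ^ (2 * q)) (ka, r) (ka', r)"
  have int: "integrable (GN N) (%x. ?e x ka ka')" if "ka \<in> S" "ka' \<in> S" for ka ka'
  proof -
   have "integrable (GN N) (%x. tr (DN N) (BB (JJ N) ka' ka ?s * XN N x ^ (2 * q)))"
    by (rule XW_integrable[OF finJJ adm_BB[OF finJJ]])
   then show ?thesis using same_side[OF S that] by (simp add: tr_BB_times[OF finJJ])
  qed
  have EMe: "EM N (2 * q) ka ka' = (\<integral>x. ?e x ka ka' \<partial>GN N) / SN N ka0" if "ka \<in> S" "ka' \<in> S" for ka ka'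
   using EM_eq same_side[OF S that] same_side(3,4)[OF S that(1) ka0] by simp
  have "(\<Sum>ka\<in>S. \<Sum>ka'\<in>S. Q ka ka' * EM N (2 * q) ka ka')
   = (\<integral>x. (\<Sum>ka\<in>S. \<Sum>ka'\<in>S. Q ka ka' * ?e x ka ka') \<partial>GN N) / SN N ka0"
  proof -
   have "(\<integral>x. (\<Sum>ka\<in>S. \<Sum>ka'\<in>S. Q ka ka' * ?e x ka ka') \<partial>GN N)
    = (\<Sum>ka\<in>S. \<integral>x. (\<Sum>ka'\<in>S. Q ka ka' * ?e x ka ka') \<partial>GN N)"
   proof (rule Bochner_Integration.integral_sum)
    fix ka assume "ka \<in> S"
    then show "integrable (GN N) (%x. \<Sum>ka'\<in>S. Q ka ka' * ?e x ka ka')"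
     by (intro Bochner_Integration.integrable_sum) (rule integrable_mult_right, rule int)
   qed
   also have "\<dots> = (\<Sum>ka\<in>S. \<Sum>ka'\<in>S. Q ka ka' * (\<integral>x. ?e x ka ka' \<partial>GN N))"
   proof (rule sum.cong[OF refl])
    fix ka assume "ka \<in> S"
    then have "(\<integral>x. (\<Sum>ka'\<in>S. Q ka ka' * ?e x ka ka') \<partial>GN N) = (\<Sum>ka'\<in>S. \<integral>x. Q ka ka' * ?e x ka ka' \<partial>GN N)"
     using int by (intro Bochner_Integration.integral_sum integrable_mult_right)
    then show "(\<integral>x. (\<Sum>ka'\<in>S. Q ka ka' * ?e x ka ka') \<partial>GN N) = (\<Sum>ka'\<in>S. Q ka ka' * (\<integral>x. ?e x ka ka' \<partial>GN N))"
     by simp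
   qed
   finally show ?thesis by (simp add: EMe sum_divide_distrib)
  qed
  also have "\<dots> \<ge> 0"
  proof (intro divide_nonneg_nonneg Bochner_Integration.integral_nonneg less_imp_le[OF SN_pos])
   fix x
   let ?Y = "XN N x ^ q"
   have pw: "ent (XN N x ^ (2 * q)) (ka, r) (ka', r) = (\<Sum>p\<in>DN N. ent ?Y p (ka, r) * ent ?Y p (ka', r))"
    if "ka \<in> S" "r \<in> JJ N" for ka ka' r
   proof -
    have "ent (?Y * ?Y) (ka, r) (ka', r) = (\<Sum>p\<in>DN N. ent ?Y (ka, r) p * ent ?Y p (ka', r))"
     using finJJ same_side(1)[OF S that(1) that(1)] that by (intro adm_times_ent) auto
    then show ?thesis using ent_power_sym[of N x q "(ka, r)"] by (simp add: mult_2 power_add)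
   qed
   have "(\<Sum>ka\<in>S. \<Sum>ka'\<in>S. Q ka ka' * ?e x ka ka')
    = (\<Sum>ka\<in>S. \<Sum>ka'\<in>S. \<Sum>r\<in>JJ N. \<Sum>p\<in>DN N. ?s r * (Q ka ka' * (ent ?Y p (ka, r) * ent ?Y p (ka', r))))"
   proof (intro sum.cong refl)
    fix ka ka' assume "ka \<in> S" "ka' \<in> S"
    then have "?e x ka ka' = (\<Sum>r\<in>JJ N. ?s r * (\<Sum>p\<in>DN N. ent ?Y p (ka, r) * ent ?Y p (ka', r)))"
     using pw by (intro sum.cong refl) auto
    then show "Q ka ka' * ?e x ka ka'
     = (\<Sum>r\<in>JJ N. \<Sum>p\<in>DN N. ?s r * (Q ka ka' * (ent ?Y p (ka, r) * ent ?Y p (ka', r))))"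
     by (simp add: sum_distrib_left mult.left_commute)
   qed
   also have "\<dots> = (\<Sum>r\<in>JJ N. \<Sum>p\<in>DN N. \<Sum>ka\<in>S. \<Sum>ka'\<in>S. ?s r * (Q ka ka' * (ent ?Y p (ka, r) * ent ?Y p (ka', r))))"
   proof -
    let ?h = "%ka ka' r p. ?s r * (Q ka ka' * (ent ?Y p (ka, r) * ent ?Y p (ka', r)))"
    have "(\<Sum>ka\<in>S. \<Sum>ka'\<in>S. \<Sum>r\<in>JJ N. \<Sum>p\<in>DN N. ?h ka ka' r p) = (\<Sum>ka\<in>S. \<Sum>r\<in>JJ N. \<Sum>ka'\<in>S. \<Sum>p\<in>DN N. ?h ka ka' r p)"
     by (intro sum.cong refl sum.swap)
    also have "\<dots> = (\<Sum>r\<in>JJ N. \<Sum>ka\<in>S. \<Sum>ka'\<in>S. \<Sum>p\<in>DN N. ?h ka ka' r p)"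
     by (rule sum.swap)
    also have "\<dots> = (\<Sum>r\<in>JJ N. \<Sum>ka\<in>S. \<Sum>p\<in>DN N. \<Sum>ka'\<in>S. ?h ka ka' r p)"
     by (intro sum.cong refl sum.swap)
    also have "\<dots> = (\<Sum>r\<in>JJ N. \<Sum>p\<in>DN N. \<Sum>ka\<in>S. \<Sum>ka'\<in>S. ?h ka ka' r p)"
     by (intro sum.cong refl sum.swap)
    finally show ?thesis .
   qed
   also have "\<dots> = (\<Sum>r\<in>JJ N. \<Sum>p\<in>DN N. ?s r * (\<Sum>ka\<in>S. \<Sum>ka'\<in>S. Q ka ka' * (ent ?Y p (ka, r) * ent ?Y p (ka', r))))"
    by (simp only: sum_distrib_left)
   also have "\<dots> \<ge> 0"
    by (intro sum_nonneg mult_nonneg_nonneg Q) (simp add: ind_def)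
   finally show "0 \<le> (\<Sum>ka\<in>S. \<Sum>ka'\<in>S. Q ka ka' * ?e x ka ka')" .
  qed
  finally show ?thesis .
 qed
 have "(%N. \<Sum>ka\<in>S. \<Sum>ka'\<in>S. Q ka ka' * EM N (2 * q) ka ka')
  \<longlonglongrightarrow> (\<Sum>ka\<in>S. \<Sum>ka'\<in>S. Q ka ka' * Mo \<alpha> (2 * q) ka ka')"
  using same_side[OF S] by (intro tendsto_sum tendsto_mult_left EM_limit) auto
 then show ?thesis by (rule tendsto_lowerbound) (use nn in auto)
qed

end

section \<open>Positivity and a recursion for traces\<close>

context bipartite
begin

lemma csum_blocks:
 "csum f = (\<Sum>i<l. \<Sum>ka<k1. \<Sum>mu\<in>{k1..<K}. \<Sum>ka'<k1. \<Sum>mu'\<in>{k1..<K}. a i ka mu * a i ka' mu' * f ka mu ka' mu')"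
proof -
 have z: "a i ka mu = 0" if "\<not> (ka < k1 \<and> k1 \<le> mu \<and> mu < K)" for i ka mu using bip that by blast
 have X: "(\<Sum>mu<K. g mu) = (\<Sum>mu\<in>{k1..<K}. g mu)" if "!!mu. mu < k1 ==> g mu = 0" for g :: "nat => real"
  by (rule sum.mono_neutral_right) (use that in auto)
 have Y: "(\<Sum>mu<K. g mu) = (\<Sum>mu<k1. g mu)" if "!!mu. k1 \<le> mu ==> g mu = 0" for g :: "nat => real"
  by (rule sum.mono_neutral_right) (use that k1 in auto)
 show ?thesis
  unfolding csum_eq
 proof (rule sum.cong[OF refl])
  fix i
  let ?h = "%ka mu ka' mu'. a i ka mu * a i ka' mu' * f ka mu ka' mu'"
  have 1: "(\<Sum>mu'<K. ?h ka mu ka' mu') = (\<Sum>mu'\<in>{k1..<K}. ?h ka mu ka' mu')" for ka mu ka'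
   by (rule X) (simp add: z)
  have 2: "(\<Sum>ka'<K. \<Sum>mu'\<in>{k1..<K}. ?h ka mu ka' mu') = (\<Sum>ka'<k1. \<Sum>mu'\<in>{k1..<K}. ?h ka mu ka' mu')" for ka mu
   by (rule Y) (simp add: z)
  have 3: "(\<Sum>mu<K. \<Sum>ka'<k1. \<Sum>mu'\<in>{k1..<K}. ?h ka mu ka' mu')
   = (\<Sum>mu\<in>{k1..<K}. \<Sum>ka'<k1. \<Sum>mu'\<in>{k1..<K}. ?h ka mu ka' mu')" for ka
   by (rule X) (simp add: z)
  have 4: "(\<Sum>ka<K. \<Sum>mu\<in>{k1..<K}. \<Sum>ka'<k1. \<Sum>mu'\<in>{k1..<K}. ?h ka mu ka' mu')
   = (\<Sum>ka<k1. \<Sum>mu\<in>{k1..<K}. \<Sum>ka'<k1. \<Sum>mu'\<in>{k1..<K}. ?h ka mu ka' mu')"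
   by (rule Y) (simp add: z)
  show "(\<Sum>ka<K. \<Sum>mu<K. \<Sum>ka'<K. \<Sum>mu'<K. ?h ka mu ka' mu')
   = (\<Sum>ka<k1. \<Sum>mu\<in>{k1..<K}. \<Sum>ka'<k1. \<Sum>mu'\<in>{k1..<K}. ?h ka mu ka' mu')"
   by (simp only: 1 2 3 4)
 qed
qed

lemma CC_block: "CC ka ka' = (\<Sum>i<l. \<Sum>mu\<in>{k1..<K}. a i ka mu * a i ka' mu)"
proof -
 have z: "a i ka mu = 0" if "mu < k1" for i mu using bip[of i ka mu] that by force
 show ?thesis unfolding CC_def by (intro sum.cong refl sum.mono_neutral_right) (auto simp: z)
qed

lemma CC_zero: "k1 \<le> ka \<or> k1 \<le> ka' ==> CC ka ka' = 0"
proof -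
 assume "k1 \<le> ka \<or> k1 \<le> ka'"
 then have "a i ka mu * a i ka' mu = 0" for i mu
  using bip[of i ka mu] bip[of i ka' mu] by force
 then show ?thesis unfolding CC_def by simp
qed

lemma CC_sym: "CC ka ka' = CC ka' ka"
 by (simp add: CC_def mult.commute)

lemma Psi_one_block: "Psi (%mu mu'. if mu = mu' then 1 else 0) B = (\<Sum>ka<k1. \<Sum>ka'<k1. CC ka ka' * B ka' ka)"
proof -
 have Y: "(\<Sum>mu<K. g mu) = (\<Sum>mu<k1. g mu)" if "!!mu. k1 \<le> mu ==> g mu = 0" for g :: "nat => real"
  by (rule sum.mono_neutral_right) (use that k1 in auto)
 have 1: "(\<Sum>ka'<K. CC ka ka' * B ka' ka) = (\<Sum>ka'<k1. CC ka ka' * B ka' ka)" for ka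
  by (rule Y) (simp add: CC_zero)
 have 2: "(\<Sum>ka<K. \<Sum>ka'<k1. CC ka ka' * B ka' ka) = (\<Sum>ka<k1. \<Sum>ka'<k1. CC ka ka' * B ka' ka)"
  by (rule Y) (simp add: CC_zero)
 show ?thesis unfolding Psi_one by (simp only: 1 2)
qed

lemma tt_2: "tt \<alpha> 2 = (\<Sum>ka<k1. CC ka ka)"
proof -
 have "tt \<alpha> 2 = Psi (Mo \<alpha> 0) (Mo \<alpha> 0)" using tt_Suc[of \<alpha> 0] by simp
 also have "\<dots> = (\<Sum>ka<k1. \<Sum>ka'<k1. if ka' = ka then CC ka ka' else 0)"
  unfolding Mo.simps Psi_one_block by (intro sum.cong refl) auto
 finally show ?thesis by simp
qed

lemma tt_0: "tt \<alpha> 0 = real k1"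
 by (simp add: tt_def)

lemma CC_form: "(\<Sum>ka<k1. \<Sum>ka'<k1. CC ka ka' * (w ka * w ka'))
 = (\<Sum>i<l. \<Sum>mu\<in>{k1..<K}. (\<Sum>ka<k1. a i ka mu * w ka)\<^sup>2)"
proof -
 let ?h = "%ka ka' i mu. (a i ka mu * w ka) * (a i ka' mu * w ka')"
 have "(\<Sum>ka<k1. \<Sum>ka'<k1. CC ka ka' * (w ka * w ka')) = (\<Sum>ka<k1. \<Sum>ka'<k1. \<Sum>i<l. \<Sum>mu\<in>{k1..<K}. ?h ka ka' i mu)"
  unfolding CC_block sum_distrib_right by (intro sum.cong refl) (simp add: mult_ac)
 also have "\<dots> = (\<Sum>ka<k1. \<Sum>i<l. \<Sum>ka'<k1. \<Sum>mu\<in>{k1..<K}. ?h ka ka' i mu)"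
  by (intro sum.cong refl sum.swap)
 also have "\<dots> = (\<Sum>i<l. \<Sum>ka<k1. \<Sum>ka'<k1. \<Sum>mu\<in>{k1..<K}. ?h ka ka' i mu)"
  by (rule sum.swap)
 also have "\<dots> = (\<Sum>i<l. \<Sum>ka<k1. \<Sum>mu\<in>{k1..<K}. \<Sum>ka'<k1. ?h ka ka' i mu)"
  by (intro sum.cong refl sum.swap)
 also have "\<dots> = (\<Sum>i<l. \<Sum>mu\<in>{k1..<K}. \<Sum>ka<k1. \<Sum>ka'<k1. ?h ka ka' i mu)"
  by (intro sum.cong refl sum.swap)
 finally show ?thesis by (simp add: power2_eq_square sum_product)
qed

lemma CC_le_trace: "(\<Sum>ka<k1. \<Sum>ka'<k1. CC ka ka' * (w ka * w ka')) \<le> (\<Sum>ka<k1. CC ka ka) * (\<Sum>ka<k1. (w ka)\<^sup>2)"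
proof -
 have "(\<Sum>i<l. \<Sum>mu\<in>{k1..<K}. (\<Sum>ka<k1. a i ka mu * w ka)\<^sup>2)
  \<le> (\<Sum>i<l. \<Sum>mu\<in>{k1..<K}. (\<Sum>ka<k1. (a i ka mu)\<^sup>2) * (\<Sum>ka<k1. (w ka)\<^sup>2))"
  by (intro sum_mono Cauchy_Schwarz_ineq_sum)
 also have "\<dots> = (\<Sum>i<l. \<Sum>mu\<in>{k1..<K}. \<Sum>ka<k1. (a i ka mu)\<^sup>2) * (\<Sum>ka<k1. (w ka)\<^sup>2)"
  by (simp only: sum_distrib_right)
 also have "(\<Sum>i<l. \<Sum>mu\<in>{k1..<K}. \<Sum>ka<k1. (a i ka mu)\<^sup>2) = (\<Sum>i<l. \<Sum>ka<k1. \<Sum>mu\<in>{k1..<K}. (a i ka mu)\<^sup>2)"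
  by (intro sum.cong refl sum.swap)
 also have "\<dots> = (\<Sum>ka<k1. \<Sum>i<l. \<Sum>mu\<in>{k1..<K}. (a i ka mu)\<^sup>2)"
  by (rule sum.swap)
 also have "\<dots> = (\<Sum>ka<k1. CC ka ka)" by (simp add: CC_block power2_eq_square)
 finally show ?thesis unfolding CC_form .
qed

text \<open>For statements that concern the limits \<open>Mo\<close> only, some sequence with the quotient
 \<open>\<alpha>\<close> is needed.\<close>

lemma bip_seq_ceiling:
 assumes \<alpha>: "0 < \<alpha>"
 shows "bip_seq K a k1 (%N. {..<Suc N}) (%N. {..<nat \<lceil>real (Suc N) / \<alpha>\<rceil>}) \<alpha>"
proof -
 define c where "c N = nat \<lceil>real (Suc N) / \<alpha>\<rceil>" for N
 have c: "real (Suc N) / \<alpha> \<le> real (c N)" "real (c N) \<le> real (Suc N) / \<alpha> + 1" "0 < c N" for N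
 proof -
  have p: "0 < real (Suc N) / \<alpha>" using \<alpha> by simp
  show "real (Suc N) / \<alpha> \<le> real (c N)" unfolding c_def by (rule real_nat_ceiling_ge)
  then show "0 < c N" using p by linarith
  show "real (c N) \<le> real (Suc N) / \<alpha> + 1" unfolding c_def using p by linarith
 qed
 have cinf: "filterlim (%N. real (c N)) at_top sequentially"
 proof (rule filterlim_at_top_mono)
  show "filterlim (%N. real (Suc N) * (1 / \<alpha>)) at_top sequentially"
   using \<alpha> filterlim_compose[OF filterlim_real_sequentially filterlim_Suc]
   by (intro filterlim_at_top_mult_tendsto_pos[OF tendsto_const, of "1 / \<alpha>" _ _] ) auto
  show "\<forall>\<^sub>F N in sequentially. real (Suc N) * (1 / \<alpha>) \<le> real (c N)" using c(1) by simp
 qed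
 have "bip_seq K a k1 (%N. {..<Suc N}) (%N. {..<c N}) \<alpha>"
 proof unfold_locales
  show "filterlim (%N. card {..<Suc N}) at_top sequentially"
   by (simp add: filterlim_Suc)
  show "filterlim (%N. card {..<c N}) at_top sequentially"
   using cinf by (simp add: filterlim_sequentially_iff_filterlim_real)
  have "(%N. 1 / real (c N)) \<longlonglongrightarrow> 0"
   by (rule tendsto_divide_0[OF tendsto_const filterlim_at_top_imp_at_infinity[OF cinf]])
  from tendsto_mult_left[OF tendsto_diff[OF tendsto_const[of 1] this], of \<alpha>]
  have "(%N. \<alpha> * (1 - 1 / real (c N))) \<longlonglongrightarrow> \<alpha> * (1 - 0)" .
  then have lower: "(%N. \<alpha> * (1 - 1 / real (c N))) \<longlonglongrightarrow> \<alpha>" by simp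
  show "(%N. real (card {..<Suc N}) / real (card {..<c N})) \<longlonglongrightarrow> \<alpha>"
  proof (rule tendsto_sandwich[OF _ _ lower tendsto_const])
   have "\<alpha> * (1 - 1 / real (c N)) \<le> real (card {..<Suc N}) / real (card {..<c N})" for N
   proof -
    have "\<alpha> * real (c N) \<le> real (Suc N) + \<alpha>" using c(2)[of N] \<alpha> by (simp add: field_simps)
    then have "(\<alpha> * real (c N) - \<alpha>) / real (c N) \<le> real (Suc N) / real (c N)"
     by (intro divide_right_mono) auto
    moreover have "\<alpha> * (1 - 1 / real (c N)) = (\<alpha> * real (c N) - \<alpha>) / real (c N)"
     using c(3)[of N] by (simp add: field_simps)
    ultimately show ?thesis by simp
   qed
   then show "\<forall>\<^sub>F N in sequentially. \<alpha> * (1 - 1 / real (c N)) \<le> real (card {..<Suc N}) / real (card {..<c N})"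
    by simp
   have "real (card {..<Suc N}) / real (card {..<c N}) \<le> \<alpha>" for N
    using c(1)[of N] c(3)[of N] \<alpha> by (simp add: field_simps)
   then show "\<forall>\<^sub>F N in sequentially. real (card {..<Suc N}) / real (card {..<c N}) \<le> \<alpha>"
    by simp
  qed
 qed (use c in auto)
 then show ?thesis by (simp only: c_def)
qed

lemma ex_bip_seq:
 assumes "0 \<le> \<alpha>"
 shows "\<exists>R C. bip_seq K a k1 R C \<alpha>"
proof (cases "\<alpha> = 0")
 case True
 have "bip_seq K a k1 (%N. {..<Suc N}) (%N. {..<Suc N * Suc N}) \<alpha>"
 proof unfold_locales
  show "filterlim (%N. card {..<Suc N}) at_top sequentially"
   by (simp add: filterlim_Suc)
  show "filterlim (%N. card {..<Suc N * Suc N}) at_top sequentially"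
   by (rule filterlim_at_top_mono[OF filterlim_Suc]) simp
  have "(%N. real (Suc N) / real (Suc N * Suc N)) = (%N. 1 / real (Suc N))"
   by (rule ext) (simp only: of_nat_mult, simp del: of_nat_Suc)
  then show "(%N. real (card {..<Suc N}) / real (card {..<Suc N * Suc N})) \<longlonglongrightarrow> \<alpha>"
   using True LIMSEQ_Suc[OF lim_1_over_n] by simp
 qed auto
 then show ?thesis by blast
next
 case False
 then show ?thesis using bip_seq_ceiling[of \<alpha>] assms by force
qed

end

context bip_seq
begin

lemma gram_le:
 assumes S: "S = {..<k1} \<or> S = {k1..<K}"
  and Q: "!!w. (\<Sum>ka\<in>S. \<Sum>ka'\<in>S. Q ka ka' * (w ka * w ka') :: real) \<le> c * (\<Sum>ka\<in>S. (w ka)\<^sup>2)"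
 shows "(\<Sum>ka\<in>S. \<Sum>ka'\<in>S. Q ka ka' * Mo \<alpha> (2 * q) ka ka') \<le> c * (\<Sum>ka\<in>S. Mo \<alpha> (2 * q) ka ka)"
proof -
 have finS: "finite S" using S by auto
 have eq: "(\<Sum>ka\<in>S. \<Sum>ka'\<in>S. ((if ka' = ka then c else 0) - Q ka ka') * F ka ka')
  = c * (\<Sum>ka\<in>S. F ka ka) - (\<Sum>ka\<in>S. \<Sum>ka'\<in>S. Q ka ka' * F ka ka')" for F :: "nat => nat => real"
 proof -
  have "(\<Sum>ka'\<in>S. ((if ka' = ka then c else 0) - Q ka ka') * F ka ka')
   = c * F ka ka - (\<Sum>ka'\<in>S. Q ka ka' * F ka ka')" if "ka \<in> S" for ka
  proof -
   have "(\<Sum>ka'\<in>S. ((if ka' = ka then c else 0) - Q ka ka') * F ka ka')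
    = (\<Sum>ka'\<in>S. (if ka' = ka then c * F ka ka else 0) - Q ka ka' * F ka ka')"
    by (intro sum.cong refl) (auto simp: left_diff_distrib)
   then show ?thesis using finS that by (simp add: sum_subtractf)
  qed
  then show ?thesis by (simp add: sum_subtractf sum_distrib_left)
 qed
 have "0 \<le> (\<Sum>ka\<in>S. \<Sum>ka'\<in>S. ((if ka' = ka then c else 0) - Q ka ka') * (w ka * w ka'))" for w
  unfolding eq using Q[of w] by (simp add: power2_eq_square)
 from gram_functional[OF S this, of q] show ?thesis unfolding eq by simp
qed

text \<open>Entries of a positive semidefinite matrix are bounded by its trace.\<close>

lemma entry_bound:
 assumes S: "S = {..<k1} \<or> S = {k1..<K}" and lt: "ka1 \<in> S" "ka2 \<in> S"
 shows "\<bar>Mo \<alpha> (2 * q) ka1 ka2\<bar> \<le> (\<Sum>ka\<in>S. Mo \<alpha> (2 * q) ka ka)"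
proof -
 have finS: "finite S" using S by auto
 have *: "\<sigma> * Mo \<alpha> (2 * q) ka1 ka2 \<le> 1 * (\<Sum>ka\<in>S. Mo \<alpha> (2 * q) ka ka)" if \<sigma>: "\<sigma> = 1 \<or> \<sigma> = - 1" for \<sigma> :: real
 proof -
  let ?Q = "%ka ka'. if ka = ka1 then (if ka' = ka2 then \<sigma> else 0) else 0"
  have eq: "(\<Sum>ka\<in>S. \<Sum>ka'\<in>S. ?Q ka ka' * F ka ka') = \<sigma> * F ka1 ka2" for F
  proof -
   have "(\<Sum>ka\<in>S. \<Sum>ka'\<in>S. ?Q ka ka' * F ka ka')
    = (\<Sum>ka\<in>S. if ka = ka1 then (\<Sum>ka'\<in>S. if ka' = ka2 then \<sigma> * F ka1 ka2 else 0) else 0)"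
    by (intro sum.cong refl) (auto intro!: sum.cong)
   then show ?thesis using finS lt by simp
  qed
  have Q: "(\<Sum>ka\<in>S. \<Sum>ka'\<in>S. ?Q ka ka' * (w ka * w ka')) \<le> 1 * (\<Sum>ka\<in>S. (w ka)\<^sup>2)" for w
  proof -
   have "(w ka1)\<^sup>2 \<le> (\<Sum>ka\<in>S. (w ka)\<^sup>2)" "(w ka2)\<^sup>2 \<le> (\<Sum>ka\<in>S. (w ka)\<^sup>2)"
    by (rule member_le_sum[OF _ _ finS]; use lt in auto)+
   moreover have "2 * (\<sigma> * (w ka1 * w ka2)) \<le> (w ka1)\<^sup>2 + (w ka2)\<^sup>2"
    using \<sigma> sum_squares_bound[of "w ka1" "w ka2"] sum_squares_bound[of "w ka1" "- w ka2"] by auto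
   ultimately show ?thesis unfolding eq by linarith
  qed
  show ?thesis using gram_le[OF S Q, of q] unfolding eq .
 qed
 show ?thesis using *[of 1] *[of "-1"] by auto
qed

lemma trace_nonneg:
 assumes S: "S = {..<k1} \<or> S = {k1..<K}"
 shows "0 \<le> (\<Sum>ka\<in>S. Mo \<alpha> (2 * q) ka ka)"
proof -
 have "0 \<in> S \<or> k1 \<in> S" using S k1 by auto
 then obtain ka where "ka \<in> S" by blast
 from entry_bound[OF S this this, of q] show ?thesis by linarith
qed

lemma tt_nonneg: "0 \<le> tt \<alpha> (2 * q)"
 unfolding tt_def using trace_nonneg by blast

text \<open>Half of the trace of an even power comes from the rows and half from the columns, but the
 normalisations differ by the quotient of the dimensions.\<close>

lemma column_trace:
 assumes p: "0 < p"
 shows "(\<Sum>ka\<in>{k1..<K}. Mo \<alpha> p ka ka) = \<alpha> * tt \<alpha> p"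
proof -
 let ?e = "%N x ka. \<Sum>r\<in>JJ N. ind (side (R N) (C N) ka) r * ent (XN N x ^ p) (ka, r) (ka, r)"
 have int: "integrable (GN N) (%x. ?e N x ka)" if "ka < K" for N ka
 proof -
  have "integrable (GN N) (%x. tr (DN N) (BB (JJ N) ka ka (ind (side (R N) (C N) ka)) * XN N x ^ p))"
   by (rule XW_integrable[OF finJJ adm_BB[OF finJJ]])
  then show ?thesis using that by (simp add: tr_BB_times[OF finJJ])
 qed
 have pt: "(\<Sum>ka\<in>{k1..<K}. ?e N x ka) = (\<Sum>ka<k1. ?e N x ka)" for N x
 proof -
  have rz: "ent (XN N x ^ p) (ka, r) (ka, r) = ind (side (R N) (C N) ka) r * ent (XN N x ^ p) (ka, r) (ka, r)"
   if "ka < K" "r \<in> JJ N" for ka r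
   using row_zero[where R = "R N" and C = "C N" and x = x and q = "(ka, r)", OF refl fin(1) fin(2) that _ p]
   by (auto simp: ind_def)
  have "tr (DN N) (XN N x ^ p) = (\<Sum>ka<K. ?e N x ka)"
   unfolding tr_def sum_DD using rz by (intro sum.cong refl) auto
  moreover have "tr (DN N) (Gam (R N) (JJ N) * XN N x ^ p) = (\<Sum>ka<k1. ?e N x ka)"
   unfolding tr_Gam[OF finJJ] using k1 by (intro sum.cong refl) (auto simp: tr_BB_times[OF finJJ] side_def)
  ultimately have "(\<Sum>ka<K. ?e N x ka) = 2 * (\<Sum>ka<k1. ?e N x ka)"
   using tr_Gam_half[OF fin refl p] by metis
  moreover have "(\<Sum>ka<K. ?e N x ka) = (\<Sum>ka<k1. ?e N x ka) + (\<Sum>ka\<in>{k1..<K}. ?e N x ka)"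
   using sum.atLeastLessThan_concat[of 0 k1 K "?e N x"] k1 by (simp add: lessThan_atLeast0)
  ultimately show ?thesis by simp
 qed
 have a: "(\<Sum>ka\<in>{k1..<K}. \<integral>x. ?e N x ka \<partial>GN N) = (\<Sum>ka<k1. \<integral>x. ?e N x ka \<partial>GN N)" for N
 proof -
  have "(\<Sum>ka\<in>{k1..<K}. \<integral>x. ?e N x ka \<partial>GN N) = (\<integral>x. (\<Sum>ka\<in>{k1..<K}. ?e N x ka) \<partial>GN N)"
   by (rule Bochner_Integration.integral_sum[symmetric]) (use int in auto)
  also have "\<dots> = (\<integral>x. (\<Sum>ka<k1. ?e N x ka) \<partial>GN N)" by (simp only: pt)
  also have "\<dots> = (\<Sum>ka<k1. \<integral>x. ?e N x ka \<partial>GN N)"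
   by (rule Bochner_Integration.integral_sum) (use int k1 in auto)
  finally show ?thesis .
 qed
 have "EM N p ka ka = (\<integral>x. ?e N x ka \<partial>GN N) / SN N ka" if "ka < K" for N ka
  by (rule EM_eq[OF that that])
 note b = this
 have eq: "(\<Sum>ka\<in>{k1..<K}. EM N p ka ka) = real (card (R N)) / real (card (C N)) * (\<Sum>ka<k1. EM N p ka ka)" for N
 proof -
  have "(\<Sum>ka\<in>{k1..<K}. EM N p ka ka) = (\<Sum>ka\<in>{k1..<K}. \<integral>x. ?e N x ka \<partial>GN N) / real (card (C N))"
   unfolding sum_divide_distrib by (intro sum.cong refl) (simp add: b SN_def side_def)
  moreover have "(\<Sum>ka<k1. EM N p ka ka) = (\<Sum>ka<k1. \<integral>x. ?e N x ka \<partial>GN N) / real (card (R N))"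
   unfolding sum_divide_distrib using k1 by (intro sum.cong refl) (simp add: b SN_def side_def)
  ultimately show ?thesis unfolding a using nz[of N] by simp
 qed
 have "(%N. \<Sum>ka\<in>{k1..<K}. EM N p ka ka) \<longlonglongrightarrow> (\<Sum>ka\<in>{k1..<K}. Mo \<alpha> p ka ka)"
  by (intro tendsto_sum EM_limit) auto
 moreover have "(%N. \<Sum>ka\<in>{k1..<K}. EM N p ka ka) \<longlonglongrightarrow> \<alpha> * tt \<alpha> p"
  unfolding eq tt_def using k1 by (intro tendsto_mult ratio tendsto_sum EM_limit) auto
 ultimately show ?thesis by (rule LIMSEQ_unique)
qed

lemma form_nonneg_Mo:
 assumes S: "S = {..<k1} \<or> S = {k1..<K}"
 shows "(\<Sum>ka\<in>S. \<Sum>ka'\<in>S. (u ka * u ka') * Mo \<alpha> (2 * q) ka ka') \<le> (\<Sum>ka\<in>S. (u ka)\<^sup>2) * (\<Sum>ka\<in>S. Mo \<alpha> (2 * q) ka ka)"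
proof (rule gram_le[OF S])
 fix w
 have "(\<Sum>ka\<in>S. \<Sum>ka'\<in>S. u ka * u ka' * (w ka * w ka')) = (\<Sum>ka\<in>S. u ka * w ka)\<^sup>2"
  unfolding power2_eq_square sum_product by (intro sum.cong refl) (simp add: mult_ac)
 then show "(\<Sum>ka\<in>S. \<Sum>ka'\<in>S. u ka * u ka' * (w ka * w ka')) \<le> (\<Sum>ka\<in>S. (u ka)\<^sup>2) * (\<Sum>ka\<in>S. (w ka)\<^sup>2)"
  using Cauchy_Schwarz_ineq_sum[of u w S] by simp
qed

lemma Psi_le:
 assumes c: "!!w. (\<Sum>ka<k1. \<Sum>ka'<k1. CC ka ka' * (w ka * w ka')) \<le> c * (\<Sum>ka<k1. (w ka)\<^sup>2)"
 shows "Psi (Mo \<alpha> (2 * p)) (Mo \<alpha> (2 * q)) \<le> c * (\<Sum>mu\<in>{k1..<K}. Mo \<alpha> (2 * p) mu mu) * tt \<alpha> (2 * q)"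
proof -
 let ?X = "{k1..<K}"
 let ?A = "Mo \<alpha> (2 * p)" and ?B = "Mo \<alpha> (2 * q)"
 define N where "N ka' ka = (\<Sum>i<l. \<Sum>mu\<in>?X. \<Sum>mu'\<in>?X. a i ka mu * a i ka' mu' * ?A mu mu')" for ka' ka
 have shuffle: "(\<Sum>i<l. \<Sum>ka<k1. \<Sum>mu\<in>?X. \<Sum>ka'<k1. \<Sum>mu'\<in>?X. a i ka mu * a i ka' mu' * ?A mu mu' * G ka' ka)
  = (\<Sum>ka'<k1. \<Sum>ka<k1. N ka' ka * G ka' ka)" for G
 proof -
  let ?h = "%i ka mu ka' mu'. a i ka mu * a i ka' mu' * ?A mu mu' * G ka' ka"
  have "(\<Sum>i<l. \<Sum>ka<k1. \<Sum>mu\<in>?X. \<Sum>ka'<k1. \<Sum>mu'\<in>?X. ?h i ka mu ka' mu')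
   = (\<Sum>i<l. \<Sum>ka<k1. \<Sum>ka'<k1. \<Sum>mu\<in>?X. \<Sum>mu'\<in>?X. ?h i ka mu ka' mu')"
   by (rule sum.cong[OF refl], rule sum.cong[OF refl], rule sum.swap)
  also have "\<dots> = (\<Sum>i<l. \<Sum>ka'<k1. \<Sum>ka<k1. \<Sum>mu\<in>?X. \<Sum>mu'\<in>?X. ?h i ka mu ka' mu')"
   by (rule sum.cong[OF refl], rule sum.swap)
  also have "\<dots> = (\<Sum>ka'<k1. \<Sum>i<l. \<Sum>ka<k1. \<Sum>mu\<in>?X. \<Sum>mu'\<in>?X. ?h i ka mu ka' mu')"
   by (rule sum.swap)
  also have "\<dots> = (\<Sum>ka'<k1. \<Sum>ka<k1. \<Sum>i<l. \<Sum>mu\<in>?X. \<Sum>mu'\<in>?X. ?h i ka mu ka' mu')"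
   by (rule sum.cong[OF refl], rule sum.swap)
  finally show ?thesis by (simp add: N_def sum_distrib_right)
 qed
 have N: "(\<Sum>ka'<k1. \<Sum>ka<k1. N ka' ka * (w ka' * w ka)) \<le> (c * (\<Sum>mu\<in>?X. ?A mu mu)) * (\<Sum>ka<k1. (w ka)\<^sup>2)" for w
 proof -
  let ?u = "%i mu. \<Sum>ka<k1. a i ka mu * w ka"
  have "(\<Sum>ka'<k1. \<Sum>ka<k1. N ka' ka * (w ka' * w ka))
   = (\<Sum>i<l. \<Sum>ka<k1. \<Sum>mu\<in>?X. \<Sum>ka'<k1. \<Sum>mu'\<in>?X. a i ka mu * a i ka' mu' * ?A mu mu' * (w ka' * w ka))"
   by (rule shuffle[symmetric])
  also have "\<dots> = (\<Sum>i<l. \<Sum>mu\<in>?X. \<Sum>ka<k1. \<Sum>mu'\<in>?X. \<Sum>ka'<k1. a i ka mu * a i ka' mu' * ?A mu mu' * (w ka' * w ka))"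
  proof (rule sum.cong[OF refl])
   fix i
   let ?h = "%ka mu ka' mu'. a i ka mu * a i ka' mu' * ?A mu mu' * (w ka' * w ka)"
   have "(\<Sum>ka<k1. \<Sum>mu\<in>?X. \<Sum>ka'<k1. \<Sum>mu'\<in>?X. ?h ka mu ka' mu') = (\<Sum>mu\<in>?X. \<Sum>ka<k1. \<Sum>ka'<k1. \<Sum>mu'\<in>?X. ?h ka mu ka' mu')"
    by (rule sum.swap)
   also have "\<dots> = (\<Sum>mu\<in>?X. \<Sum>ka<k1. \<Sum>mu'\<in>?X. \<Sum>ka'<k1. ?h ka mu ka' mu')"
    by (rule sum.cong[OF refl], rule sum.cong[OF refl], rule sum.swap)
   finally show "(\<Sum>ka<k1. \<Sum>mu\<in>?X. \<Sum>ka'<k1. \<Sum>mu'\<in>?X. ?h ka mu ka' mu')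
    = (\<Sum>mu\<in>?X. \<Sum>ka<k1. \<Sum>mu'\<in>?X. \<Sum>ka'<k1. ?h ka mu ka' mu')" .
  qed
  also have "\<dots> = (\<Sum>i<l. \<Sum>mu\<in>?X. \<Sum>mu'\<in>?X. \<Sum>ka<k1. \<Sum>ka'<k1. a i ka mu * a i ka' mu' * ?A mu mu' * (w ka' * w ka))"
   by (rule sum.cong[OF refl], rule sum.cong[OF refl], rule sum.swap)
  also have "\<dots> = (\<Sum>i<l. \<Sum>mu\<in>?X. \<Sum>mu'\<in>?X. (?u i mu * ?u i mu') * ?A mu mu')"
   unfolding sum_product unfolding sum_distrib_right by (intro sum.cong refl) (simp add: mult_ac)
  also have "\<dots> \<le> (\<Sum>i<l. (\<Sum>mu\<in>?X. (?u i mu)\<^sup>2) * (\<Sum>mu\<in>?X. ?A mu mu))"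
   by (intro sum_mono form_nonneg_Mo) simp
  also have "\<dots> = (\<Sum>ka<k1. \<Sum>ka'<k1. CC ka ka' * (w ka * w ka')) * (\<Sum>mu\<in>?X. ?A mu mu)"
   unfolding CC_form by (simp only: sum_distrib_right)
  also have "\<dots> \<le> (c * (\<Sum>ka<k1. (w ka)\<^sup>2)) * (\<Sum>mu\<in>?X. ?A mu mu)"
   by (intro mult_right_mono c trace_nonneg) simp
  finally show ?thesis by (simp add: mult_ac)
 qed
 have "Psi ?A ?B = (\<Sum>ka'<k1. \<Sum>ka<k1. N ka' ka * ?B ka' ka)"
  unfolding shuffle[symmetric] Psi_def csum_blocks by (simp add: mult.assoc)
 also have "\<dots> \<le> (c * (\<Sum>mu\<in>?X. ?A mu mu)) * (\<Sum>ka<k1. ?B ka ka)"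
  by (rule gram_le[OF _ N]) simp
 finally show ?thesis by (simp add: tt_def)
qed

text \<open>The recursion for the traces loses the matrix structure and keeps only an upper bound
 \<open>c\<close> for \<open>CC\<close>.\<close>

lemma tt_rec:
 assumes c: "!!w. (\<Sum>ka<k1. \<Sum>ka'<k1. CC ka ka' * (w ka * w ka')) \<le> c * (\<Sum>ka<k1. (w ka)\<^sup>2)"
 shows "tt \<alpha> (2 * Suc q) \<le> c * (tt \<alpha> (2 * q) + \<alpha> * (\<Sum>i<q. tt \<alpha> (2 * (q - i)) * tt \<alpha> (2 * i)))"
proof -
 let ?t = "%i. tt \<alpha> (2 * i)"
 have 1: "?t (Suc q) = (\<Sum>i<q. Psi (Mo \<alpha> (2 * (q - i))) (Mo \<alpha> (2 * i))) + Psi (Mo \<alpha> 0) (Mo \<alpha> (2 * q))"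
  unfolding tt_Suc lessThan_Suc_atMost[symmetric] by simp
 have 2: "Psi (Mo \<alpha> (2 * (q - i))) (Mo \<alpha> (2 * i)) \<le> c * (\<alpha> * (?t (q - i) * ?t i))" if "i < q" for i
 proof -
  have "0 < 2 * (q - i)" using that by simp
  from Psi_le[OF c, of "q - i" i] show ?thesis unfolding column_trace[OF \<open>0 < 2 * (q - i)\<close>] by (simp only: mult.assoc)
 qed
 have 3: "Psi (Mo \<alpha> 0) (Mo \<alpha> (2 * q)) \<le> c * ?t q"
 proof -
  have "Psi (Mo \<alpha> 0) (Mo \<alpha> (2 * q)) = (\<Sum>ka<k1. \<Sum>ka'<k1. CC ka ka' * Mo \<alpha> (2 * q) ka' ka)"
   unfolding Mo.simps Psi_one_block ..
  also have "\<dots> = (\<Sum>ka<k1. \<Sum>ka'<k1. CC ka ka' * Mo \<alpha> (2 * q) ka ka')"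
   by (intro sum.cong refl arg_cong2[of _ _ _ _ "(*)"] Mo_sym[of "{..<k1}"]) auto
  also have "\<dots> \<le> c * (\<Sum>ka<k1. Mo \<alpha> (2 * q) ka ka)"
   by (rule gram_le[OF _ c]) simp
  finally show ?thesis by (simp only: tt_def)
 qed
 have "(\<Sum>i<q. Psi (Mo \<alpha> (2 * (q - i))) (Mo \<alpha> (2 * i))) \<le> (\<Sum>i<q. c * (\<alpha> * (?t (q - i) * ?t i)))"
  by (rule sum_mono) (use 2 in auto)
 also have "\<dots> = c * (\<alpha> * (\<Sum>i<q. ?t (q - i) * ?t i))" by (simp only: sum_distrib_left)
 finally show ?thesis unfolding 1 using 3 by (simp only: distrib_left)
qed

end

section \<open>Growth of the limiting moments\<close>

context bipartite
begin

lemma tt_nonneg': "0 \<le> \<alpha> ==> 0 \<le> tt \<alpha> (2 * q)"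
proof -
 assume "0 \<le> \<alpha>"
 then obtain R C where "bip_seq K a k1 R C \<alpha>" using ex_bip_seq by blast
 then interpret bip_seq K l a k1 R C \<alpha> .
 show ?thesis by (rule tt_nonneg)
qed

text \<open>Meaning that \<open>z\<close> is at least the exponential growth rate of the moments. Comparing
 with the second moment, instead of allowing any constant, fits the lower bound for the largest
 singular value.\<close>

definition edge_bound :: "real => real => bool" where
 "edge_bound \<alpha> z \<longleftrightarrow> 0 \<le> z \<and> (\<forall>q. tt \<alpha> (2 * Suc q) \<le> z ^ (2 * q) * tt \<alpha> 2)"

lemma ex_edge_bound:
 assumes \<alpha>: "0 \<le> \<alpha>"
 shows "\<exists>z. edge_bound \<alpha> z"
proof -
 obtain R C where "bip_seq K a k1 R C \<alpha>" using ex_bip_seq \<alpha> by blast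
 then interpret bip_seq K l a k1 R C \<alpha> .
 let ?t = "%q. tt \<alpha> (2 * q)"
 let ?c = "tt \<alpha> 2"
 have c0: "0 \<le> ?c" using tt_nonneg[of 1] by simp
 have rec: "?t (Suc q) \<le> ?c * (?t q + \<alpha> * (\<Sum>i<q. ?t (q - i) * ?t i))" for q
  by (rule tt_rec) (use CC_le_trace tt_2 in simp)
 show ?thesis
 proof (cases "?c = 0")
  case True
  have "edge_bound \<alpha> 0" unfolding edge_bound_def using rec True by simp
  then show ?thesis by blast
 next
  case False
  then have c: "0 < ?c" using c0 by simp
  define T where "T = real k1 + 1"
  define s where "s = 1 / (1 + ?c * (T + \<alpha> * T\<^sup>2))"
  have T: "0 < T" by (simp add: T_def)
  have p: "0 \<le> ?c * (T + \<alpha> * T\<^sup>2)" using c0 T \<alpha> by (intro mult_nonneg_nonneg add_nonneg_nonneg) auto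
  have s: "0 < s" unfolding s_def using p by simp
  have "s * (?c * (T + \<alpha> * T\<^sup>2)) \<le> 1" unfolding s_def using p by simp
  then have "?t 0 + s * ?c * (T + \<alpha> * T\<^sup>2) \<le> T" by (simp add: tt_0 T_def mult.assoc)
  then have g: "?t q * s ^ q \<le> T" for q
   using T s \<alpha> c0 by (intro quadratic_growth[OF tt_nonneg rec]) auto
  \<comment> \<open>The factor \<open>D\<close> turns the bound by a constant into one by the second moment.\<close>
 define D where "D = max 1 (T / (s * ?c))"
  have D: "1 \<le> D" "T / (s * ?c) \<le> D" by (auto simp: D_def)
  have "tt \<alpha> (2 * Suc q) \<le> (sqrt (D / s)) ^ (2 * q) * ?c" for q
  proof (cases q)
   case (Suc q')
   have "D ^ 1 \<le> D ^ q" using D Suc by (intro power_increasing) auto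
   then have "T / (s * ?c) \<le> D ^ q" using D by simp
   then have "T \<le> D ^ q * (s * ?c)" using s c by (simp add: pos_divide_le_eq)
   then have "?t (Suc q) * s ^ Suc q \<le> D ^ q * (s * ?c)" using g[of "Suc q"] by linarith
   then have "?t (Suc q) * s ^ q \<le> D ^ q * ?c" using s by (simp add: mult_ac)
   then have "?t (Suc q) \<le> D ^ q * ?c / s ^ q" using s by (simp add: pos_le_divide_eq)
   moreover have "(sqrt (D / s)) ^ (2 * q) = (D / s) ^ q" using D s by (simp add: power_mult)
   ultimately show ?thesis by (simp add: power_divide)
  qed simp
  then have "edge_bound \<alpha> (sqrt (D / s))" unfolding edge_bound_def using D s by simp
  then show ?thesis by blast
 qed
qed

lemma edge_growth:
 assumes \<alpha>: "0 \<le> \<alpha>" and z: "edge_bound \<alpha> z" "z < z'"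
 shows "\<exists>C\<ge>0. \<forall>q. tt \<alpha> (2 * q) \<le> C * z' ^ (2 * q)"
proof -
 have z': "0 \<le> z" "0 < z'" using z by (auto simp: edge_bound_def)
 have c: "0 \<le> tt \<alpha> 2" using tt_nonneg'[OF \<alpha>, of 1] by simp
 let ?C = "real k1 + tt \<alpha> 2 / z'\<^sup>2"
 have "tt \<alpha> (2 * q) \<le> ?C * z' ^ (2 * q)" for q
 proof (cases q)
  case 0
  then show ?thesis using c z' by (simp add: tt_0)
 next
  case (Suc q')
  have "tt \<alpha> (2 * Suc q') \<le> z ^ (2 * q') * tt \<alpha> 2" using z by (simp add: edge_bound_def)
  also have "\<dots> \<le> z' ^ (2 * q') * tt \<alpha> 2" using z z' c by (intro mult_right_mono power_mono) auto
  also have "\<dots> = tt \<alpha> 2 / z'\<^sup>2 * z' ^ (2 * Suc q')" using z' by (simp add: power2_eq_square)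
  also have "\<dots> \<le> ?C * z' ^ (2 * Suc q')" using z' by (intro mult_right_mono) auto
  finally show ?thesis by (simp only: Suc)
 qed
 moreover have "0 \<le> ?C" using c by simp
 ultimately show ?thesis by blast
qed

lemma HH_zero: "HH 0 A B ka0 ka0' = csum (%ka mu ka' mu'. if ka = ka0 then A mu mu' * B ka' ka0' else 0)"
proof -
 have "csum (%ka mu ka' mu'. if mu' = ka0 then 0 * A ka' ka * B mu ka0' else 0) = 0" by (simp add: csum_eq)
 then show ?thesis by (simp only: HH_def)
qed

lemma csum_0: "(!!ka mu ka' mu'. ka < k1 ==> k1 \<le> mu ==> mu < K ==> f ka mu ka' mu' = 0) ==> csum f = 0"
proof -
 assume "!!ka mu ka' mu'. ka < k1 ==> k1 \<le> mu ==> mu < K ==> f ka mu ka' mu' = 0"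
 then have "csum f = csum (%_ _ _ _. 0)" by (intro csum_cong_bip) auto
 then show ?thesis by (simp add: csum_eq)
qed

lemma Mo_zero_columns:
 assumes "k1 \<le> mu" "0 < p"
 shows "Mo 0 p mu mu' = 0"
proof -
 consider "p = Suc 0" | p' where "p = Suc (Suc p')" using assms by (metis gr0_implies_Suc not0_implies_Suc)
 then show ?thesis
 proof cases
  case (2 p')
  have "HH 0 (Mo 0 (p' - j)) (Mo 0 j) mu mu' = 0" for j
   unfolding HH_zero using assms by (intro csum_0) auto
  then show ?thesis by (simp add: 2)
 qed simp
qed

lemma Mo_zero_Suc:
 assumes ka: "ka < k1"
 shows "Mo 0 (2 * Suc q) ka ka0 = (\<Sum>mu<k1. CC ka mu * Mo 0 (2 * q) mu ka0)"
proof -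
 have "HH 0 (Mo 0 (2 * q - j)) (Mo 0 j) ka ka0 = 0" if "j < 2 * q" for j
  unfolding HH_zero by (rule csum_0) (use that in \<open>simp add: Mo_zero_columns\<close>)
 then have z: "(\<Sum>j<2 * q. HH 0 (Mo 0 (2 * q - j)) (Mo 0 j) ka ka0) = 0" by simp
 have "Mo 0 (2 * Suc q) ka ka0 = (\<Sum>j\<le>2 * q. HH 0 (Mo 0 (2 * q - j)) (Mo 0 j) ka ka0)" by simp
 also have "\<dots> = HH 0 (Mo 0 0) (Mo 0 (2 * q)) ka ka0"
  unfolding lessThan_Suc_atMost[symmetric] sum.lessThan_Suc z by simp
 also have "\<dots> = Psi (%mu mu'. if mu = mu' then 1 else 0) (%ka' ka1. if ka1 = ka then Mo 0 (2 * q) ka' ka0 else 0)"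
  unfolding HH_zero Psi_def by (rule csum_cong_bip) simp
 also have "\<dots> = (\<Sum>ka1<k1. if ka1 = ka then (\<Sum>mu<k1. CC ka mu * Mo 0 (2 * q) mu ka0) else 0)"
  unfolding Psi_one_block by (intro sum.cong refl) auto
 also have "\<dots> = (\<Sum>mu<k1. CC ka mu * Mo 0 (2 * q) mu ka0)" using ka by simp
 finally show ?thesis .
qed

text \<open>For \<open>\<alpha> = 0\<close> the moments are the powers of \<open>CC\<close>, and their growth
 rate is the largest eigenvalue of \<open>CC\<close>. Quadratic forms along the orders \<open>2 ^
 k\<close> replace the spectral theorem.\<close>

lemma edge_CC:
 assumes z: "edge_bound 0 z"
 shows "(\<Sum>ka<k1. \<Sum>ka'<k1. CC ka ka' * (w ka * w ka')) \<le> z\<^sup>2 * (\<Sum>ka<k1. (w ka)\<^sup>2)"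
proof (rule ccontr)
 assume "\<not> ?thesis"
 then have lt: "z\<^sup>2 * (\<Sum>ka<k1. (w ka)\<^sup>2) < (\<Sum>ka<k1. \<Sum>ka'<k1. CC ka ka' * (w ka * w ka'))" by simp
 obtain R C where "bip_seq K a k1 R C 0" using ex_bip_seq by blast
 then interpret bip_seq K l a k1 R C 0 .
 define v where "v q ka = (\<Sum>ka'<k1. Mo 0 (2 * q) ka ka' * w ka')" for q ka
 define ip where "ip p q = (\<Sum>ka<k1. v p ka * v q ka)" for p q
 have v0: "v 0 ka = w ka" if "ka < k1" for ka
 proof -
  have "v 0 ka = (\<Sum>ka'<k1. if ka' = ka then w ka' else 0)" unfolding v_def by (intro sum.cong refl) auto
  then show ?thesis using that by simp
 qed
 have vS: "v (Suc q) ka = (\<Sum>mu<k1. CC ka mu * v q mu)" if "ka < k1" for q ka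
 proof -
  have "v (Suc q) ka = (\<Sum>ka'<k1. \<Sum>mu<k1. CC ka mu * (Mo 0 (2 * q) mu ka' * w ka'))"
   unfolding v_def Mo_zero_Suc[OF that] by (simp add: sum_distrib_right mult.assoc)
  also have "\<dots> = (\<Sum>mu<k1. \<Sum>ka'<k1. CC ka mu * (Mo 0 (2 * q) mu ka' * w ka'))" by (rule sum.swap)
  finally show ?thesis by (simp add: v_def sum_distrib_left)
 qed
 have shift: "ip (Suc p) q = ip p (Suc q)" for p q
 proof -
  have "ip (Suc p) q = (\<Sum>ka<k1. \<Sum>mu<k1. CC ka mu * v p mu * v q ka)"
   unfolding ip_def by (intro sum.cong refl) (simp add: vS sum_distrib_right)
  also have "\<dots> = (\<Sum>mu<k1. \<Sum>ka<k1. CC ka mu * v p mu * v q ka)" by (rule sum.swap)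
  also have "\<dots> = ip p (Suc q)"
   unfolding ip_def
  proof (intro sum.cong refl)
   fix mu assume "mu \<in> {..<k1}"
   then have "v (Suc q) mu = (\<Sum>ka<k1. CC mu ka * v q ka)" by (simp add: vS)
   then show "(\<Sum>ka<k1. CC ka mu * v p mu * v q ka) = v p mu * v (Suc q) mu"
    by (simp add: sum_distrib_left CC_sym[of _ mu] mult_ac)
  qed
  finally show ?thesis .
 qed
 have ip0: "ip p q = ip 0 (p + q)" for p q
  by (induction p arbitrary: q) (simp_all add: shift)
 have g0: "ip 0 0 = (\<Sum>ka<k1. (w ka)\<^sup>2)" by (simp add: ip_def v0 power2_eq_square)
 have g1: "ip 0 1 = (\<Sum>ka<k1. \<Sum>ka'<k1. CC ka ka' * (w ka * w ka'))"
  unfolding ip_def One_nat_def by (intro sum.cong refl) (simp add: vS v0 sum_distrib_left mult_ac)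
 have pos: "0 < ip 0 0"
 proof (rule ccontr)
  assume "\<not> ?thesis"
  moreover have "0 \<le> ip 0 0" unfolding g0 by (intro sum_nonneg) auto
  ultimately have "(\<Sum>ka<k1. (w ka)\<^sup>2) = 0" using g0 by simp
  then show False using lt CC_le_trace[of w] by simp
 qed
 define x where "x = ip 0 1 / ip 0 0"
 have x: "z\<^sup>2 < x" unfolding x_def using lt pos by (simp add: g0 g1[unfolded One_nat_def] pos_less_divide_eq)
 \<comment> \<open>The forms grow like \<open>x ^ q\<close> at least, but at most like \<open>y ^ q\<close>.\<close>
 obtain y where y: "z\<^sup>2 < y" "y < x" using dense[OF x] by blast
 have y0: "0 < y" using y(1) zero_le_power2[of z] by linarith
 have "z < sqrt y" using y(1) by (rule real_less_rsqrt)
 then obtain B where B: "0 \<le> B" "!!q. tt 0 (2 * q) \<le> B * sqrt y ^ (2 * q)"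
  using edge_growth[OF _ z] by auto
 have upper: "ip 0 q \<le> ip 0 0 * (B * y ^ q)" for q
 proof -
  have "ip 0 q = (\<Sum>ka<k1. \<Sum>ka'<k1. (w ka * w ka') * Mo 0 (2 * q) ka ka')"
   unfolding ip_def by (intro sum.cong refl) (simp add: v0, simp add: v_def sum_distrib_left mult_ac)
  also have "\<dots> \<le> (\<Sum>ka<k1. (w ka)\<^sup>2) * tt 0 (2 * q)"
   unfolding tt_def by (rule form_nonneg_Mo) simp
  also have "\<dots> \<le> ip 0 0 * (B * y ^ q)"
   unfolding g0[symmetric] using pos B(2)[of q] y0 by (intro mult_left_mono) (auto simp: power_mult)
  finally show ?thesis .
 qed
 have lower: "ip 0 0 * x ^ (2 ^ k) \<le> ip 0 (2 ^ k)" for k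
 proof (induction k)
  case 0
  then show ?case using pos by (simp add: x_def)
 next
  case (Suc k)
  let ?j = "2 ^ k :: nat"
  have x0: "0 \<le> x" using y y0 by linarith
  have "(ip 0 0 * x ^ ?j)\<^sup>2 \<le> (ip 0 ?j)\<^sup>2" using Suc pos x0 by (intro power_mono) auto
  also have "\<dots> \<le> ip 0 0 * ip ?j ?j"
   using Cauchy_Schwarz_ineq_sum[of "v 0" "v ?j" "{..<k1}"] unfolding ip_def by (simp add: power2_eq_square)
  also have "\<dots> = ip 0 0 * ip 0 (2 ^ Suc k)" unfolding ip0[of ?j ?j] by (simp add: mult_2)
  finally have "ip 0 0 * (ip 0 0 * x ^ (2 ^ Suc k)) \<le> ip 0 0 * ip 0 (2 ^ Suc k)"
   by (simp add: power2_eq_square power_add mult_2 mult_ac)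
  then show ?case using pos by simp
 qed
 have xy: "1 < x / y" using y y0 by simp
 obtain n where n: "B < (x / y) ^ n" using real_arch_pow[OF xy] by blast
 have "(x / y) ^ n \<le> (x / y) ^ (2 ^ n)" using xy less_exp[of n] by (intro power_increasing) auto
 moreover have "(x / y) ^ (2 ^ n) \<le> B"
 proof -
  have "ip 0 0 * x ^ (2 ^ n) \<le> ip 0 0 * (B * y ^ (2 ^ n))" using lower[of n] upper[of "2 ^ n"] by linarith
  then have "x ^ (2 ^ n) \<le> B * y ^ (2 ^ n)" using pos by simp
  then show ?thesis using y0 by (simp add: power_divide pos_divide_le_eq)
 qed
 ultimately show False using n by linarith
qed

text \<open>Deleting columns of a matrix with quotient \<open>\<alpha>\<close> leaves one with the larger
 quotient \<open>\<beta>\<close>.\<close>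

lemma tt_ratio:
 assumes \<alpha>: "0 < \<alpha>" "\<alpha> \<le> \<beta>"
 shows "tt \<beta> (2 ^ Suc s) \<le> (\<beta> / \<alpha>) ^ (2 ^ s) * tt \<alpha> (2 ^ Suc s)"
proof -
 let ?P = "2 ^ Suc s :: nat"
 define R where "R N = {..<Suc N}" for N
 define C where "C \<alpha> N = {..<nat \<lceil>real (Suc N) / \<alpha>\<rceil>}" for \<alpha> N
 have R: "R = (%N. {..<Suc N})" and C: "C x = (%N. {..<nat \<lceil>real (Suc N) / x\<rceil>})" for x
  by (auto simp: R_def C_def fun_eq_iff)
 interpret A: bip_seq K l a k1 R "C \<alpha>" \<alpha> unfolding R C by (rule bip_seq_ceiling[OF \<alpha>(1)])
 interpret B: bip_seq K l a k1 R "C \<beta>" \<beta> unfolding R C by (rule bip_seq_ceiling) (use \<alpha> in simp)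
 have le: "FF (R N) (C \<beta> N) ?P \<le> (real (card (C \<alpha> N)) / real (card (C \<beta> N))) ^ (2 ^ s) * FF (R N) (C \<alpha> N) ?P" for N
 proof (rule FF_mono[OF A.fin(1) A.fin(2) order.refl _ B.nz(2) refl])
  have "real (Suc N) / \<beta> \<le> real (Suc N) / \<alpha>" using \<alpha> by (intro divide_left_mono) auto
  then have "nat \<lceil>real (Suc N) / \<beta>\<rceil> \<le> nat \<lceil>real (Suc N) / \<alpha>\<rceil>" by (intro nat_mono ceiling_mono)
  then show "C \<beta> N \<subseteq> C \<alpha> N" unfolding C by (simp only: lessThan_subset_iff)
 qed
 have P0: "0 < ?P" by simp
 have "(%N. real (card (R N)) / real (card (C \<beta> N)) / (real (card (R N)) / real (card (C \<alpha> N)))) \<longlonglongrightarrow> \<beta> / \<alpha>"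
  using \<alpha> by (intro tendsto_divide A.ratio B.ratio) auto
 moreover have "real (card (R N)) / real (card (C \<beta> N)) / (real (card (R N)) / real (card (C \<alpha> N)))
  = real (card (C \<alpha> N)) / real (card (C \<beta> N))" for N using A.nz(1)[of N] by simp
 ultimately have "(%N. real (card (C \<alpha> N)) / real (card (C \<beta> N))) \<longlonglongrightarrow> \<beta> / \<alpha>" by simp
 then have "(%N. (real (card (C \<alpha> N)) / real (card (C \<beta> N))) ^ (2 ^ s) * (FF (R N) (C \<alpha> N) ?P / real (card (R N))))
  \<longlonglongrightarrow> (\<beta> / \<alpha>) ^ (2 ^ s) * (2 * tt \<alpha> ?P)"
  by (intro tendsto_mult tendsto_power A.FF_limit P0)
 moreover have "FF (R N) (C \<beta> N) ?P / real (card (R N))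
  \<le> (real (card (C \<alpha> N)) / real (card (C \<beta> N))) ^ (2 ^ s) * (FF (R N) (C \<alpha> N) ?P / real (card (R N)))" for N
  using divide_right_mono[OF le, of "real (card (R N))" N] by simp
 ultimately have "2 * tt \<beta> ?P \<le> (\<beta> / \<alpha>) ^ (2 ^ s) * (2 * tt \<alpha> ?P)"
  using LIMSEQ_le[OF B.FF_limit[OF P0]] by blast
 then show ?thesis by simp
qed

text \<open>For \<open>\<alpha> > 0\<close> this follows from comparison with a submatrix. For \<open>\<alpha>
 = 0\<close> that comparison fails, and the recursion for the traces is used instead, in which
 \<open>\<alpha>\<close> multiplies the quadratic term.\<close>

lemma edge_right_continuous:
 assumes \<alpha>: "0 \<le> \<alpha>" and z: "edge_bound \<alpha> z" "z < z'"
 shows "\<exists>\<beta>0>\<alpha>. \<forall>\<beta>. \<alpha> < \<beta> \<and> \<beta> \<le> \<beta>0 \<longrightarrow> (\<exists>B. \<forall>s. tt \<beta> (2 ^ Suc s) \<le> B * z' ^ (2 ^ Suc s))"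
proof (cases "\<alpha> = 0")
 case False
 then have \<alpha>: "0 < \<alpha>" using \<alpha> by simp
 define z1 where "z1 = (z + z') / 2"
 have z0: "0 \<le> z" using z by (simp add: edge_bound_def)
 have z1: "z < z1" "z1 < z'" "0 < z1" using z z0 by (auto simp: z1_def)
 obtain B where B: "0 \<le> B" "!!q. tt \<alpha> (2 * q) \<le> B * z1 ^ (2 * q)"
  using edge_growth[OF _ z(1) z1(1)] \<alpha> by auto
 have "tt \<beta> (2 ^ Suc s) \<le> B * z' ^ (2 ^ Suc s)" if \<beta>: "\<alpha> < \<beta>" "\<beta> \<le> \<alpha> * (z' / z1)\<^sup>2" for \<beta> s
 proof -
  have "tt \<beta> (2 ^ Suc s) \<le> (\<beta> / \<alpha>) ^ (2 ^ s) * tt \<alpha> (2 ^ Suc s)"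
   using tt_ratio[OF \<alpha>, of \<beta> s] \<beta> by simp
  also have "\<dots> \<le> (\<beta> / \<alpha>) ^ (2 ^ s) * (B * z1 ^ (2 ^ Suc s))"
   using B(2)[of "2 ^ s"] \<alpha> \<beta> by (intro mult_left_mono) auto
  also have "\<dots> \<le> ((z' / z1)\<^sup>2) ^ (2 ^ s) * (B * z1 ^ (2 ^ Suc s))"
   using \<alpha> \<beta> B z1 by (intro mult_right_mono power_mono) (auto simp: pos_divide_le_eq mult.commute)
  also have "\<dots> = B * z' ^ (2 ^ Suc s)"
   using z1 by (simp add: power_mult[symmetric] power_divide)
  finally show ?thesis .
 qed
 moreover have "\<alpha> < \<alpha> * (z' / z1)\<^sup>2"
 proof -
  have "1 < z' / z1" using z1 by simp
  then have "1 < (z' / z1)\<^sup>2" by (intro one_less_power) auto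
  then show ?thesis using \<alpha> by simp
 qed
 ultimately show ?thesis by blast
next
 case True
 have z0: "0 \<le> z" "0 < z'" using z by (auto simp: edge_bound_def)
 define \<rho> where "\<rho> = z\<^sup>2 / z'\<^sup>2"
 have \<rho>: "0 \<le> \<rho>" "\<rho> < 1"
  using z z0 power_strict_mono[of z z' 2] by (auto simp: \<rho>_def)
 define T where "T = 2 * real k1 / (1 - \<rho>)"
 have T: "0 \<le> T" "T * (1 - \<rho>) = 2 * real k1" using \<rho> by (auto simp: T_def)
 \<comment> \<open>Small enough for \<open>T\<close> to be a supersolution in \<open>quadratic_growth\<close>.\<close>
 define \<beta>0 where "\<beta>0 = real k1 / (T\<^sup>2 + 1)"
 have T2: "0 < T\<^sup>2 + 1" using zero_le_power2[of T] by linarith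
 have \<beta>0: "0 < \<beta>0" using k1 T2 by (simp add: \<beta>0_def)
 have "tt \<beta> (2 ^ Suc s) \<le> T * z' ^ (2 ^ Suc s)" if \<beta>: "0 < \<beta>" "\<beta> \<le> \<beta>0" for \<beta> s
 proof -
  obtain R C where "bip_seq K a k1 R C \<beta>" using ex_bip_seq[of \<beta>] \<beta> by auto
  then interpret bip_seq K l a k1 R C \<beta> .
  have "\<beta> * T\<^sup>2 \<le> \<beta>0 * (T\<^sup>2 + 1)" using \<beta> \<beta>0 by (intro mult_mono) auto
  also have "\<dots> = real k1" using T2 by (simp add: \<beta>0_def)
  finally have "\<beta> * T\<^sup>2 \<le> real k1" .
  then have "\<rho> * (\<beta> * T\<^sup>2) \<le> 1 * real k1" using \<rho> \<beta> by (intro mult_mono) auto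
  then have "real k1 + \<rho> * (T + \<beta> * T\<^sup>2) \<le> T" using T(2) by (simp add: algebra_simps)
  then have 1: "tt \<beta> (2 * 0) + 1 / z'\<^sup>2 * z\<^sup>2 * (T + \<beta> * T\<^sup>2) \<le> T" by (simp add: tt_0 \<rho>_def)
  have "tt \<beta> (2 * q) * (1 / z'\<^sup>2) ^ q \<le> T" for q
   using z(1) True \<beta> z0 T 1
   by (intro quadratic_growth[OF tt_nonneg tt_rec[OF edge_CC]]) auto
  from this[of "2 ^ s"] have "tt \<beta> (2 ^ Suc s) / (z'\<^sup>2) ^ (2 ^ s) \<le> T" by (simp add: power_one_over)
  then show ?thesis using z0 by (simp add: pos_divide_le_eq power_mult)
 qed
 then show ?thesis using \<beta>0 True by (intro exI[of _ \<beta>0]) auto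
qed

text \<open>The errors of all doublings together are a geometric series with sum \<open>4 * c\<close>, and the
 limit of the normalised traces along the doublings is the moment for the exact quotient of the
 dimensions.\<close>

theorem trace_moment_bound:
 assumes fin: "finite R" "finite C" and nz: "0 < card R" "0 < card C"
  and P: "P = 2 ^ Suc s" and \<tau>: "0 < \<tau>"
  and c: "c = 1 / real (card C) * real P ^ 2 *
   (2 * AA * (16 * (1 / real (card C)) * AA * real P ^ 2 / \<tau> ^ 4 + 1 / \<tau>\<^sup>2))"
 shows "FF R C P \<le> exp (4 * c) *
  (real (card R) * (2 * tt (real (card R) / real (card C)) P) + \<tau> ^ P * (real K * real (card (R \<union> C))) / 2)"
proof -
 let ?D = "\<tau> ^ P * (real K * real (card (R \<union> C)))"
 let ?good = "%j X. finite (fst X) \<and> finite (snd X) \<and> card (fst X) = 2 ^ j * card R \<and>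
  card (snd X) = 2 ^ j * card C \<and> card (fst X \<union> snd X) = 2 ^ j * card (R \<union> C) \<and> (j = 0 \<longrightarrow> X = (R, C))"
 let ?step = "%j X Y. FF (fst X) (snd X) P / 2 ^ j + ?D / 2
  \<le> exp (2 * (c / 2 ^ j)) * (FF (fst Y) (snd Y) P / 2 ^ Suc j + ?D / 2)"
 have AA0: "0 \<le> AA" by (rule AA_nonneg[OF fin(1)])
 have "\<exists>f. \<forall>j. ?good j (f j) \<and> ?step j (f j) (f (Suc j))"
 proof (rule dependent_nat_choice)
  show "\<exists>X. ?good 0 X" using fin by (intro exI[of _ "(R, C)"]) simp
  fix X j assume g: "?good j X"
  let ?cj = "1 / real (card (snd X)) * real P ^ 2 *
   (2 * AA * (16 * (1 / real (card (snd X))) * AA * real P ^ 2 / \<tau> ^ 4 + 1 / \<tau>\<^sup>2))"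
  have pos: "0 < card (snd X)" using g nz by simp
  obtain R2 C2 where d: "finite R2" "finite C2" "card R2 = 2 * card (fst X)" "card C2 = 2 * card (snd X)"
   "card (R2 \<union> C2) = 2 * card (fst X \<union> snd X)"
   "2 * FF (fst X) (snd X) P + \<tau> ^ P * (real K * real (card (fst X \<union> snd X)))
    \<le> exp (2 * ?cj) * (FF R2 C2 P + \<tau> ^ P * (real K * real (card (fst X \<union> snd X))))"
   using doubling[OF _ _ pos P \<tau>, of "fst X"] g by blast
  have cj: "?cj \<le> c / 2 ^ j"
  proof -
   have le: "1 / (2 ^ j * real (card C)) \<le> 1 / real (card C)"
    using nz mult_right_mono[of 1 "2 ^ j :: real" "real (card C)"] by (intro divide_left_mono) auto
   have "?cj = 1 / real (card C) * real P ^ 2 *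
    (2 * AA * (16 * (1 / (2 ^ j * real (card C))) * AA * real P ^ 2 / \<tau> ^ 4 + 1 / \<tau>\<^sup>2)) / 2 ^ j"
    using g by simp
   also have "\<dots> \<le> c / 2 ^ j"
    unfolding c using le AA0 \<tau>
    by (intro divide_right_mono mult_left_mono add_right_mono mult_right_mono) auto
   finally show ?thesis .
  qed
  have FFn: "0 \<le> FF R2 C2 P" using d unfolding P by (intro FF_nonneg) auto
  have D0: "0 \<le> ?D" using \<tau> by simp
  have Dj: "\<tau> ^ P * (real K * real (card (fst X \<union> snd X))) = 2 ^ j * ?D" using g by simp
  have "2 * FF (fst X) (snd X) P + 2 ^ j * ?D \<le> exp (2 * ?cj) * (FF R2 C2 P + 2 ^ j * ?D)"
   using d(6) unfolding Dj .
  also have "\<dots> \<le> exp (2 * (c / 2 ^ j)) * (FF R2 C2 P + 2 ^ j * ?D)"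
   using cj FFn D0 by (intro mult_right_mono) auto
  finally have "(2 * FF (fst X) (snd X) P + 2 ^ j * ?D) / 2 ^ Suc j
   \<le> exp (2 * (c / 2 ^ j)) * (FF R2 C2 P + 2 ^ j * ?D) / 2 ^ Suc j" by (rule divide_right_mono) simp
  moreover have "(2 * F + 2 ^ j * D) / 2 ^ Suc j = F / 2 ^ j + D / 2" for F D :: real by (simp add: field_simps)
  moreover have "e * (F + 2 ^ j * D) / 2 ^ Suc j = e * (F / 2 ^ Suc j + D / 2)" for e F D :: real by (simp add: field_simps)
  ultimately have "?step j X (R2, C2)" by simp
  then show "\<exists>Y. ?good (Suc j) Y \<and> ?step j X Y"
   using d g by (intro exI[of _ "(R2, C2)"]) auto
 qed
 then obtain f where f: "!!j. ?good j (f j)" "!!j. ?step j (f j) (f (Suc j))" by blast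
 define \<psi> where "\<psi> j = FF (fst (f j)) (snd (f j)) P / 2 ^ j + ?D / 2" for j
 have nn: "0 \<le> \<psi> j" for j
 proof -
  have "0 \<le> FF (fst (f j)) (snd (f j)) P" using f(1)[of j] unfolding P by (intro FF_nonneg) auto
  then show ?thesis using \<tau> by (simp add: \<psi>_def)
 qed
 have c0: "0 \<le> c" unfolding c using AA0 \<tau> by simp
 have it: "\<psi> 0 \<le> exp (4 * c - 4 * c / 2 ^ j) * \<psi> j" for j
 proof (induction j)
  case (Suc j)
  have "exp (4 * c - 4 * c / 2 ^ j) * \<psi> j \<le> exp (4 * c - 4 * c / 2 ^ j) * (exp (2 * (c / 2 ^ j)) * \<psi> (Suc j))"
   using f(2)[of j] unfolding \<psi>_def by (intro mult_left_mono) auto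
  also have "\<dots> = exp (4 * c - 4 * c / 2 ^ Suc j) * \<psi> (Suc j)"
  proof -
   have "4 * c - 4 * c / 2 ^ j + 2 * (c / 2 ^ j) = 4 * c - 4 * c / 2 ^ Suc j" by (simp add: field_simps)
   then show ?thesis by (simp only: mult.assoc[symmetric] exp_add[symmetric])
  qed
  finally show ?case using Suc by linarith
 qed simp
 have le: "\<psi> 0 \<le> exp (4 * c) * \<psi> j" for j
  by (rule order.trans[OF it[of j]]) (use nn c0 in \<open>auto intro!: mult_right_mono\<close>)
 let ?\<beta> = "real (card R) / real (card C)"
 have inf: "filterlim (%j. 2 ^ j * x) at_top sequentially" if "0 < x" for x :: nat
 proof (rule filterlim_at_top_mono[OF filterlim_ident])
  have "j \<le> 2 ^ j * x" for j
  proof -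
   have "j * 1 \<le> 2 ^ j * x" using that less_exp[of j] by (intro mult_le_mono) auto
   then show ?thesis by simp
  qed
  then show "\<forall>\<^sub>F j in sequentially. j \<le> 2 ^ j * x" by simp
 qed
 interpret S: bip_seq K l a k1 "%j. fst (f j)" "%j. snd (f j)" ?\<beta>
  by unfold_locales (use f(1) nz inf in auto)
 have "(%j. FF (fst (f j)) (snd (f j)) P / real (card (fst (f j)))) \<longlonglongrightarrow> 2 * tt ?\<beta> P"
  by (rule S.FF_limit) (simp add: P)
 from tendsto_add[OF tendsto_mult_left[OF this, of "real (card R)"] tendsto_const[of "?D / 2"]]
 have "(%j. real (card R) * (FF (fst (f j)) (snd (f j)) P / real (card (fst (f j)))) + ?D / 2)
  \<longlonglongrightarrow> real (card R) * (2 * tt ?\<beta> P) + ?D / 2" .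
 moreover have "real (card R) * (FF (fst (f j)) (snd (f j)) P / real (card (fst (f j)))) + ?D / 2 = \<psi> j" for j
  using f(1)[of j] nz by (simp add: \<psi>_def)
 ultimately have "\<psi> \<longlonglongrightarrow> real (card R) * (2 * tt ?\<beta> P) + ?D / 2" by simp
 from tendsto_mult_left[OF this, of "exp (4 * c)"]
 have "\<psi> 0 \<le> exp (4 * c) * (real (card R) * (2 * tt ?\<beta> P) + ?D / 2)"
  by (rule LIMSEQ_le_const) (use le in blast)
 moreover have "FF R C P \<le> \<psi> 0" using f(1)[of 0] \<tau> by (simp add: \<psi>_def)
 ultimately show ?thesis by linarith
qed

end

section \<open>Convergence of the expected largest singular value\<close>

lemma superset_with_card:
 fixes A :: "nat set"
 assumes "finite A" "card A \<le> k"
 shows "\<exists>B. finite B \<and> A \<subseteq> B \<and> card B = k"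
proof -
 have "infinite (UNIV - A)" using assms by (simp add: Diff_infinite_finite)
 then obtain T where T: "finite T" "card T = k - card A" "T \<subseteq> UNIV - A"
  using infinite_arbitrarily_large by metis
 then have "card (A \<union> T) = card A + card T" using assms by (intro card_Un_disjoint) auto
 then show ?thesis using T assms by (intro exI[of _ "A \<union> T"]) auto
qed

lemma le_plus_power:
 fixes s z :: real
 assumes "0 \<le> s" "0 < z"
 shows "s \<le> z + s ^ Suc k / z ^ k"
proof (cases "s \<le> z")
 case True
 have "0 \<le> s ^ Suc k / z ^ k" using assms by simp
 then show ?thesis using True by linarith
next
 case False
 have "s * 1 \<le> s * (s / z) ^ k" using assms False by (intro mult_left_mono one_le_power) auto
 then show ?thesis using assms by (simp add: power_divide)
qed

text \<open>The two inequalities are all that the limit theorem uses of the largest singular value.\<close>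

locale top_value = bip_seq +
 fixes S :: "nat => (nat \<times> nat \<times> nat => real) => real"
 assumes S_meas: "!!N. S N \<in> borel_measurable (GN N)"
  and S_nonneg: "!!N x. 0 \<le> S N x"
  and S_le: "!!N x q. 0 < q ==> S N x ^ (2 * q) \<le> tr (DN N) (XN N x ^ (2 * q)) / 2"
  and S_ge: "!!N x p q. 0 < p ==>
   tr (DN N) (XN N x ^ (2 * (p + q))) \<le> S N x ^ (2 * q) * tr (DN N) (XN N x ^ (2 * p))"
begin

lemma tr_int: "integrable (GN N) (%x. tr (DN N) (XN N x ^ p))"
 by (rule XW_integrable'[OF finJJ])

lemma S_int: "integrable (GN N) (S N)"
proof (rule Bochner_Integration.integrable_bound)
 interpret prob_space "GN N" by (rule prob_space_gm)
 show "integrable (GN N) (%x. 1 + tr (DN N) (XN N x ^ (2 * 1)) / 2)"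
  by (intro Bochner_Integration.integrable_add integrable_const integrable_divide tr_int)
 show "AE x in GN N. norm (S N x) \<le> norm (1 + tr (DN N) (XN N x ^ (2 * 1)) / 2)"
 proof (rule AE_I2)
  fix x
  have "S N x ^ 2 \<le> tr (DN N) (XN N x ^ (2 * 1)) / 2" using S_le[of 1 N x] by simp
  moreover have "S N x \<le> 1 + S N x ^ 2"
   using sum_squares_bound[of 1 "S N x"] zero_le_power2[of "S N x"] S_nonneg[of N x] by simp
  ultimately show "norm (S N x) \<le> norm (1 + tr (DN N) (XN N x ^ (2 * 1)) / 2)"
   using S_nonneg[of N x] by simp
 qed
qed (rule S_meas)

lemma row_trace_variance:
 "(%N. \<integral>x. (tr (DN N) (Gam (R N) (JJ N) * XN N x ^ p) / real (card (R N)) - tt \<alpha> p)\<^sup>2 \<partial>GN N) \<longlonglongrightarrow> 0"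
 "integrable (GN N) (%x. (tr (DN N) (Gam (R N) (JJ N) * XN N x ^ p) / real (card (R N)) - tt \<alpha> p)\<^sup>2)"
proof -
 let ?u = "%N x. tr (DN N) (Gam (R N) (JJ N) * XN N x ^ p) / real (card (R N))"
 have i1: "integrable (GN N) (?u N)" for N
  by (intro integrable_divide XW_integrable[OF finJJ adm_Gam[OF finJJ]])
 have i2: "integrable (GN N) (%x. (?u N x)\<^sup>2)" for N
  unfolding power_divide unfolding power2_eq_square
  by (intro integrable_divide XW_prod_integrable[OF finJJ adm_Gam[OF finJJ] adm_Gam[OF finJJ]])
 have eq: "(%x. (?u N x - tt \<alpha> p)\<^sup>2) = (%x. (?u N x)\<^sup>2 - 2 * tt \<alpha> p * ?u N x + (tt \<alpha> p)\<^sup>2)" for N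
  by (simp add: power2_diff mult_ac fun_eq_iff)
 have i3: "integrable (GN N) (%x. (?u N x)\<^sup>2 - 2 * tt \<alpha> p * ?u N x)" for N
  by (intro Bochner_Integration.integrable_diff i2 integrable_mult_right i1)
 have ic: "integrable (GN N) (%x. (tt \<alpha> p)\<^sup>2)" "(\<integral>x. (tt \<alpha> p)\<^sup>2 \<partial>GN N) = (tt \<alpha> p)\<^sup>2" for N
 proof -
  interpret prob_space "GN N" by (rule prob_space_gm)
  show "integrable (GN N) (%x. (tt \<alpha> p)\<^sup>2)" "(\<integral>x. (tt \<alpha> p)\<^sup>2 \<partial>GN N) = (tt \<alpha> p)\<^sup>2"
   by (simp_all add: prob_space)
 qed
 show "integrable (GN N) (%x. (?u N x - tt \<alpha> p)\<^sup>2)"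
  unfolding eq by (intro Bochner_Integration.integrable_add i3 ic)
 have "(\<integral>x. (?u N x - tt \<alpha> p)\<^sup>2 \<partial>GN N)
  = (\<integral>x. (?u N x)\<^sup>2 \<partial>GN N) - 2 * tt \<alpha> p * (\<integral>x. ?u N x \<partial>GN N) + (tt \<alpha> p)\<^sup>2" for N
  unfolding eq Bochner_Integration.integral_add[OF i3 ic(1)] ic(2)
   Bochner_Integration.integral_diff[OF i2 integrable_mult_right[OF i1]] by simp
 moreover have "(%N. (\<integral>x. (?u N x)\<^sup>2 \<partial>GN N) - 2 * tt \<alpha> p * (\<integral>x. ?u N x \<partial>GN N) + (tt \<alpha> p)\<^sup>2)
  \<longlonglongrightarrow> (tt \<alpha> p)\<^sup>2 - 2 * tt \<alpha> p * tt \<alpha> p + (tt \<alpha> p)\<^sup>2"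
 proof (intro tendsto_add tendsto_diff tendsto_mult_left tendsto_const row_trace_square_limit)
  show "(%N. \<integral>x. ?u N x \<partial>GN N) \<longlonglongrightarrow> tt \<alpha> p" using row_trace_limit[of p] by simp
 qed
 ultimately show "(%N. \<integral>x. (?u N x - tt \<alpha> p)\<^sup>2 \<partial>GN N) \<longlonglongrightarrow> 0"
  by (simp add: power2_eq_square)
qed

text \<open>On the event that the two traces are close to their limits, their quotient exceeds \<open>z ^ (2 *
 q)\<close>. Subtracting the relative square deviation makes the bound valid everywhere, so that
 it can be integrated.\<close>

lemma lower_edge:
 assumes z: "0 \<le> z" "\<not> edge_bound \<alpha> z" "y < z"
 shows "\<forall>\<^sub>F N in sequentially. y < (\<integral>x. S N x \<partial>GN N)"
proof -
 obtain q where q: "z ^ (2 * q) * tt \<alpha> 2 < tt \<alpha> (2 * Suc q)"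
  using z by (auto simp: edge_bound_def not_le)
 then have q0: "0 < q" by (cases q) auto
 let ?p = "2 * Suc q"
 let ?u = "%p N x. tr (DN N) (Gam (R N) (JJ N) * XN N x ^ p) / real (card (R N))"
 let ?V = "%p N x. (?u p N x - tt \<alpha> p)\<^sup>2"
 define d where "d = tt \<alpha> ?p - z ^ (2 * q) * tt \<alpha> 2"
 have d: "0 < d" using q by (simp add: d_def)
 have u: "?u (2 * p) N x = tr (DN N) (XN N x ^ (2 * p)) / 2 / real (card (R N))" if "0 < p" for p N x
  using tr_Gam_half[OF fin refl, of "2 * p" N N x] that by simp
 let ?e = "%N x. (2 * ?V ?p N x + 2 * (z ^ (2 * q))\<^sup>2 * ?V 2 N x) / d\<^sup>2"
 have pt: "z * (1 - ?e N x) \<le> S N x" for N x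
 proof -
  define w where "w = ?u ?p N x - z ^ (2 * q) * ?u 2 N x"
  have sq: "(w - d)\<^sup>2 \<le> 2 * ?V ?p N x + 2 * (z ^ (2 * q))\<^sup>2 * ?V 2 N x"
  proof -
   have "(a - b)\<^sup>2 \<le> 2 * a\<^sup>2 + 2 * b\<^sup>2" for a b :: real
    using zero_le_power2[of "a + b"] by (simp add: power2_sum power2_diff)
   from this[of "?u ?p N x - tt \<alpha> ?p" "z ^ (2 * q) * (?u 2 N x - tt \<alpha> 2)"]
   have "(?u ?p N x - tt \<alpha> ?p - z ^ (2 * q) * (?u 2 N x - tt \<alpha> 2))\<^sup>2
    \<le> 2 * ?V ?p N x + 2 * ((z ^ (2 * q))\<^sup>2 * ?V 2 N x)" by (simp only: power_mult_distrib)
   moreover have "w - d = ?u ?p N x - tt \<alpha> ?p - z ^ (2 * q) * (?u 2 N x - tt \<alpha> 2)"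
    unfolding w_def d_def by (simp only: right_diff_distrib)
   ultimately show ?thesis by (simp only: mult.assoc)
  qed
  show ?thesis
  proof (cases "w > 0")
   case True
   have R0: "0 < real (card (R N))" using nz(1)[of N] by simp
   have n1: "0 \<le> ?u 2 N x"
   proof -
    have "0 \<le> S N x ^ (2 * 1)" using S_nonneg by simp
    also have "\<dots> \<le> tr (DN N) (XN N x ^ (2 * 1)) / 2" by (rule S_le) simp
    finally show ?thesis using u[of 1 N x] by simp
   qed
   have "tr (DN N) (XN N x ^ ?p) \<le> S N x ^ (2 * q) * tr (DN N) (XN N x ^ 2)"
    using S_ge[of 1 N x q] by simp
   then have "tr (DN N) (XN N x ^ ?p) / 2 / real (card (R N)) \<le> S N x ^ (2 * q) * tr (DN N) (XN N x ^ 2) / 2 / real (card (R N))"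
    using R0 by (intro divide_right_mono) auto
   then have "?u ?p N x \<le> S N x ^ (2 * q) * ?u 2 N x"
    using u[of "Suc q" N x] u[of 1 N x] by simp
   then have "z ^ (2 * q) * ?u 2 N x < S N x ^ (2 * q) * ?u 2 N x" using True unfolding w_def by linarith
   then have "z ^ (2 * q) < S N x ^ (2 * q)" using n1 by (rule mult_right_less_imp_less)
   then have "z < S N x" using S_nonneg by (rule power_less_imp_less_base)
   moreover have "z * (1 - ?e N x) \<le> z * 1" using z by (intro mult_left_mono) auto
   ultimately show ?thesis by linarith
  next
   case False
   then have "d\<^sup>2 \<le> (d - w)\<^sup>2" using d by (intro power_mono) auto
   then have "d\<^sup>2 \<le> 2 * ?V ?p N x + 2 * (z ^ (2 * q))\<^sup>2 * ?V 2 N x"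
    using sq by (simp add: power2_commute)
   then have "1 \<le> ?e N x" using d by (simp add: pos_le_divide_eq)
   then have "z * (1 - ?e N x) \<le> 0" using z by (intro mult_nonneg_nonpos) auto
   then show ?thesis using S_nonneg[of N x] by linarith
  qed
 qed
 let ?E = "%N. (2 * (\<integral>x. ?V ?p N x \<partial>GN N) + 2 * (z ^ (2 * q))\<^sup>2 * (\<integral>x. ?V 2 N x \<partial>GN N)) / d\<^sup>2"
 have "z * (1 - ?E N) \<le> (\<integral>x. S N x \<partial>GN N)" for N
 proof -
  interpret prob_space "GN N" by (rule prob_space_gm)
  have i: "integrable (GN N) (?e N)"
   by (intro integrable_divide Bochner_Integration.integrable_add integrable_mult_right row_trace_variance(2))
  have "(\<integral>x. z * (1 - ?e N x) \<partial>GN N) \<le> (\<integral>x. S N x \<partial>GN N)"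
   by (intro integral_mono S_int pt integrable_mult_right Bochner_Integration.integrable_diff i integrable_const)
  also have "(\<integral>x. z * (1 - ?e N x) \<partial>GN N) = z * (1 - (\<integral>x. ?e N x \<partial>GN N))"
   using i by (simp add: prob_space)
  also have "(\<integral>x. ?e N x \<partial>GN N) = ?E N"
  proof -
   have "(\<integral>x. 2 * ?V ?p N x + 2 * (z ^ (2 * q))\<^sup>2 * ?V 2 N x \<partial>GN N)
    = (\<integral>x. 2 * ?V ?p N x \<partial>GN N) + (\<integral>x. 2 * (z ^ (2 * q))\<^sup>2 * ?V 2 N x \<partial>GN N)"
    by (intro Bochner_Integration.integral_add integrable_mult_right row_trace_variance(2))
   then show ?thesis by simp
  qed
  finally show ?thesis .
 qed
 moreover have "(%N. z * (1 - ?E N)) \<longlonglongrightarrow> z * (1 - (2 * 0 + 2 * (z ^ (2 * q))\<^sup>2 * 0) / d\<^sup>2)"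
  using d by (intro tendsto_mult_left tendsto_diff tendsto_const tendsto_divide tendsto_add row_trace_variance(1)) auto
 then have "(%N. z * (1 - ?E N)) \<longlonglongrightarrow> z" by simp
 then have "\<forall>\<^sub>F N in sequentially. y < z * (1 - ?E N)" using z(3) by (rule order_tendstoD)
 ultimately show ?thesis by (auto elim!: eventually_mono intro: order.strict_trans2)
qed

lemma expectation_le:
 assumes z: "0 < z''" and P: "P = 2 ^ Suc s"
 shows "(\<integral>x. S N x \<partial>GN N) \<le> z'' + z'' / z'' ^ P * (FF (R N) (C N) P / 2)"
proof -
 interpret prob_space "GN N" by (rule prob_space_gm)
 obtain k where k: "P = Suc k" unfolding P by (metis not0_implies_Suc power_not_zero zero_neq_numeral)
 have pt: "S N x \<le> z'' + z'' / z'' ^ P * (tr (DN N) (XN N x ^ P) / 2)" for x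
 proof -
  have "S N x ^ P \<le> tr (DN N) (XN N x ^ P) / 2" using S_le[of "2 ^ s" N x] by (simp add: P)
  then have "S N x ^ P / z'' ^ k \<le> tr (DN N) (XN N x ^ P) / 2 / z'' ^ k" using z by (intro divide_right_mono) auto
  moreover have "z'' / z'' ^ P = 1 / z'' ^ k" using z by (simp add: k)
  ultimately show ?thesis using le_plus_power[OF S_nonneg[of N x] z, of k] by (simp add: k)
 qed
 have "(\<integral>x. S N x \<partial>GN N) \<le> (\<integral>x. z'' + z'' / z'' ^ P * (tr (DN N) (XN N x ^ P) / 2) \<partial>GN N)"
  by (intro integral_mono S_int pt Bochner_Integration.integrable_add integrable_const integrable_mult_right integrable_divide tr_int)
 also have "\<dots> = z'' + z'' / z'' ^ P * (FF (R N) (C N) P / 2)"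
  using tr_int[of N P] by (simp add: prob_space FF_def Phi_def)
 finally show ?thesis .
qed

text \<open>With \<open>P\<^sup>2\<close> of the order of \<open>n\<close> the moment bound applies, and
 \<open>n * (z' / z'') ^ P\<close> tends to zero.\<close>

lemma upper_edge:
 assumes z: "edge_bound \<alpha> z" "z < y"
 shows "\<forall>\<^sub>F N in sequentially. (\<integral>x. S N x \<partial>GN N) < y"
proof -
 have z0: "0 \<le> z" using z by (simp add: edge_bound_def)
 obtain z'' where z'': "z < z''" "z'' < y" using dense[OF z(2)] by blast
 obtain z' where z': "z < z'" "z' < z''" using dense[OF z''(1)] by blast
 have pos: "0 < z'" "0 < z''" using z0 z' by auto
 obtain \<beta>0 where \<beta>0: "\<alpha> < \<beta>0" "!!\<beta>. \<alpha> < \<beta> ==> \<beta> \<le> \<beta>0 ==> \<exists>B. \<forall>s. tt \<beta> (2 ^ Suc s) \<le> B * z' ^ (2 ^ Suc s)"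
  using edge_right_continuous[OF \<alpha>_nonneg z(1) z'(1)] by blast
 obtain \<beta> where \<beta>r: "\<beta> \<in> \<rat>" and \<beta>: "\<alpha> < \<beta>" "\<beta> < \<beta>0" using Rats_dense_in_real[OF \<beta>0(1)] by blast
 have \<beta>p: "0 < \<beta>" using \<beta> \<alpha>_nonneg by linarith
 obtain p q :: nat where pq: "q \<noteq> 0" "\<bar>\<beta>\<bar> = real p / real q"
  using Rats_abs_nat_div_natE[OF \<beta>r] by metis
 then have \<beta>pq: "\<beta> = real p / real q" and q: "0 < q" using \<beta>p by auto
 have p: "0 < p" using \<beta>p \<beta>pq by (cases p) auto
 obtain B0 where B0: "!!s. tt \<beta> (2 ^ Suc s) \<le> B0 * z' ^ (2 ^ Suc s)" using \<beta>0(2)[of \<beta>] \<beta> by auto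
 define B where "B = max 0 B0"
 have B: "0 \<le> B" "tt \<beta> (2 ^ Suc s) \<le> B * z' ^ (2 ^ Suc s)" for s
 proof -
  show "0 \<le> B" by (simp add: B_def)
  have "B0 * z' ^ (2 ^ Suc s) \<le> B * z' ^ (2 ^ Suc s)" using pos by (intro mult_right_mono) (auto simp: B_def)
  then show "tt \<beta> (2 ^ Suc s) \<le> B * z' ^ (2 ^ Suc s)" using B0[of s] by linarith
 qed
 have AA0: "0 \<le> AA" by (rule AA_nonneg[OF finJJ])
 define c0 where "c0 = 2 * AA * (16 * AA / z' ^ 4 + 1 / z'\<^sup>2)"
 define r where "r = z' / z''"
 have r: "0 < r" "r < 1" using pos z' by (auto simp: r_def)
 define D where "D = z'' * (exp (real q) * (exp (4 * c0) * (\<beta> * (2 * B) + real K * (\<beta> + 1) / 2))) * (4 * (1 + real q)) / 2"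
 let ?n = "%N. card (C N)" and ?m = "%N. card (R N)"
 \<comment> \<open>The order \<open>P N\<close> is a power of two with \<open>(P N)\<^sup>2 \<le> n < 4 * (P N)\<^sup>2\<close>.\<close>
 define s where "s N = (SOME s. 4 ^ Suc s \<le> ?n N \<and> ?n N < 4 ^ Suc (Suc s))" for N
 have s: "4 ^ Suc (s N) \<le> ?n N" "?n N < 4 ^ Suc (Suc (s N))" if n4: "4 \<le> ?n N" for N
 proof -
  obtain k where k: "4 ^ k \<le> ?n N" "?n N < 4 ^ (k + 1)" using ex_power_ivl1[of 4 "?n N"] n4 by auto
  have "k \<noteq> 0" using k(2) n4 by (intro notI) simp
  then obtain k' where "k = Suc k'" by (cases k) auto
  then have "\<exists>s. 4 ^ Suc s \<le> ?n N \<and> ?n N < 4 ^ Suc (Suc s)" using k by auto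
  from someI_ex[OF this] show "4 ^ Suc (s N) \<le> ?n N" "?n N < 4 ^ Suc (Suc (s N))" unfolding s_def by auto
 qed
 define P where "P N = (2 :: nat) ^ Suc (s N)" for N
 have P2: "(P N)\<^sup>2 = 4 ^ Suc (s N)" for N
  unfolding P_def power_mult[symmetric] mult.commute[of _ 2] unfolding power_mult by simp
 have PN: "(P N)\<^sup>2 \<le> ?n N" "?n N < 4 * (P N)\<^sup>2" if "4 \<le> ?n N" for N
  using s[OF that] unfolding P2 by auto
 have main: "(\<integral>x. S N x \<partial>GN N) \<le> z'' + D * ((real (P N))\<^sup>2 * r ^ P N)"
  if n4: "4 \<le> ?n N" and ratio: "real (?m N) / real (?n N) < \<beta>" for N
 proof -
  let ?P = "P N"
  \<comment> \<open>The smallest admissible size with quotient exactly \<open>\<beta> = p / q\<close>.\<close>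
  define h where "h = ?n N div q + 1"
  define n' where "n' = q * h"
  define m' where "m' = p * h"
  have n0: "0 < ?n N" using nz by simp
  have n': "?n N \<le> n'" "n' \<le> ?n N + q"
  proof -
   have "q * (?n N div q) + ?n N mod q = ?n N" by (rule mult_div_mod_eq)
   moreover have "?n N mod q < q" using q by simp
   moreover have "n' = q * (?n N div q) + q" by (simp add: n'_def h_def)
   ultimately show "?n N \<le> n'" "n' \<le> ?n N + q" by linarith+
  qed
  have m'n': "real m' = \<beta> * real n'" using q by (simp add: m'_def n'_def \<beta>pq)
  have "real (?m N) \<le> \<beta> * real (?n N)" using ratio n0 by (simp add: pos_divide_less_eq)
  also have "\<dots> \<le> \<beta> * real n'" using n' \<beta>p by (intro mult_left_mono) auto
  finally have m': "?m N \<le> m'" unfolding m'n'[symmetric] by simp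
  obtain R' where R': "finite R'" "R N \<subseteq> R'" "card R' = m'" using superset_with_card[OF fin(1) m'] by blast
  obtain C' where C': "finite C'" "C N \<subseteq> C'" "card C' = n'" using superset_with_card[OF fin(2) n'(1)] by blast
  have pos': "0 < n'" "0 < m'" using p q by (auto simp: n'_def m'_def h_def)
  have P1: "1 \<le> ?P" by (simp add: P_def)
  have P2n: "(real ?P)\<^sup>2 \<le> real (?n N)" "real (?n N) \<le> 4 * (real ?P)\<^sup>2"
   using PN[OF n4] by (simp_all flip: of_nat_power)
  define c where "c = 1 / real n' * (real ?P)\<^sup>2 *
   (2 * AA * (16 * (1 / real n') * AA * (real ?P)\<^sup>2 / z' ^ 4 + 1 / z'\<^sup>2))"
  have FF1: "FF R' C' ?P \<le> exp (4 * c) *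
   (real (card R') * (2 * tt (real (card R') / real (card C')) ?P) + z' ^ ?P * (real K * real (card (R' \<union> C'))) / 2)"
   using pos' by (intro trace_moment_bound[OF R'(1) C'(1) _ _ P_def pos(1)]) (simp_all add: R' C' c_def)
  have cc: "c \<le> c0"
  proof -
   have x: "1 / real n' * (real ?P)\<^sup>2 \<le> 1" using P2n(1) n'(1) pos' by simp
   have x0: "0 \<le> 1 / real n' * (real ?P)\<^sup>2" by simp
   have "c = (1 / real n' * (real ?P)\<^sup>2) * (2 * AA * (16 * AA * (1 / real n' * (real ?P)\<^sup>2) / z' ^ 4 + 1 / z'\<^sup>2))"
    unfolding c_def by simp
   also have "\<dots> \<le> 1 * (2 * AA * (16 * AA * 1 / z' ^ 4 + 1 / z'\<^sup>2))"
    using x x0 AA0 pos by (intro mult_mono add_right_mono divide_right_mono mult_left_mono) (auto intro!: mult_nonneg_nonneg add_nonneg_nonneg)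
   finally show ?thesis by (simp add: c0_def)
  qed
  have cardU: "real (card (R' \<union> C')) \<le> (\<beta> + 1) * real n'"
  proof -
   have "card (R' \<union> C') \<le> m' + n'" using card_Un_le[of R' C'] R' C' by simp
   then have "real (card (R' \<union> C')) \<le> real m' + real n'" by linarith
   then show ?thesis unfolding m'n' by (simp add: distrib_right)
  qed
  have br: "real (card R') * (2 * tt (real (card R') / real (card C')) ?P) + z' ^ ?P * (real K * real (card (R' \<union> C'))) / 2
   \<le> (\<beta> * (2 * B) + real K * (\<beta> + 1) / 2) * (real n' * z' ^ ?P)"
  proof -
   have h0: "real (card R') / real (card C') = \<beta>" using R' C' m'n' pos' by simp
   have h1: "real m' * (2 * tt \<beta> ?P) \<le> real m' * (2 * (B * z' ^ ?P))"
    using B(2)[of "s N"] unfolding P_def by (intro mult_left_mono) auto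
   have h2: "z' ^ ?P * (real K * real (card (R' \<union> C'))) / 2 \<le> z' ^ ?P * (real K * ((\<beta> + 1) * real n')) / 2"
    using cardU pos by (intro divide_right_mono mult_left_mono) auto
   have h3: "(\<beta> * (2 * B) + real K * (\<beta> + 1) / 2) * (real n' * z' ^ ?P)
    = \<beta> * real n' * (2 * (B * z' ^ ?P)) + z' ^ ?P * (real K * ((\<beta> + 1) * real n')) / 2"
    by (simp add: field_simps)
   show ?thesis unfolding h0 h3 unfolding R'(3) m'n' by (rule add_mono[OF h1[unfolded m'n'] h2])
  qed
  have FF2: "FF R' C' ?P \<le> exp (4 * c0) * ((\<beta> * (2 * B) + real K * (\<beta> + 1) / 2) * (real n' * z' ^ ?P))"
  proof (rule order.trans[OF FF1], rule mult_mono)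
   show "exp (4 * c) \<le> exp (4 * c0)" using cc by simp
   have "0 \<le> tt (real (card R') / real (card C')) ?P"
    using tt_nonneg'[of "real (card R') / real (card C')" "2 ^ s N"] by (simp add: P_def)
   then show "0 \<le> real (card R') * (2 * tt (real (card R') / real (card C')) ?P) + z' ^ ?P * (real K * real (card (R' \<union> C'))) / 2"
    using pos by (intro add_nonneg_nonneg mult_nonneg_nonneg divide_nonneg_nonneg) auto
  qed (use br in auto)
  have FF3: "FF (R N) (C N) ?P \<le> exp (real q) * FF R' C' ?P"
  proof -
   have "FF (R N) (C N) ?P \<le> (real (card C') / real (?n N)) ^ (2 ^ s N) * FF R' C' ?P"
    by (rule FF_mono[OF R'(1) C'(1) R'(2) C'(2) n0 P_def])
   moreover have "(real (card C') / real (?n N)) ^ (2 ^ s N) \<le> exp (real q)"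
   proof -
    have "real n' \<le> real (?n N) + real q" using n'(2) by linarith
    then have "real n' / real (?n N) \<le> (real (?n N) + real q) / real (?n N)" by (intro divide_right_mono) auto
    also have "\<dots> = 1 + real q / real (?n N)" using n0 by (simp add: add_divide_distrib)
    also have "\<dots> \<le> exp (real q / real (?n N))" by (rule exp_ge_add_one_self)
    finally have "(real n' / real (?n N)) ^ (2 ^ s N) \<le> exp (real q / real (?n N)) ^ (2 ^ s N)"
     by (intro power_mono) auto
    also have "\<dots> = exp (real (2 ^ s N) * (real q / real (?n N)))" by (rule exp_of_nat_mult[symmetric])
    also have "\<dots> \<le> exp (real q)"
    proof -
     have "(2::nat) ^ s N \<le> ?P" by (simp add: P_def)
     also have "?P \<le> ?P\<^sup>2" using P1 by (simp add: power2_eq_square)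
     also have "\<dots> \<le> ?n N" by (rule PN(1)[OF n4])
     finally have "real (2 ^ s N) \<le> real (?n N)" by (simp only: of_nat_le_iff)
     then have "real (2 ^ s N) * real q \<le> real (?n N) * real q" by (intro mult_right_mono) auto
     then have "real (2 ^ s N) * real q / real (?n N) \<le> real q" using n0 by (simp add: pos_divide_le_eq mult.commute)
     then show ?thesis by simp
    qed
    finally show ?thesis by (simp add: C')
   qed
   moreover have "0 \<le> FF R' C' ?P" unfolding P_def by (intro FF_nonneg) (auto simp: R' C')
   ultimately show ?thesis by (meson mult_right_mono order.trans)
  qed
  let ?k = "\<beta> * (2 * B) + real K * (\<beta> + 1) / 2"
  have k0: "0 \<le> ?k" using \<beta>p B by simp
  have n'P: "real n' \<le> 4 * (1 + real q) * (real ?P)\<^sup>2"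
  proof -
   have "real n' \<le> real (?n N) + real q * real (?n N)"
   proof -
    have "real q * 1 \<le> real q * real (?n N)" using n0 by (intro mult_left_mono) auto
    then show ?thesis using n'(2) by linarith
   qed
   also have "\<dots> = (1 + real q) * real (?n N)" by (simp add: distrib_right)
   also have "\<dots> \<le> (1 + real q) * (4 * (real ?P)\<^sup>2)" using P2n by (intro mult_left_mono) auto
   finally show ?thesis by (simp only: mult_ac)
  qed
  have FF4: "FF (R N) (C N) ?P \<le> exp (real q) * (exp (4 * c0) * (?k * (4 * (1 + real q) * (real ?P)\<^sup>2 * z' ^ ?P)))"
  proof (rule order.trans[OF FF3], rule mult_left_mono[OF order.trans[OF FF2]])
   show "exp (4 * c0) * (?k * (real n' * z' ^ ?P)) \<le> exp (4 * c0) * (?k * (4 * (1 + real q) * (real ?P)\<^sup>2 * z' ^ ?P))"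
    using n'P k0 pos by (intro mult_left_mono mult_right_mono) auto
  qed simp
  have "(\<integral>x. S N x \<partial>GN N) \<le> z'' + z'' / z'' ^ ?P * (FF (R N) (C N) ?P / 2)"
   by (rule expectation_le[OF pos(2) P_def])
  also have "\<dots> \<le> z'' + z'' / z'' ^ ?P * ((exp (real q) * (exp (4 * c0) * (?k * (4 * (1 + real q) * (real ?P)\<^sup>2 * z' ^ ?P)))) / 2)"
   using FF4 pos by (intro add_left_mono mult_left_mono divide_right_mono) auto
  also have "\<dots> = z'' + D * ((real ?P)\<^sup>2 * r ^ ?P)"
   unfolding D_def r_def power_divide by simp
  finally show ?thesis .
 qed
 have Pinf: "filterlim P at_top sequentially"
  unfolding filterlim_at_top
 proof
  fix Z :: nat
  have "\<forall>\<^sub>F N in sequentially. 4 + 4 * Z\<^sup>2 \<le> ?n N" using Cinf by (simp add: filterlim_at_top)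
  then show "\<forall>\<^sub>F N in sequentially. Z \<le> P N"
  proof (rule eventually_mono)
   fix N assume a: "4 + 4 * Z\<^sup>2 \<le> ?n N"
   then have "4 * Z\<^sup>2 < 4 * (P N)\<^sup>2" using PN(2)[of N] by linarith
   then have "Z\<^sup>2 < (P N)\<^sup>2" by simp
   then have "Z < P N" by (rule power_less_imp_less_base) simp
   then show "Z \<le> P N" by simp
  qed
 qed
 have "(%k. (real k)\<^sup>2 * r ^ k) \<longlonglongrightarrow> 0"
 proof -
  have "norm (sqrt r) < 1" using r by simp
  from tendsto_power[OF powser_times_n_limit_0[OF this], of 2]
  have "(%k. (real k * sqrt r ^ k)\<^sup>2) \<longlonglongrightarrow> 0" by simp
  moreover have "(real k * sqrt r ^ k)\<^sup>2 = (real k)\<^sup>2 * r ^ k" for k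
  proof -
   have "(sqrt r ^ k)\<^sup>2 = (sqrt r ^ 2) ^ k" by (simp only: power_mult[symmetric] mult.commute)
   then show ?thesis using r by (simp add: power_mult_distrib)
  qed
  ultimately show ?thesis by simp
 qed
 from filterlim_compose[OF this Pinf]
 have "(%N. z'' + D * ((real (P N))\<^sup>2 * r ^ P N)) \<longlonglongrightarrow> z'' + D * 0"
  by (intro tendsto_add tendsto_const tendsto_mult_left)
 then have "\<forall>\<^sub>F N in sequentially. z'' + D * ((real (P N))\<^sup>2 * r ^ P N) < y"
  using z''(2) by (intro order_tendstoD(2)) auto
 moreover have "\<forall>\<^sub>F N in sequentially. real (?m N) / real (?n N) < \<beta>"
  by (rule order_tendstoD(2)[OF ratio \<beta>(1)])
 moreover have "\<forall>\<^sub>F N in sequentially. 4 \<le> ?n N" using Cinf by (simp add: filterlim_at_top)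
 ultimately show ?thesis
 proof eventually_elim
  case (elim N)
  show ?case using main[OF elim(3) elim(2)] elim(1) by (rule order.strict_trans1)
 qed
qed

theorem expectation_limit: "(%N. \<integral>x. S N x \<partial>GN N) \<longlonglongrightarrow> Inf {z. edge_bound \<alpha> z}"
proof (rule order_tendstoI)
 have ne: "{z. edge_bound \<alpha> z} \<noteq> {}" using ex_edge_bound[OF \<alpha>_nonneg] by blast
 have bdd: "bdd_below {z. edge_bound \<alpha> z}" by (rule bdd_belowI[of _ 0]) (simp add: edge_bound_def)
 fix y assume y: "y < Inf {z. edge_bound \<alpha> z}"
 show "\<forall>\<^sub>F N in sequentially. y < (\<integral>x. S N x \<partial>GN N)"
 proof (cases "y < 0")
  case True
  have "0 \<le> (\<integral>x. S N x \<partial>GN N)" for N by (simp add: S_nonneg)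
  then show ?thesis using True by (intro always_eventually allI) (rule order.strict_trans2)
 next
  case False
  obtain z where z: "y < z" "z < Inf {z. edge_bound \<alpha> z}" using dense[OF y] by blast
  have "\<not> edge_bound \<alpha> z" using cInf_lower[OF _ bdd, of z] z(2) by auto
  then show ?thesis using False z by (intro lower_edge[of z]) auto
 qed
next
 fix y assume y: "Inf {z. edge_bound \<alpha> z} < y"
 have ne: "{z. edge_bound \<alpha> z} \<noteq> {}" using ex_edge_bound[OF \<alpha>_nonneg] by blast
 obtain z where "edge_bound \<alpha> z" "z < y" using cInf_lessD[OF ne y] by blast
 then show "\<forall>\<^sub>F N in sequentially. (\<integral>x. S N x \<partial>GN N) < y" by (rule upper_edge)
qed

end

section \<open>Positive semidefinite matrices\<close>

lemma mult_mat_entry: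
 assumes "A \<in> carrier_mat n k" "B \<in> carrier_mat k p" "i < n" "j < p"
 shows "(A * B) $$ (i, j) = (\<Sum>h<k. A $$ (i, h) * B $$ (h, j))"
 using assms by (auto simp: scalar_prod_def lessThan_atLeast0 intro!: sum.cong)

lemma mult_mat_vec_entry:
 assumes "A \<in> carrier_mat n k" "v \<in> carrier_vec k" "i < n"
 shows "vec_index (A *\<^sub>v v) i = (\<Sum>h<k. A $$ (i, h) * vec_index v h)"
 using assms by (auto simp: scalar_prod_def lessThan_atLeast0 intro!: sum.cong)

lemma scalar_prod_sum:
 assumes "w \<in> carrier_vec d"
 shows "scalar_prod v w = (\<Sum>i<d. vec_index v i * vec_index w i)"
 using assms by (auto simp: scalar_prod_def lessThan_atLeast0)

lemma quad_form:
 fixes P :: "real mat"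
 assumes P: "P \<in> carrier_mat d d" and v: "v \<in> carrier_vec d"
 shows "scalar_prod v (P *\<^sub>v v) = (\<Sum>i<d. \<Sum>j<d. P $$ (i, j) * (vec_index v i * vec_index v j))"
proof -
 have "P *\<^sub>v v \<in> carrier_vec d" using P v by simp
 then show ?thesis
  unfolding scalar_prod_sum[OF \<open>P *\<^sub>v v \<in> carrier_vec d\<close>]
  by (intro sum.cong refl) (simp add: mult_mat_vec_entry[OF P v] sum_distrib_left mult_ac)
qed

definition mat_trace :: "'a :: comm_ring_1 mat => 'a" where
 "mat_trace M = (\<Sum>i<dim_row M. M $$ (i, i))"

lemma mat_trace_commute:
 fixes A B :: "'a :: comm_ring_1 mat"
 assumes A: "A \<in> carrier_mat n k" and B: "B \<in> carrier_mat k n"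
 shows "mat_trace (A * B) = mat_trace (B * A)"
proof -
 have "mat_trace (A * B) = (\<Sum>i<n. \<Sum>h<k. A $$ (i, h) * B $$ (h, i))"
  unfolding mat_trace_def using A by (auto simp: mult_mat_entry[OF A B] intro!: sum.cong)
 also have "\<dots> = (\<Sum>h<k. \<Sum>i<n. A $$ (i, h) * B $$ (h, i))" by (rule sum.swap)
 also have "\<dots> = mat_trace (B * A)"
  unfolding mat_trace_def using B by (auto simp: mult_mat_entry[OF B A] mult.commute intro!: sum.cong)
 finally show ?thesis .
qed

lemma upper_triangular_power:
 fixes B :: "'a :: comm_ring_1 mat"
 assumes B: "B \<in> carrier_mat n n" and ut: "upper_triangular B"
 shows "(\<forall>i<n. (B ^\<^sub>m q) $$ (i, i) = B $$ (i, i) ^ q) \<and> (\<forall>i<n. \<forall>j<i. (B ^\<^sub>m q) $$ (i, j) = 0)"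
proof (induction q)
 case 0
 then show ?case using B by auto
next
 case (Suc q)
 have Bq: "B ^\<^sub>m q \<in> carrier_mat n n" using B by simp
 have low: "B $$ (h, j) = 0" if "j < h" "h < n" for h j using ut that B by auto
 have e: "(B ^\<^sub>m Suc q) $$ (i, j) = (\<Sum>h<n. if h = i then (if j = i then B $$ (i, i) ^ q * B $$ (i, i) else 0) else 0)"
  if ij: "i < n" "j \<le> i" for i j
 proof -
  have "(B ^\<^sub>m Suc q) $$ (i, j) = (\<Sum>h<n. (B ^\<^sub>m q) $$ (i, h) * B $$ (h, j))"
   using mult_mat_entry[OF Bq B, of i j] that by simp
  also have "\<dots> = (\<Sum>h<n. if h = i then (if j = i then B $$ (i, i) ^ q * B $$ (i, i) else 0) else 0)"
  proof (intro sum.cong refl)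
   fix h assume h: "h \<in> {..<n}"
   consider "h < i" | "h = i" "j = i" | "h = i" "j < i" | "i < h" using ij by linarith
   then show "(B ^\<^sub>m q) $$ (i, h) * B $$ (h, j)
    = (if h = i then (if j = i then B $$ (i, i) ^ q * B $$ (i, i) else 0) else 0)"
    by cases (use Suc h ij low in auto)
  qed
  finally show ?thesis .
 qed
 show ?case using e by (auto simp: mult.commute)
qed

definition psd :: "nat => real mat => bool" where
 "psd d P \<longleftrightarrow> P \<in> carrier_mat d d \<and> transpose_mat P = P \<and> (\<forall>v\<in>carrier_vec d. 0 \<le> scalar_prod v (P *\<^sub>v v))"

lemma psd_sum:
 assumes "psd d P"
 shows "0 \<le> (\<Sum>i<d. \<Sum>j<d. P $$ (i, j) * (w i * w j))"
proof -
 have P: "P \<in> carrier_mat d d" using assms by (simp add: psd_def)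
 have "0 \<le> scalar_prod (Matrix.vec d w) (P *\<^sub>v Matrix.vec d w)" using assms unfolding psd_def by auto
 then show ?thesis by (simp add: quad_form[OF P])
qed

lemma psd_sym: "psd d P ==> i < d ==> j < d ==> P $$ (i, j) = P $$ (j, i)"
 unfolding psd_def by (metis carrier_matD index_transpose_mat(1))

text \<open>A quadratic form of a complex vector is the sum of those of its real and imaginary parts.\<close>

lemma psd_eigenvalue:
 assumes psd: "psd d P" and v: "v \<in> carrier_vec d" "v \<noteq> 0\<^sub>v d"
  and ev: "map_mat complex_of_real P *\<^sub>v v = a \<cdot>\<^sub>v v"
 shows "a = complex_of_real (Re a)" "0 \<le> Re a"
proof -
 have P: "P \<in> carrier_mat d d" using psd by (simp add: psd_def)
 have A: "map_mat complex_of_real P \<in> carrier_mat d d" using P by simp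
 let ?v = "vec_index v"
 let ?Q = "%w. \<Sum>i<d. \<Sum>j<d. P $$ (i, j) * (w i * w j)"
 define V where "V = (\<Sum>i<d. (cmod (?v i))\<^sup>2)"
 have row: "(\<Sum>j<d. complex_of_real (P $$ (i, j)) * ?v j) = a * ?v i" if "i < d" for i
 proof -
  have "vec_index (map_mat complex_of_real P *\<^sub>v v) i = (\<Sum>j<d. complex_of_real (P $$ (i, j)) * ?v j)"
   unfolding mult_mat_vec_entry[OF A v(1) that] using P that by (intro sum.cong refl) simp
  then show ?thesis unfolding ev using v that by simp
 qed
 have V: "0 < V"
 proof -
  have "\<exists>i<d. ?v i \<noteq> 0"
  proof (rule ccontr)
   assume "\<not> ?thesis"
   then have "v = 0\<^sub>v d" using v(1) by (intro eq_vecI) auto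
   then show False using v(2) by simp
  qed
  then obtain i where i: "i < d" "?v i \<noteq> 0" by blast
  have "0 < (cmod (?v i))\<^sup>2" using i by simp
  also have "\<dots> \<le> V" unfolding V_def using i by (intro member_le_sum) auto
  finally show ?thesis .
 qed
 have 1: "(\<Sum>i<d. \<Sum>j<d. complex_of_real (P $$ (i, j)) * ?v j * cnj (?v i)) = a * complex_of_real V"
 proof -
  have "(\<Sum>j<d. complex_of_real (P $$ (i, j)) * ?v j * cnj (?v i)) = a * complex_of_real ((cmod (?v i))\<^sup>2)" if "i < d" for i
   unfolding sum_distrib_right[symmetric] row[OF that] by (simp only: complex_norm_square mult.assoc)
  then show ?thesis by (simp add: V_def sum_distrib_left)
 qed
 have 2: "(\<Sum>i<d. \<Sum>j<d. complex_of_real (P $$ (i, j)) * ?v j * cnj (?v i))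
  = complex_of_real (?Q (%i. Re (?v i)) + ?Q (%i. Im (?v i)))"
 proof (rule complex_eqI)
  show "Re (\<Sum>i<d. \<Sum>j<d. complex_of_real (P $$ (i, j)) * ?v j * cnj (?v i))
   = Re (complex_of_real (?Q (%i. Re (?v i)) + ?Q (%i. Im (?v i))))"
   unfolding Re_sum Re_complex_of_real sum.distrib[symmetric]
   by (intro sum.cong refl) (simp add: algebra_simps)
  have "(\<Sum>i<d. \<Sum>j<d. P $$ (i, j) * (Im (?v j) * Re (?v i))) = (\<Sum>j<d. \<Sum>i<d. P $$ (i, j) * (Im (?v j) * Re (?v i)))"
   by (rule sum.swap)
  also have "\<dots> = (\<Sum>j<d. \<Sum>i<d. P $$ (j, i) * (Re (?v i) * Im (?v j)))"
   by (intro sum.cong refl) (simp add: psd_sym[OF psd] mult.commute)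
  finally have sw: "(\<Sum>i<d. \<Sum>j<d. P $$ (i, j) * (Im (?v j) * Re (?v i)))
   = (\<Sum>i<d. \<Sum>j<d. P $$ (i, j) * (Re (?v j) * Im (?v i)))" .
  have "Im (\<Sum>i<d. \<Sum>j<d. complex_of_real (P $$ (i, j)) * ?v j * cnj (?v i))
   = (\<Sum>i<d. \<Sum>j<d. P $$ (i, j) * (Im (?v j) * Re (?v i)) - P $$ (i, j) * (Re (?v j) * Im (?v i)))"
   unfolding Im_sum by (intro sum.cong refl) (simp add: algebra_simps)
  then show "Im (\<Sum>i<d. \<Sum>j<d. complex_of_real (P $$ (i, j)) * ?v j * cnj (?v i))
   = Im (complex_of_real (?Q (%i. Re (?v i)) + ?Q (%i. Im (?v i))))"
   by (simp add: sum_subtractf sw)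
 qed
 define U where "U = ?Q (%i. Re (?v i)) + ?Q (%i. Im (?v i))"
 have U: "0 \<le> U" unfolding U_def by (intro add_nonneg_nonneg psd_sum[OF psd])
 have "a * complex_of_real V = complex_of_real U" using 1 2 by (simp only: U_def)
 then have "a = complex_of_real U / complex_of_real V" using V by (simp add: eq_divide_eq)
 then have a: "a = complex_of_real (U / V)" by (simp only: of_real_divide)
 show "a = complex_of_real (Re a)" "0 \<le> Re a" unfolding a using U V by simp_all
qed

text \<open>The Schur decomposition over the complex numbers gives the traces of powers in terms of the
 eigenvalues, and these are real and nonnegative.\<close>

theorem psd_spectrum:
 assumes psd: "psd d P"
 shows "\<exists>es. length es = d \<and> (\<forall>x\<in>set es. 0 \<le> x) \<and> set es = spectrum P \<and>
  (\<forall>q. mat_trace (P ^\<^sub>m q) = (\<Sum>x\<leftarrow>es. x ^ q))"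
proof -
 have P: "P \<in> carrier_mat d d" using psd by (simp add: psd_def)
 let ?A = "map_mat complex_of_real P"
 have A: "?A \<in> carrier_mat d d" using P by simp
 obtain as where as: "char_poly ?A = (\<Prod>a\<leftarrow>as. [:- a, 1:])" "length as = d"
  using char_poly_factorized[OF A] by blast
 have root': "poly (\<Prod>a\<leftarrow>bs. [:- a, 1:]) x = 0 \<longleftrightarrow> x \<in> set bs" for bs and x :: complex
  by (induction bs) auto
 have root: "poly (char_poly ?A) x = 0 \<longleftrightarrow> x \<in> set as" for x unfolding as(1) by (rule root')
 have asr: "a = complex_of_real (Re a)" "0 \<le> Re a" if "a \<in> set as" for a
 proof -
  have "eigenvalue ?A a" using eigenvalue_root_char_poly[OF A] root that by blast
  then obtain v where "v \<in> carrier_vec d" "v \<noteq> 0\<^sub>v d" "?A *\<^sub>v v = a \<cdot>\<^sub>v v"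
   unfolding eigenvalue_def eigenvector_def using P by auto
  from psd_eigenvalue[OF psd this] show "a = complex_of_real (Re a)" "0 \<le> Re a" by blast+
 qed
 obtain B S T where sd: "schur_decomposition ?A as = (B, S, T)" by (cases "schur_decomposition ?A as") auto
 have sch: "similar_mat_wit ?A B S T" "upper_triangular B" "diag_mat B = as"
  using schur_decomposition[OF A as(1) sd] by auto
 have w: "B \<in> carrier_mat d d" "S \<in> carrier_mat d d" "T \<in> carrier_mat d d" "T * S = 1\<^sub>m d"
  using similar_mat_witD2[OF A sch(1)] by auto
 have tr: "mat_trace (P ^\<^sub>m q) = (\<Sum>x\<leftarrow>map Re as. x ^ q)" for q
 proof -
  have Bq: "B ^\<^sub>m q \<in> carrier_mat d d" using w by simp
  have "complex_of_real (mat_trace (P ^\<^sub>m q)) = mat_trace (map_mat complex_of_real (P ^\<^sub>m q))"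
   unfolding mat_trace_def using P by simp
  also have "\<dots> = mat_trace (?A ^\<^sub>m q)" by (simp only: of_real_hom.mat_hom_pow[OF P])
  also have "\<dots> = mat_trace (S * B ^\<^sub>m q * T)" by (simp only: similar_mat_wit_pow_id[OF sch(1)])
  also have "S * B ^\<^sub>m q * T = S * (B ^\<^sub>m q * T)" using w Bq by (intro assoc_mult_mat) auto
  also have "mat_trace (S * (B ^\<^sub>m q * T)) = mat_trace (B ^\<^sub>m q * T * S)"
   using w Bq by (intro mat_trace_commute[of _ d d]) auto
  also have "B ^\<^sub>m q * T * S = B ^\<^sub>m q * (T * S)" using w Bq by (intro assoc_mult_mat) auto
  also have "\<dots> = B ^\<^sub>m q" using w Bq by simp
  also have "mat_trace (B ^\<^sub>m q) = (\<Sum>i<d. B $$ (i, i) ^ q)"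
   unfolding mat_trace_def using upper_triangular_power[OF w(1) sch(2), of q] w(1) by (intro sum.cong) auto
  also have "\<dots> = (\<Sum>a\<leftarrow>diag_mat B. a ^ q)"
   using w(1) by (simp add: diag_mat_def o_def interv_sum_list_conv_sum_set_nat lessThan_atLeast0)
  also have "\<dots> = (\<Sum>a\<leftarrow>as. complex_of_real (Re a ^ q))"
  proof -
   have "a ^ q = complex_of_real (Re a ^ q)" if "a \<in> set as" for a
    using arg_cong[OF asr(1)[OF that], of "%z. z ^ q"] by (simp only: of_real_power)
   then show ?thesis unfolding sch(3) by (intro arg_cong[where f = sum_list] map_cong refl)
  qed
  also have "\<dots> = complex_of_real (\<Sum>x\<leftarrow>map Re as. x ^ q)"
  proof -
   have "(\<Sum>a\<leftarrow>bs. complex_of_real (f a)) = complex_of_real (\<Sum>a\<leftarrow>bs. f a)" for bs and f :: "complex => real"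
    by (induction bs) auto
   from this[of "%a. Re a ^ q" as] show ?thesis by (simp only: map_map o_def)
  qed
  finally show ?thesis by (simp only: of_real_eq_iff)
 qed
 have "set (map Re as) = spectrum P"
 proof -
  have "x \<in> spectrum P \<longleftrightarrow> complex_of_real x \<in> set as" for x
  proof -
   have "x \<in> spectrum P \<longleftrightarrow> complex_of_real (poly (char_poly P) x) = 0"
    unfolding spectrum_root_char_poly[OF P] by simp
   also have "\<dots> \<longleftrightarrow> poly (char_poly ?A) (complex_of_real x) = 0"
    unfolding of_real_hom.char_poly_hom[OF P] by simp
   finally show ?thesis using root by simp
  qed
  moreover have "x \<in> Re ` set as \<longleftrightarrow> complex_of_real x \<in> set as" for x
   using asr(1) by (metis Re_complex_of_real image_iff)
  ultimately show ?thesis by auto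
 qed
 moreover have "\<forall>x\<in>set (map Re as). 0 \<le> x" using asr(2) by auto
 moreover have "length (map Re as) = d" using as(2) by simp
 ultimately show ?thesis using tr by blast
qed

lemma max_eigenvalue_nonneg:
 assumes "psd d P" "0 < d"
 shows "0 \<le> max_eigenvalue P"
proof -
 obtain es where es: "length es = d" "\<forall>x\<in>set es. 0 \<le> x" "set es = spectrum P"
  using psd_spectrum[OF assms(1)] by blast
 then have "es \<noteq> []" using assms(2) by auto
 then have "Max (set es) \<in> set es" by (intro Max_in) auto
 then show ?thesis using es by (auto simp: max_eigenvalue_def)
qed

lemma scalar_prod_self: "0 \<le> scalar_prod w w" for w :: "real vec"
 unfolding scalar_prod_def by (intro sum_nonneg) simp

lemma psd_congruence:
 assumes W: "psd k W" and A: "A \<in> carrier_mat k d"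
 shows "psd d (transpose_mat A * W * A)"
proof -
 have Wc: "W \<in> carrier_mat k k" "transpose_mat W = W" using W by (auto simp: psd_def)
 have AT: "transpose_mat A \<in> carrier_mat d k" using A by simp
 have ATW: "transpose_mat A * W \<in> carrier_mat d k" using AT Wc by simp
 have "transpose_mat (transpose_mat A * W) = W * A" using transpose_mult[OF AT Wc(1)] Wc by simp
 then have "transpose_mat (transpose_mat A * W * A) = transpose_mat A * (W * A)"
  using transpose_mult[OF ATW A] by simp
 also have "\<dots> = transpose_mat A * W * A" using A Wc AT by (intro assoc_mult_mat[symmetric]) auto
 finally have sym: "transpose_mat (transpose_mat A * W * A) = transpose_mat A * W * A" .
 have "0 \<le> scalar_prod v ((transpose_mat A * W * A) *\<^sub>v v)" if v: "v \<in> carrier_vec d" for v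
 proof -
  have Av: "A *\<^sub>v v \<in> carrier_vec k" using A v by simp
  have WAv: "W *\<^sub>v (A *\<^sub>v v) \<in> carrier_vec k" using Wc Av by simp
  have "(transpose_mat A * W * A) *\<^sub>v v = (transpose_mat A * W) *\<^sub>v (A *\<^sub>v v)"
   using A AT Wc v by (intro assoc_mult_mat_vec) auto
  also have "\<dots> = transpose_mat A *\<^sub>v (W *\<^sub>v (A *\<^sub>v v))"
   using AT Wc Av by (intro assoc_mult_mat_vec) auto
  finally have e: "(transpose_mat A * W * A) *\<^sub>v v = transpose_mat A *\<^sub>v (W *\<^sub>v (A *\<^sub>v v))" .
  have "scalar_prod v (transpose_mat A *\<^sub>v (W *\<^sub>v (A *\<^sub>v v))) = scalar_prod (transpose_mat A *\<^sub>v (W *\<^sub>v (A *\<^sub>v v))) v"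
   using AT WAv v by (intro comm_scalar_prod[of _ d]) auto
  also have "\<dots> = scalar_prod (W *\<^sub>v (A *\<^sub>v v)) (A *\<^sub>v v)"
   by (rule transpose_vec_mult_scalar[OF A v WAv])
  also have "\<dots> = scalar_prod (A *\<^sub>v v) (W *\<^sub>v (A *\<^sub>v v))" by (rule comm_scalar_prod[OF WAv Av])
  also have "0 \<le> \<dots>" using W Av by (simp add: psd_def)
  finally show ?thesis unfolding e .
 qed
 then show ?thesis using sym A Wc by (auto simp: psd_def)
qed

lemma psd_one: "psd k (1\<^sub>m k)"
 unfolding psd_def using scalar_prod_self by auto

lemma psd_gram:
 assumes H: "H \<in> carrier_mat e d"
 shows "psd d (transpose_mat H * H)"
 using psd_congruence[OF psd_one H] H by simp

lemma psd_add_mat_sum: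
 assumes Z: "psd d Z" and F: "!!i. i < l ==> psd d (F i)" and c: "0 \<le> c"
 shows "psd d (Z + c \<cdot>\<^sub>m mat_sum d d F l)"
proof -
 have Zc: "Z \<in> carrier_mat d d" using Z by (simp add: psd_def)
 let ?M = "Z + c \<cdot>\<^sub>m mat_sum d d F l"
 have M: "?M \<in> carrier_mat d d" by (simp add: mat_sum_def)
 have e: "?M $$ (i, j) = Z $$ (i, j) + c * (\<Sum>h<l. F h $$ (i, j))" if "i < d" "j < d" for i j
  using Zc that by (simp add: mat_sum_def)
 have "transpose_mat ?M = ?M"
 proof (rule eq_matI)
  fix i j assume "i < dim_row ?M" "j < dim_col ?M"
  then have ij: "i < d" "j < d" using M by auto
  have "transpose_mat ?M $$ (i, j) = ?M $$ (j, i)" using M ij by (simp add: mat_sum_def)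
  then show "transpose_mat ?M $$ (i, j) = ?M $$ (i, j)"
   unfolding e[OF ij] e[OF ij(2,1)] using psd_sym[OF Z ij] psd_sym[OF F ij] by simp
 qed (auto simp: mat_sum_def)
 moreover have "0 \<le> scalar_prod v (?M *\<^sub>v v)" if v: "v \<in> carrier_vec d" for v
 proof -
  let ?v = "vec_index v"
  have "scalar_prod v (?M *\<^sub>v v) = (\<Sum>i<d. \<Sum>j<d. Z $$ (i, j) * (?v i * ?v j))
   + c * (\<Sum>i<d. \<Sum>j<d. \<Sum>h<l. F h $$ (i, j) * (?v i * ?v j))"
  proof -
   have "(\<Sum>i<d. \<Sum>j<d. ?M $$ (i, j) * (?v i * ?v j))
    = (\<Sum>i<d. \<Sum>j<d. Z $$ (i, j) * (?v i * ?v j) + c * (\<Sum>h<l. F h $$ (i, j) * (?v i * ?v j)))"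
    by (intro sum.cong refl) (simp add: e distrib_right sum_distrib_right mult.assoc)
   then show ?thesis unfolding quad_form[OF M v] by (simp only: sum.distrib sum_distrib_left[symmetric])
  qed
  also have "(\<Sum>i<d. \<Sum>j<d. \<Sum>h<l. F h $$ (i, j) * (?v i * ?v j)) = (\<Sum>i<d. \<Sum>h<l. \<Sum>j<d. F h $$ (i, j) * (?v i * ?v j))"
   by (rule sum.cong[OF refl], rule sum.swap)
  also have "\<dots> = (\<Sum>h<l. \<Sum>i<d. \<Sum>j<d. F h $$ (i, j) * (?v i * ?v j))" by (rule sum.swap)
  also have "0 \<le> (\<Sum>i<d. \<Sum>j<d. Z $$ (i, j) * (?v i * ?v j)) + c * (\<Sum>h<l. \<Sum>i<d. \<Sum>j<d. F h $$ (i, j) * (?v i * ?v j))"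
   using c by (intro add_nonneg_nonneg mult_nonneg_nonneg sum_nonneg psd_sum Z F) auto
  finally show ?thesis .
 qed
 ultimately show ?thesis using M by (auto simp: psd_def)
qed

lemma inv_mat_eqI:
 assumes Z: "Z \<in> carrier_mat k k" and G: "G \<in> carrier_mat k k" and ZG: "Z * G = 1\<^sub>m k"
 shows "inv_mat Z = G" "G * Z = 1\<^sub>m k"
proof -
 show GZ: "G * Z = 1\<^sub>m k" by (rule mat_mult_left_right_inverse[OF Z G ZG])
 have "Z \<in> Units (ring_mat TYPE(real) k ())"
  unfolding Units_def using Z G ZG GZ by (auto simp: ring_mat_def)
 then obtain B where B: "mat_inverse Z = Some B" using mat_inverse(1)[OF Z, of "()"] by (cases "mat_inverse Z") auto
 have Bp: "Z * B = 1\<^sub>m k" "B * Z = 1\<^sub>m k" "B \<in> carrier_mat k k" using mat_inverse(2)[OF Z B] by auto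
 have "B = B * (Z * G)" using Bp ZG by simp
 also have "\<dots> = B * Z * G" using Bp Z G by (intro assoc_mult_mat[symmetric]) auto
 also have "\<dots> = G" using Bp G by simp
 finally show "inv_mat Z = G" by (simp add: inv_mat_def B)
qed

lemma sym_pos_def_psd:
 assumes Z: "sym_pos_def k Z"
 shows "psd k Z" "psd k (inv_mat Z)"
proof -
 have Zc: "Z \<in> carrier_mat k k" "transpose_mat Z = Z"
  and pos: "!!v. v \<in> carrier_vec k ==> v \<noteq> 0\<^sub>v k ==> 0 < scalar_prod v (Z *\<^sub>v v)"
  using Z by (auto simp: sym_pos_def_def)
 have nonneg: "0 \<le> scalar_prod v (Z *\<^sub>v v)" if "v \<in> carrier_vec k" for v
  using pos[OF that] Zc that by (cases "v = 0\<^sub>v k") (auto simp: less_imp_le)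
 then show "psd k Z" using Zc by (simp add: psd_def)
 have "det Z \<noteq> 0"
 proof
  assume "det Z = 0"
  then obtain v where v: "v \<in> carrier_vec k" "v \<noteq> 0\<^sub>v k" "Z *\<^sub>v v = 0\<^sub>v k"
   using det_0_iff_vec_prod_zero[OF Zc(1)] by blast
  then show False using pos[OF v(1,2)] by simp
 qed
 then have "Z \<in> Units (ring_mat TYPE(real) k ())" by (rule det_non_zero_imp_unit[OF Zc(1)])
 then obtain G where G: "mat_inverse Z = Some G" using mat_inverse(1)[OF Zc(1), of "()"] by (cases "mat_inverse Z") auto
 have Gp: "Z * G = 1\<^sub>m k" "G * Z = 1\<^sub>m k" "G \<in> carrier_mat k k" using mat_inverse(2)[OF Zc(1) G] by auto
 have GT: "transpose_mat G \<in> carrier_mat k k" using Gp by simp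
 have "transpose_mat G * Z = 1\<^sub>m k"
  using transpose_mult[OF Zc(1) Gp(3)] Gp(1) Zc by simp
 then have "transpose_mat G = transpose_mat G * (Z * G)" using Gp GT by simp
 also have "\<dots> = transpose_mat G * Z * G" using Gp GT Zc by (intro assoc_mult_mat[symmetric]) auto
 finally have sym: "transpose_mat G = G" using \<open>transpose_mat G * Z = 1\<^sub>m k\<close> Gp by simp
 have "0 \<le> scalar_prod w (G *\<^sub>v w)" if w: "w \<in> carrier_vec k" for w
 proof -
  have Gw: "G *\<^sub>v w \<in> carrier_vec k" using Gp w by simp
  have "Z *\<^sub>v (G *\<^sub>v w) = w"
   using assoc_mult_mat_vec[OF Zc(1) Gp(3) w] Gp w by simp
  then have "scalar_prod w (G *\<^sub>v w) = scalar_prod (Z *\<^sub>v (G *\<^sub>v w)) (G *\<^sub>v w)" by simp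
  also have "\<dots> = scalar_prod (G *\<^sub>v w) (Z *\<^sub>v (G *\<^sub>v w))"
   using Zc Gw by (intro comm_scalar_prod[of _ k]) auto
  finally show ?thesis using nonneg[OF Gw] by simp
 qed
 then show "psd k (inv_mat Z)" using sym Gp by (simp add: psd_def inv_mat_def G)
qed

section \<open>The largest singular value\<close>

lemma elem_le_sum_list:
 fixes f :: "'b => real"
 shows "(!!x. x \<in> set xs ==> 0 \<le> f x) ==> e \<in> set xs ==> f e \<le> (\<Sum>x\<leftarrow>xs. f x)"
proof (induction xs)
 case (Cons x xs)
 have "0 \<le> (\<Sum>x\<leftarrow>xs. f x)" using Cons.prems by (intro sum_list_nonneg) auto
 then show ?case using Cons by (auto intro: add_increasing)
qed simp

lemma max_singular_value_bounds:
 assumes H: "H \<in> carrier_mat e d" and d: "0 < d"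
 defines "s \<equiv> max_singular_value H" and "P \<equiv> transpose_mat H * H"
 shows "0 \<le> s" "s ^ (2 * q) \<le> mat_trace (P ^\<^sub>m q)"
  "mat_trace (P ^\<^sub>m (p + q)) \<le> s ^ (2 * q) * mat_trace (P ^\<^sub>m p)"
  "mat_trace (P ^\<^sub>m q) \<le> real d * s ^ (2 * q)"
proof -
 have psd: "psd d P" unfolding P_def by (rule psd_gram[OF H])
 obtain es where es: "length es = d" "!!x. x \<in> set es ==> 0 \<le> x" "set es = spectrum P"
  "!!q. mat_trace (P ^\<^sub>m q) = (\<Sum>x\<leftarrow>es. x ^ q)"
  using psd_spectrum[OF psd] by blast
 have s: "s = Max (sqrt ` set es)"
  unfolding s_def max_singular_value_def singular_values_def es(3) P_def ..
 have "es \<noteq> []" using es(1) d by auto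
 then have "s \<in> sqrt ` set es" unfolding s by (intro Max_in) auto
 then obtain e0 where e0: "e0 \<in> set es" "s = sqrt e0" by blast
 show s0: "0 \<le> s" using e0 es(2) by simp
 have le: "x \<le> s\<^sup>2" if "x \<in> set es" for x
 proof -
  have "sqrt x \<le> s" unfolding s using that by (intro Max_ge) auto
  then have "(sqrt x)\<^sup>2 \<le> s\<^sup>2" using es(2)[OF that] by (intro power_mono) auto
  then show ?thesis using es(2)[OF that] by simp
 qed
 have "s ^ (2 * q) = e0 ^ q" using e0 es(2) by (simp add: power_mult)
 also have "\<dots> \<le> (\<Sum>x\<leftarrow>es. x ^ q)" by (rule elem_le_sum_list[OF _ e0(1)]) (simp add: es(2))
 finally show "s ^ (2 * q) \<le> mat_trace (P ^\<^sub>m q)" unfolding es(4) .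
 have pw: "x ^ q \<le> s ^ (2 * q)" if "x \<in> set es" for x
  unfolding power_mult using le[OF that] es(2)[OF that] by (intro power_mono) auto
 have "(\<Sum>x\<leftarrow>es. x ^ (p + q)) \<le> (\<Sum>x\<leftarrow>es. s ^ (2 * q) * x ^ p)"
 proof (rule sum_list_mono)
  fix x assume x: "x \<in> set es"
  have "x ^ q * x ^ p \<le> s ^ (2 * q) * x ^ p" using pw[OF x] es(2)[OF x] by (intro mult_right_mono) auto
  then show "x ^ (p + q) \<le> s ^ (2 * q) * x ^ p" by (simp add: power_add mult.commute)
 qed
 then show "mat_trace (P ^\<^sub>m (p + q)) \<le> s ^ (2 * q) * mat_trace (P ^\<^sub>m p)"
  unfolding es(4) sum_list_const_mult .
 have "(\<Sum>x\<leftarrow>es. x ^ q) \<le> (\<Sum>x\<leftarrow>es. s ^ (2 * q))" by (rule sum_list_mono) (rule pw)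
 then show "mat_trace (P ^\<^sub>m q) \<le> real d * s ^ (2 * q)"
  unfolding es(4) by (simp add: sum_list_triv es(1))
qed

text \<open>Needed for measurability: each term is a continuous function of the entries.\<close>

lemma max_singular_value_limit:
 assumes H: "H \<in> carrier_mat e d" and d: "0 < d"
 shows "(%q. root (2 * Suc q) (mat_trace ((transpose_mat H * H) ^\<^sub>m Suc q))) \<longlonglongrightarrow> max_singular_value H"
proof -
 let ?s = "max_singular_value H" and ?P = "transpose_mat H * H"
 note b = max_singular_value_bounds[OF H d]
 have "filterlim (%q. 2 * Suc q) at_top sequentially"
  by (rule filterlim_at_top_mono[OF filterlim_ident]) simp
 from filterlim_compose[OF LIMSEQ_root_const this, of "real d"]
 have "(%q. root (2 * Suc q) (real d)) \<longlonglongrightarrow> 1" using d by simp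
 from tendsto_mult_right[OF this, of ?s]
 have up: "(%q. root (2 * Suc q) (real d) * ?s) \<longlonglongrightarrow> ?s" by simp
 have pc: "root (2 * Suc q) (?s ^ (2 * Suc q)) = ?s" for q
  using b(1) by (intro real_root_power_cancel) auto
 show ?thesis
 proof (rule tendsto_sandwich[OF _ _ tendsto_const up])
  have "?s \<le> root (2 * Suc q) (mat_trace (?P ^\<^sub>m Suc q))" for q
  proof -
   have "root (2 * Suc q) (?s ^ (2 * Suc q)) \<le> root (2 * Suc q) (mat_trace (?P ^\<^sub>m Suc q))"
    using b(2)[of "Suc q"] by (intro real_root_le_mono) auto
   then show ?thesis unfolding pc .
  qed
  then show "\<forall>\<^sub>F q in sequentially. ?s \<le> root (2 * Suc q) (mat_trace (?P ^\<^sub>m Suc q))" by simp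
  have "root (2 * Suc q) (mat_trace (?P ^\<^sub>m Suc q)) \<le> root (2 * Suc q) (real d) * ?s" for q
  proof -
   have "root (2 * Suc q) (mat_trace (?P ^\<^sub>m Suc q)) \<le> root (2 * Suc q) (real d * ?s ^ (2 * Suc q))"
    using b(4)[of "Suc q"] by (intro real_root_le_mono) auto
   then show ?thesis unfolding real_root_mult pc .
  qed
  then show "\<forall>\<^sub>F q in sequentially. root (2 * Suc q) (mat_trace (?P ^\<^sub>m Suc q)) \<le> root (2 * Suc q) (real d) * ?s" by simp
 qed
qed

lemma pow_mat_Suc_left:
 assumes "P \<in> carrier_mat d d"
 shows "P ^\<^sub>m Suc q = P * P ^\<^sub>m q"
proof (induction q)
 case 0
 then show ?case using assms by simp
next
 case (Suc q)
 have "P ^\<^sub>m Suc (Suc q) = P * P ^\<^sub>m q * P" using Suc by simp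
 also have "\<dots> = P * (P ^\<^sub>m q * P)" using assms by (intro assoc_mult_mat) auto
 finally show ?case by simp
qed

lemma sum_blocks: "(\<Sum>i<k * m. f i) = (\<Sum>ka<k. \<Sum>r<m. f (ka * m + r))" for f :: "nat => real"
proof -
 have "sum f {ka * m..<ka * m + m} = (\<Sum>r<m. f (ka * m + r))" for ka
  using sum.shift_bounds_nat_ivl[of f 0 "ka * m" m] by (simp add: lessThan_atLeast0 add.commute)
 then show ?thesis by (simp add: sum.nat_group[symmetric])
qed

lemma block_index: "ka < k ==> r < m ==> ka * m + r < k * m" for ka r :: nat
proof -
 assume a: "ka < k" "r < m"
 have "Suc ka * m \<le> k * m" using a by (intro mult_le_mono1) simp
 then show ?thesis using a by simp
qed

context bipartite
begin

text \<open>An entry of the matrix \<open>H\<close>, with the row and column indices split into their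
 Kronecker factors.\<close>

definition rect :: "nat => (nat \<times> nat \<times> nat => real) => nat => nat => nat => nat => real" where
 "rect n x ka r mu c = 1 / sqrt (real n) * (\<Sum>i<l. a i ka mu * x (i, r, c))"

definition Hmat :: "nat => nat => (nat \<times> nat \<times> nat => real) => real mat" where
 "Hmat m n x = mat (k1 * m) ((K - k1) * n)
  (%(r, c). rect n x (r div m) (r mod m) (k1 + c div n) (c mod n))"

lemma Hmat_carrier: "Hmat m n x \<in> carrier_mat (k1 * m) ((K - k1) * n)"
 by (simp add: Hmat_def)

lemma Hmat_entry:
 assumes "ka < k1" "r < m" "mu < K - k1" "c < n"
 shows "Hmat m n x $$ (ka * m + r, mu * n + c) = rect n x ka r (k1 + mu) c"
 using assms block_index[OF assms(1,2)] block_index[OF assms(3,4)] by (simp add: Hmat_def)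

lemma ent_rect:
 assumes J: "J = {..<m} \<union> {..<n}" and lt: "ka < K" "mu < K" "r \<in> J" "c \<in> J"
 shows "ent (XW J (wb {..<m} {..<n}) x) (ka, r) (mu, c)
  = (if ka < k1 \<and> r < m \<and> k1 \<le> mu \<and> c < n then rect n x ka r mu c else 0)
  + (if mu < k1 \<and> c < m \<and> k1 \<le> ka \<and> r < n then rect n x mu c ka r else 0)"
proof -
 have finJ: "finite J" using J by simp
 have h: "(\<Sum>i<l. wb {..<m} {..<n} r c * x (i, r, c) * a i ka mu)
  = (if ka < k1 \<and> r < m \<and> k1 \<le> mu \<and> c < n then rect n x ka r mu c else 0)" for ka mu r c
 proof (cases "ka < k1 \<and> r < m \<and> k1 \<le> mu \<and> c < n")
  case True
  then show ?thesis by (simp add: rect_def wb_def sum_distrib_left mult_ac)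
 next
  case False
  have z: "wb {..<m} {..<n} r c * x (i, r, c) * a i ka mu = 0" for i
   using False bip[of i ka mu] by (cases "a i ka mu = 0") (auto simp: wb_def)
  show ?thesis unfolding if_not_P[OF False] by (rule sum.neutral) (use z in blast)
 qed
 show ?thesis using lt by (simp add: ent_XX[OF finJ] sum.distrib h)
qed

lemma ent_row_step:
 assumes J: "J = {..<m} \<union> {..<n}" and ka: "ka < k1" "r < m"
 shows "ent (XW J (wb {..<m} {..<n}) x * Y) (ka, r) p
  = (\<Sum>mu<K - k1. \<Sum>c<n. rect n x ka r (k1 + mu) c * ent Y (k1 + mu, c) p)"
proof -
 let ?X = "XW J (wb {..<m} {..<n}) x"
 have finJ: "finite J" using J by simp
 have kaK: "ka < K" "r \<in> J" using ka k1 J by auto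
 have e: "ent ?X (ka, r) (mu, c) = (if k1 \<le> mu \<and> c < n then rect n x ka r mu c else 0)" if "mu < K" "c \<in> J" for mu c
  using ka that ent_rect[OF J kaK(1) that(1) kaK(2) that(2), of x] by simp
 have "ent (?X * Y) (ka, r) p = (\<Sum>u\<in>DD J. ent ?X (ka, r) u * ent Y u p)"
  using finJ kaK by (intro adm_times_ent) auto
 also have "\<dots> = (\<Sum>mu<K. \<Sum>c\<in>J. (if k1 \<le> mu \<and> c < n then rect n x ka r mu c else 0) * ent Y (mu, c) p)"
  unfolding sum_DD using e by (intro sum.cong refl) auto
 also have "\<dots> = (\<Sum>mu\<in>{k1..<K}. \<Sum>c\<in>J. (if k1 \<le> mu \<and> c < n then rect n x ka r mu c else 0) * ent Y (mu, c) p)"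
  by (rule sum.mono_neutral_right) auto
 also have "\<dots> = (\<Sum>mu\<in>{k1..<K}. \<Sum>c<n. rect n x ka r mu c * ent Y (mu, c) p)"
 proof (rule sum.cong[OF refl])
  fix mu assume "mu \<in> {k1..<K}"
  then show "(\<Sum>c\<in>J. (if k1 \<le> mu \<and> c < n then rect n x ka r mu c else 0) * ent Y (mu, c) p) = (\<Sum>c<n. rect n x ka r mu c * ent Y (mu, c) p)"
   using J finJ by (intro sum.mono_neutral_cong_right) auto
 qed
 also have "\<dots> = (\<Sum>mu<K - k1. \<Sum>c<n. rect n x ka r (k1 + mu) c * ent Y (k1 + mu, c) p)"
  using sum.shift_bounds_nat_ivl[of "%mu. \<Sum>c<n. rect n x ka r mu c * ent Y (mu, c) p" 0 k1 "K - k1"] k1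
  by (simp add: lessThan_atLeast0 add.commute)
 finally show ?thesis .
qed

lemma ent_column_step:
 assumes J: "J = {..<m} \<union> {..<n}" and mu: "mu < K - k1" "c < n"
 shows "ent (XW J (wb {..<m} {..<n}) x * Y) (k1 + mu, c) p
  = (\<Sum>ka<k1. \<Sum>r<m. rect n x ka r (k1 + mu) c * ent Y (ka, r) p)"
proof -
 let ?X = "XW J (wb {..<m} {..<n}) x"
 have finJ: "finite J" using J by simp
 have muK: "k1 + mu < K" "c \<in> J" using mu J by auto
 have e: "ent ?X (k1 + mu, c) (ka, r) = (if ka < k1 \<and> r < m then rect n x ka r (k1 + mu) c else 0)" if "ka < K" "r \<in> J" for ka r
  using mu that ent_rect[OF J muK(1) that(1) muK(2) that(2), of x] by simp
 have "ent (?X * Y) (k1 + mu, c) p = (\<Sum>u\<in>DD J. ent ?X (k1 + mu, c) u * ent Y u p)"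
  using finJ muK by (intro adm_times_ent) auto
 also have "\<dots> = (\<Sum>ka<K. \<Sum>r\<in>J. (if ka < k1 \<and> r < m then rect n x ka r (k1 + mu) c else 0) * ent Y (ka, r) p)"
  unfolding sum_DD using e by (intro sum.cong refl) auto
 also have "\<dots> = (\<Sum>ka<k1. \<Sum>r\<in>J. (if ka < k1 \<and> r < m then rect n x ka r (k1 + mu) c else 0) * ent Y (ka, r) p)"
  using k1 by (intro sum.mono_neutral_right) auto
 also have "\<dots> = (\<Sum>ka<k1. \<Sum>r<m. rect n x ka r (k1 + mu) c * ent Y (ka, r) p)"
 proof (rule sum.cong[OF refl])
  fix ka assume "ka \<in> {..<k1}"
  then show "(\<Sum>r\<in>J. (if ka < k1 \<and> r < m then rect n x ka r (k1 + mu) c else 0) * ent Y (ka, r) p)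
   = (\<Sum>r<m. rect n x ka r (k1 + mu) c * ent Y (ka, r) p)"
   using J finJ by (intro sum.mono_neutral_cong_right) auto
 qed
 finally show ?thesis .
qed

lemma ent_even_power:
 assumes J: "J = {..<m} \<union> {..<n}" and lt: "mu < K - k1" "c < n" "mu' < K - k1" "c' < n"
 shows "ent (XW J (wb {..<m} {..<n}) x ^ (2 * q)) (k1 + mu, c) (k1 + mu', c')
  = ((transpose_mat (Hmat m n x) * Hmat m n x) ^\<^sub>m q) $$ (mu * n + c, mu' * n + c')"
 using lt
proof (induction q arbitrary: mu c)
 case 0
 have "mu * n + c = mu' * n + c' \<longleftrightarrow> mu = mu' \<and> c = c'"
 proof
  assume e: "mu * n + c = mu' * n + c'"
  have "(mu * n + c) div n = mu" "(mu' * n + c') div n = mu'" using 0 by auto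
  then show "mu = mu' \<and> c = c'" using e by simp
 qed simp
 moreover have "mu * n + c < (K - k1) * n" "mu' * n + c' < (K - k1) * n" using 0 block_index by auto
 ultimately show ?case using Hmat_carrier[of m n x] by (auto simp: one_lmat.rep_eq)
next
 case (Suc q)
 let ?X = "XW J (wb {..<m} {..<n}) x" and ?H = "Hmat m n x"
 let ?P = "transpose_mat ?H * ?H" and ?d = "(K - k1) * n"
 have H: "?H \<in> carrier_mat (k1 * m) ?d" by (rule Hmat_carrier)
 have HT: "transpose_mat ?H \<in> carrier_mat ?d (k1 * m)" using H by simp
 have P: "?P \<in> carrier_mat ?d ?d" using H by simp
 have Pq: "?P ^\<^sub>m q \<in> carrier_mat ?d ?d" using P by simp
 have HP: "?H * ?P ^\<^sub>m q \<in> carrier_mat (k1 * m) ?d" using H Pq by simp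
 have i: "mu * n + c < ?d" "mu' * n + c' < ?d" using Suc.prems block_index by auto
 have "?P ^\<^sub>m Suc q = transpose_mat ?H * (?H * ?P ^\<^sub>m q)"
  unfolding pow_mat_Suc_left[OF P] using H HT Pq by (intro assoc_mult_mat) auto
 then have "(?P ^\<^sub>m Suc q) $$ (mu * n + c, mu' * n + c')
  = (\<Sum>h<k1 * m. transpose_mat ?H $$ (mu * n + c, h) * (?H * ?P ^\<^sub>m q) $$ (h, mu' * n + c'))"
  by (simp only: mult_mat_entry[OF HT HP i])
 also have "\<dots> = (\<Sum>h<k1 * m. ?H $$ (h, mu * n + c) * (\<Sum>g<?d. ?H $$ (h, g) * (?P ^\<^sub>m q) $$ (g, mu' * n + c')))"
 proof (rule sum.cong[OF refl])
  fix h assume "h \<in> {..<k1 * m}"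
  then have h: "h < k1 * m" by simp
  show "transpose_mat ?H $$ (mu * n + c, h) * (?H * ?P ^\<^sub>m q) $$ (h, mu' * n + c')
   = ?H $$ (h, mu * n + c) * (\<Sum>g<?d. ?H $$ (h, g) * (?P ^\<^sub>m q) $$ (g, mu' * n + c'))"
   unfolding mult_mat_entry[OF H Pq h i(2)] using H i h by simp
 qed
 also have "\<dots> = (\<Sum>ka<k1. \<Sum>r<m. rect n x ka r (k1 + mu) c *
   (\<Sum>\<nu><K - k1. \<Sum>b<n. rect n x ka r (k1 + \<nu>) b * ent (?X ^ (2 * q)) (k1 + \<nu>, b) (k1 + mu', c')))"
  unfolding sum_blocks using Suc by (intro sum.cong refl arg_cong2[where f = "(*)"]) (auto simp: Hmat_entry)
 also have "\<dots> = (\<Sum>ka<k1. \<Sum>r<m. rect n x ka r (k1 + mu) c * ent (?X * ?X ^ (2 * q)) (ka, r) (k1 + mu', c'))"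
  by (intro sum.cong refl) (simp add: ent_row_step[OF J])
 also have "\<dots> = ent (?X * (?X * ?X ^ (2 * q))) (k1 + mu, c) (k1 + mu', c')"
  by (rule ent_column_step[OF J Suc.prems(1,2), symmetric])
 finally show ?case by simp
qed

text \<open>The even powers of \<open>X\<close> are block-diagonal, the column block being \<open>(H\<^sup>T *
 H) ^ q\<close>. Both blocks have the same trace.\<close>

theorem half_trace:
 assumes J: "J = {..<m} \<union> {..<n}" and q: "0 < q"
 shows "tr (DD J) (XW J (wb {..<m} {..<n}) x ^ (2 * q)) / 2
  = mat_trace ((transpose_mat (Hmat m n x) * Hmat m n x) ^\<^sub>m q)"
proof -
 let ?X = "XW J (wb {..<m} {..<n}) x" and ?P = "transpose_mat (Hmat m n x) * Hmat m n x"
 have finJ: "finite J" using J by simp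
 have p: "0 < 2 * q" using q by simp
 let ?e = "%ka r. ent (?X ^ (2 * q)) (ka, r) (ka, r)"
 have rz: "?e ka r = 0" if "ka < K" "r \<in> J" "r \<notin> side {..<m} {..<n} ka" for ka r
  using row_zero[OF J _ _ that p] by simp
 have "tr (DD J) (?X ^ (2 * q)) = (\<Sum>ka<K. \<Sum>r\<in>J. ?e ka r)" unfolding tr_def sum_DD by simp
 also have "\<dots> = (\<Sum>ka<k1. \<Sum>r\<in>J. ?e ka r) + (\<Sum>ka\<in>{k1..<K}. \<Sum>r\<in>J. ?e ka r)"
  using sum.atLeastLessThan_concat[of 0 k1 K "%ka. \<Sum>r\<in>J. ?e ka r"] k1 by (simp add: lessThan_atLeast0)
 also have "(\<Sum>ka<k1. \<Sum>r\<in>J. ?e ka r) = tr (DD J) (Gam {..<m} J * ?X ^ (2 * q))"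
 proof -
  have "tr (DD J) (Gam {..<m} J * ?X ^ (2 * q)) = (\<Sum>ka<k1. \<Sum>r\<in>J. ind {..<m} r * ?e ka r)"
   unfolding tr_Gam[OF finJ] using k1 by (intro sum.cong refl) (auto simp: tr_BB_times[OF finJ])
  moreover have "ind {..<m} r * ?e ka r = ?e ka r" if "ka < k1" "r \<in> J" for ka r
   using rz[of ka r] that k1 by (auto simp: ind_def side_def)
  ultimately show ?thesis by simp
 qed
 finally have "tr (DD J) (?X ^ (2 * q)) / 2 = (\<Sum>ka\<in>{k1..<K}. \<Sum>r\<in>J. ?e ka r)"
  using tr_Gam_half[OF _ _ J p, of x] by simp
 also have "\<dots> = (\<Sum>ka\<in>{k1..<K}. \<Sum>r<n. ?e ka r)"
 proof (rule sum.cong[OF refl])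
  fix ka assume "ka \<in> {k1..<K}"
  then show "(\<Sum>r\<in>J. ?e ka r) = (\<Sum>r<n. ?e ka r)"
   using rz[of ka] J finJ by (intro sum.mono_neutral_right) (auto simp: side_def)
 qed
 also have "\<dots> = (\<Sum>mu<K - k1. \<Sum>c<n. ?e (k1 + mu) c)"
  using sum.shift_bounds_nat_ivl[of "%ka. \<Sum>r<n. ?e ka r" 0 k1 "K - k1"] k1
  by (simp add: lessThan_atLeast0 add.commute)
 also have "\<dots> = (\<Sum>mu<K - k1. \<Sum>c<n. (?P ^\<^sub>m q) $$ (mu * n + c, mu * n + c))"
  by (intro sum.cong refl) (simp add: ent_even_power[OF J])
 also have "\<dots> = mat_trace (?P ^\<^sub>m q)"
  unfolding mat_trace_def sum_blocks[symmetric, of "%i. (?P ^\<^sub>m q) $$ (i, i)"] using Hmat_carrier[of m n x] by simp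
 finally show ?thesis .
qed

end

section \<open>Transfer to the product measure\<close>

text \<open>The law of the given matrix entries is a marginal of the product measure over a larger index set.\<close>

lemma gaussian_transfer:
 fixes F :: "(nat \<times> nat \<times> nat => real) => real"
 assumes G: "indep_std_normal_mats M l m n G"
  and I: "finite I'" "{..<l} \<times> {..<m} \<times> {..<n} \<subseteq> I'"
  and F: "F \<in> borel_measurable (gm I')"
  and dep: "!!x y. (!!e. e \<in> {..<l} \<times> {..<m} \<times> {..<n} ==> x e = y e) ==> F x = F y"
 shows "(\<integral>\<omega>. F (%(i, r, c). G i \<omega> $$ (r, c)) \<partial>M) = (\<integral>x. F x \<partial>gm I')"
proof -
 let ?I = "{..<l} \<times> {..<m} \<times> {..<n}"
 let ?X = "%e \<omega>. (%(i, r, c). G i \<omega> $$ (r, c)) e"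
 have finI: "finite ?I" by simp
 interpret Mp: prob_space M using G by (simp add: indep_std_normal_mats_def)
 interpret gI: prob_space "gm I' :: (nat \<times> nat \<times> nat => real) measure" by (rule prob_space_gm)
 interpret st: product_prob_space "%_ :: nat \<times> nat \<times> nat. stdn" I'
  unfolding product_prob_space_def product_prob_space_axioms_def product_sigma_finite_def
  using prob_space_stdn prob_space_imp_sigma_finite by blast
 show ?thesis
 proof (cases "?I = {}")
  case True
  have c: "F x = F (%_. 0)" for x by (rule dep) (use True in blast)
  have "(\<integral>\<omega>. F (%e. ?X e \<omega>) \<partial>M) = (\<integral>\<omega>. F (%_. 0) \<partial>M)" by (simp only: c[of "%e. ?X e _"])
  moreover have "(\<integral>x. F x \<partial>gm I') = (\<integral>x. F (%_. 0) \<partial>gm I')" by (rule Bochner_Integration.integral_cong[OF refl c])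
  ultimately show ?thesis by (simp add: Mp.prob_space gI.prob_space)
 next
  case False
  have dist: "distributed M lborel (?X e) std_normal_density" if "e \<in> ?I" for e
   using G that by (auto simp: indep_std_normal_mats_def)
  have rv: "?X e \<in> borel_measurable M" if "e \<in> ?I" for e
   using distributed_measurable[OF dist[OF that]] by simp
  have law: "distr M borel (?X e) = stdn" if "e \<in> ?I" for e
  proof -
   have "distr M borel (?X e) = distr M lborel (?X e)" by (rule distr_cong) auto
   then show ?thesis using distributed_distr_eq_density[OF dist[OF that]] by simp
  qed
  have "Mp.indep_vars (%_. borel) ?X ?I"
   using G by (simp add: indep_std_normal_mats_def case_prod_unfold)
  then have "distr M (\<Pi>\<^sub>M e\<in>?I. borel) (%\<omega>. \<lambda>e\<in>?I. ?X e \<omega>) = (\<Pi>\<^sub>M e\<in>?I. distr M borel (?X e))"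
   using Mp.indep_vars_iff_distr_eq_PiM'[OF False, of ?X "%_. borel"] rv by blast
  also have "\<dots> = gm ?I" unfolding gm_def by (intro PiM_cong refl law)
  finally have 1: "distr M (\<Pi>\<^sub>M e\<in>?I. borel) (%\<omega>. \<lambda>e\<in>?I. ?X e \<omega>) = gm ?I" .
  have 2: "distr (gm I') (gm ?I) (%x. restrict x ?I) = gm ?I"
   unfolding gm_def by (rule st.distr_PiM_restrict_finite[OF finI I(2)])
  have sets_stdn: "sets stdn = sets borel" by simp
  define ext where "ext y = (\<lambda>e\<in>I'. if e \<in> ?I then y e else 0)" for y :: "nat \<times> nat \<times> nat => real"
  have ext: "ext \<in> measurable (\<Pi>\<^sub>M e\<in>?I. borel) (gm I')"
   unfolding ext_def gm_def
  proof (rule measurable_restrict)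
   fix e assume "e \<in> I'"
   show "(%y. if e \<in> ?I then y e else 0) \<in> measurable (\<Pi>\<^sub>M e\<in>?I. borel) stdn"
    unfolding measurable_cong_sets[OF refl sets_stdn]
    by (cases "e \<in> ?I") (auto intro: measurable_component_singleton)
  qed
  have F': "(%y. F (ext y)) \<in> borel_measurable (\<Pi>\<^sub>M e\<in>?I. borel)" by (rule measurable_compose[OF ext F])
  have sI: "sets (gm ?I) = sets (\<Pi>\<^sub>M e\<in>?I. borel)" unfolding gm_def by (intro sets_PiM_cong refl sets_stdn)
  have F'': "(%y. F (ext y)) \<in> borel_measurable (gm ?I)" using F' unfolding measurable_cong_sets[OF sI refl] .
  have m1: "(%\<omega>. \<lambda>e\<in>?I. ?X e \<omega>) \<in> measurable M (\<Pi>\<^sub>M e\<in>?I. borel)" by (rule measurable_restrict[OF rv])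
  have m2: "(%x. restrict x ?I) \<in> measurable (gm I') (gm ?I)"
   unfolding gm_def by (rule measurable_restrict_subset[OF I(2)])
  have "(\<integral>\<omega>. F (%e. ?X e \<omega>) \<partial>M) = (\<integral>\<omega>. F (ext (\<lambda>e\<in>?I. ?X e \<omega>)) \<partial>M)"
   by (intro Bochner_Integration.integral_cong refl dep) (use I(2) in \<open>auto simp: ext_def\<close>)
  also have "\<dots> = (\<integral>y. F (ext y) \<partial>gm ?I)"
   unfolding 1[symmetric] by (rule integral_distr[OF m1 F', symmetric])
  also have "\<dots> = (\<integral>x. F (ext (restrict x ?I)) \<partial>gm I')"
   by (subst 2[symmetric]) (rule integral_distr[OF m2 F''])
  also have "\<dots> = (\<integral>x. F x \<partial>gm I')"
   by (intro Bochner_Integration.integral_cong refl dep) (use I(2) in \<open>auto simp: ext_def\<close>)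
  finally show ?thesis .
 qed
qed

section \<open>The resolvent and the variational bound\<close>

lemma sum_shift: "(\<Sum>mu\<in>{k..<k + k2}. f mu) = (\<Sum>mu<k2. f (k + mu))" for f :: "nat => real"
 using sum.shift_bounds_nat_ivl[of f 0 k k2] by (simp add: lessThan_atLeast0 add.commute)

lemma pos_def_of_inverse:
 assumes Z: "Z \<in> carrier_mat k k" and G: "G \<in> carrier_mat k k" and ZG: "Z * G = 1\<^sub>m k"
  and sym: "transpose_mat G = G" and c: "0 < c"
  and pos: "!!w. c * (\<Sum>i<k. (w i)\<^sup>2) \<le> (\<Sum>i<k. \<Sum>j<k. G $$ (i, j) * (w i * w j))"
 shows "sym_pos_def k Z"
proof -
 have GZ: "G * Z = 1\<^sub>m k" by (rule inv_mat_eqI(2)[OF Z G ZG])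
 have ZT: "transpose_mat Z \<in> carrier_mat k k" using Z by simp
 have GZT: "G * transpose_mat Z = 1\<^sub>m k" using transpose_mult[OF Z G] ZG sym by simp
 have "transpose_mat Z = Z * G * transpose_mat Z" using ZT ZG by simp
 also have "\<dots> = Z * (G * transpose_mat Z)" using Z G ZT by (intro assoc_mult_mat) auto
 finally have symZ: "transpose_mat Z = Z" using GZT Z by simp
 have "0 < scalar_prod v (Z *\<^sub>v v)" if v: "v \<in> carrier_vec k" "v \<noteq> 0\<^sub>v k" for v
 proof -
  define w where "w = Z *\<^sub>v v"
  have w: "w \<in> carrier_vec k" using Z v by (simp add: w_def)
  have Gw: "G *\<^sub>v w = v"
   using assoc_mult_mat_vec[OF G Z v(1)] GZ v by (simp add: w_def)
  have "\<exists>i<k. vec_index w i \<noteq> 0"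
  proof (rule ccontr)
   assume "\<not> ?thesis"
   then have "w = 0\<^sub>v k" using w by (intro eq_vecI) auto
   moreover have "G *\<^sub>v 0\<^sub>v k = 0\<^sub>v k" by (rule eq_vecI) (use G in \<open>auto simp: scalar_prod_def\<close>)
   ultimately have "v = 0\<^sub>v k" using Gw by simp
   then show False using v by simp
  qed
  then obtain i where i: "i < k" "vec_index w i \<noteq> 0" by blast
  have "0 < (vec_index w i)\<^sup>2" using i by simp
  also have "\<dots> \<le> (\<Sum>i<k. (vec_index w i)\<^sup>2)" using i by (intro member_le_sum) auto
  finally have "0 < c * (\<Sum>i<k. (vec_index w i)\<^sup>2)" using c by simp
  also have "\<dots> \<le> scalar_prod w (G *\<^sub>v w)" unfolding quad_form[OF G w] by (rule pos)
  also have "\<dots> = scalar_prod v (Z *\<^sub>v v)"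
   unfolding Gw using comm_scalar_prod[OF w v(1)] by (simp add: w_def)
  finally show ?thesis .
 qed
 then show ?thesis using Z symZ by (simp add: sym_pos_def_def)
qed

lemma max_eigenvalue_scalar:
 assumes "0 < k"
 shows "max_eigenvalue (t \<cdot>\<^sub>m 1\<^sub>m k) = t"
proof -
 have mv: "(t \<cdot>\<^sub>m 1\<^sub>m k) *\<^sub>v v = t \<cdot>\<^sub>v v" if v: "v \<in> carrier_vec k" for v :: "real vec"
 proof (rule eq_vecI)
  fix i assume "i < dim_vec (t \<cdot>\<^sub>v v)"
  then have i: "i < k" using v by simp
  have "vec_index ((t \<cdot>\<^sub>m 1\<^sub>m k) *\<^sub>v v) i = (\<Sum>h<k. (t \<cdot>\<^sub>m 1\<^sub>m k) $$ (i, h) * vec_index v h)"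
   using i v by (intro mult_mat_vec_entry[of _ k k]) auto
  also have "\<dots> = (\<Sum>h<k. if h = i then t * vec_index v i else 0)"
   using i by (intro sum.cong refl) auto
  finally show "vec_index ((t \<cdot>\<^sub>m 1\<^sub>m k) *\<^sub>v v) i = vec_index (t \<cdot>\<^sub>v v) i" using i v by simp
 qed (use v in simp)
 have "spectrum (t \<cdot>\<^sub>m 1\<^sub>m k) = {t}"
 proof (intro Set.set_eqI iffI)
  fix x assume "x \<in> spectrum (t \<cdot>\<^sub>m 1\<^sub>m k)"
  then obtain v where v: "v \<in> carrier_vec k" "v \<noteq> 0\<^sub>v k" "(t \<cdot>\<^sub>m 1\<^sub>m k) *\<^sub>v v = x \<cdot>\<^sub>v v"
   by (auto simp: spectrum_def eigenvalue_def eigenvector_def)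
  have "\<exists>i<k. vec_index v i \<noteq> 0"
  proof (rule ccontr)
   assume "\<not> ?thesis"
   then have "v = 0\<^sub>v k" using v(1) by (intro eq_vecI) auto
   then show False using v by simp
  qed
  then obtain i where i: "i < k" "vec_index v i \<noteq> 0" by blast
  have "t \<cdot>\<^sub>v v = x \<cdot>\<^sub>v v" using v mv by simp
  then have "vec_index (t \<cdot>\<^sub>v v) i = vec_index (x \<cdot>\<^sub>v v) i" by simp
  then show "x \<in> {t}" using i v(1) by simp
 next
  fix x assume "x \<in> {t}"
  moreover have "unit_vec k 0 \<in> carrier_vec k" "unit_vec k 0 \<noteq> (0\<^sub>v k :: real vec)" using assms by auto
  ultimately show "x \<in> spectrum (t \<cdot>\<^sub>m 1\<^sub>m k)"
   unfolding spectrum_def eigenvalue_def eigenvector_def using mv[of "unit_vec k 0"]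
   by (auto intro!: exI[of _ "unit_vec k 0"])
 qed
 then show ?thesis by (simp add: max_eigenvalue_def)
qed

context bipartite
begin

lemma csum_sums:
 assumes "!!ka mu ka' mu'. ka < k1 ==> k1 \<le> mu ==> mu < K ==> ka' < k1 ==> k1 \<le> mu' ==> mu' < K ==>
  (%p. f p ka mu ka' mu') sums g ka mu ka' mu'"
 shows "(%p. csum (f p)) sums csum g"
 unfolding csum_eq
proof (intro sums_sum)
 fix i ka mu ka' mu'
 show "(%p. a i ka mu * a i ka' mu' * f p ka mu ka' mu') sums (a i ka mu * a i ka' mu' * g ka mu ka' mu')"
 proof (cases "a i ka mu = 0 \<or> a i ka' mu' = 0")
  case True
  then show ?thesis by auto
 next
  case False
  then have "(%p. f p ka mu ka' mu') sums g ka mu ka' mu'" using bip assms by metis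
  then show ?thesis by (rule sums_mult)
 qed
qed

lemma csum_sum: "(\<Sum>j\<in>A. csum (f j)) = csum (%ka mu ka' mu'. \<Sum>j\<in>A. f j ka mu ka' mu')"
  unfolding csum_eq sum_distrib_left
  apply (subst sum.swap, rule sum.cong[OF refl])
  apply (subst sum.swap, rule sum.cong[OF refl])
  apply (subst sum.swap, rule sum.cong[OF refl])
  apply (subst sum.swap, rule sum.cong[OF refl])
  apply (subst sum.swap, rule sum.cong[OF refl])
  apply (rule refl)
  done

lemma csum_cmult: "c * csum f = csum (%ka mu ka' mu'. c * f ka mu ka' mu')"
 unfolding csum_eq sum_distrib_left by (intro sum.cong refl) simp

definition same_block :: "nat => nat => bool" where
 "same_block ka ka' \<longleftrightarrow> (ka < k1 \<and> ka' < k1) \<or> (k1 \<le> ka \<and> ka < K \<and> k1 \<le> ka' \<and> ka' < K)"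

lemma Mo_bound:
 assumes \<alpha>: "0 \<le> \<alpha>" and z: "edge_bound \<alpha> z" "z < z'"
 shows "\<exists>B\<ge>0. \<forall>p ka ka'. same_block ka ka' \<longrightarrow> \<bar>Mo \<alpha> p ka ka'\<bar> \<le> B * z' ^ p"
proof -
 obtain R C where "bip_seq K a k1 R C \<alpha>" using ex_bip_seq \<alpha> by blast
 then interpret bip_seq K l a k1 R C \<alpha> .
 have z0: "0 < z'" using z by (auto simp: edge_bound_def)
 obtain B where B: "0 \<le> B" "!!q. tt \<alpha> (2 * q) \<le> B * z' ^ (2 * q)" using edge_growth[OF \<alpha> z] by blast
 let ?B = "1 + B + \<alpha> * B"
 have aB: "0 \<le> \<alpha> * B" using \<alpha> B by simp
 have B0: "0 \<le> ?B" using B aB by simp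
 have "\<bar>Mo \<alpha> p ka ka'\<bar> \<le> ?B * z' ^ p" if sb: "same_block ka ka'" for p ka ka'
 proof (cases "odd p")
  case True
  then show ?thesis using B0 z0 by (simp add: Mo_odd)
 next
  case False
  then obtain q where p: "p = 2 * q" by (auto elim: evenE)
  have zp: "0 < z' ^ (2 * q)" using z0 by simp
  have le: "b * z' ^ (2 * q) \<le> ?B * z' ^ (2 * q)" if "b \<le> ?B" for b
   using that zp by (intro mult_right_mono) auto
  consider "ka \<in> {..<k1}" "ka' \<in> {..<k1}" | "ka \<in> {k1..<K}" "ka' \<in> {k1..<K}" "q = 0"
   | "ka \<in> {k1..<K}" "ka' \<in> {k1..<K}" "0 < q"
   using sb unfolding same_block_def by auto
  then show ?thesis
  proof cases
   case 1
   have "\<bar>Mo \<alpha> (2 * q) ka ka'\<bar> \<le> tt \<alpha> (2 * q)" unfolding tt_def by (rule entry_bound[OF _ 1]) simp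
   also have "\<dots> \<le> B * z' ^ (2 * q)" by (rule B(2))
   also have "\<dots> \<le> ?B * z' ^ (2 * q)" by (rule le) (use aB in simp)
   finally show ?thesis unfolding p .
  next
   case 2
   then show ?thesis using B0 B(1) aB by (simp add: p)
  next
   case 3
   have q: "0 < 2 * q" using 3 by simp
   have "\<bar>Mo \<alpha> (2 * q) ka ka'\<bar> \<le> \<alpha> * tt \<alpha> (2 * q)"
    unfolding column_trace[OF q, symmetric] by (rule entry_bound[OF _ 3(1,2)]) simp
   also have "\<dots> \<le> \<alpha> * (B * z' ^ (2 * q))" using \<alpha> by (intro mult_left_mono B(2))
   also have "\<dots> = (\<alpha> * B) * z' ^ (2 * q)" by simp
   also have "\<dots> \<le> ?B * z' ^ (2 * q)" by (rule le) (use B in simp)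
   finally show ?thesis unfolding p .
  qed
 qed
 then show ?thesis using B0 by blast
qed

text \<open>The resolvent \<open>t * G\<close> at \<open>u = 1 / t\<close>, applied to entries within one
 block.\<close>

definition Gr :: "real => real => nat => nat => real" where
 "Gr \<alpha> u ka ka' = (\<Sum>p. Mo \<alpha> p ka ka' * u ^ p)"

lemma Gr_summable:
 assumes \<alpha>: "0 \<le> \<alpha>" and z: "edge_bound \<alpha> z" "z < t" and sb: "same_block ka ka'"
 shows "summable (%p. norm (Mo \<alpha> p ka ka' * (1 / t) ^ p))"
proof -
 have z0: "0 \<le> z" using z by (simp add: edge_bound_def)
 obtain z' where z': "z < z'" "z' < t" using dense[OF z(2)] by blast
 obtain B where B: "0 \<le> B" "!!p. \<bar>Mo \<alpha> p ka ka'\<bar> \<le> B * z' ^ p" using Mo_bound[OF \<alpha> z(1) z'(1)] sb by blast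
 have t: "0 < t" "0 < z'" using z0 z' by auto
 have "norm (z' / t) < 1" using t z' by simp
 from summable_mult[OF summable_geometric[OF this], of B] have s: "summable (%p. B * (z' / t) ^ p)" .
 have "norm (norm (Mo \<alpha> p ka ka' * (1 / t) ^ p)) \<le> B * (z' / t) ^ p" for p
 proof -
  have "norm (Mo \<alpha> p ka ka' * (1 / t) ^ p) = \<bar>Mo \<alpha> p ka ka'\<bar> * (1 / t) ^ p" using t by (simp add: abs_mult)
  also have "\<dots> \<le> B * z' ^ p * (1 / t) ^ p" using B(2)[of p] t by (intro mult_right_mono) auto
  also have "\<dots> = B * (z' / t) ^ p" by (simp add: power_divide)
  finally show ?thesis by simp
 qed
 then show ?thesis by (intro summable_comparison_test'[OF s]) auto
qed

text \<open>The quadratic recursion for \<open>Mo\<close> becomes a product of power series. The parameters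
 \<open>w\<close>, \<open>f\<close>, \<open>f'\<close>, \<open>h\<close> cover the row and the
 column block at once.\<close>

lemma Gr_equation:
 assumes summ: "!!ka ka'. same_block ka ka' ==> summable (%p. norm (Mo \<alpha> p ka ka' * u ^ p))"
  and HHeq: "!!A B. HH \<alpha> A B ka0 ka0' = csum (%ka mu ka' mu'. w ka mu ka' mu' *
   (A (f ka mu ka' mu') (f' ka mu ka' mu') * B (h ka mu ka' mu') ka0'))"
  and blk: "!!ka mu ka' mu'. ka < k1 ==> k1 \<le> mu ==> mu < K ==> ka' < k1 ==> k1 \<le> mu' ==> mu' < K ==>
   same_block (f ka mu ka' mu') (f' ka mu ka' mu') \<and> same_block (h ka mu ka' mu') ka0'"
 shows "Gr \<alpha> u ka0 ka0' = (if ka0 = ka0' then 1 else 0) + u\<^sup>2 * csum (%ka mu ka' mu'. w ka mu ka' mu' *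
   (Gr \<alpha> u (f ka mu ka' mu') (f' ka mu ka' mu') * Gr \<alpha> u (h ka mu ka' mu') ka0'))"
proof -
 let ?F = "%p. Mo \<alpha> p ka0 ka0' * u ^ p"
 let ?c = "%p ka mu ka' mu'. \<Sum>j\<le>p. (Mo \<alpha> j (h ka mu ka' mu') ka0' * u ^ j) *
  (Mo \<alpha> (p - j) (f ka mu ka' mu') (f' ka mu ka' mu') * u ^ (p - j))"
 let ?G = "%ka mu ka' mu'. Gr \<alpha> u (f ka mu ka' mu') (f' ka mu ka' mu') * Gr \<alpha> u (h ka mu ka' mu') ka0'"
 have T: "?F (p + 2) = u\<^sup>2 * csum (%ka mu ka' mu'. w ka mu ka' mu' * ?c p ka mu ka' mu')" for p
 proof -
  have "Mo \<alpha> (p + 2) ka0 ka0' = (\<Sum>j\<le>p. HH \<alpha> (Mo \<alpha> (p - j)) (Mo \<alpha> j) ka0 ka0')"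
   by (simp add: numeral_2_eq_2)
  also have "\<dots> = csum (%ka mu ka' mu'. \<Sum>j\<le>p. w ka mu ka' mu' *
   (Mo \<alpha> (p - j) (f ka mu ka' mu') (f' ka mu ka' mu') * Mo \<alpha> j (h ka mu ka' mu') ka0'))"
   unfolding HHeq by (rule csum_sum)
  finally have M: "Mo \<alpha> (p + 2) ka0 ka0' = csum (%ka mu ka' mu'. \<Sum>j\<le>p. w ka mu ka' mu' *
   (Mo \<alpha> (p - j) (f ka mu ka' mu') (f' ka mu ka' mu') * Mo \<alpha> j (h ka mu ka' mu') ka0'))" .
  have "u ^ p * (\<Sum>j\<le>p. w ka mu ka' mu' * (Mo \<alpha> (p - j) (f ka mu ka' mu') (f' ka mu ka' mu') * Mo \<alpha> j (h ka mu ka' mu') ka0'))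
   = w ka mu ka' mu' * ?c p ka mu ka' mu'" for ka mu ka' mu'
   unfolding sum_distrib_left
  proof (rule sum.cong[OF refl])
   fix j assume "j \<in> {..p}"
   then have "u ^ p = u ^ j * u ^ (p - j)" by (simp flip: power_add)
   then show "u ^ p * (w ka mu ka' mu' * (Mo \<alpha> (p - j) (f ka mu ka' mu') (f' ka mu ka' mu') * Mo \<alpha> j (h ka mu ka' mu') ka0'))
    = w ka mu ka' mu' * ((Mo \<alpha> j (h ka mu ka' mu') ka0' * u ^ j) *
     (Mo \<alpha> (p - j) (f ka mu ka' mu') (f' ka mu ka' mu') * u ^ (p - j)))"
    by (simp only: mult_ac)
  qed
  then have "u ^ p * Mo \<alpha> (p + 2) ka0 ka0' = csum (%ka mu ka' mu'. w ka mu ka' mu' * ?c p ka mu ka' mu')"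
   unfolding M csum_cmult by simp
  moreover have "?F (p + 2) = u\<^sup>2 * (u ^ p * Mo \<alpha> (p + 2) ka0 ka0')" unfolding power_add by (simp only: mult_ac)
  ultimately show ?thesis by simp
 qed
 have "(%p. csum (%ka mu ka' mu'. w ka mu ka' mu' * ?c p ka mu ka' mu')) sums csum (%ka mu ka' mu'. w ka mu ka' mu' * ?G ka mu ka' mu')"
 proof (rule csum_sums)
  fix ka mu ka' mu'
  assume "ka < k1" "k1 \<le> mu" "mu < K" "ka' < k1" "k1 \<le> mu'" "mu' < K"
  from blk[OF this] have b: "same_block (f ka mu ka' mu') (f' ka mu ka' mu')" "same_block (h ka mu ka' mu') ka0'" by auto
  have "(%p. ?c p ka mu ka' mu') sums (Gr \<alpha> u (h ka mu ka' mu') ka0' * Gr \<alpha> u (f ka mu ka' mu') (f' ka mu ka' mu'))"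
   unfolding Gr_def by (rule Cauchy_product_sums[OF summ[OF b(2)] summ[OF b(1)]])
  then have "(%p. ?c p ka mu ka' mu') sums ?G ka mu ka' mu'" by (simp only: mult.commute)
  then show "(%p. w ka mu ka' mu' * ?c p ka mu ka' mu') sums (w ka mu ka' mu' * ?G ka mu ka' mu')" by (rule sums_mult)
 qed
 from sums_mult[OF this, of "u\<^sup>2"]
 have "(%p. ?F (p + 2)) sums (u\<^sup>2 * csum (%ka mu ka' mu'. w ka mu ka' mu' * ?G ka mu ka' mu'))" unfolding T .
 then have "?F sums (u\<^sup>2 * csum (%ka mu ka' mu'. w ka mu ka' mu' * ?G ka mu ka' mu') + (\<Sum>p<2. ?F p))"
  by (rule sums_iff_shift[of ?F 2, THEN iffD1])
 moreover have "(\<Sum>p<2. ?F p) = (if ka0 = ka0' then 1 else 0)" by (simp add: numeral_2_eq_2)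
 ultimately show ?thesis unfolding Gr_def[of _ _ ka0 ka0'] by (simp add: sums_unique[symmetric])
qed

text \<open>Every term of the series is positive semidefinite, and the constant term is the identity.\<close>

lemma Gr_form:
 assumes \<alpha>: "0 \<le> \<alpha>" and z: "edge_bound \<alpha> z" "z < t"
  and S: "S = {..<k1} \<or> S = {k1..<K}"
 shows "(\<Sum>ka\<in>S. (w ka)\<^sup>2) \<le> (\<Sum>ka\<in>S. \<Sum>ka'\<in>S. Gr \<alpha> (1 / t) ka ka' * (w ka * w ka'))"
proof -
 obtain R C where "bip_seq K a k1 R C \<alpha>" using ex_bip_seq \<alpha> by blast
 then interpret bip_seq K l a k1 R C \<alpha> .
 have finS: "finite S" using S by auto
 have t: "0 < t" using z by (auto simp: edge_bound_def)
 let ?f = "%p. \<Sum>ka\<in>S. \<Sum>ka'\<in>S. Mo \<alpha> p ka ka' * (1 / t) ^ p * (w ka * w ka')"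
 have sums: "?f sums (\<Sum>ka\<in>S. \<Sum>ka'\<in>S. Gr \<alpha> (1 / t) ka ka' * (w ka * w ka'))"
 proof (intro sums_sum sums_mult2)
  fix ka ka' assume "ka \<in> S" "ka' \<in> S"
  then have "same_block ka ka'" using S by (auto simp: same_block_def)
  then have "summable (%p. Mo \<alpha> p ka ka' * (1 / t) ^ p)"
   by (rule summable_norm_cancel[OF Gr_summable[OF \<alpha> z]])
  then show "(%p. Mo \<alpha> p ka ka' * (1 / t) ^ p) sums Gr \<alpha> (1 / t) ka ka'"
   unfolding Gr_def by (rule summable_sums)
 qed
 have nn: "0 \<le> ?f p" for p
 proof (cases "odd p")
  case True
  then show ?thesis by (simp add: Mo_odd)
 next
  case False
  then obtain q where p: "p = 2 * q" by (auto elim: evenE)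
  have "0 \<le> (\<Sum>ka\<in>S. \<Sum>ka'\<in>S. (w ka * w ka') * Mo \<alpha> (2 * q) ka ka')"
  proof (rule gram_functional[OF S])
   fix v
   have "(\<Sum>ka\<in>S. \<Sum>ka'\<in>S. w ka * w ka' * (v ka * v ka')) = (\<Sum>ka\<in>S. w ka * v ka)\<^sup>2"
    unfolding power2_eq_square sum_product by (intro sum.cong refl) (simp add: mult_ac)
   then show "0 \<le> (\<Sum>ka\<in>S. \<Sum>ka'\<in>S. w ka * w ka' * (v ka * v ka'))" by simp
  qed
  then have "0 \<le> (1 / t) ^ p * (\<Sum>ka\<in>S. \<Sum>ka'\<in>S. (w ka * w ka') * Mo \<alpha> p ka ka')" using t unfolding p by simp
  also have "\<dots> = ?f p" unfolding sum_distrib_left by (intro sum.cong refl) (simp only: mult_ac)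
  finally show ?thesis .
 qed
 have "?f 0 = (\<Sum>ka\<in>S. \<Sum>ka'\<in>S. if ka' = ka then w ka * w ka else 0)"
  by (intro sum.cong refl) auto
 also have "\<dots> = (\<Sum>ka\<in>S. (w ka)\<^sup>2)" using finS by (simp add: power2_eq_square)
 finally have "(\<Sum>ka\<in>S. (w ka)\<^sup>2) = sum ?f {0}" by simp
 also have "\<dots> \<le> suminf ?f" using sums nn by (intro sum_le_suminf) (auto simp: sums_iff)
 finally show ?thesis using sums by (simp add: sums_iff)
qed

lemma Gr_sym:
 assumes "0 \<le> \<alpha>" "S = {..<k1} \<or> S = {k1..<K}" "ka \<in> S" "ka' \<in> S"
 shows "Gr \<alpha> u ka ka' = Gr \<alpha> u ka' ka"
proof -
 obtain R C where "bip_seq K a k1 R C \<alpha>" using ex_bip_seq assms(1) by blast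
 then interpret bip_seq K l a k1 R C \<alpha> .
 have "(%p. Mo \<alpha> p ka ka' * u ^ p) = (%p. Mo \<alpha> p ka' ka * u ^ p)" using Mo_sym[OF assms(2-4)] by simp
 then show ?thesis by (simp only: Gr_def)
qed

lemma csum_row:
 assumes ka0: "ka0 < k1"
 shows "csum (%ka mu ka' mu'. (if ka = ka0 then 1 else 0) * (X mu mu' * Y ka'))
  = (\<Sum>ka'<k1. (\<Sum>i<l. \<Sum>mu'\<in>{k1..<K}. (\<Sum>mu\<in>{k1..<K}. a i ka0 mu * X mu mu') * a i ka' mu') * Y ka')"
proof -
 let ?X = "{k1..<K}"
 let ?h = "%i mu ka' mu'. a i ka0 mu * X mu mu' * a i ka' mu' * Y ka'"
 have "csum (%ka mu ka' mu'. (if ka = ka0 then 1 else 0) * (X mu mu' * Y ka'))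
  = (\<Sum>i<l. \<Sum>ka<k1. if ka = ka0 then \<Sum>mu\<in>?X. \<Sum>ka'<k1. \<Sum>mu'\<in>?X. ?h i mu ka' mu' else 0)"
  unfolding csum_blocks by (intro sum.cong refl) (simp add: mult_ac)
 also have "\<dots> = (\<Sum>i<l. \<Sum>mu\<in>?X. \<Sum>ka'<k1. \<Sum>mu'\<in>?X. ?h i mu ka' mu')" using ka0 by simp
 also have "\<dots> = (\<Sum>i<l. \<Sum>ka'<k1. \<Sum>mu\<in>?X. \<Sum>mu'\<in>?X. ?h i mu ka' mu')"
  by (rule sum.cong[OF refl], rule sum.swap)
 also have "\<dots> = (\<Sum>ka'<k1. \<Sum>i<l. \<Sum>mu\<in>?X. \<Sum>mu'\<in>?X. ?h i mu ka' mu')" by (rule sum.swap)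
 also have "\<dots> = (\<Sum>ka'<k1. \<Sum>i<l. \<Sum>mu'\<in>?X. \<Sum>mu\<in>?X. ?h i mu ka' mu')"
  by (rule sum.cong[OF refl], rule sum.cong[OF refl], rule sum.swap)
 finally show ?thesis by (simp only: sum_distrib_right)
qed

lemma csum_column:
 assumes mu0: "mu0 \<in> {k1..<K}"
 shows "csum (%ka mu ka' mu'. (if mu' = mu0 then \<alpha> else 0) * (Y ka' ka * X mu))
  = (\<Sum>mu\<in>{k1..<K}. (\<Sum>i<l. \<Sum>ka<k1. (\<Sum>ka'<k1. a i ka' mu0 * Y ka' ka) * a i ka mu) * (\<alpha> * X mu))"
proof -
 let ?X = "{k1..<K}"
 let ?h = "%i ka mu ka'. a i ka' mu0 * Y ka' ka * a i ka mu * (\<alpha> * X mu)"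
 have "csum (%ka mu ka' mu'. (if mu' = mu0 then \<alpha> else 0) * (Y ka' ka * X mu))
  = (\<Sum>i<l. \<Sum>ka<k1. \<Sum>mu\<in>?X. \<Sum>ka'<k1. \<Sum>mu'\<in>?X. if mu' = mu0 then ?h i ka mu ka' else 0)"
  unfolding csum_blocks by (intro sum.cong refl) (simp add: mult_ac)
 also have "\<dots> = (\<Sum>i<l. \<Sum>ka<k1. \<Sum>mu\<in>?X. \<Sum>ka'<k1. ?h i ka mu ka')" using mu0 by simp
 also have "\<dots> = (\<Sum>i<l. \<Sum>mu\<in>?X. \<Sum>ka<k1. \<Sum>ka'<k1. ?h i ka mu ka')"
  by (rule sum.cong[OF refl], rule sum.swap)
 also have "\<dots> = (\<Sum>mu\<in>?X. \<Sum>i<l. \<Sum>ka<k1. \<Sum>ka'<k1. ?h i ka mu ka')" by (rule sum.swap)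
 finally show ?thesis by (simp only: sum_distrib_right)
qed

lemma Gr_row_equation:
 assumes \<alpha>: "0 \<le> \<alpha>" and z: "edge_bound \<alpha> z" "z < t" and lt: "ka0 < k1" "ka0' < k1"
 shows "Gr \<alpha> (1 / t) ka0 ka0' = (if ka0 = ka0' then 1 else 0) + (1 / t)\<^sup>2 *
  (\<Sum>ka'<k1. (\<Sum>i<l. \<Sum>mu'\<in>{k1..<K}. (\<Sum>mu\<in>{k1..<K}. a i ka0 mu * Gr \<alpha> (1 / t) mu mu') * a i ka' mu') * Gr \<alpha> (1 / t) ka' ka0')"
proof -
 have "HH \<alpha> A B ka0 ka0' = csum (%ka mu ka' mu'. (if ka = ka0 then 1 else 0) * (A mu mu' * B ka' ka0'))" for A B
 proof -
  have "csum (%ka mu ka' mu'. if mu' = ka0 then \<alpha> * A ka' ka * B mu ka0' else 0) = csum (%ka mu ka' mu'. 0)"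
   using lt by (intro csum_cong_bip) auto
  moreover have "csum (%ka mu ka' mu'. if ka = ka0 then A mu mu' * B ka' ka0' else 0)
   = csum (%ka mu ka' mu'. (if ka = ka0 then 1 else 0) * (A mu mu' * B ka' ka0'))"
   by (intro csum_cong_bip) auto
  ultimately show ?thesis by (simp add: HH_def csum_eq)
 qed
 note HHe = this
 have "Gr \<alpha> (1 / t) ka0 ka0' = (if ka0 = ka0' then 1 else 0) + (1 / t)\<^sup>2 *
  csum (%ka mu ka' mu'. (if ka = ka0 then 1 else 0) * (Gr \<alpha> (1 / t) mu mu' * Gr \<alpha> (1 / t) ka' ka0'))"
  by (rule Gr_equation[where w = "%ka mu ka' mu'. if ka = ka0 then 1 else 0" and f = "%ka mu ka' mu'. mu"
    and f' = "%ka mu ka' mu'. mu'" and h = "%ka mu ka' mu'. ka'", OF Gr_summable[OF \<alpha> z] HHe])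
   (use lt in \<open>simp_all add: same_block_def\<close>)
 then show ?thesis unfolding csum_row[OF lt(1)] .
qed

lemma Gr_column_equation:
 assumes \<alpha>: "0 \<le> \<alpha>" and z: "edge_bound \<alpha> z" "z < t" and lt: "mu0 \<in> {k1..<K}" "mu0' \<in> {k1..<K}"
 shows "Gr \<alpha> (1 / t) mu0 mu0' = (if mu0 = mu0' then 1 else 0) + (1 / t)\<^sup>2 *
  (\<Sum>mu\<in>{k1..<K}. (\<Sum>i<l. \<Sum>ka<k1. (\<Sum>ka'<k1. a i ka' mu0 * Gr \<alpha> (1 / t) ka' ka) * a i ka mu) * (\<alpha> * Gr \<alpha> (1 / t) mu mu0'))"
proof -
 have "HH \<alpha> A B mu0 mu0' = csum (%ka mu ka' mu'. (if mu' = mu0 then \<alpha> else 0) * (A ka' ka * B mu mu0'))" for A B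
 proof -
  have "csum (%ka mu ka' mu'. if ka = mu0 then A mu mu' * B ka' mu0' else 0) = csum (%ka mu ka' mu'. 0)"
   using lt by (intro csum_cong_bip) auto
  moreover have "csum (%ka mu ka' mu'. if mu' = mu0 then \<alpha> * A ka' ka * B mu mu0' else 0)
   = csum (%ka mu ka' mu'. (if mu' = mu0 then \<alpha> else 0) * (A ka' ka * B mu mu0'))"
   by (intro csum_cong_bip) auto
  ultimately show ?thesis by (simp add: HH_def csum_eq)
 qed
 note HHe = this
 have "Gr \<alpha> (1 / t) mu0 mu0' = (if mu0 = mu0' then 1 else 0) + (1 / t)\<^sup>2 *
  csum (%ka mu ka' mu'. (if mu' = mu0 then \<alpha> else 0) * (Gr \<alpha> (1 / t) ka' ka * Gr \<alpha> (1 / t) mu mu0'))"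
  by (rule Gr_equation[where w = "%ka mu ka' mu'. if mu' = mu0 then \<alpha> else 0" and f = "%ka mu ka' mu'. ka'"
    and f' = "%ka mu ka' mu'. ka" and h = "%ka mu ka' mu'. mu", OF Gr_summable[OF \<alpha> z] HHe])
   (use lt in \<open>simp_all add: same_block_def\<close>)
 then show ?thesis unfolding csum_column[OF lt(1)] .
qed

text \<open>The Dyson equations state that \<open>Z\<^sub>Y = t - \<Sum>A\<^sub>i * G\<^sub>X *
 A\<^sub>i\<^sup>T\<close> and \<open>Z\<^sub>X = t - \<alpha> * \<Sum>A\<^sub>i\<^sup>T *
 G\<^sub>Y * A\<^sub>i\<close> are inverse to the blocks \<open>G\<^sub>Y\<close> and
 \<open>G\<^sub>X\<close> of the resolvent.\<close>

theorem edge_variational: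
 assumes K: "K = k1 + k2" and A: "!!i. i < l ==> A i \<in> carrier_mat k1 k2"
  and aA: "!!i ka mu. i < l ==> ka < k1 ==> mu < k2 ==> a i ka (k1 + mu) = A i $$ (ka, mu)"
  and \<alpha>: "0 \<le> \<alpha>" and z: "edge_bound \<alpha> z" "z < t"
 shows "\<exists>ZY ZX. sym_pos_def k1 ZY \<and> sym_pos_def k2 ZX \<and>
  max_eigenvalue (ZX + \<alpha> \<cdot>\<^sub>m mat_sum k2 k2 (%i. transpose_mat (A i) * inv_mat ZY * A i) l) = t \<and>
  max_eigenvalue (ZY + mat_sum k1 k1 (%i. A i * inv_mat ZX * transpose_mat (A i)) l) = t"
proof -
 have t: "0 < t" using z by (auto simp: edge_bound_def)
 have k2: "0 < k2" using K k1 by simp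
 have shiftK: "(\<Sum>mu\<in>{k1..<K}. f mu) = (\<Sum>mu<k2. f (k1 + mu))" for f :: "nat => real"
  unfolding K by (rule sum_shift)
 have kK: "k1 + i \<in> {k1..<K}" if "i < k2" for i using K that by simp
 let ?G = "Gr \<alpha> (1 / t)"
 \<comment> \<open>The factor \<open>1 / t\<close> turns \<open>Gr\<close> into the resolvent.\<close>
 define GY where "GY = mat k1 k1 (%(i, j). ?G i j / t)"
 define GX where "GX = mat k2 k2 (%(i, j). ?G (k1 + i) (k1 + j) / t)"
 have G: "GY \<in> carrier_mat k1 k1" "GX \<in> carrier_mat k2 k2" by (simp_all add: GY_def GX_def)
 define SY where "SY = mat_sum k1 k1 (%i. A i * GX * transpose_mat (A i)) l"
 define SX where "SX = mat_sum k2 k2 (%i. transpose_mat (A i) * GY * A i) l"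
 have S: "SY \<in> carrier_mat k1 k1" "SX \<in> carrier_mat k2 k2" by (simp_all add: SY_def SX_def mat_sum_def)
 define ZY where "ZY = mat k1 k1 (%(i, j). (if i = j then t else 0) - SY $$ (i, j))"
 define ZX where "ZX = mat k2 k2 (%(i, j). (if i = j then t else 0) - \<alpha> * SX $$ (i, j))"
 have Z: "ZY \<in> carrier_mat k1 k1" "ZX \<in> carrier_mat k2 k2" by (simp_all add: ZY_def ZX_def)
 have entSY: "SY $$ (r, s) = (\<Sum>i<l. \<Sum>mu'\<in>{k1..<K}. (\<Sum>mu\<in>{k1..<K}. a i r mu * ?G mu mu') * a i s mu') / t"
  if rs: "r < k1" "s < k1" for r s
 proof -
  have "(A i * GX * transpose_mat (A i)) $$ (r, s) = (\<Sum>mu'\<in>{k1..<K}. (\<Sum>mu\<in>{k1..<K}. a i r mu * ?G mu mu') * a i s mu') / t"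
   if i: "i < l" for i
  proof -
   have AG: "A i * GX \<in> carrier_mat k1 k2" and AT: "transpose_mat (A i) \<in> carrier_mat k2 k1" using A[OF i] G by auto
   have "(A i * GX * transpose_mat (A i)) $$ (r, s) = (\<Sum>mu'<k2. (A i * GX) $$ (r, mu') * transpose_mat (A i) $$ (mu', s))"
    by (rule mult_mat_entry[OF AG AT rs])
   also have "\<dots> = (\<Sum>mu'<k2. (\<Sum>mu<k2. a i r (k1 + mu) * ?G (k1 + mu) (k1 + mu')) * a i s (k1 + mu') / t)"
   proof (rule sum.cong[OF refl])
    fix mu' assume "mu' \<in> {..<k2}"
    then have m: "mu' < k2" by simp
    have "(A i * GX) $$ (r, mu') = (\<Sum>mu<k2. a i r (k1 + mu) * ?G (k1 + mu) (k1 + mu')) / t"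
     unfolding mult_mat_entry[OF A[OF i] G(2) rs(1) m] sum_divide_distrib
     using m by (intro sum.cong refl) (simp add: GX_def aA[OF i rs(1)])
    moreover have "transpose_mat (A i) $$ (mu', s) = a i s (k1 + mu')"
     using A[OF i] m rs by (simp add: aA[OF i])
    ultimately show "(A i * GX) $$ (r, mu') * transpose_mat (A i) $$ (mu', s)
     = (\<Sum>mu<k2. a i r (k1 + mu) * ?G (k1 + mu) (k1 + mu')) * a i s (k1 + mu') / t" by simp
   qed
   finally show ?thesis unfolding shiftK sum_divide_distrib .
  qed
  then show ?thesis unfolding SY_def mat_sum_def sum_divide_distrib[of _ "{..<l}"] using rs by simp
 qed
 have entSX: "SX $$ (r, s) = (\<Sum>i<l. \<Sum>ka<k1. (\<Sum>ka'<k1. a i ka' (k1 + r) * ?G ka' ka) * a i ka (k1 + s)) / t"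
  if rs: "r < k2" "s < k2" for r s
 proof -
  have "(transpose_mat (A i) * GY * A i) $$ (r, s) = (\<Sum>ka<k1. (\<Sum>ka'<k1. a i ka' (k1 + r) * ?G ka' ka) * a i ka (k1 + s)) / t"
   if i: "i < l" for i
  proof -
   have AT: "transpose_mat (A i) \<in> carrier_mat k2 k1" using A[OF i] by auto
   have AG: "transpose_mat (A i) * GY \<in> carrier_mat k2 k1" using AT G by auto
   have "(transpose_mat (A i) * GY * A i) $$ (r, s) = (\<Sum>ka<k1. (transpose_mat (A i) * GY) $$ (r, ka) * A i $$ (ka, s))"
    by (rule mult_mat_entry[OF AG A[OF i] rs])
   also have "\<dots> = (\<Sum>ka<k1. (\<Sum>ka'<k1. a i ka' (k1 + r) * ?G ka' ka) * a i ka (k1 + s) / t)"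
   proof (rule sum.cong[OF refl])
    fix ka assume "ka \<in> {..<k1}"
    then have m: "ka < k1" by simp
    have "(transpose_mat (A i) * GY) $$ (r, ka) = (\<Sum>ka'<k1. a i ka' (k1 + r) * ?G ka' ka) / t"
     unfolding mult_mat_entry[OF AT G(1) rs(1) m] sum_divide_distrib
     using m rs A[OF i] by (intro sum.cong refl) (simp add: GY_def aA[OF i])
    then show "(transpose_mat (A i) * GY) $$ (r, ka) * A i $$ (ka, s)
     = (\<Sum>ka'<k1. a i ka' (k1 + r) * ?G ka' ka) * a i ka (k1 + s) / t" using m rs by (simp add: aA[OF i])
   qed
   finally show ?thesis unfolding sum_divide_distrib .
  qed
  then show ?thesis unfolding SX_def mat_sum_def sum_divide_distrib[of _ "{..<l}"] using rs by simp
 qed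
 have ZYG: "ZY * GY = 1\<^sub>m k1"
 proof (rule eq_matI)
  fix r s assume "r < dim_row (1\<^sub>m k1)" "s < dim_col (1\<^sub>m k1)"
  then have rs: "r < k1" "s < k1" by auto
  have "(ZY * GY) $$ (r, s) = (\<Sum>h<k1. ZY $$ (r, h) * GY $$ (h, s))" by (rule mult_mat_entry[OF Z(1) G(1) rs])
  also have "\<dots> = (\<Sum>h<k1. (if h = r then ?G r s else 0) - SY $$ (r, h) * ?G h s / t)"
   using rs t by (intro sum.cong refl) (auto simp: ZY_def GY_def left_diff_distrib diff_divide_distrib)
  also have "\<dots> = ?G r s - (\<Sum>h<k1. SY $$ (r, h) * ?G h s / t)" using rs by (simp add: sum_subtractf)
  also have "(\<Sum>h<k1. SY $$ (r, h) * ?G h s / t) = (1 / t)\<^sup>2 *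
   (\<Sum>ka'<k1. (\<Sum>i<l. \<Sum>mu'\<in>{k1..<K}. (\<Sum>mu\<in>{k1..<K}. a i r mu * ?G mu mu') * a i ka' mu') * ?G ka' s)"
   unfolding sum_distrib_left[of "(1 / t)\<^sup>2"] using rs
   by (intro sum.cong refl) (simp add: entSY power2_eq_square)
  also have "?G r s - \<dots> = (if r = s then 1 else 0)" using Gr_row_equation[OF \<alpha> z rs] by simp
  finally show "(ZY * GY) $$ (r, s) = 1\<^sub>m k1 $$ (r, s)" using rs by simp
 qed (use Z G in auto)
 have ZXG: "ZX * GX = 1\<^sub>m k2"
 proof (rule eq_matI)
  fix r s assume "r < dim_row (1\<^sub>m k2)" "s < dim_col (1\<^sub>m k2)"
  then have rs: "r < k2" "s < k2" by auto
  then have rs': "k1 + r \<in> {k1..<K}" "k1 + s \<in> {k1..<K}" using K by auto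
  have "(ZX * GX) $$ (r, s) = (\<Sum>h<k2. ZX $$ (r, h) * GX $$ (h, s))" by (rule mult_mat_entry[OF Z(2) G(2) rs])
  also have "\<dots> = (\<Sum>h<k2. (if h = r then ?G (k1 + r) (k1 + s) else 0) - \<alpha> * SX $$ (r, h) * ?G (k1 + h) (k1 + s) / t)"
   using rs t by (intro sum.cong refl) (auto simp: ZX_def GX_def left_diff_distrib diff_divide_distrib)
  also have "\<dots> = ?G (k1 + r) (k1 + s) - (\<Sum>h<k2. \<alpha> * SX $$ (r, h) * ?G (k1 + h) (k1 + s) / t)" using rs by (simp add: sum_subtractf)
  also have "(\<Sum>h<k2. \<alpha> * SX $$ (r, h) * ?G (k1 + h) (k1 + s) / t) = (1 / t)\<^sup>2 *
   (\<Sum>mu\<in>{k1..<K}. (\<Sum>i<l. \<Sum>ka<k1. (\<Sum>ka'<k1. a i ka' (k1 + r) * ?G ka' ka) * a i ka mu) * (\<alpha> * ?G mu (k1 + s)))"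
   unfolding shiftK sum_distrib_left[of "(1 / t)\<^sup>2"] using rs
   by (intro sum.cong refl) (simp add: entSX power2_eq_square)
  also have "?G (k1 + r) (k1 + s) - \<dots> = (if r = s then 1 else 0)" using Gr_column_equation[OF \<alpha> z rs'] by simp
  finally show "(ZX * GX) $$ (r, s) = 1\<^sub>m k2 $$ (r, s)" using rs by simp
 qed (use Z G in auto)
 have invs: "inv_mat ZY = GY" "inv_mat ZX = GX"
  using inv_mat_eqI(1)[OF Z(1) G(1) ZYG] inv_mat_eqI(1)[OF Z(2) G(2) ZXG] by auto
 have symY: "transpose_mat GY = GY"
 proof (rule eq_matI)
  fix i j assume "i < dim_row GY" "j < dim_col GY"
  then have ij: "i < k1" "j < k1" by (auto simp: GY_def)
  then have "j \<in> {..<k1}" "i \<in> {..<k1}" by auto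
  from Gr_sym[OF \<alpha> disjI1[OF refl] this, of "1 / t"]
  show "transpose_mat GY $$ (i, j) = GY $$ (i, j)" using ij by (simp add: GY_def)
 qed (auto simp: GY_def)
 have symX: "transpose_mat GX = GX"
 proof (rule eq_matI)
  fix i j assume "i < dim_row GX" "j < dim_col GX"
  then have ij: "i < k2" "j < k2" by (auto simp: GX_def)
  show "transpose_mat GX $$ (i, j) = GX $$ (i, j)"
   using ij Gr_sym[OF \<alpha> disjI2[OF refl] kK[OF ij(2)] kK[OF ij(1)], of "1 / t"] by (simp add: GX_def)
 qed (auto simp: GX_def)
 have pY: "sym_pos_def k1 ZY"
 proof (rule pos_def_of_inverse[OF Z(1) G(1) ZYG symY])
  show "0 < 1 / t" using t by simp
  fix w
  have "(1 / t) * (\<Sum>i<k1. (w i)\<^sup>2) \<le> (1 / t) * (\<Sum>i<k1. \<Sum>j<k1. ?G i j * (w i * w j))"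
   using Gr_form[OF \<alpha> z, of "{..<k1}" w] t by (intro mult_left_mono) auto
  also have "\<dots> = (\<Sum>i<k1. \<Sum>j<k1. GY $$ (i, j) * (w i * w j))"
   unfolding sum_distrib_left by (intro sum.cong refl) (simp add: GY_def)
  finally show "(1 / t) * (\<Sum>i<k1. (w i)\<^sup>2) \<le> (\<Sum>i<k1. \<Sum>j<k1. GY $$ (i, j) * (w i * w j))" .
 qed
 have pX: "sym_pos_def k2 ZX"
 proof (rule pos_def_of_inverse[OF Z(2) G(2) ZXG symX])
  show "0 < 1 / t" using t by simp
  fix w
  have "(\<Sum>i<k2. (w i)\<^sup>2) \<le> (\<Sum>i<k2. \<Sum>j<k2. ?G (k1 + i) (k1 + j) * (w i * w j))"
   using Gr_form[OF \<alpha> z, of "{k1..<K}" "%ka. w (ka - k1)"] unfolding shiftK by simp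
  then have "(1 / t) * (\<Sum>i<k2. (w i)\<^sup>2) \<le> (1 / t) * (\<Sum>i<k2. \<Sum>j<k2. ?G (k1 + i) (k1 + j) * (w i * w j))"
   using t by (intro mult_left_mono) auto
  also have "\<dots> = (\<Sum>i<k2. \<Sum>j<k2. GX $$ (i, j) * (w i * w j))"
   unfolding sum_distrib_left by (intro sum.cong refl) (simp add: GX_def)
  finally show "(1 / t) * (\<Sum>i<k2. (w i)\<^sup>2) \<le> (\<Sum>i<k2. \<Sum>j<k2. GX $$ (i, j) * (w i * w j))" .
 qed
 have eX: "ZX + \<alpha> \<cdot>\<^sub>m mat_sum k2 k2 (%i. transpose_mat (A i) * inv_mat ZY * A i) l = t \<cdot>\<^sub>m 1\<^sub>m k2"
  unfolding invs SX_def[symmetric] by (rule eq_matI) (use S Z in \<open>auto simp: ZX_def\<close>)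
 have eY: "ZY + mat_sum k1 k1 (%i. A i * inv_mat ZX * transpose_mat (A i)) l = t \<cdot>\<^sub>m 1\<^sub>m k1"
  unfolding invs SY_def[symmetric] by (rule eq_matI) (use S Z in \<open>auto simp: ZY_def\<close>)
 show ?thesis
 proof (intro exI conjI)
  show "sym_pos_def k1 ZY" by (rule pY)
  show "sym_pos_def k2 ZX" by (rule pX)
  show "max_eigenvalue (ZX + \<alpha> \<cdot>\<^sub>m mat_sum k2 k2 (%i. transpose_mat (A i) * inv_mat ZY * A i) l) = t"
   unfolding eX by (rule max_eigenvalue_scalar[OF k2])
  show "max_eigenvalue (ZY + mat_sum k1 k1 (%i. A i * inv_mat ZX * transpose_mat (A i)) l) = t"
   unfolding eY by (rule max_eigenvalue_scalar[OF k1(1)])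
 qed
qed

end

section \<open>Expected norms of Gaussian Kronecker sums\<close>

lemma gaussian_kronecker_eq:
 assumes B: "bipartite K a k1" and K: "K = k1 + k2"
  and A: "!!i. i < l ==> A i \<in> carrier_mat k1 k2" and G: "!!i. i < l ==> G i \<in> carrier_mat m n"
  and aA: "!!i ka mu. i < l ==> ka < k1 ==> mu < k2 ==> a i ka (k1 + mu) = A i $$ (ka, mu)"
 shows "gaussian_kronecker k1 k2 l m n A G = bipartite.Hmat K l a k1 m n (%(i, r, c). G i $$ (r, c))"
proof -
 interpret bipartite K l a k1 by (rule B)
 have Kk: "K - k1 = k2" using K by simp
 have dims: "dim_row (Hmat m n x) = k1 * m" "dim_col (Hmat m n x) = k2 * n" for x
  by (simp_all add: Hmat_def Kk)
 show ?thesis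
 proof (rule eq_matI)
  fix r c assume "r < dim_row (Hmat m n (%(i, r, c). G i $$ (r, c)))" "c < dim_col (Hmat m n (%(i, r, c). G i $$ (r, c)))"
  then have rc: "r < k1 * m" "c < k2 * n" by (simp_all only: dims)
  then have pos: "0 < m" "0 < n" by (auto intro: Nat.gr0I)
  have d: "r div m < k1" "c div n < k2" "r mod m < m" "c mod n < n"
   using rc pos by (auto intro: less_mult_imp_div_less)
  have "kronecker (A i) (G i) $$ (r, c) = a i (r div m) (k1 + c div n) * G i $$ (r mod m, c mod n)" if "i < l" for i
   using A[OF that] G[OF that] rc d by (simp add: kronecker_def aA[OF that])
  then show "gaussian_kronecker k1 k2 l m n A G $$ (r, c) = Hmat m n (%(i, r, c). G i $$ (r, c)) $$ (r, c)"
   using rc by (simp add: gaussian_kronecker_def mat_sum_def Hmat_def Kk rect_def)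
 qed (simp_all add: gaussian_kronecker_def mat_sum_def dims)
qed

lemma (in bipartite) Hmat_cong:
 assumes "!!e. e \<in> {..<l} \<times> {..<m} \<times> {..<n} ==> x e = y e"
 shows "Hmat m n x = Hmat m n y"
proof (rule eq_matI)
 fix r c assume "r < dim_row (Hmat m n y)" "c < dim_col (Hmat m n y)"
 then have rc: "r < k1 * m" "c < (K - k1) * n" by (simp_all add: Hmat_def)
 then have pos: "0 < m" "0 < n" by (auto intro: Nat.gr0I)
 have "x (i, r mod m, c mod n) = y (i, r mod m, c mod n)" if "i < l" for i
  using that pos by (intro assms) auto
 then show "Hmat m n x $$ (r, c) = Hmat m n y $$ (r, c)" using rc by (simp add: Hmat_def rect_def)
qed (simp_all add: Hmat_def)

lemma (in bipartite) Hmat_measurable: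
 assumes n: "0 < n" and J: "J = {..<m} \<union> {..<n}"
 shows "(%x. max_singular_value (Hmat m n x)) \<in> borel_measurable (gm (EE J))"
proof -
 have finJ: "finite J" using J by simp
 have d: "0 < (K - k1) * n" using n k1 by simp
 let ?t = "%q x. tr (DD J) (XW J (wb {..<m} {..<n}) x ^ (2 * Suc q)) / 2"
 have lim: "(%q. root (2 * Suc q) (?t q x)) \<longlonglongrightarrow> max_singular_value (Hmat m n x)" for x
  unfolding half_trace[OF J zero_less_Suc] by (rule max_singular_value_limit[OF Hmat_carrier d])
 have t: "?t q \<in> borel_measurable (gm (EE J))" for q
  by (intro borel_measurable_divide borel_measurable_const borel_measurable_integrable[OF XW_integrable'[OF finJ]])
 have r: "root k \<in> borel_measurable borel" for k
  by (intro borel_measurable_continuous_onI continuous_on_real_root continuous_on_id)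
 have meas: "(%x. root (2 * Suc q) (?t q x)) \<in> borel_measurable (gm (EE J))" for q
  by (rule measurable_compose[OF t r])
 show ?thesis
  by (rule borel_measurable_LIMSEQ_real[where u = "%q x. root (2 * Suc q) (?t q x)", OF lim meas])
qed

theorem corollary2:
  fixes k1 k2 l :: nat
    and m :: "nat \<Rightarrow> nat"
    and \<alpha> :: real
    and A :: "nat \<Rightarrow> real mat"
    and M :: "nat \<Rightarrow> 'w measure"
    and G :: "nat \<Rightarrow> nat \<Rightarrow> 'w \<Rightarrow> real mat"
  assumes "0 < k1" and "0 < k2"
    and "filterlim m at_top sequentially"
    and "(\<lambda>n. real (m n) / real n) \<longlonglongrightarrow> \<alpha>"
    and "\<And>i. i < l \<Longrightarrow> A i \<in> carrier_mat k1 k2"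
    and "\<And>n. indep_std_normal_mats (M n) l (m n) n (G n)"
  shows "\<exists>L. (\<lambda>n. \<integral>\<omega>. max_singular_value
                  (gaussian_kronecker k1 k2 l (m n) n A (\<lambda>i. G n i \<omega>)) \<partial>M n) \<longlonglongrightarrow> L \<and>
             L \<ge> 1 / 2 *
               (INF (Z\<^sub>Y, Z\<^sub>X) \<in> {Z. sym_pos_def k1 Z} \<times> {Z. sym_pos_def k2 Z}.
                  max_eigenvalue
                    (Z\<^sub>X + \<alpha> \<cdot>\<^sub>m mat_sum k2 k2
                            (\<lambda>i. transpose_mat (A i) * inv_mat Z\<^sub>Y * A i) l) +
                  max_eigenvalue
                    (Z\<^sub>Y + mat_sum k1 k1
                            (\<lambda>i. A i * inv_mat Z\<^sub>X * transpose_mat (A i)) l))"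
proof -
 define K where "K = k1 + k2"
 define a where "a i ka mu = (if ka < k1 \<and> k1 \<le> mu \<and> mu < K then A i $$ (ka, mu - k1) else 0)" for i ka mu
 have bipKa: "bipartite K a k1"
  by unfold_locales (use assms(1,2) in \<open>auto simp: a_def K_def split: if_splits\<close>)
 interpret bipartite K l a k1 by (rule bipKa)
 have aA: "a i ka (k1 + mu) = A i $$ (ka, mu)" if "i < l" "ka < k1" "mu < k2" for i ka mu
  using that by (simp add: a_def K_def)
 have "\<forall>\<^sub>F n in sequentially. 1 \<le> m n" using assms(3) by (simp add: filterlim_at_top)
 then obtain N0 where N0: "!!n. N0 \<le> n ==> 1 \<le> m n" by (auto simp: eventually_sequentially)
 \<comment> \<open>Finitely many indices are skipped, for which a dimension may be zero.\<close>
 define s where "s N = N + Suc N0" for N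
 define R where "R N = {..<m (s N)}" for N
 define C where "C N = {..<s N}" for N
 define S where "S N x = max_singular_value (Hmat (m (s N)) (s N) x)" for N x
 have s: "0 < s N" "0 < m (s N)" for N using N0[of "s N"] by (auto simp: s_def)
 have sinf: "filterlim s at_top sequentially"
  by (rule filterlim_at_top_mono[OF filterlim_ident]) (simp add: s_def)
 interpret B: bip_seq K l a k1 R C \<alpha>
 proof unfold_locales
  show "filterlim (%N. card (R N)) at_top sequentially"
   using filterlim_compose[OF assms(3) sinf] by (simp add: R_def)
  show "filterlim (%N. card (C N)) at_top sequentially" using sinf by (simp add: C_def)
  show "(%N. real (card (R N)) / real (card (C N))) \<longlonglongrightarrow> \<alpha>"
   using filterlim_compose[OF assms(4) sinf] by (simp add: R_def C_def)
 qed (use s in \<open>auto simp: R_def C_def\<close>)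
 have d: "0 < (K - k1) * s N" for N using s k1 by simp
 have J: "R N \<union> C N = {..<m (s N)} \<union> {..<s N}" for N by (simp add: R_def C_def)
 interpret T: top_value K l a k1 R C \<alpha> S
 proof unfold_locales
  show "S N \<in> borel_measurable (gm (EE (R N \<union> C N)))" for N
   unfolding S_def by (rule Hmat_measurable[OF s(1) J])
  show "0 \<le> S N x" for N x unfolding S_def by (rule max_singular_value_bounds(1)[OF Hmat_carrier d])
  show "S N x ^ (2 * q) \<le> tr (DD (R N \<union> C N)) (XW (R N \<union> C N) (wb (R N) (C N)) x ^ (2 * q)) / 2" if "0 < q" for N x q
   using max_singular_value_bounds(2)[OF Hmat_carrier[of "m (s N)" "s N" x] d[of N], where q = q]
   unfolding R_def[of N] C_def[of N] half_trace[OF refl that] S_def .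
  show "tr (DD (R N \<union> C N)) (XW (R N \<union> C N) (wb (R N) (C N)) x ^ (2 * (p + q)))
   \<le> S N x ^ (2 * q) * tr (DD (R N \<union> C N)) (XW (R N \<union> C N) (wb (R N) (C N)) x ^ (2 * p))" if p: "0 < p" for N x p q
  proof -
   have pq: "0 < p + q" using p by simp
   have "tr (DD (R N \<union> C N)) (XW (R N \<union> C N) (wb (R N) (C N)) x ^ (2 * (p + q))) / 2
    \<le> S N x ^ (2 * q) * (tr (DD (R N \<union> C N)) (XW (R N \<union> C N) (wb (R N) (C N)) x ^ (2 * p)) / 2)"
    using max_singular_value_bounds(3)[OF Hmat_carrier[of "m (s N)" "s N" x] d[of N], where p = p and q = q]
    unfolding R_def[of N] C_def[of N] half_trace[OF refl pq] half_trace[OF refl p] S_def .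
   then show ?thesis by simp
  qed
 qed
 let ?E = "%n. \<integral>\<omega>. max_singular_value (gaussian_kronecker k1 k2 l (m n) n A (%i. G n i \<omega>)) \<partial>M n"
 let ?L = "Inf {z. edge_bound \<alpha> z}"
 have E: "?E (s N) = (\<integral>x. S N x \<partial>gm (EE (R N \<union> C N)))" for N
 proof -
  let ?n = "s N"
  have "?E ?n = (\<integral>\<omega>. S N (%(i, r, c). G ?n i \<omega> $$ (r, c)) \<partial>M ?n)"
  proof (rule Bochner_Integration.integral_cong[OF refl])
   fix \<omega> assume \<omega>: "\<omega> \<in> space (M ?n)"
   have Gc: "G ?n i \<omega> \<in> carrier_mat (m ?n) ?n" if "i < l" for i
    using assms(6)[of ?n] that \<omega> by (auto simp: indep_std_normal_mats_def)
   have "gaussian_kronecker k1 k2 l (m ?n) ?n A (%i. G ?n i \<omega>) = Hmat (m ?n) ?n (%(i, r, c). G ?n i \<omega> $$ (r, c))"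
    by (rule gaussian_kronecker_eq[OF bipKa K_def assms(5) Gc aA])
   then show "max_singular_value (gaussian_kronecker k1 k2 l (m ?n) ?n A (%i. G ?n i \<omega>))
    = S N (%(i, r, c). G ?n i \<omega> $$ (r, c))" by (simp only: S_def)
  qed
  also have "\<dots> = (\<integral>x. S N x \<partial>gm (EE (R N \<union> C N)))"
  proof (rule gaussian_transfer[OF assms(6)])
   show "finite (EE (R N \<union> C N))" using B.finJJ by simp
   show "{..<l} \<times> {..<m ?n} \<times> {..<?n} \<subseteq> EE (R N \<union> C N)" by (auto simp: EE_def R_def C_def)
   show "S N \<in> borel_measurable (gm (EE (R N \<union> C N)))" by (rule T.S_meas)
   show "S N x = S N y" if "!!e. e \<in> {..<l} \<times> {..<m ?n} \<times> {..<?n} ==> x e = y e" for x y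
    unfolding S_def using Hmat_cong[OF that] by simp
  qed
  finally show ?thesis .
 qed
 have "(%N. ?E (s N)) \<longlonglongrightarrow> ?L" unfolding E by (rule T.expectation_limit)
 then have "(%N. ?E (N + Suc N0)) \<longlonglongrightarrow> ?L" by (simp only: s_def)
 then have lim: "?E \<longlonglongrightarrow> ?L" by (rule LIMSEQ_offset)
 let ?P = "{Z. sym_pos_def k1 Z} \<times> {Z. sym_pos_def k2 Z}"
 let ?X = "%ZY ZX. ZX + \<alpha> \<cdot>\<^sub>m mat_sum k2 k2 (%i. transpose_mat (A i) * inv_mat ZY * A i) l"
 let ?Y = "%ZY ZX. ZY + mat_sum k1 k1 (%i. A i * inv_mat ZX * transpose_mat (A i)) l"
 let ?V = "%(ZY, ZX). max_eigenvalue (?X ZY ZX) + max_eigenvalue (?Y ZY ZX)"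
 have \<alpha>: "0 \<le> \<alpha>" by (rule B.\<alpha>_nonneg)
 have nonneg: "0 \<le> ?V (ZY, ZX)" if Z: "sym_pos_def k1 ZY" "sym_pos_def k2 ZX" for ZY ZX
 proof -
  have "psd k2 (transpose_mat (A i) * inv_mat ZY * A i)" if "i < l" for i
   by (rule psd_congruence[OF sym_pos_def_psd(2)[OF Z(1)] assms(5)[OF that]])
  then have "psd k2 (?X ZY ZX)" by (intro psd_add_mat_sum sym_pos_def_psd(1)[OF Z(2)] \<alpha>)
  then have 1: "0 \<le> max_eigenvalue (?X ZY ZX)" using assms(2) by (rule max_eigenvalue_nonneg)
  have "psd k1 (A i * inv_mat ZX * transpose_mat (A i))" if "i < l" for i
   using psd_congruence[OF sym_pos_def_psd(2)[OF Z(2)], of "transpose_mat (A i)" k1] assms(5)[OF that] by simp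
  then have "psd k1 (ZY + 1 \<cdot>\<^sub>m mat_sum k1 k1 (%i. A i * inv_mat ZX * transpose_mat (A i)) l)"
   by (intro psd_add_mat_sum sym_pos_def_psd(1)[OF Z(1)]) auto
  moreover have "1 \<cdot>\<^sub>m mat_sum k1 k1 F l = mat_sum k1 k1 F l" for F by (rule eq_matI) (auto simp: mat_sum_def)
  ultimately have "psd k1 (?Y ZY ZX)" by simp
  then have "0 \<le> max_eigenvalue (?Y ZY ZX)" using assms(1) by (rule max_eigenvalue_nonneg)
  then show ?thesis using 1 by simp
 qed
 have bdd: "bdd_below (?V ` ?P)" by (rule bdd_belowI[of _ 0]) (use nonneg in auto)
 have bound: "1 / 2 * (INF Z\<in>?P. ?V Z) \<le> ?L"
 proof (rule dense_ge)
  fix t assume t: "?L < t"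
  have ne: "{z. edge_bound \<alpha> z} \<noteq> {}" using ex_edge_bound[OF \<alpha>] by blast
  obtain z where z: "edge_bound \<alpha> z" "z < t" using cInf_lessD[OF ne t] by blast
  have "\<exists>ZY ZX. sym_pos_def k1 ZY \<and> sym_pos_def k2 ZX \<and>
   max_eigenvalue (?X ZY ZX) = t \<and> max_eigenvalue (?Y ZY ZX) = t"
   by (rule edge_variational[OF K_def assms(5) aA \<alpha> z])
  then obtain ZY ZX where Z: "sym_pos_def k1 ZY" "sym_pos_def k2 ZX"
   "max_eigenvalue (?X ZY ZX) = t" "max_eigenvalue (?Y ZY ZX) = t"
   by (elim exE conjE) (rule that)
  have le: "(INF Z\<in>?P. ?V Z) \<le> ?V (ZY, ZX)" by (rule cINF_lower[OF bdd]) (use Z in auto)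
  have v: "?V (ZY, ZX) = 2 * t" by (simp only: prod.case Z mult_2)
  show "1 / 2 * (INF Z\<in>?P. ?V Z) \<le> t" using order.trans[OF le eq_refl[OF v]] by linarith
 qed
 show ?thesis by (intro exI[of _ ?L] conjI lim bound)
qed

end
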